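(* Let $\mathcal{A}$ be a real (linear or affine) hyperplane arrangement with associated oriented system $(\Gamma,\sim)$. For a cover of oriented systems $\rho:(\Theta,\sim)\rightarrow(\Gamma,\sim)$, the fundamental group of the homotopy colimit of the diagram model $\mathscr{D}_\rho$ is isomorphic to the fundamental group of the oriented system $(\Theta,\sim)$: $$\pi_1(\mathrm{hocolim}\,\mathscr{D}_\rho)\cong\pi(\Theta,\sim).$$
   Context: **Arrangements.** $\mathcal{A}$ is a finite set of linear or affine hyperplanes in $\mathbb{R}^d$. $\mathcal{F}=\mathcal{F}(\mathcal{A})$ is its face poset: the set of all relatively open polyhedral cells of the stratification of $\mathbb{R}^d$ induced by $\mathcal{A}$, ordered by $F_1\ge F_2 \iff \overline{F_1}\subseteq\overline{F_2}$. The chambers $\mathcal{C}(\mathcal{A})$ (components of $\mathbb{R}^d\setminus\bigcup\mathcal{A}$) are the minimal elements. $|F|$ is the affine hull of $F$, and $\mathcal{A}_{|F|}=\{H\in\mathcal{A}: |F|\subseteq H\}$. For a face $F$ and chamber $C$, $C_F$ is the unique chamber of $\mathcal{A}$ whose closure contains $F$ and which lies in the same chamber of $\mathcal{A}_{|F|}$ as $C$. **Oriented systems.** In an oriented graph (edges are ordered pairs of vertices), a path is a sequence of edges with exponents $\pm1$ (traversed forward or backward), consecutive in the obvious sense; it is positive if all exponents are $+1$. An oriented system $(\Psi,\sim)$ is an oriented graph $\Psi$ together with an equivalence relation $\sim$ on its paths such that: $\alpha\sim\beta$ implies equal beginnings and equal ends; $\alpha\alpha^{-1}\sim begin(\alpha)$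 (constant path); $\alpha\sim\beta$ implies $\alpha^{-1}\sim\beta^{-1}$; $\alpha\sim\beta$ implies $\gamma_1\alpha\gamma_2\sim\gamma_1\beta\gamma_2$ whenever composable. All graphs are assumed connected. The fundamental group of the oriented system is $\pi(\Psi,\sim)=\pi_1(\Psi)/\!\sim$, the quotient of the fundamental group of the underlying 1-complex by the equivalence relation induced by $\sim$ on loops. The oriented system $(\Gamma,\sim)$ of $\mathcal{A}$ has vertex set $\mathcal{C}(\mathcal{A})$, an edge $(A,B)$ for every ordered pair of adjacent chambers (separated by exactly one hyperplane), and $\sim$ is generated by identifying any two positive paths with the same beginning and end that both have minimal length among positive paths joining these vertices. A cover $\rho:(\Theta,\sim)\to(\Gamma,\sim)$ is a morphism of oriented graphs such that (1) for each vertex $v$ of $\Theta$ and each path $\alpha$ in $\Gamma$ with $begin(\alpha)=\rho(v)$ there is a unique path $\hat\alpha_v$ in $\Theta$ beginning at $v$ with $\rho(\hat\alpha_v)=\alpha$; (2) $\alpha\sim\beta$ and $begin(\alpha)=begin(\beta)=\rho(v)$ imply $\hat\alpha_v\sim\hat\beta_v$. The relation $\sim$ on $\Theta$ is the one induced through $\rho$, i.e. the smallest relation such that $\alpha\sim\beta$ whenever $begin(\alpha)=begin(\beta)$ and $\rho(\alpha)\sim\rho(\beta)$. For a vertex $v$ of $\Theta$ with $\rho(v)=A$, $\hat\gamma_v(A\to B)$ denotes the lift at $v$ of a positive minimal path from $A$ to $B$ (unique up to $\sim$; its end is well defined). **The diagram.** A diagram of spaces over a poset $\mathcal{P}$ is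 a covariant functor $\mathcal{P}\to Top$, with an arrow $p\to q$ iff $p\ge q$. $\mathscr{D}_\rho:\mathcal{F}\to Top$ has discrete spaces $\mathscr{D}_\rho(F)=\{v\in V(\Theta):\rho(v)\le F\}$ and maps, for $F_1>F_2$, $v\mapsto end(\hat\gamma_v(\rho(v)\to\rho(v)_{F_2}))$. For a diagram $\mathscr{D}$ with spaces $D_p$ and maps $f_{p>q}$, $\mathrm{hocolim}\,\mathscr{D}=\bigsqcup_{p} D_p\times\Delta(\mathcal{P}_{\le p})/\!\sim$, where for $p>q$ each point $(x,t)\in D_p\times\Delta(\mathcal{P}_{\le q})\subseteq D_p\times\Delta(\mathcal{P}_{\le p})$ is identified with $(f_{p>q}(x),t)\in D_q\times\Delta(\mathcal{P}_{\le q})$; $\Delta(\cdot)$ is the order complex. *)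

theory Defs
  imports
    "HOL-Analysis.Analysis"
    "HOL-Algebra.Group"
    "Graph_Theory.Pair_Digraph"
begin

section \<open>Quotients and fundamental groups of topological spaces\<close>

text \<open>The final topology on the set of classes: a set of classes is open iff its preimage
  under the projection is open.\<close>

definition quotient_topology :: "'a topology \<Rightarrow> 'a rel \<Rightarrow> 'a set topology" where
  "quotient_topology X r =
     topology (\<lambda>U. U \<subseteq> topspace X // r \<and> openin X {x \<in> topspace X. r `` {x} \<in> U})"

lemma istopology_quotient_topology:
  "istopology (\<lambda>U. U \<subseteq> topspace X // r \<and> openin X {x \<in> topspace X. r `` {x} \<in> U})"
proof -
  have 1: "{x \<in> topspace X. r `` {x} \<in> S \<inter> T} =
      {x \<in> topspace X. r `` {x} \<in> S} \<inter> {x \<in> topspace X. r `` {x} \<in> T}" for S T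
    by auto
  have 2: "{x \<in> topspace X. r `` {x} \<in> \<Union>K} = \<Union>((\<lambda>S. {x \<in> topspace X. r `` {x} \<in> S}) ` K)" for K
    by auto
  show ?thesis
    unfolding istopology_def
    by (intro conjI allI impI; (simp only: 1 2)?) (auto intro!: openin_Union openin_Int)
qed

lemma openin_quotient_topology:
  "openin (quotient_topology X r) U \<longleftrightarrow>
     U \<subseteq> topspace X // r \<and> openin X {x \<in> topspace X. r `` {x} \<in> U}"
  unfolding quotient_topology_def
  using istopology_quotient_topology[of X r] by (simp add: topology_inverse')

lemma topspace_quotient_topology: "topspace (quotient_topology X r) = topspace X // r"
proof -
  have "{x \<in> topspace X. r `` {x} \<in> topspace X // r} = topspace X"
    by (auto intro: quotientI)
  then have "openin (quotient_topology X r) (topspace X // r)"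
    by (simp add: openin_quotient_topology)
  then show ?thesis
    by (meson openin_quotient_topology openin_subset openin_topspace subset_antisym)
qed

lemma quotient_map_quotient_topology:
  "quotient_map X (quotient_topology X r) (\<lambda>x. r `` {x})"
  unfolding quotient_map_def topspace_quotient_topology openin_quotient_topology
  by (auto simp: quotient_def)

text \<open>Quotient of an algebraic structure by an equivalence relation on its carrier
  that is compatible with multiplication.\<close>

definition quotient_monoid :: "('a, 'm) monoid_scheme \<Rightarrow> 'a rel \<Rightarrow> 'a set monoid" where
  "quotient_monoid M r =
     \<lparr>carrier = carrier M // r,
      mult = (\<lambda>X Y. \<Union>x\<in>X. \<Union>y\<in>Y. r `` {x \<otimes>\<^bsub>M\<^esub> y}),
      one = r `` {\<one>\<^bsub>M\<^esub>}\<rparr>"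

definition path_join :: "(real \<Rightarrow> 'a) \<Rightarrow> (real \<Rightarrow> 'a) \<Rightarrow> real \<Rightarrow> 'a" where
  "path_join g h = (\<lambda>t. if t \<le> 1/2 then g (2 * t) else h (2 * t - 1))"

definition loop_structure :: "'a topology \<Rightarrow> 'a \<Rightarrow> (real \<Rightarrow> 'a) monoid" where
  "loop_structure X x =
     \<lparr>carrier = {g. pathin X g \<and> g 0 = x \<and> g 1 = x}, mult = path_join, one = (\<lambda>_. x)\<rparr>"

definition loop_homotopy :: "'a topology \<Rightarrow> 'a \<Rightarrow> (real \<Rightarrow> 'a) rel" where
  "loop_homotopy X x =
     {(g, h). g \<in> carrier (loop_structure X x) \<and> h \<in> carrier (loop_structure X x) \<and>
        homotopic_with (\<lambda>k. k 0 = x \<and> k 1 = x) (top_of_set {0..1}) X g h}"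

definition fundamental_group :: "'a topology \<Rightarrow> 'a \<Rightarrow> (real \<Rightarrow> 'a) set monoid" where
  "fundamental_group X x = quotient_monoid (loop_structure X x) (loop_homotopy X x)"

section \<open>Homotopy colimits of diagrams of spaces\<close>

text \<open>Barycentric coordinates, with the subspace topology of the product. This is the usual
  topology of the realization because the posets considered here are finite.\<close>

definition order_complex :: "'p set \<Rightarrow> ('p \<Rightarrow> 'p \<Rightarrow> bool) \<Rightarrow> ('p \<Rightarrow> real) topology" where
  "order_complex P leq = subtopology (powertop_real UNIV)
     {t. (\<forall>p. 0 \<le> t p) \<and> finite {p. t p \<noteq> 0} \<and> {p. t p \<noteq> 0} \<subseteq> P \<and>
         Complete_Partial_Order.chain leq {p. t p \<noteq> 0} \<and> (\<Sum>p | t p \<noteq> 0. t p) = 1}"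

text \<open>A diagram of spaces over the poset \<open>(P, leq)\<close> is given by spaces \<open>D p\<close> and,
  for \<open>p > q\<close>, maps \<open>f p q\<close> from \<open>D p\<close> to \<open>D q\<close>.\<close>

definition hocolim_sum ::
    "'p set \<Rightarrow> ('p \<Rightarrow> 'p \<Rightarrow> bool) \<Rightarrow> ('p \<Rightarrow> 'x topology) \<Rightarrow> ('p \<times> 'x \<times> ('p \<Rightarrow> real)) topology" where
  "hocolim_sum P leq D =
     sum_topology (\<lambda>p. prod_topology (D p) (order_complex {q \<in> P. leq q p} leq)) P"

definition hocolim_step ::
    "'p set \<Rightarrow> ('p \<Rightarrow> 'p \<Rightarrow> bool) \<Rightarrow> ('p \<Rightarrow> 'x topology) \<Rightarrow> ('p \<Rightarrow> 'p \<Rightarrow> 'x \<Rightarrow> 'x) \<Rightarrow>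
     'p \<times> 'x \<times> ('p \<Rightarrow> real) \<Rightarrow> 'p \<times> 'x \<times> ('p \<Rightarrow> real) \<Rightarrow> bool" where
  "hocolim_step P leq D f = (\<lambda>(p, x, t) (q, y, s).
     p \<in> P \<and> q \<in> P \<and> leq q p \<and> q \<noteq> p \<and> x \<in> topspace (D p) \<and>
     t \<in> topspace (order_complex {q' \<in> P. leq q' q} leq) \<and> y = f p q x \<and> s = t)"

definition hocolim ::
    "'p set \<Rightarrow> ('p \<Rightarrow> 'p \<Rightarrow> bool) \<Rightarrow> ('p \<Rightarrow> 'x topology) \<Rightarrow> ('p \<Rightarrow> 'p \<Rightarrow> 'x \<Rightarrow> 'x) \<Rightarrow>
     ('p \<times> 'x \<times> ('p \<Rightarrow> real)) set topology" where
  "hocolim P leq D f = quotient_topology (hocolim_sum P leq D)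
     {(a, b). a \<in> topspace (hocolim_sum P leq D) \<and> b \<in> topspace (hocolim_sum P leq D) \<and>
        equivclp (hocolim_step P leq D f) a b}"

section \<open>Oriented systems\<close>

text \<open>A path is its initial vertex together with a list of edges with exponents, where \<open>True\<close>
  stands for \<open>+1\<close> and \<open>False\<close> for \<open>-1\<close>; the initial vertex is needed for constant paths.\<close>

type_synonym 'v signed_path = "'v \<times> (('v \<times> 'v) \<times> bool) list"

definition step_begin :: "('v \<times> 'v) \<times> bool \<Rightarrow> 'v" where
  "step_begin e = (if snd e then fst (fst e) else snd (fst e))"

definition step_end :: "('v \<times> 'v) \<times> bool \<Rightarrow> 'v" where
  "step_end e = (if snd e then snd (fst e) else fst (fst e))"

fun signed_walk :: "'v pair_pre_digraph \<Rightarrow> 'v \<Rightarrow> (('v \<times> 'v) \<times> bool) list \<Rightarrow> bool" where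
  "signed_walk \<Psi> v [] \<longleftrightarrow> v \<in> pverts \<Psi>"
| "signed_walk \<Psi> v (e # es) \<longleftrightarrow>
     fst e \<in> parcs \<Psi> \<and> step_begin e = v \<and> signed_walk \<Psi> (step_end e) es"

definition signed_paths :: "'v pair_pre_digraph \<Rightarrow> 'v signed_path set" where
  "signed_paths \<Psi> = {(v, es). signed_walk \<Psi> v es}"

definition path_begin :: "'v signed_path \<Rightarrow> 'v" where
  "path_begin \<alpha> = fst \<alpha>"

definition path_end :: "'v signed_path \<Rightarrow> 'v" where
  "path_end \<alpha> = (if snd \<alpha> = [] then fst \<alpha> else step_end (last (snd \<alpha>)))"

definition const_path :: "'v \<Rightarrow> 'v signed_path" where
  "const_path v = (v, [])"

definition path_comp :: "'v signed_path \<Rightarrow> 'v signed_path \<Rightarrow> 'v signed_path" (infixl \<open>\<bullet>\<^sub>p\<close> 70) where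
  "\<alpha> \<bullet>\<^sub>p \<beta> = (fst \<alpha>, snd \<alpha> @ snd \<beta>)"

definition path_inverse :: "'v signed_path \<Rightarrow> 'v signed_path" where
  "path_inverse \<alpha> = (path_end \<alpha>, rev (map (\<lambda>(e, s). (e, \<not> s)) (snd \<alpha>)))"

definition positive_path :: "'v signed_path \<Rightarrow> bool" where
  "positive_path \<alpha> \<longleftrightarrow> (\<forall>e \<in> set (snd \<alpha>). snd e)"

definition map_path :: "('v \<Rightarrow> 'w) \<Rightarrow> 'v signed_path \<Rightarrow> 'w signed_path" where
  "map_path \<rho> \<alpha> = (\<rho> (fst \<alpha>), map (\<lambda>((u, w), s). ((\<rho> u, \<rho> w), s)) (snd \<alpha>))"

text \<open>The underlying graph of an oriented system is always assumed to be connected.\<close>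

locale oriented_system = pair_wf_digraph \<Psi>
  for \<Psi> :: "'v pair_pre_digraph" +
  fixes R :: "'v signed_path rel"
  assumes nonempty: "pverts \<Psi> \<noteq> {}"
    and connected_graph: "\<lbrakk>u \<in> pverts \<Psi>; w \<in> pverts \<Psi>\<rbrakk> \<Longrightarrow>
      \<exists>\<alpha> \<in> signed_paths \<Psi>. path_begin \<alpha> = u \<and> path_end \<alpha> = w"
    and equiv_paths: "equiv (signed_paths \<Psi>) R"
    and same_begin: "(\<alpha>, \<beta>) \<in> R \<Longrightarrow> path_begin \<alpha> = path_begin \<beta>"
    and same_end: "(\<alpha>, \<beta>) \<in> R \<Longrightarrow> path_end \<alpha> = path_end \<beta>"
    and cancel: "\<alpha> \<in> signed_paths \<Psi> \<Longrightarrow>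
      (\<alpha> \<bullet>\<^sub>p path_inverse \<alpha>, const_path (path_begin \<alpha>)) \<in> R"
    and inverse: "(\<alpha>, \<beta>) \<in> R \<Longrightarrow> (path_inverse \<alpha>, path_inverse \<beta>) \<in> R"
    and composition: "\<lbrakk>(\<alpha>, \<beta>) \<in> R; \<gamma>\<^sub>1 \<in> signed_paths \<Psi>; \<gamma>\<^sub>2 \<in> signed_paths \<Psi>;
      path_end \<gamma>\<^sub>1 = path_begin \<alpha>; path_end \<alpha> = path_begin \<gamma>\<^sub>2\<rbrakk> \<Longrightarrow>
      (\<gamma>\<^sub>1 \<bullet>\<^sub>p \<alpha> \<bullet>\<^sub>p \<gamma>\<^sub>2, \<gamma>\<^sub>1 \<bullet>\<^sub>p \<beta> \<bullet>\<^sub>p \<gamma>\<^sub>2) \<in> R"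

text \<open>The relation of an oriented system generated by a set \<open>S\<close> of pairs of paths
  with equal beginnings and equal ends.\<close>

inductive_set generated_relation :: "'v pair_pre_digraph \<Rightarrow> 'v signed_path rel \<Rightarrow> 'v signed_path rel"
  for \<Psi> :: "'v pair_pre_digraph" and S :: "'v signed_path rel" where
  gen_base: "\<lbrakk>(\<alpha>, \<beta>) \<in> S; \<alpha> \<in> signed_paths \<Psi>; \<beta> \<in> signed_paths \<Psi>\<rbrakk> \<Longrightarrow>
    (\<alpha>, \<beta>) \<in> generated_relation \<Psi> S"
| gen_refl: "\<alpha> \<in> signed_paths \<Psi> \<Longrightarrow> (\<alpha>, \<alpha>) \<in> generated_relation \<Psi> S"
| gen_sym: "(\<alpha>, \<beta>) \<in> generated_relation \<Psi> S \<Longrightarrow> (\<beta>, \<alpha>) \<in> generated_relation \<Psi> S"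
| gen_trans: "\<lbrakk>(\<alpha>, \<beta>) \<in> generated_relation \<Psi> S; (\<beta>, \<gamma>) \<in> generated_relation \<Psi> S\<rbrakk> \<Longrightarrow>
    (\<alpha>, \<gamma>) \<in> generated_relation \<Psi> S"
| gen_cancel: "\<alpha> \<in> signed_paths \<Psi> \<Longrightarrow>
    (\<alpha> \<bullet>\<^sub>p path_inverse \<alpha>, const_path (path_begin \<alpha>)) \<in> generated_relation \<Psi> S"
| gen_inverse: "(\<alpha>, \<beta>) \<in> generated_relation \<Psi> S \<Longrightarrow>
    (path_inverse \<alpha>, path_inverse \<beta>) \<in> generated_relation \<Psi> S"
| gen_composition: "\<lbrakk>(\<alpha>, \<beta>) \<in> generated_relation \<Psi> S; \<gamma>\<^sub>1 \<in> signed_paths \<Psi>; \<gamma>\<^sub>2 \<in> signed_paths \<Psi>;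
    path_end \<gamma>\<^sub>1 = path_begin \<alpha>; path_end \<alpha> = path_begin \<gamma>\<^sub>2\<rbrakk> \<Longrightarrow>
    (\<gamma>\<^sub>1 \<bullet>\<^sub>p \<alpha> \<bullet>\<^sub>p \<gamma>\<^sub>2, \<gamma>\<^sub>1 \<bullet>\<^sub>p \<beta> \<bullet>\<^sub>p \<gamma>\<^sub>2) \<in> generated_relation \<Psi> S"

text \<open>The fundamental group of the underlying 1-complex is the edge-path group: closed edge paths
  modulo insertion and deletion of \<open>\<alpha>\<alpha>\<inverse>\<close>. Note that \<open>(u, v)\<close> and \<open>(v, u)\<close> are different edges.\<close>

definition edge_loops :: "'v pair_pre_digraph \<Rightarrow> 'v \<Rightarrow> 'v signed_path monoid" where
  "edge_loops \<Psi> v =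
     \<lparr>carrier = {\<alpha> \<in> signed_paths \<Psi>. path_begin \<alpha> = v \<and> path_end \<alpha> = v},
      mult = path_comp, one = const_path v\<rparr>"

definition graph_fundamental_group :: "'v pair_pre_digraph \<Rightarrow> 'v \<Rightarrow> 'v signed_path set monoid" where
  "graph_fundamental_group \<Psi> v = quotient_monoid (edge_loops \<Psi> v)
     (generated_relation \<Psi> {} \<inter> carrier (edge_loops \<Psi> v) \<times> carrier (edge_loops \<Psi> v))"

definition system_fundamental_group ::
    "'v pair_pre_digraph \<Rightarrow> 'v signed_path rel \<Rightarrow> 'v \<Rightarrow> 'v signed_path set set monoid" where
  "system_fundamental_group \<Psi> R v = quotient_monoid (graph_fundamental_group \<Psi> v)
     {(X, Y). X \<in> carrier (graph_fundamental_group \<Psi> v) \<and>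
        Y \<in> carrier (graph_fundamental_group \<Psi> v) \<and> (\<exists>\<alpha>\<in>X. \<exists>\<beta>\<in>Y. (\<alpha>, \<beta>) \<in> R)}"

definition path_lift :: "'v pair_pre_digraph \<Rightarrow> ('v \<Rightarrow> 'w) \<Rightarrow> 'v \<Rightarrow> 'w signed_path \<Rightarrow> 'v signed_path" where
  "path_lift \<Theta> \<rho> v \<alpha> = (THE \<beta>. \<beta> \<in> signed_paths \<Theta> \<and> path_begin \<beta> = v \<and> map_path \<rho> \<beta> = \<alpha>)"

locale oriented_cover = oriented_system \<Theta> R
  for \<Theta> :: "'v pair_pre_digraph" and R :: "'v signed_path rel" +
  fixes \<Gamma> :: "'w pair_pre_digraph" and S :: "'w signed_path rel" and \<rho> :: "'v \<Rightarrow> 'w"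
  assumes vertex_map: "v \<in> pverts \<Theta> \<Longrightarrow> \<rho> v \<in> pverts \<Gamma>"
    and edge_map: "(u, w) \<in> parcs \<Theta> \<Longrightarrow> (\<rho> u, \<rho> w) \<in> parcs \<Gamma>"
    and unique_lift: "\<lbrakk>v \<in> pverts \<Theta>; \<alpha> \<in> signed_paths \<Gamma>; path_begin \<alpha> = \<rho> v\<rbrakk> \<Longrightarrow>
      \<exists>!\<beta>. \<beta> \<in> signed_paths \<Theta> \<and> path_begin \<beta> = v \<and> map_path \<rho> \<beta> = \<alpha>"
    and lift_relation: "\<lbrakk>v \<in> pverts \<Theta>; (\<alpha>, \<beta>) \<in> S; path_begin \<alpha> = \<rho> v; path_begin \<beta> = \<rho> v\<rbrakk> \<Longrightarrow>
      (path_lift \<Theta> \<rho> v \<alpha>, path_lift \<Theta> \<rho> v \<beta>) \<in> R"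
    and induced_relation: "R = {(\<alpha>, \<beta>). \<alpha> \<in> signed_paths \<Theta> \<and> \<beta> \<in> signed_paths \<Theta> \<and>
      path_begin \<alpha> = path_begin \<beta> \<and> (map_path \<rho> \<alpha>, map_path \<rho> \<beta>) \<in> S}"

definition minimal_positive_paths :: "'v pair_pre_digraph \<Rightarrow> 'v \<Rightarrow> 'v \<Rightarrow> 'v signed_path set" where
  "minimal_positive_paths \<Psi> u w =
     {\<alpha> \<in> signed_paths \<Psi>. positive_path \<alpha> \<and> path_begin \<alpha> = u \<and> path_end \<alpha> = w \<and>
        (\<forall>\<beta> \<in> signed_paths \<Psi>. positive_path \<beta> \<and> path_begin \<beta> = u \<and> path_end \<beta> = w \<longrightarrow>
           length (snd \<alpha>) \<le> length (snd \<beta>))}"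

section \<open>Hyperplane arrangements\<close>

definition hyperplane_arrangement :: "'a::euclidean_space set set \<Rightarrow> bool" where
  "hyperplane_arrangement \<A> \<longleftrightarrow>
     finite \<A> \<and> (\<forall>H\<in>\<A>. \<exists>a b. a \<noteq> 0 \<and> H = {x. a \<bullet> x = b})"

text \<open>Cells of the stratification: two points lie in the same cell iff each hyperplane
  either contains both of them or has both of them strictly on the same side.\<close>

definition faces :: "'a::euclidean_space set set \<Rightarrow> 'a set set" where
  "faces \<A> = UNIV // {(x, y). \<forall>a b. {z. a \<bullet> z = b} \<in> \<A> \<longrightarrow> sgn (a \<bullet> x - b) = sgn (a \<bullet> y - b)}"

text \<open>The order is reverse inclusion of closures, so the chambers are the minimal faces.\<close>

definition face_le :: "'a::euclidean_space set \<Rightarrow> 'a set \<Rightarrow> bool" where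
  "face_le G F \<longleftrightarrow> closure F \<subseteq> closure G"

definition chambers :: "'a::euclidean_space set set \<Rightarrow> 'a set set" where
  "chambers \<A> = components (- \<Union>\<A>)"

definition localization :: "'a::euclidean_space set set \<Rightarrow> 'a set \<Rightarrow> 'a set set" where
  "localization \<A> F = {H \<in> \<A>. affine hull F \<subseteq> H}"

text \<open>The chamber \<open>C\<^sub>F\<close>.\<close>

definition chamber_at :: "'a::euclidean_space set set \<Rightarrow> 'a set \<Rightarrow> 'a set \<Rightarrow> 'a set" where
  "chamber_at \<A> C F = (THE C'. C' \<in> chambers \<A> \<and> F \<subseteq> closure C' \<and>
     (\<exists>K \<in> chambers (localization \<A> F). C \<subseteq> K \<and> C' \<subseteq> K))"

definition separating :: "'a::euclidean_space set set \<Rightarrow> 'a set \<Rightarrow> 'a set \<Rightarrow> 'a set set" where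
  "separating \<A> A B = {H \<in> \<A>. \<exists>a b. H = {x. a \<bullet> x = b} \<and>
     A \<subseteq> {x. a \<bullet> x < b} \<and> B \<subseteq> {x. b < a \<bullet> x}}"

definition arrangement_graph :: "'a::euclidean_space set set \<Rightarrow> 'a set pair_pre_digraph" where
  "arrangement_graph \<A> =
     \<lparr>pverts = chambers \<A>,
      parcs = {(A, B). A \<in> chambers \<A> \<and> B \<in> chambers \<A> \<and> card (separating \<A> A B) = 1}\<rparr>"

definition arrangement_relation :: "'a::euclidean_space set set \<Rightarrow> 'a set signed_path rel" where
  "arrangement_relation \<A> = generated_relation (arrangement_graph \<A>)
     {(\<alpha>, \<beta>). \<exists>A B. \<alpha> \<in> minimal_positive_paths (arrangement_graph \<A>) A B \<and>
        \<beta> \<in> minimal_positive_paths (arrangement_graph \<A>) A B}"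

section \<open>The diagram of a cover\<close>

definition cover_space ::
    "'v pair_pre_digraph \<Rightarrow> ('v \<Rightarrow> 'a::euclidean_space set) \<Rightarrow> 'a set \<Rightarrow> 'v topology" where
  "cover_space \<Theta> \<rho> F = discrete_topology {v \<in> pverts \<Theta>. face_le (\<rho> v) F}"

text \<open>The end of the lift at \<open>v\<close> does not depend on the chosen positive minimal path from
  \<open>\<rho> v\<close> to \<open>(\<rho> v)\<^sub>G\<close>.\<close>

definition cover_map ::
    "'a::euclidean_space set set \<Rightarrow> 'v pair_pre_digraph \<Rightarrow> ('v \<Rightarrow> 'a set) \<Rightarrow>
     'a set \<Rightarrow> 'a set \<Rightarrow> 'v \<Rightarrow> 'v" where
  "cover_map \<A> \<Theta> \<rho> F G v =
     (THE w. \<exists>\<gamma> \<in> minimal_positive_paths (arrangement_graph \<A>) (\<rho> v) (chamber_at \<A> (\<rho> v) G).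
        w = path_end (path_lift \<Theta> \<rho> v \<gamma>))"

definition cover_hocolim ::
    "'a::euclidean_space set set \<Rightarrow> 'v pair_pre_digraph \<Rightarrow> ('v \<Rightarrow> 'a set) \<Rightarrow>
     ('a set \<times> 'v \<times> ('a set \<Rightarrow> real)) set topology" where
  "cover_hocolim \<A> \<Theta> \<rho> = hocolim (faces \<A>) face_le (cover_space \<Theta> \<rho>) (cover_map \<A> \<Theta> \<rho>)"

end

theory Submission
  imports Defs
begin

text \<open>The diagram spaces are discrete, so the homotopy colimit is the order complex of the poset of pairs
  \<open>(F, u)\<close> with \<open>\<rho> u \<le> F\<close>, in which \<open>(F, u)\<close> lies above \<open>(G, act G u)\<close>. The map \<open>act G u\<close> is the end of a
  minimal path of the cover, and so the classes of paths of \<open>\<Theta>\<close> form a local system on the homotopy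
  colimit: transporting the class of the constant path along a loop produces a class of loops of \<open>\<Theta>\<close>,
  which depends only on the homotopy class of the given loop.

  Conversely, an edge from \<open>u\<close> to \<open>v\<close> is realized by the path through the common facet of the two
  chambers. Minimal paths with the same ends have homotopic realizations: the pairs \<open>(F, act F u)\<close> form a
  copy of the face poset, over which the local system of homotopy classes of paths is trivial because
  the Euclidean space is simply connected. Hence realization respects the relation of \<open>\<Theta>\<close>, and it maps
  the first local system to the second. This makes the transport map injective, and transporting along
  the realization of a loop returns the loop, so that it is surjective.\<close>

section \<open>Path homotopy in abstract topological spaces\<close>

text \<open>Paths in the quotient space are never made simplicial. All that is asked of the space is
  that its map to the poset be continuous for upward closed sets: sections of a local system along a
  map then exist locally, are unique on connected sets, and extend over intervals and squares by
  bisection. This theory is applied to two stratified spaces, the homotopy colimit over the poset of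
  pairs and the Euclidean space over its faces. In the first, transport goes from a pair to those
  above it; in the second, from a face to those below it, because the strata near a point lie on
  that side. Convexity of the ambient space and of the cells thus stands in for contractibility of
  the order complex of the face poset. The fibres of the second system on the homotopy colimit are
  themselves homotopy classes of paths, so transporting the class of a ray along a loop returns that
  loop followed by the ray. A morphism from the first system therefore recovers the loop from its
  transport. Two obstacles cost work: contracting an open star continuously across the quotient, and
  lifting every rule that generates the relation to the cover, where intermediate paths must be
  shown to end at the same vertex.\<close>

definition path_homotopic :: "'a topology \<Rightarrow> (real \<Rightarrow> 'a) \<Rightarrow> (real \<Rightarrow> 'a) \<Rightarrow> bool" where
  "path_homotopic X g h \<longleftrightarrow> pathin X g \<and> pathin X h \<and> g 0 = h 0 \<and> g 1 = h 1 \<and>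
     homotopic_with (\<lambda>k. k 0 = g 0 \<and> k 1 = g 1) (top_of_set {0..1}) X g h"

lemma path_homotopic_pathin:
  assumes "path_homotopic X g h"
  shows "pathin X g" "pathin X h"
  using assms by (auto simp: path_homotopic_def)

lemma path_homotopic_ends:
  assumes "path_homotopic X g h"
  shows "g 0 = h 0" "g 1 = h 1"
  using assms by (auto simp: path_homotopic_def)

lemma path_homotopic_refl: "pathin X g \<Longrightarrow> path_homotopic X g g"
  unfolding path_homotopic_def by (simp add: pathin_def)

lemma path_homotopic_sym: "path_homotopic X g h \<Longrightarrow> path_homotopic X h g"
  unfolding path_homotopic_def by (auto simp: homotopic_with_sym)

lemma path_homotopic_trans [trans]:
  "path_homotopic X g h \<Longrightarrow> path_homotopic X h k \<Longrightarrow> path_homotopic X g k"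
  unfolding path_homotopic_def by (auto intro: homotopic_with_trans)

lemma path_homotopic_eq:
  assumes "pathin X g" and "\<And>t. t \<in> {0..1} \<Longrightarrow> g t = h t"
  shows "path_homotopic X g h"
proof -
  have "pathin X h"
    using assms unfolding pathin_def by (auto intro: continuous_map_eq)
  moreover have "homotopic_with (\<lambda>k. k 0 = g 0 \<and> k 1 = g 1) (top_of_set {0..1}) X g h"
    using assms by (intro homotopic_with_equal) (auto simp: pathin_def)
  ultimately show ?thesis
    using assms by (simp add: path_homotopic_def)
qed

text \<open>\<open>homotopic_with\<close> prescribes its end maps at every real argument. The
  endpoint condition only looks at values in the unit interval, so a homotopy may be given as a map
  on the square constrained on its boundary alone; this is the form in which potentials use
  it.\<close>

lemma path_homotopic_iff_square:
  "path_homotopic X g h \<longleftrightarrow> (\<exists>K. continuous_map (top_of_set ({0..1::real} \<times> {0..1::real})) X K \<and>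
     (\<forall>t\<in>{0..1}. K (0, t) = g t) \<and> (\<forall>t\<in>{0..1}. K (1, t) = h t) \<and>
     (\<forall>s\<in>{0..1}. K (s, 0) = g 0 \<and> K (s, 1) = g (1::real)))" (is "_ = ?R")
proof
  assume *: "path_homotopic X g h"
  have "\<exists>K. continuous_map (prod_topology (top_of_set {0..1::real}) (top_of_set {0..1::real})) X K \<and>
     (\<forall>t. K (0, t) = g t) \<and> (\<forall>t. K (1, t) = h t) \<and>
     (\<forall>s\<in>{0..1}. K (s, 0) = g 0 \<and> K (s, 1) = g (1::real))"
    using * unfolding path_homotopic_def homotopic_with_def by blast
  then show ?R
    by (auto simp: prod_topology_subtopology_eu)
next
  assume ?R
  then obtain K where K: "continuous_map (top_of_set ({0..1} \<times> {0..1})) X K"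
    "\<forall>t\<in>{0..1}. K (0::real, t) = g t" "\<forall>t\<in>{0..1}. K (1, t) = h t"
    "\<forall>s\<in>{0..1}. K (s, 0) = g 0 \<and> K (s, 1) = g (1::real)"
    by blast
  have "g 0 = h 0" "g 1 = h 1"
    using K(3,4) by (metis atLeastAtMost_iff order_refl zero_le_one)+
  moreover have slice: "pathin X (\<lambda>t. K (s, t))" if "s \<in> {0..1}" for s
  proof -
    have "continuous_map (top_of_set {0..1}) (top_of_set ({0..1} \<times> {0..1})) (\<lambda>t. (s, t))"
      using that by (auto simp: continuous_map_in_subtopology intro!: continuous_intros)
    from continuous_map_compose[OF this K(1)] show ?thesis
      by (simp add: pathin_def o_def)
  qed
  have "pathin X g" "pathin X h"
    using continuous_map_eq[OF slice[of 0, unfolded pathin_def], of g]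
      continuous_map_eq[OF slice[of 1, unfolded pathin_def], of h] K(2,3)
    by (simp_all add: pathin_def)
  moreover have "homotopic_with (\<lambda>k. k 0 = g 0 \<and> k 1 = g 1) (top_of_set {0..1}) X g h"
  proof (subst homotopic_with, goal_cases)
    case 1
    then show ?case by simp
  next
    case 2
    show ?case
      using K by (intro exI[of _ K]) (auto simp: prod_topology_subtopology_eu)
  qed
  ultimately show "path_homotopic X g h"
    by (simp add: path_homotopic_def)
qed

text \<open>All the groupoid laws below are reparametrisations, hence instances of this lemma.\<close>

lemma path_homotopic_convex:
  fixes C :: "'b::real_normed_vector set"
  assumes K: "continuous_map (top_of_set C) X K" and C: "convex C"
    and p: "path p" "path_image p \<subseteq> C" and q: "path q" "path_image q \<subseteq> C"
    and ends: "pathstart p = pathstart q" "pathfinish p = pathfinish q"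
  shows "path_homotopic X (K \<circ> p) (K \<circ> q)"
proof (subst path_homotopic_iff_square, intro exI conjI)
  let ?L = "\<lambda>(s, t). (1 - s) *\<^sub>R p t + s *\<^sub>R q t"
  have pq: "p t \<in> C" "q t \<in> C" if "t \<in> {0..1}" for t
    using p q that by (auto simp: path_image_def)
  have "continuous_on ({0..1} \<times> {0..1}) ?L"
    using p(1) q(1) unfolding path_def case_prod_unfold
    by (intro continuous_intros continuous_on_compose2[of "{0..1}" p _ snd]
        continuous_on_compose2[of "{0..1}" q _ snd]) auto
  moreover have "?L ` ({0..1} \<times> {0..1}) \<subseteq> C"
    using pq C by (auto simp: convex_def)
  ultimately have "continuous_map (top_of_set ({0..1} \<times> {0..1})) (top_of_set C) ?L"
    by (auto simp: continuous_map_in_subtopology)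
  from continuous_map_compose[OF this K]
  show "continuous_map (top_of_set ({0..1} \<times> {0..1})) X (K \<circ> ?L)" .
qed (use ends in \<open>auto simp: pathstart_def pathfinish_def algebra_simps simp flip: scaleR_left_distrib\<close>)

lemma path_join_0 [simp]: "path_join g h 0 = g 0"
  and path_join_1 [simp]: "path_join g h 1 = h 1"
  by (auto simp: path_join_def)

definition path_reverse :: "(real \<Rightarrow> 'a) \<Rightarrow> real \<Rightarrow> 'a" where
  "path_reverse g = (\<lambda>t. g (1 - t))"

lemma path_reverse_0 [simp]: "path_reverse g 0 = g 1"
  and path_reverse_1 [simp]: "path_reverse g 1 = g 0"
  and path_reverse_reverse [simp]: "path_reverse (path_reverse g) = g"
  by (auto simp: path_reverse_def)

lemma path_compose_path_join: "K \<circ> (p +++ q) = path_join (K \<circ> p) (K \<circ> q)"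
  by (auto simp: joinpaths_def path_join_def)

text \<open>The parameter space \<open>S\<close> makes one gluing argument serve twice: a single
  point gives concatenation of paths, the unit interval gives concatenation of homotopies.\<close>

lemma square_path_join:
  fixes K L :: "'b::t2_space \<times> real \<Rightarrow> 'a"
  assumes "continuous_map (top_of_set (S \<times> {0..1})) X K" "continuous_map (top_of_set (S \<times> {0..1})) X L"
    and "\<And>s. s \<in> S \<Longrightarrow> K (s, 1) = L (s, 0)"
  shows "continuous_map (top_of_set (S \<times> {0..1})) X (\<lambda>(s, t). path_join (\<lambda>t. K (s, t)) (\<lambda>t. L (s, t)) t)"
proof -
  have "continuous_map (top_of_set (S \<times> {0..1})) X
      (\<lambda>z. if snd z \<le> (1/2::real) then (K \<circ> (\<lambda>z. (fst z, 2 * snd z))) z else (L \<circ> (\<lambda>z. (fst z, 2 * snd z - 1))) z)"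
  proof (rule continuous_map_cases_le)
    have "continuous_map (subtopology (top_of_set (S \<times> {0..1})) {z \<in> topspace (top_of_set (S \<times> {0..1})). snd z \<le> (1/2::real)})
        (top_of_set (S \<times> {0..1})) (\<lambda>z. (fst z, 2 * snd z))"
      by (auto simp: continuous_map_in_subtopology subtopology_subtopology case_prod_unfold intro!: continuous_intros)
    from continuous_map_compose[OF this assms(1)]
    show "continuous_map (subtopology (top_of_set (S \<times> {0..1})) {z \<in> topspace (top_of_set (S \<times> {0..1})). snd z \<le> (1/2::real)})
        X (K \<circ> (\<lambda>z. (fst z, 2 * snd z)))" .
    have "continuous_map (subtopology (top_of_set (S \<times> {0..1})) {z \<in> topspace (top_of_set (S \<times> {0..1})). (1/2::real) \<le> snd z})
        (top_of_set (S \<times> {0..1})) (\<lambda>z. (fst z, 2 * snd z - 1))"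
      by (auto simp: continuous_map_in_subtopology subtopology_subtopology case_prod_unfold intro!: continuous_intros)
    from continuous_map_compose[OF this assms(2)]
    show "continuous_map (subtopology (top_of_set (S \<times> {0..1})) {z \<in> topspace (top_of_set (S \<times> {0..1})). (1/2::real) \<le> snd z})
        X (L \<circ> (\<lambda>z. (fst z, 2 * snd z - 1)))" .
    fix z assume z: "z \<in> topspace (top_of_set (S \<times> {0..1}))" "snd z = (1/2::real)"
    then obtain s where s: "z = (s, 1/2)" "s \<in> S"
      by (cases z) auto
    show "(K \<circ> (\<lambda>z. (fst z, 2 * snd z))) z = (L \<circ> (\<lambda>z. (fst z, 2 * snd z - 1))) z"
      using assms(3)[OF s(2)] by (simp add: s(1))
  qed (auto intro!: continuous_intros simp: continuous_map_from_subtopology)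
  then show ?thesis
    by (rule continuous_map_eq) (auto simp: path_join_def)
qed

lemma pathin_square:
  fixes K :: "'b::t2_space \<times> real \<Rightarrow> 'a"
  assumes "continuous_map (top_of_set (S \<times> {0..1})) X K" "s \<in> S"
  shows "pathin X (\<lambda>t. K (s, t))"
proof -
  have "continuous_map (top_of_set {0..1}) (top_of_set (S \<times> {0..1})) (\<lambda>t. (s, t))"
    using assms(2) by (auto simp: continuous_map_in_subtopology intro!: continuous_intros)
  from continuous_map_compose[OF this assms(1)] show ?thesis
    by (simp add: pathin_def o_def)
qed

lemma pathin_of_snd:
  assumes "pathin X g"
  shows "continuous_map (top_of_set ({0::real} \<times> {0..1})) X (\<lambda>(s, t). g t)"
proof -
  have "continuous_map (top_of_set ({0::real} \<times> {0..1})) (top_of_set {0..1}) snd"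
    by (auto simp: continuous_map_in_subtopology intro!: continuous_intros)
  from continuous_map_compose[OF this] assms show ?thesis
    unfolding pathin_def by (fastforce simp: o_def case_prod_unfold)
qed

lemma pathin_join:
  assumes "pathin X g" "pathin X h" "g 1 = h 0"
  shows "pathin X (path_join g h)"
  using pathin_square[OF square_path_join[OF pathin_of_snd[OF assms(1)] pathin_of_snd[OF assms(2)]], of 0] assms(3)
  by simp

lemma path_homotopic_join:
  assumes "path_homotopic X g g'" "path_homotopic X h h'" "g 1 = h 0"
  shows "path_homotopic X (path_join g h) (path_join g' h')"
proof -
  obtain K where K: "continuous_map (top_of_set ({0..1} \<times> {0..1})) X K"
    "\<forall>t\<in>{0..1}. K (0::real, t) = g t" "\<forall>t\<in>{0..1}. K (1, t) = g' t"
    "\<forall>s\<in>{0..1}. K (s, 0) = g 0 \<and> K (s, 1) = g (1::real)"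
    using assms(1) unfolding path_homotopic_iff_square by blast
  obtain L where L: "continuous_map (top_of_set ({0..1} \<times> {0..1})) X L"
    "\<forall>t\<in>{0..1}. L (0::real, t) = h t" "\<forall>t\<in>{0..1}. L (1, t) = h' t"
    "\<forall>s\<in>{0..1}. L (s, 0) = h 0 \<and> L (s, 1) = h (1::real)"
    using assms(2) unfolding path_homotopic_iff_square by blast
  have "continuous_map (top_of_set ({0..1} \<times> {0..1})) X (\<lambda>(s, t). path_join (\<lambda>t. K (s, t)) (\<lambda>t. L (s, t)) t)"
    using K L assms(3) by (intro square_path_join) auto
  then show ?thesis
    unfolding path_homotopic_iff_square
    by (intro exI conjI, assumption) (use K L in \<open>auto simp: path_join_def\<close>)
qed

lemma pathin_reverse:
  assumes "pathin X g"
  shows "pathin X (path_reverse g)"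
proof -
  have "continuous_map (top_of_set {0..1}) (top_of_set {0..1}) (\<lambda>t::real. 1 - t)"
    by (auto simp: continuous_map_in_subtopology intro!: continuous_intros)
  from continuous_map_compose[OF this] assms show ?thesis
    unfolding pathin_def path_reverse_def by (fastforce simp: o_def)
qed

lemma path_homotopic_cong:
  assumes "path_homotopic X g h" and "\<And>t. t \<in> {0..1} \<Longrightarrow> g t = g' t" "\<And>t. t \<in> {0..1} \<Longrightarrow> h t = h' t"
  shows "path_homotopic X g' h'"
  using path_homotopic_trans[OF path_homotopic_trans[OF path_homotopic_sym[OF path_homotopic_eq[of X g g']]
      assms(1)] path_homotopic_eq[of X h h']] path_homotopic_pathin[OF assms(1)] assms by blast

lemma path_join_cong:
  assumes "\<And>t. t \<in> {0..1} \<Longrightarrow> g t = g' t" "\<And>t. t \<in> {0..1} \<Longrightarrow> h t = h' t" "t \<in> {0..1}"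
  shows "path_join g h t = path_join g' h' t"
  using assms by (auto simp: path_join_def)

lemma path_homotopic_assoc:
  assumes "pathin X g" "pathin X h" "pathin X k" "g 1 = h 0" "h 1 = k 0"
  shows "path_homotopic X (path_join (path_join g h) k) (path_join g (path_join h k))"
proof -
  let ?K = "path_join g (path_join h k)"
  \<comment> \<open>The path \<open>?K\<close> traverses \<open>g\<close>, \<open>h\<close> and
    \<open>k\<close> on the intervals cut at \<open>1/2\<close> and \<open>3/4\<close>. These affine
    pieces recover the three paths, so both bracketings become \<open>?K\<close> composed with paths
    in the convex unit interval.\<close>
  let ?p = "linepath 0 (1/2::real)" and ?q = "linepath (1/2) (3/4::real)" and ?r = "linepath (3/4) (1::real)"
  have K: "pathin X ?K"
    using assms by (intro pathin_join) auto
  have im: "path_image ?p \<subseteq> {0..1}" "path_image ?q \<subseteq> {0..1}" "path_image ?r \<subseteq> {0..1}"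
    by (auto simp: closed_segment_eq_real_ivl)
  have "path_homotopic X (?K \<circ> ((?p +++ ?q) +++ ?r)) (?K \<circ> (?p +++ (?q +++ ?r)))"
    using K im by (intro path_homotopic_convex[of "{0..1}"]) (auto simp: pathin_def path_image_join)
  then have *: "path_homotopic X (path_join (path_join (?K \<circ> ?p) (?K \<circ> ?q)) (?K \<circ> ?r))
      (path_join (?K \<circ> ?p) (path_join (?K \<circ> ?q) (?K \<circ> ?r)))"
    by (simp add: path_compose_path_join)
  have pqr: "?p t = t / 2" "?q t = 1/2 + t / 4" "?r t = 3/4 + t / 4" for t
    by (simp_all add: linepath_def field_simps)
  have "?K (?p t) = g t" "?K (?q t) = h t" "?K (?r t) = k t" if "t \<in> {0..1}" for t
    unfolding pqr using that assms by (cases "t = 0"; auto simp: path_join_def algebra_simps)+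
  then show ?thesis
    by (intro path_homotopic_cong[OF *]) (auto intro!: path_join_cong)
qed

lemma path_homotopic_const_left:
  assumes "pathin X g"
  shows "path_homotopic X (path_join (\<lambda>_. g 0) g) g"
proof -
  have "path_homotopic X (g \<circ> (linepath 0 0 +++ linepath 0 1)) (g \<circ> linepath 0 1)"
    using assms by (intro path_homotopic_convex[of "{0..1}"])
      (auto simp: pathin_def path_image_join closed_segment_eq_real_ivl)
  then show ?thesis
    unfolding path_compose_path_join
    by (rule path_homotopic_cong) (auto intro!: path_join_cong simp: linepath_def)
qed

lemma path_homotopic_const_right:
  assumes "pathin X g"
  shows "path_homotopic X (path_join g (\<lambda>_. g 1)) g"
proof -
  have "path_homotopic X (g \<circ> (linepath 0 1 +++ linepath 1 1)) (g \<circ> linepath 0 1)"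
    using assms by (intro path_homotopic_convex[of "{0..1}"])
      (auto simp: pathin_def path_image_join closed_segment_eq_real_ivl)
  then show ?thesis
    unfolding path_compose_path_join
    by (rule path_homotopic_cong) (auto intro!: path_join_cong simp: linepath_def)
qed

lemma path_homotopic_reverse_right:
  assumes "pathin X g"
  shows "path_homotopic X (path_join g (path_reverse g)) (\<lambda>_. g 0)"
proof -
  have "path_homotopic X (g \<circ> (linepath 0 1 +++ linepath 1 0)) (g \<circ> linepath 0 0)"
    using assms by (intro path_homotopic_convex[of "{0..1}"])
      (auto simp: pathin_def path_image_join closed_segment_eq_real_ivl)
  then show ?thesis
    unfolding path_compose_path_join
    by (rule path_homotopic_cong) (auto intro!: path_join_cong simp: linepath_def path_reverse_def)
qed

section \<open>Local systems on stratified spaces\<close>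

text \<open>A functor from the poset \<open>Q\<close> to sets all of whose structure maps are
  bijections. Pulled back to a space stratified by \<open>Q\<close> it is a local system, and its
  monodromy is what the proof computes.\<close>

locale poset_system =
  fixes Q :: "'q set" and le :: "'q \<Rightarrow> 'q \<Rightarrow> bool"
    and fib :: "'q \<Rightarrow> 'm set" and tr :: "'q \<Rightarrow> 'q \<Rightarrow> 'm \<Rightarrow> 'm"
  assumes le_refl: "q \<in> Q \<Longrightarrow> le q q"
    and le_trans: "\<lbrakk>q \<in> Q; r \<in> Q; s \<in> Q; le q r; le r s\<rbrakk> \<Longrightarrow> le q s"
    and tr_bij: "\<lbrakk>q \<in> Q; r \<in> Q; le q r\<rbrakk> \<Longrightarrow> bij_betw (tr q r) (fib q) (fib r)"
    and tr_id: "\<lbrakk>q \<in> Q; m \<in> fib q\<rbrakk> \<Longrightarrow> tr q q m = m"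
    and tr_tr: "\<lbrakk>q \<in> Q; r \<in> Q; s \<in> Q; le q r; le r s; m \<in> fib q\<rbrakk> \<Longrightarrow> tr r s (tr q r m) = tr q s m"
begin

lemma tr_in: "\<lbrakk>q \<in> Q; r \<in> Q; le q r; m \<in> fib q\<rbrakk> \<Longrightarrow> tr q r m \<in> fib r"
  using tr_bij bij_betwE by metis

lemma tr_inj: "\<lbrakk>q \<in> Q; r \<in> Q; le q r; m \<in> fib q; n \<in> fib q\<rbrakk> \<Longrightarrow> tr q r m = tr q r n \<longleftrightarrow> m = n"
  using tr_bij by (meson bij_betw_def inj_on_eq_iff)

lemma tr_surj:
  assumes "q \<in> Q" "r \<in> Q" "le q r" "n \<in> fib r"
  obtains m where "m \<in> fib q" "tr q r m = n"
  using tr_bij[OF assms(1-3)] assms(4) by (metis bij_betw_iff_bijections)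

end

text \<open>A map to a poset that is continuous for the topology of upward closed sets.\<close>

locale stratification =
  fixes X :: "'a topology" and Q :: "'q set" and le :: "'q \<Rightarrow> 'q \<Rightarrow> bool" and \<sigma> :: "'a \<Rightarrow> 'q"
  assumes stratum_in: "z \<in> topspace X \<Longrightarrow> \<sigma> z \<in> Q"
    and open_upper: "q \<in> Q \<Longrightarrow> openin X {z \<in> topspace X. le q (\<sigma> z)}"

locale stratified_system = poset_system Q le fib tr + stratification X Q le \<sigma>
  for X :: "'a topology" and Q :: "'q set" and le and \<sigma> :: "'a \<Rightarrow> 'q"
    and fib :: "'q \<Rightarrow> 'm set" and tr
begin

text \<open>A potential is a section of the pullback of the local system along \<open>\<phi>\<close>.\<close>

definition potential :: "'z::metric_space set \<Rightarrow> ('z \<Rightarrow> 'a) \<Rightarrow> ('z \<Rightarrow> 'm) \<Rightarrow> bool" where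
  "potential S \<phi> A \<longleftrightarrow> (\<forall>z\<in>S. \<phi> z \<in> topspace X \<and> A z \<in> fib (\<sigma> (\<phi> z)) \<and>
     (\<exists>T. open T \<and> z \<in> T \<and> (\<forall>w\<in>S \<inter> T. le (\<sigma> (\<phi> z)) (\<sigma> (\<phi> w)) \<and>
        A w = tr (\<sigma> (\<phi> z)) (\<sigma> (\<phi> w)) (A z))))"

lemma potentialE:
  assumes "potential S \<phi> A" "z \<in> S"
  obtains T where "open T" "z \<in> T" "\<And>w. w \<in> S \<Longrightarrow> w \<in> T \<Longrightarrow> le (\<sigma> (\<phi> z)) (\<sigma> (\<phi> w))"
    "\<And>w. w \<in> S \<Longrightarrow> w \<in> T \<Longrightarrow> A w = tr (\<sigma> (\<phi> z)) (\<sigma> (\<phi> w)) (A z)"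
proof -
  obtain T where "open T" "z \<in> T" "\<forall>w\<in>S \<inter> T. le (\<sigma> (\<phi> z)) (\<sigma> (\<phi> w)) \<and>
      A w = tr (\<sigma> (\<phi> z)) (\<sigma> (\<phi> w)) (A z)"
    using assms unfolding potential_def by meson
  with that show ?thesis
    by blast
qed

lemma potential_stratum: "potential S \<phi> A \<Longrightarrow> z \<in> S \<Longrightarrow> \<sigma> (\<phi> z) \<in> Q"
  by (auto simp: potential_def intro: stratum_in)

lemma potential_in: "potential S \<phi> A \<Longrightarrow> z \<in> S \<Longrightarrow> A z \<in> fib (\<sigma> (\<phi> z))"
  by (auto simp: potential_def)

lemma potential_subset:
  assumes "potential S \<phi> A" "T \<subseteq> S"
  shows "potential T \<phi> A"
  unfolding potential_def
proof
  fix z assume "z \<in> T"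
  then have "z \<in> S"
    using assms(2) by blast
  then obtain U where U: "open U" "z \<in> U" "\<And>w. w \<in> S \<Longrightarrow> w \<in> U \<Longrightarrow> le (\<sigma> (\<phi> z)) (\<sigma> (\<phi> w))"
    "\<And>w. w \<in> S \<Longrightarrow> w \<in> U \<Longrightarrow> A w = tr (\<sigma> (\<phi> z)) (\<sigma> (\<phi> w)) (A z)"
    using potentialE[OF assms(1)] by metis
  moreover have "\<phi> z \<in> topspace X" "A z \<in> fib (\<sigma> (\<phi> z))"
    using assms(1) \<open>z \<in> S\<close> unfolding potential_def by blast+
  moreover have "\<forall>w\<in>T \<inter> U. le (\<sigma> (\<phi> z)) (\<sigma> (\<phi> w)) \<and> A w = tr (\<sigma> (\<phi> z)) (\<sigma> (\<phi> w)) (A z)"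
    using U(3,4) assms(2) by blast
  ultimately show "\<phi> z \<in> topspace X \<and> A z \<in> fib (\<sigma> (\<phi> z)) \<and> (\<exists>U. open U \<and> z \<in> U \<and>
      (\<forall>w\<in>T \<inter> U. le (\<sigma> (\<phi> z)) (\<sigma> (\<phi> w)) \<and> A w = tr (\<sigma> (\<phi> z)) (\<sigma> (\<phi> w)) (A z)))"
    by blast
qed

lemma potential_cong:
  assumes "potential S \<phi> A" "\<And>z. z \<in> S \<Longrightarrow> \<phi> z = \<psi> z" "\<And>z. z \<in> S \<Longrightarrow> A z = B z"
  shows "potential S \<psi> B"
proof -
  have "(\<forall>w\<in>S \<inter> T. le (\<sigma> (\<phi> z)) (\<sigma> (\<phi> w)) \<and> A w = tr (\<sigma> (\<phi> z)) (\<sigma> (\<phi> w)) (A z)) \<longleftrightarrow>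
      (\<forall>w\<in>S \<inter> T. le (\<sigma> (\<psi> z)) (\<sigma> (\<psi> w)) \<and> B w = tr (\<sigma> (\<psi> z)) (\<sigma> (\<psi> w)) (B z))" if "z \<in> S" for z T
    using assms(2,3) that by (intro ball_cong) auto
  then show ?thesis
    using assms unfolding potential_def by simp
qed

lemma potential_compose:
  assumes "potential S \<phi> A" "continuous_on T f" "f ` T \<subseteq> S"
  shows "potential T (\<phi> \<circ> f) (A \<circ> f)"
  unfolding potential_def
proof (intro ballI conjI)
  fix z assume z: "z \<in> T"
  then have fz: "f z \<in> S"
    using assms(3) by blast
  then show "(\<phi> \<circ> f) z \<in> topspace X" "(A \<circ> f) z \<in> fib (\<sigma> ((\<phi> \<circ> f) z))"
    using assms(1) by (auto simp: potential_def)
  obtain U where U: "open U" "f z \<in> U" "\<And>w. w \<in> S \<Longrightarrow> w \<in> U \<Longrightarrow> le (\<sigma> (\<phi> (f z))) (\<sigma> (\<phi> w))"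
    "\<And>w. w \<in> S \<Longrightarrow> w \<in> U \<Longrightarrow> A w = tr (\<sigma> (\<phi> (f z))) (\<sigma> (\<phi> w)) (A (f z))"
    using potentialE[OF assms(1) fz] by metis
  obtain V where V: "open V" "z \<in> V" "\<forall>y\<in>T. y \<in> V \<longrightarrow> f y \<in> U"
    using assms(2) z U unfolding continuous_on_topological by metis
  then show "\<exists>T'. open T' \<and> z \<in> T' \<and> (\<forall>w\<in>T \<inter> T'. le (\<sigma> ((\<phi> \<circ> f) z)) (\<sigma> ((\<phi> \<circ> f) w)) \<and>
        (A \<circ> f) w = tr (\<sigma> ((\<phi> \<circ> f) z)) (\<sigma> ((\<phi> \<circ> f) w)) ((A \<circ> f) z))"
    using U(3,4) V assms(3) by (intro exI[of _ V]) (auto simp: image_subset_iff)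
qed

text \<open>Near a point \<open>a\<close> both potentials are transports of their values at
  \<open>a\<close>, and transports are injective. So they agree at one nearby point iff they agree
  at all of them, and connectedness does the rest.\<close>

lemma potential_unique:
  assumes S: "connected S" and A: "potential S \<phi> A" and B: "potential S \<phi> B"
    and "z \<in> S" "w \<in> S" "A z = B z"
  shows "A w = B w"
proof (rule connected_induction_simple[OF S \<open>z \<in> S\<close> \<open>w \<in> S\<close>, where P = "\<lambda>z. A z = B z"])
  fix a assume a: "a \<in> S"
  obtain U where U: "open U" "a \<in> U" "\<And>w. w \<in> S \<Longrightarrow> w \<in> U \<Longrightarrow> le (\<sigma> (\<phi> a)) (\<sigma> (\<phi> w))"
    "\<And>w. w \<in> S \<Longrightarrow> w \<in> U \<Longrightarrow> A w = tr (\<sigma> (\<phi> a)) (\<sigma> (\<phi> w)) (A a)"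
    using potentialE[OF A a] by metis
  obtain V where V: "open V" "a \<in> V"
    "\<And>w. w \<in> S \<Longrightarrow> w \<in> V \<Longrightarrow> B w = tr (\<sigma> (\<phi> a)) (\<sigma> (\<phi> w)) (B a)"
    using potentialE[OF B a] by metis
  have "A x = B x \<longleftrightarrow> A a = B a" if "x \<in> S \<inter> (U \<inter> V)" for x
  proof -
    have "\<sigma> (\<phi> a) \<in> Q" "\<sigma> (\<phi> x) \<in> Q"
      using A a that by (auto intro: potential_stratum)
    moreover have "le (\<sigma> (\<phi> a)) (\<sigma> (\<phi> x))" "A x = tr (\<sigma> (\<phi> a)) (\<sigma> (\<phi> x)) (A a)"
      "B x = tr (\<sigma> (\<phi> a)) (\<sigma> (\<phi> x)) (B a)"
      using that U(3,4) V(3) by blast+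
    ultimately show ?thesis
      using tr_inj potential_in[OF A a] potential_in[OF B a] by metis
  qed
  then have "\<forall>x\<in>S \<inter> (U \<inter> V). \<forall>y\<in>S \<inter> (U \<inter> V). A x = B x \<longrightarrow> A y = B y"
    by blast
  moreover have "openin (top_of_set S) (S \<inter> (U \<inter> V))" "a \<in> S \<inter> (U \<inter> V)"
    using U(1,2) V(1,2) a by (auto intro: openin_open_Int)
  ultimately show "\<exists>T. openin (top_of_set S) T \<and> a \<in> T \<and> (\<forall>x\<in>T. \<forall>y\<in>T. A x = B x \<longrightarrow> A y = B y)"
    by blast
qed (rule assms)

text \<open>The condition is tested on neighbourhoods. Since the pieces are closed, a point outside
  one of them has a neighbourhood that misses it; a point in both has a neighbourhood for each, with
  the same value at the centre.\<close>

lemma potential_glue: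
  assumes A: "potential S \<phi> A" and B: "potential T \<phi> B" and "closed S" "closed T"
    and eq: "\<And>z. z \<in> S \<inter> T \<Longrightarrow> A z = B z"
  shows "potential (S \<union> T) \<phi> (\<lambda>z. if z \<in> S then A z else B z)"
  unfolding potential_def
proof (intro ballI conjI)
  let ?A = "\<lambda>z. if z \<in> S then A z else B z"
  fix z assume z: "z \<in> S \<union> T"
  then show "\<phi> z \<in> topspace X" "?A z \<in> fib (\<sigma> (\<phi> z))"
    using A B by (auto simp: potential_def)
  have "\<exists>U. open U \<and> z \<in> U \<and> (\<forall>w\<in>S \<inter> U. le (\<sigma> (\<phi> z)) (\<sigma> (\<phi> w)) \<and>
        A w = tr (\<sigma> (\<phi> z)) (\<sigma> (\<phi> w)) (?A z))"
  proof (cases "z \<in> S")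
    case True
    obtain U where "open U" "z \<in> U" "\<And>w. w \<in> S \<Longrightarrow> w \<in> U \<Longrightarrow> le (\<sigma> (\<phi> z)) (\<sigma> (\<phi> w))"
      "\<And>w. w \<in> S \<Longrightarrow> w \<in> U \<Longrightarrow> A w = tr (\<sigma> (\<phi> z)) (\<sigma> (\<phi> w)) (A z)"
      using potentialE[OF A True] by blast
    moreover have eqz: "?A z = A z"
      using True by simp
    ultimately show ?thesis
      unfolding eqz by blast
  next
    case False
    then show ?thesis
      using \<open>closed S\<close> by (intro exI[of _ "- S"]) (auto simp: open_Compl)
  qed
  then obtain U where U: "open U" "z \<in> U" "\<forall>w\<in>S \<inter> U. le (\<sigma> (\<phi> z)) (\<sigma> (\<phi> w)) \<and>
        A w = tr (\<sigma> (\<phi> z)) (\<sigma> (\<phi> w)) (?A z)"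
    by blast
  have "\<exists>V. open V \<and> z \<in> V \<and> (\<forall>w\<in>T \<inter> V. le (\<sigma> (\<phi> z)) (\<sigma> (\<phi> w)) \<and>
        B w = tr (\<sigma> (\<phi> z)) (\<sigma> (\<phi> w)) (?A z))"
  proof (cases "z \<in> T")
    case True
    then have eqz: "?A z = B z"
      using eq by auto
    obtain U where "open U" "z \<in> U" "\<And>w. w \<in> T \<Longrightarrow> w \<in> U \<Longrightarrow> le (\<sigma> (\<phi> z)) (\<sigma> (\<phi> w))"
      "\<And>w. w \<in> T \<Longrightarrow> w \<in> U \<Longrightarrow> B w = tr (\<sigma> (\<phi> z)) (\<sigma> (\<phi> w)) (B z)"
      using potentialE[OF B True] by blast
    then show ?thesis
      unfolding eqz by blast
  next
    case False
    then show ?thesis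
      using \<open>closed T\<close> by (intro exI[of _ "- T"]) (auto simp: open_Compl)
  qed
  then obtain V where V: "open V" "z \<in> V" "\<forall>w\<in>T \<inter> V. le (\<sigma> (\<phi> z)) (\<sigma> (\<phi> w)) \<and>
        B w = tr (\<sigma> (\<phi> z)) (\<sigma> (\<phi> w)) (?A z)"
    by blast
  have "\<forall>w\<in>(S \<union> T) \<inter> (U \<inter> V). le (\<sigma> (\<phi> z)) (\<sigma> (\<phi> w)) \<and>
        ?A w = tr (\<sigma> (\<phi> z)) (\<sigma> (\<phi> w)) (?A z)"
    using U(3) V(3) by auto
  then show "\<exists>U. open U \<and> z \<in> U \<and> (\<forall>w\<in>(S \<union> T) \<inter> U. le (\<sigma> (\<phi> z)) (\<sigma> (\<phi> w)) \<and>
        ?A w = tr (\<sigma> (\<phi> z)) (\<sigma> (\<phi> w)) (?A z))"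
    using U(1,2) V(1,2) by (intro exI[of _ "U \<inter> V"] conjI open_Int) auto
qed

text \<open>Continuity for upward closed sets, in the form used from here on: close to a point
  strata can only rise.\<close>

lemma strata_near:
  assumes "continuous_map (top_of_set S) X \<phi>" "z \<in> S"
  obtains T where "open T" "z \<in> T" "\<And>w. w \<in> S \<inter> T \<Longrightarrow> le (\<sigma> (\<phi> z)) (\<sigma> (\<phi> w))"
proof -
  have z: "\<phi> z \<in> topspace X"
    using assms continuous_map_image_subset_topspace by fastforce
  let ?U = "{y \<in> topspace X. le (\<sigma> (\<phi> z)) (\<sigma> y)}"
  have "openin (top_of_set S) {w \<in> topspace (top_of_set S). \<phi> w \<in> ?U}"
    using openin_continuous_map_preimage[OF assms(1) open_upper[OF stratum_in[OF z]]] .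
  then obtain T where "open T" "{w \<in> topspace (top_of_set S). \<phi> w \<in> ?U} = S \<inter> T"
    unfolding openin_open by auto
  moreover have "z \<in> {w \<in> topspace (top_of_set S). \<phi> w \<in> ?U}"
    using assms z by (auto intro: le_refl stratum_in)
  ultimately show ?thesis
    using that by blast
qed

section \<open>Existence of potentials on intervals and squares\<close>

definition solvable :: "'z::metric_space set \<Rightarrow> ('z \<Rightarrow> 'a) \<Rightarrow> bool" where
  "solvable S \<phi> \<longleftrightarrow> (\<forall>z\<in>S. \<forall>m\<in>fib (\<sigma> (\<phi> z)). \<exists>A. potential S \<phi> A \<and> A z = m)"

text \<open>A local system is trivial on a star: if every stratum lies above \<open>q\<close>, the
  transports out of \<open>q\<close> form a section, and functoriality \<open>tr_tr\<close> is its
  compatibility at nearby points.\<close>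

lemma potential_star:
  assumes "continuous_map (top_of_set S) X \<phi>" "q \<in> Q" "m \<in> fib q" "\<And>z. z \<in> S \<Longrightarrow> le q (\<sigma> (\<phi> z))"
  shows "potential S \<phi> (\<lambda>z. tr q (\<sigma> (\<phi> z)) m)"
  unfolding potential_def
proof (intro ballI conjI)
  have X: "\<phi> z \<in> topspace X" if "z \<in> S" for z
    using assms that continuous_map_image_subset_topspace by fastforce
  fix z assume z: "z \<in> S"
  then show "\<phi> z \<in> topspace X" "tr q (\<sigma> (\<phi> z)) m \<in> fib (\<sigma> (\<phi> z))"
    using X assms by (auto intro: tr_in stratum_in)
  obtain T where "open T" "z \<in> T" "\<And>w. w \<in> S \<inter> T \<Longrightarrow> le (\<sigma> (\<phi> z)) (\<sigma> (\<phi> w))"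
    using strata_near[OF assms(1) z] by blast
  then show "\<exists>T. open T \<and> z \<in> T \<and> (\<forall>w\<in>S \<inter> T. le (\<sigma> (\<phi> z)) (\<sigma> (\<phi> w)) \<and>
        tr q (\<sigma> (\<phi> w)) m = tr (\<sigma> (\<phi> z)) (\<sigma> (\<phi> w)) (tr q (\<sigma> (\<phi> z)) m))"
    using assms z X by (intro exI[of _ T]) (auto intro!: tr_tr[symmetric] stratum_in)
qed

text \<open>On a neighbourhood where all strata lie above that of \<open>z\<close>, a value
  prescribed at any point is pulled back to the fibre over \<open>z\<close> by surjectivity and then
  spread by \<open>potential_star\<close>. Every subset \<open>S'\<close> is included because
  bisection decides which piece is needed.\<close>

lemma solvable_local:
  assumes "continuous_map (top_of_set S) X \<phi>" "z \<in> S"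
  obtains T where "open T" "z \<in> T" "\<And>S'. S' \<subseteq> S \<inter> T \<Longrightarrow> solvable S' \<phi>"
proof -
  have X: "\<phi> z \<in> topspace X" if "z \<in> S" for z
    using assms that continuous_map_image_subset_topspace by fastforce
  obtain T where T: "open T" "z \<in> T" "\<And>w. w \<in> S \<inter> T \<Longrightarrow> le (\<sigma> (\<phi> z)) (\<sigma> (\<phi> w))"
    using strata_near[OF assms] by blast
  have "solvable S' \<phi>" if S': "S' \<subseteq> S \<inter> T" for S'
    unfolding solvable_def
  proof (intro ballI)
    fix w m assume w: "w \<in> S'" and m: "m \<in> fib (\<sigma> (\<phi> w))"
    obtain n where n: "n \<in> fib (\<sigma> (\<phi> z))" "tr (\<sigma> (\<phi> z)) (\<sigma> (\<phi> w)) n = m"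
      using tr_surj[of "\<sigma> (\<phi> z)" "\<sigma> (\<phi> w)" m] m w S' T assms(2) X stratum_in by (metis Int_iff subsetD)
    have "continuous_map (top_of_set S') X \<phi>"
      using assms(1) S' by (metis continuous_map_from_subtopology_mono le_infE)
    then have "potential S' \<phi> (\<lambda>w. tr (\<sigma> (\<phi> z)) (\<sigma> (\<phi> w)) n)"
      using n assms(2) X T S' by (intro potential_star) (auto intro: stratum_in)
    then show "\<exists>A. potential S' \<phi> A \<and> A w = m"
      using n by blast
  qed
  with T that show ?thesis
    by blast
qed

text \<open>A potential on one piece is continued by the potential on the other that agrees with it
  at one common point. Connectedness of the intersection turns this into agreement on all of
  it.\<close>

lemma solvable_glue:
  assumes S: "solvable S \<phi>" and T: "solvable T \<phi>" and cl: "closed S" "closed T"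
    and con: "connected (S \<inter> T)" and ne: "S \<inter> T \<noteq> {}"
  shows "solvable (S \<union> T) \<phi>"
proof -
  have main: "\<exists>A. potential (S \<union> T) \<phi> A \<and> A z = m"
    if ST: "solvable S \<phi>" "solvable T \<phi>" "closed S" "closed T" "connected (S \<inter> T)" "S \<inter> T \<noteq> {}"
      and z: "z \<in> S" "m \<in> fib (\<sigma> (\<phi> z))" for S T :: "'b set" and z m
  proof -
    obtain A where A: "potential S \<phi> A" "A z = m"
      using ST z unfolding solvable_def by blast
    obtain c where c: "c \<in> S" "c \<in> T"
      using ST by blast
    obtain B where B: "potential T \<phi> B" "B c = A c"
      using ST c potential_in[OF A(1)] unfolding solvable_def by blast
    have "A w = B w" if "w \<in> S \<inter> T" for w
      using potential_unique[OF ST(5) potential_subset[OF A(1)] potential_subset[OF B(1)], of c w] c B that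
      by auto
    from potential_glue[OF A(1) B(1) ST(3,4) this] show ?thesis
      using z A by (intro exI[of _ "\<lambda>z. if z \<in> S then A z else B z"]) auto
  qed
  show ?thesis
    unfolding solvable_def
  proof (intro ballI)
    fix z m assume z: "z \<in> S \<union> T" "m \<in> fib (\<sigma> (\<phi> z))"
    show "\<exists>A. potential (S \<union> T) \<phi> A \<and> A z = m"
    proof (cases "z \<in> S")
      case True
      then show ?thesis
        using main[OF S T cl con ne] z by blast
    next
      case False
      then have "z \<in> T"
        using z by blast
      then show ?thesis
        using main[OF T S cl(2,1)] con ne z by (simp add: Int_commute Un_commute)
    qed
  qed
qed

lemma solvable_interval:
  fixes a b :: real
  assumes "continuous_map (top_of_set {a..b}) X \<phi>"
  shows "solvable {a..b} \<phi>"
proof (cases "a \<le> b")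
  case True
  \<comment> \<open>Bisection generalizes the endpoints, whereas \<open>\<phi>\<close> is continuous
    on the original interval; \<open>lo\<close> and \<open>hi\<close> remember that
    interval.\<close>
  define lo hi where "lo = a" and "hi = b"
  have "lo \<le> a \<and> b \<le> hi \<longrightarrow> solvable {a..b} \<phi>"
    using True
  proof (induction rule: Bolzano)
    case (trans c d e)
    show ?case
    proof
      assume "lo \<le> c \<and> e \<le> hi"
      then have "solvable ({c..d} \<union> {d..e}) \<phi>"
        using trans by (intro solvable_glue) (auto simp: Int_atLeastAtMost max_def min_def)
      then show "solvable {c..e} \<phi>"
        using trans by (simp add: ivl_disj_un_two_touch)
    qed
  next
    case (local x)
    obtain T where T: "open T" "x \<in> T" "\<And>S'. S' \<subseteq> {a..b} \<inter> T \<Longrightarrow> solvable S' \<phi>"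
      using solvable_local[OF assms, of x] local by auto
    then obtain e where e: "e > 0" "ball x e \<subseteq> T"
      by (meson open_contains_ball)
    have "solvable {c..d} \<phi>" if "c \<le> x \<and> x \<le> d \<and> d - c < e" "lo \<le> c \<and> d \<le> hi" for c d
    proof (rule T(3))
      have "{c..d} \<subseteq> ball x e"
        using that by (auto simp: dist_real_def)
      then show "{c..d} \<subseteq> {a..b} \<inter> T"
        using e that by (auto simp: lo_def hi_def)
    qed
    then show ?case
      using e by blast
  qed
  then show ?thesis
    by (simp add: lo_def hi_def)
qed (simp add: solvable_def)

text \<open>A tube argument by two nested bisections. Bisecting the second coordinate gives each
  \<open>s\<close> a strip of positive width, since the minimum of two widths is positive; bisecting
  the first coordinate then glues strips along vertical segments, which are connected.\<close>

lemma solvable_square: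
  fixes a b c d :: real
  assumes \<phi>: "continuous_map (top_of_set ({a..b} \<times> {c..d})) X \<phi>" and "c \<le> d"
  shows "solvable ({a..b} \<times> {c..d}) \<phi>"
proof -
  have strip: "\<exists>\<delta>>0. \<forall>a' b'. a \<le> a' \<and> a' \<le> s \<and> s \<le> b' \<and> b' \<le> b \<and> b' - a' < \<delta> \<longrightarrow>
      solvable ({a'..b'} \<times> {c..d}) \<phi>" if s: "s \<in> {a..b}" for s
  proof -
    define lo hi where "lo = c" and "hi = d"
    have "lo \<le> c \<and> d \<le> hi \<longrightarrow> (\<exists>\<delta>>0. \<forall>a' b'. a \<le> a' \<and> a' \<le> s \<and> s \<le> b' \<and> b' \<le> b \<and> b' - a' < \<delta> \<longrightarrow>
        solvable ({a'..b'} \<times> {c..d}) \<phi>)"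
      using \<open>c \<le> d\<close>
    proof (induction rule: Bolzano)
      case (trans c' d' e')
      show ?case
      proof
        assume *: "lo \<le> c' \<and> e' \<le> hi"
        then have "d' \<le> hi" "lo \<le> d'"
          using trans by auto
        with * trans obtain \<delta> \<delta>' where \<delta>: "\<delta> > 0" "\<delta>' > 0"
          "\<And>a' b'. a \<le> a' \<and> a' \<le> s \<and> s \<le> b' \<and> b' \<le> b \<and> b' - a' < \<delta> \<Longrightarrow> solvable ({a'..b'} \<times> {c'..d'}) \<phi>"
          "\<And>a' b'. a \<le> a' \<and> a' \<le> s \<and> s \<le> b' \<and> b' \<le> b \<and> b' - a' < \<delta>' \<Longrightarrow> solvable ({a'..b'} \<times> {d'..e'}) \<phi>"
          by blast
        have "solvable ({a'..b'} \<times> {c'..e'}) \<phi>"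
          if "a \<le> a' \<and> a' \<le> s \<and> s \<le> b' \<and> b' \<le> b \<and> b' - a' < min \<delta> \<delta>'" for a' b'
        proof -
          have int: "({a'..b'} \<times> {c'..d'}) \<inter> ({a'..b'} \<times> {d'..e'}) = {a'..b'} \<times> {d'}"
            using trans by auto
          have "solvable (({a'..b'} \<times> {c'..d'}) \<union> ({a'..b'} \<times> {d'..e'})) \<phi>"
            using \<delta> that by (intro solvable_glue, unfold int) (auto intro!: closed_Times connected_Times)
          moreover have "({a'..b'} \<times> {c'..d'}) \<union> ({a'..b'} \<times> {d'..e'}) = {a'..b'} \<times> {c'..e'}"
            using trans by auto
          ultimately show ?thesis
            by simp
        qed
        then show "\<exists>\<delta>>0. \<forall>a' b'. a \<le> a' \<and> a' \<le> s \<and> s \<le> b' \<and> b' \<le> b \<and> b' - a' < \<delta> \<longrightarrow>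
            solvable ({a'..b'} \<times> {c'..e'}) \<phi>"
          using \<delta> by (intro exI[of _ "min \<delta> \<delta>'"]) auto
      qed
    next
      case (local t)
      obtain T where T: "open T" "(s, t) \<in> T" "\<And>S'. S' \<subseteq> ({a..b} \<times> {c..d}) \<inter> T \<Longrightarrow> solvable S' \<phi>"
        using solvable_local[OF \<phi>, of "(s, t)"] local s by auto
      then obtain U V where UV: "open U" "open V" "s \<in> U" "t \<in> V" "U \<times> V \<subseteq> T"
        by (metis mem_Sigma_iff open_prod_elim)
      obtain e1 e2 where "e1 > 0" "ball s e1 \<subseteq> U" "e2 > 0" "ball t e2 \<subseteq> V"
        using UV by (meson open_contains_ball)
      then obtain e where e: "e > 0" "ball s e \<subseteq> U" "ball t e \<subseteq> V"
        by (intro that[of "min e1 e2"]) auto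
      have "solvable ({a'..b'} \<times> {c'..d'}) \<phi>"
        if "a \<le> a' \<and> a' \<le> s \<and> s \<le> b' \<and> b' \<le> b \<and> b' - a' < e"
          "c' \<le> t \<and> t \<le> d' \<and> d' - c' < e" "lo \<le> c' \<and> d' \<le> hi" for a' b' c' d'
      proof (rule T(3))
        have "{a'..b'} \<subseteq> ball s e" "{c'..d'} \<subseteq> ball t e"
          using that by (auto simp: dist_real_def)
        then have "{a'..b'} \<times> {c'..d'} \<subseteq> T"
          using e UV by blast
        then show "{a'..b'} \<times> {c'..d'} \<subseteq> ({a..b} \<times> {c..d}) \<inter> T"
          using that by (auto simp: lo_def hi_def)
      qed
      then show ?case
        using e by (intro exI[of _ e]) blast
    qed
    then show ?thesis
      by (simp add: lo_def hi_def)
  qed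
  show ?thesis
  proof (cases "a \<le> b")
    case True
    define lo hi where "lo = a" and "hi = b"
    have "lo \<le> a \<and> b \<le> hi \<longrightarrow> solvable ({a..b} \<times> {c..d}) \<phi>"
      using True
    proof (induction rule: Bolzano)
      case (trans a' b' e')
      show ?case
      proof
        assume *: "lo \<le> a' \<and> e' \<le> hi"
        have int: "({a'..b'} \<times> {c..d}) \<inter> ({b'..e'} \<times> {c..d}) = {b'} \<times> {c..d}"
          using trans by auto
        have "solvable (({a'..b'} \<times> {c..d}) \<union> ({b'..e'} \<times> {c..d})) \<phi>"
          using trans * \<open>c \<le> d\<close> by (intro solvable_glue, unfold int) (auto intro!: closed_Times connected_Times)
        moreover have "({a'..b'} \<times> {c..d}) \<union> ({b'..e'} \<times> {c..d}) = {a'..e'} \<times> {c..d}"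
          using trans by auto
        ultimately show "solvable ({a'..e'} \<times> {c..d}) \<phi>"
          by simp
      qed
    next
      case (local s)
      show ?case
        using strip[of s] local by (auto simp: lo_def hi_def)
    qed
    then show ?thesis
      by (simp add: lo_def hi_def)
  qed (simp add: solvable_def)
qed

text \<open>Where the stratum does not change, the identity law makes a constant function a
  potential, and uniqueness applies. This is used on the two sides of a homotopy that keep the
  endpoints fixed.\<close>

lemma potential_const:
  fixes S :: "'z::metric_space set"
  assumes "potential S \<phi> A" "connected S" "z \<in> S" "\<And>w. w \<in> S \<Longrightarrow> \<sigma> (\<phi> w) = \<sigma> (\<phi> z)" "w \<in> S"
  shows "A w = A z"
proof -
  have z: "\<sigma> (\<phi> z) \<in> Q" "A z \<in> fib (\<sigma> (\<phi> z))"
    using assms(1,3) unfolding potential_def by (auto intro: stratum_in)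
  have "potential S \<phi> (\<lambda>_. A z)"
    unfolding potential_def
  proof (intro ballI conjI)
    fix w assume w: "w \<in> S"
    then show "\<phi> w \<in> topspace X" "A z \<in> fib (\<sigma> (\<phi> w))"
      using assms(1) z assms(4)[OF w] by (auto simp: potential_def)
    show "\<exists>T. open T \<and> w \<in> T \<and> (\<forall>y\<in>S \<inter> T. le (\<sigma> (\<phi> w)) (\<sigma> (\<phi> y)) \<and> A z = tr (\<sigma> (\<phi> w)) (\<sigma> (\<phi> y)) (A z))"
      using z assms(4) w by (intro exI[of _ UNIV]) (auto simp: tr_id le_refl)
  qed
  from potential_unique[OF assms(2) assms(1) this assms(3,5)] show ?thesis
    by simp
qed

section \<open>Transport along paths and its invariance under homotopy\<close>

definition transports :: "(real \<Rightarrow> 'a) \<Rightarrow> 'm \<Rightarrow> 'm \<Rightarrow> bool" where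
  "transports g m n \<longleftrightarrow> (\<exists>A. potential {0..1} g A \<and> A 0 = m \<and> A 1 = n)"

lemma transports_exists:
  assumes "pathin X g" "m \<in> fib (\<sigma> (g 0))"
  obtains n where "transports g m n"
proof -
  have "solvable {0..1} g"
    using assms(1) by (intro solvable_interval) (simp add: pathin_def)
  then obtain A where "potential {0..1} g A" "A 0 = m"
    using assms(2) unfolding solvable_def by fastforce
  then show ?thesis
    using that unfolding transports_def by blast
qed

lemma transports_unique: "transports g m n \<Longrightarrow> transports g m n' \<Longrightarrow> n = n'"
  unfolding transports_def using potential_unique[of "{0..1::real}" g _ _ 0 1] by auto

lemma transports_in: "transports g m n \<Longrightarrow> m \<in> fib (\<sigma> (g 0)) \<and> n \<in> fib (\<sigma> (g 1))"
  unfolding transports_def using potential_in[of "{0..1::real}" g] by force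

text \<open>A potential on the whole square of the homotopy restricts to potentials along
  \<open>g\<close> and \<open>h\<close>. On the two sides where the homotopy is constant it does not
  change, so both restrictions have the same initial and final values.\<close>

lemma transports_path_homotopic:
  assumes "path_homotopic X g h" "transports g m n"
  shows "transports h m n"
proof -
  obtain K where K: "continuous_map (top_of_set ({0..1} \<times> {0..1})) X K"
    "\<forall>t\<in>{0..1}. K (0::real, t) = g t" "\<forall>t\<in>{0..1}. K (1, t) = h t"
    "\<forall>s\<in>{0..1}. K (s, 0) = g 0 \<and> K (s, 1) = g (1::real)"
    using assms(1) unfolding path_homotopic_iff_square by blast
  have m: "m \<in> fib (\<sigma> (K (0, 0)))"
    using transports_in[OF assms(2)] K by auto
  obtain A where A: "potential ({0..1} \<times> {0..1}) K A" "A (0, 0) = m"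
    using solvable_square[OF K(1)] m unfolding solvable_def by force
  have hor: "potential {0..1} (\<lambda>t. K (s, t)) (\<lambda>t. A (s, t))" if "s \<in> {0..1}" for s
    by (rule potential_cong[OF potential_compose[OF A(1), of "{0..1}" "\<lambda>t. (s, t)"]])
      (use that in \<open>auto intro!: continuous_intros\<close>)
  have ver: "potential {0..1} (\<lambda>s. K (s, t)) (\<lambda>s. A (s, t))" if "t \<in> {0..1}" for t
    by (rule potential_cong[OF potential_compose[OF A(1), of "{0..1}" "\<lambda>s. (s, t)"]])
      (use that in \<open>auto intro!: continuous_intros\<close>)
  have "transports g m (A (0, 1))"
    unfolding transports_def
    using potential_cong[OF hor[of 0], of g "\<lambda>t. A (0, t)"] K A by (intro exI[of _ "\<lambda>t. A (0, t)"]) auto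
  then have "A (0, 1) = n"
    using transports_unique assms(2) by blast
  moreover have "A (1, 0) = A (0, 0)"
    using potential_const[OF ver[of 0], of 0 1] K by auto
  moreover have "A (1, 1) = A (0, 1)"
    using potential_const[OF ver[of 1], of 0 1] K by auto
  ultimately show ?thesis
    unfolding transports_def
    using potential_cong[OF hor[of 1], of h "\<lambda>t. A (1, t)"] K A by (intro exI[of _ "\<lambda>t. A (1, t)"]) auto
qed

lemma transports_join:
  assumes "transports g m n" "transports h n k" "g 1 = h 0"
  shows "transports (path_join g h) m k"
proof -
  obtain A where A: "potential {0..1} g A" "A 0 = m" "A 1 = n"
    using assms(1) unfolding transports_def by blast
  obtain B where B: "potential {0..1} h B" "B 0 = n" "B 1 = k"
    using assms(2) unfolding transports_def by blast
  have half: "t = 1/2" if "t \<in> {0..1/2} \<inter> {1/2..1}" for t :: real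
    using that by auto
  have right: "path_join g h t = h (2 * t - 1)" if "1/2 \<le> t" for t
  proof (cases "t = 1/2")
    case True
    then show ?thesis
      unfolding True using assms(3) by (simp add: path_join_def)
  qed (use that in \<open>auto simp: path_join_def\<close>)
  have "potential {0..1/2} (path_join g h) (\<lambda>t. A (2 * t))"
    by (rule potential_cong[OF potential_compose[OF A(1), of "{0..1/2}" "\<lambda>t. 2 * t"]])
      (auto simp: path_join_def intro!: continuous_intros)
  moreover have "potential {1/2..1} (path_join g h) (\<lambda>t. B (2 * t - 1))"
    by (rule potential_cong[OF potential_compose[OF B(1), of "{1/2..1}" "\<lambda>t. 2 * t - 1"]])
      (auto simp: right intro!: continuous_intros)
  moreover have "A (2 * t) = B (2 * t - 1)" if "t \<in> {0..1/2} \<inter> {1/2..1}" for t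
    unfolding half[OF that] using A B by simp
  ultimately have "potential ({0..1/2} \<union> {1/2..1}) (path_join g h)
      (\<lambda>t. if t \<in> {0..1/2} then A (2 * t) else B (2 * t - 1))"
    by (intro potential_glue) auto
  moreover have "{0..1/2} \<union> {1/2..1} = {0..1::real}"
    by auto
  ultimately show ?thesis
    unfolding transports_def using A B
    by (intro exI[of _ "\<lambda>t. if t \<in> {0..1/2} then A (2 * t) else B (2 * t - 1)"]) auto
qed

lemma transports_reverse:
  assumes "transports g m n"
  shows "transports (path_reverse g) n m"
proof -
  obtain A where A: "potential {0..1} g A" "A 0 = m" "A 1 = n"
    using assms(1) unfolding transports_def by blast
  have "potential {0..1} (path_reverse g) (path_reverse A)"
    by (rule potential_cong[OF potential_compose[OF A(1), of "{0..1}" "\<lambda>t. 1 - t"]])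
      (auto simp: path_reverse_def intro!: continuous_intros)
  then show ?thesis
    unfolding transports_def using A by (intro exI[of _ "path_reverse A"]) auto
qed

text \<open>A path that stays above its first stratum is transported by a single structure map; this
  evaluates transport along edges and rays.\<close>

lemma transports_star:
  assumes "pathin X g" "m \<in> fib (\<sigma> (g 0))" "\<And>t. t \<in> {0..1} \<Longrightarrow> le (\<sigma> (g 0)) (\<sigma> (g t))"
  shows "transports g m (tr (\<sigma> (g 0)) (\<sigma> (g 1)) m)"
proof -
  have "\<sigma> (g 0) \<in> Q"
    using assms(1) by (intro stratum_in path_start_in_topspace)
  then show ?thesis
    unfolding transports_def
    using potential_star[OF assms(1)[unfolded pathin_def], of "\<sigma> (g 0)" m] assms
    by (intro exI[of _ "\<lambda>t. tr (\<sigma> (g 0)) (\<sigma> (g t)) m"]) (auto simp: tr_id)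
qed

end

text \<open>Simple connectedness of a vector space, stated for local systems. The value at
  \<open>y\<close> is the transport along the segment from \<open>b\<close>. For \<open>w\<close>
  near \<open>y\<close>, the detour through \<open>y\<close> is homotopic to the segment from
  \<open>b\<close> to \<open>w\<close> by convexity, so the values at \<open>y\<close> and
  \<open>w\<close> differ by one structure map.\<close>

lemma global_potential:
  fixes \<sigma> :: "'z::real_normed_vector \<Rightarrow> 'q" and fib :: "'q \<Rightarrow> 'm set" and le :: "'q \<Rightarrow> 'q \<Rightarrow> bool"
  assumes "stratified_system euclidean Q le \<sigma> fib tr" and m: "m \<in> fib (\<sigma> b)"
  obtains A where "A b = m" "\<And>y. A y \<in> fib (\<sigma> y)"
    "\<And>y. \<exists>T. open T \<and> y \<in> T \<and> (\<forall>w\<in>T. A w = tr (\<sigma> y) (\<sigma> w) (A y))"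
    "\<And>S y w. connected S \<Longrightarrow> y \<in> S \<Longrightarrow> w \<in> S \<Longrightarrow> (\<And>z. z \<in> S \<Longrightarrow> \<sigma> z = \<sigma> y) \<Longrightarrow> A w = A y"
proof -
  interpret stratified_system euclidean Q le \<sigma> fib tr
    by fact
  have path: "pathin euclidean (linepath y w)" for y w :: 'z
    using path_linepath[of y w] by (simp add: pathin_def path_def)
  have joins: "path_join (p :: real \<Rightarrow> 'z) q = p +++ q" for p q
    by (simp add: path_join_def joinpaths_def fun_eq_iff)
  define A where "A y = (SOME n. transports (linepath b y) m n)" for y
  have A: "transports (linepath b y) m (A y)" for y
    unfolding A_def using transports_exists[OF path, of m b y] m
    by (metis linepath_0' someI_ex)
  have in_fib: "A y \<in> fib (\<sigma> y)" for y
    using transports_in[OF A] by (simp add: linepath_1')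
  have near: "\<exists>T. open T \<and> y \<in> T \<and> (\<forall>w\<in>UNIV \<inter> T. le (\<sigma> y) (\<sigma> w) \<and> A w = tr (\<sigma> y) (\<sigma> w) (A y))" for y
  proof -
    obtain T where T: "open T" "y \<in> T" "\<And>w. w \<in> T \<Longrightarrow> le (\<sigma> y) (\<sigma> w)"
      using strata_near[of UNIV "\<lambda>z. z" y] by auto
    then obtain e where e: "e > 0" "ball y e \<subseteq> T"
      by (meson open_contains_ball)
    have ball: "A w = tr (\<sigma> y) (\<sigma> w) (A y)" if w: "w \<in> ball y e" for w
    proof -
      have "closed_segment y w \<subseteq> ball y e"
        using w e by (intro closed_segment_subset) auto
      then have "linepath y w t \<in> T" if "t \<in> {0..1}" for t
        using e that unfolding path_image_linepath[symmetric] path_image_def by blast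
      then have "transports (linepath y w) (A y) (tr (\<sigma> y) (\<sigma> w) (A y))"
        using transports_star[OF path, of "A y" y w] in_fib T(3) by (simp add: linepath_0' linepath_1')
      then have "transports (path_join (linepath b y) (linepath y w)) m (tr (\<sigma> y) (\<sigma> w) (A y))"
        by (intro transports_join[OF A]) (auto simp: linepath_0' linepath_1')
      moreover have "path_homotopic euclidean (path_join (linepath b y) (linepath y w)) (linepath b w)"
        using path_homotopic_convex[of UNIV euclidean "\<lambda>z. z" "linepath b y +++ linepath y w" "linepath b w"]
        by (simp add: o_def joins)
      ultimately have "transports (linepath b w) m (tr (\<sigma> y) (\<sigma> w) (A y))"
        using transports_path_homotopic by blast
      then show ?thesis
        using A transports_unique by blast
    qed
    have "\<forall>w\<in>UNIV \<inter> ball y e. le (\<sigma> y) (\<sigma> w) \<and> A w = tr (\<sigma> y) (\<sigma> w) (A y)"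
    proof (intro ballI conjI)
      fix w assume "w \<in> UNIV \<inter> ball y e"
      then have w: "w \<in> ball y e"
        by simp
      then show "le (\<sigma> y) (\<sigma> w)"
        using e(2) T(3) by blast
      show "A w = tr (\<sigma> y) (\<sigma> w) (A y)"
        by (rule ball[OF w])
    qed
    moreover have "open (ball y e)" "y \<in> ball y e"
      using e by auto
    ultimately show ?thesis
      by blast
  qed
  have pot: "potential UNIV (\<lambda>z. z) A"
    unfolding potential_def using near in_fib by auto
  show ?thesis
  proof (rule that)
    have "transports (linepath b b) m m"
      using transports_star[OF path, of m b b] m stratum_in[of b]
      by (auto simp: linepath_refl tr_id le_refl)
    then show "A b = m"
      using A transports_unique by blast
    show "\<exists>T. open T \<and> y \<in> T \<and> (\<forall>w\<in>T. A w = tr (\<sigma> y) (\<sigma> w) (A y))" for y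
      using near[of y] by auto
    show "A w = A y" if "connected S" "y \<in> S" "w \<in> S" "\<And>z. z \<in> S \<Longrightarrow> \<sigma> z = \<sigma> y" for S y w
      using potential_const[OF potential_subset[OF pot] that(1,2) that(4) that(3)] by simp
  qed (fact in_fib)
qed

text \<open>A natural transformation between two local systems over the same stratification. Applied
  pointwise it sends potentials to potentials, so it carries transports to transports.\<close>

locale system_morphism =
  S: stratified_system X Q le \<sigma> fib tr + T: stratified_system X Q le \<sigma> fib' tr'
  for X :: "'a topology" and Q :: "'q set" and le and \<sigma> :: "'a \<Rightarrow> 'q"
    and fib :: "'q \<Rightarrow> 'm set" and tr and fib' :: "'q \<Rightarrow> 'n set" and tr' +
  fixes f :: "'q \<Rightarrow> 'm \<Rightarrow> 'n"
  assumes map_in: "\<lbrakk>q \<in> Q; m \<in> fib q\<rbrakk> \<Longrightarrow> f q m \<in> fib' q"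
    and natural: "\<lbrakk>q \<in> Q; r \<in> Q; le q r; m \<in> fib q\<rbrakk> \<Longrightarrow> f r (tr q r m) = tr' q r (f q m)"
begin

lemma transports_map:
  assumes "S.transports g m n"
  shows "T.transports g (f (\<sigma> (g 0)) m) (f (\<sigma> (g 1)) n)"
proof -
  obtain A where A: "S.potential {0..1} g A" "A 0 = m" "A 1 = n"
    using assms unfolding S.transports_def by blast
  have "T.potential {0..1} g (\<lambda>t. f (\<sigma> (g t)) (A t))"
    unfolding T.potential_def
  proof (intro ballI conjI)
    fix t :: real assume t: "t \<in> {0..1}"
    show "g t \<in> topspace X"
      using A(1) t by (auto simp: S.potential_def)
    show "f (\<sigma> (g t)) (A t) \<in> fib' (\<sigma> (g t))"
      using S.potential_in[OF A(1) t] S.potential_stratum[OF A(1) t] by (intro map_in)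
    obtain T where T: "open T" "t \<in> T" "\<And>w. w \<in> {0..1} \<Longrightarrow> w \<in> T \<Longrightarrow> le (\<sigma> (g t)) (\<sigma> (g w))"
      "\<And>w. w \<in> {0..1} \<Longrightarrow> w \<in> T \<Longrightarrow> A w = tr (\<sigma> (g t)) (\<sigma> (g w)) (A t)"
      using S.potentialE[OF A(1) t] by blast
    have "f (\<sigma> (g w)) (A w) = tr' (\<sigma> (g t)) (\<sigma> (g w)) (f (\<sigma> (g t)) (A t))" if w: "w \<in> {0..1}" "w \<in> T" for w
      unfolding T(4)[OF w]
      using S.potential_in[OF A(1) t] S.potential_stratum[OF A(1)] t w T(3) by (intro natural)
    then show "\<exists>T. open T \<and> t \<in> T \<and> (\<forall>w\<in>{0..1} \<inter> T. le (\<sigma> (g t)) (\<sigma> (g w)) \<and>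
        f (\<sigma> (g w)) (A w) = tr' (\<sigma> (g t)) (\<sigma> (g w)) (f (\<sigma> (g t)) (A t)))"
      using T(1,2,3) by blast
  qed
  then show ?thesis
    unfolding T.transports_def using A by blast
qed

end

section \<open>Groupoids of paths and their local systems\<close>

text \<open>A groupoid presented by representatives: composition acts on paths, and the unit,
  associativity and inverse laws hold modulo \<open>r\<close>. The two instances are signed paths of
  the cover modulo \<open>R\<close> and paths in the homotopy colimit modulo homotopy; working with
  representatives lets both share the construction of local systems.\<close>

locale path_groupoid =
  fixes P :: "'p set" and r :: "'p rel" and ob :: "'o set" and src tgt :: "'p \<Rightarrow> 'o"
    and cmp :: "'p \<Rightarrow> 'p \<Rightarrow> 'p" and inv_path :: "'p \<Rightarrow> 'p" and idp :: "'o \<Rightarrow> 'p"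
  assumes equiv_r: "equiv P r"
    and src_r: "(\<alpha>, \<beta>) \<in> r \<Longrightarrow> src \<alpha> = src \<beta>"
    and tgt_r: "(\<alpha>, \<beta>) \<in> r \<Longrightarrow> tgt \<alpha> = tgt \<beta>"
    and src_ob: "\<alpha> \<in> P \<Longrightarrow> src \<alpha> \<in> ob"
    and tgt_ob: "\<alpha> \<in> P \<Longrightarrow> tgt \<alpha> \<in> ob"
    and cmp_in: "\<lbrakk>\<alpha> \<in> P; \<beta> \<in> P; tgt \<alpha> = src \<beta>\<rbrakk> \<Longrightarrow> cmp \<alpha> \<beta> \<in> P"
    and src_cmp: "\<lbrakk>\<alpha> \<in> P; \<beta> \<in> P; tgt \<alpha> = src \<beta>\<rbrakk> \<Longrightarrow> src (cmp \<alpha> \<beta>) = src \<alpha>"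
    and tgt_cmp: "\<lbrakk>\<alpha> \<in> P; \<beta> \<in> P; tgt \<alpha> = src \<beta>\<rbrakk> \<Longrightarrow> tgt (cmp \<alpha> \<beta>) = tgt \<beta>"
    and cmp_r: "\<lbrakk>(\<alpha>, \<alpha>') \<in> r; (\<beta>, \<beta>') \<in> r; tgt \<alpha> = src \<beta>\<rbrakk> \<Longrightarrow> (cmp \<alpha> \<beta>, cmp \<alpha>' \<beta>') \<in> r"
    and assoc_r: "\<lbrakk>\<alpha> \<in> P; \<beta> \<in> P; \<gamma> \<in> P; tgt \<alpha> = src \<beta>; tgt \<beta> = src \<gamma>\<rbrakk> \<Longrightarrow>
      (cmp (cmp \<alpha> \<beta>) \<gamma>, cmp \<alpha> (cmp \<beta> \<gamma>)) \<in> r"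
    and idp_in: "x \<in> ob \<Longrightarrow> idp x \<in> P"
    and src_idp: "src (idp x) = x"
    and tgt_idp: "tgt (idp x) = x"
    and idp_left: "\<alpha> \<in> P \<Longrightarrow> (cmp (idp (src \<alpha>)) \<alpha>, \<alpha>) \<in> r"
    and idp_right: "\<alpha> \<in> P \<Longrightarrow> (cmp \<alpha> (idp (tgt \<alpha>)), \<alpha>) \<in> r"
    and inv_in: "\<alpha> \<in> P \<Longrightarrow> inv_path \<alpha> \<in> P"
    and src_inv: "\<alpha> \<in> P \<Longrightarrow> src (inv_path \<alpha>) = tgt \<alpha>"
    and tgt_inv: "\<alpha> \<in> P \<Longrightarrow> tgt (inv_path \<alpha>) = src \<alpha>"
    and inv_right: "\<alpha> \<in> P \<Longrightarrow> (cmp \<alpha> (inv_path \<alpha>), idp (src \<alpha>)) \<in> r"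
    and inv_inv: "\<alpha> \<in> P \<Longrightarrow> inv_path (inv_path \<alpha>) = \<alpha>"
begin

lemma refl_r: "\<alpha> \<in> P \<Longrightarrow> (\<alpha>, \<alpha>) \<in> r"
  using equiv_r by (meson equivE refl_onD)

lemma sym_r: "(\<alpha>, \<beta>) \<in> r \<Longrightarrow> (\<beta>, \<alpha>) \<in> r"
  using equiv_r by (meson equivE symD)

lemma trans_r [trans]: "(\<alpha>, \<beta>) \<in> r \<Longrightarrow> (\<beta>, \<gamma>) \<in> r \<Longrightarrow> (\<alpha>, \<gamma>) \<in> r"
  using equiv_r by (meson equivE transD)

lemma in_r: "(\<alpha>, \<beta>) \<in> r \<Longrightarrow> \<alpha> \<in> P \<and> \<beta> \<in> P"
  using equiv_type[OF equiv_r] by auto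

lemma inv_left:
  assumes "\<alpha> \<in> P"
  shows "(cmp (inv_path \<alpha>) \<alpha>, idp (tgt \<alpha>)) \<in> r"
  using inv_right[OF inv_in[OF assms]] assms by (simp add: inv_inv src_inv)

lemmas cmp_simps = cmp_in src_cmp tgt_cmp inv_in src_inv tgt_inv src_idp tgt_idp inv_inv

lemma cmp_cancel_right:
  assumes "\<alpha> \<in> P" "\<beta> \<in> P" "tgt \<alpha> = src \<beta>"
  shows "(cmp (cmp \<alpha> \<beta>) (inv_path \<beta>), \<alpha>) \<in> r"
proof -
  have "(cmp (cmp \<alpha> \<beta>) (inv_path \<beta>), cmp \<alpha> (cmp \<beta> (inv_path \<beta>))) \<in> r"
    using assms by (intro assoc_r) (auto simp: cmp_simps)
  also have "(cmp \<alpha> (cmp \<beta> (inv_path \<beta>)), cmp \<alpha> (idp (tgt \<alpha>))) \<in> r"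
    using assms inv_right[OF assms(2)] by (intro cmp_r refl_r) (auto simp: cmp_simps)
  also have "(cmp \<alpha> (idp (tgt \<alpha>)), \<alpha>) \<in> r"
    using assms by (intro idp_right)
  finally show ?thesis .
qed

lemma cmp_cancel_right':
  assumes "\<alpha> \<in> P" "\<beta> \<in> P" "tgt \<alpha> = tgt \<beta>"
  shows "(cmp (cmp \<alpha> (inv_path \<beta>)) \<beta>, \<alpha>) \<in> r"
  using cmp_cancel_right[of \<alpha> "inv_path \<beta>"] assms by (simp add: cmp_simps)

lemma cmp_left_cancel:
  assumes "(cmp \<alpha> \<gamma>, cmp \<beta> \<gamma>) \<in> r" "\<alpha> \<in> P" "\<beta> \<in> P" "\<gamma> \<in> P" "tgt \<alpha> = src \<gamma>" "tgt \<beta> = src \<gamma>"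
  shows "(\<alpha>, \<beta>) \<in> r"
proof -
  have "(\<alpha>, cmp (cmp \<alpha> \<gamma>) (inv_path \<gamma>)) \<in> r"
    using assms by (intro sym_r[OF cmp_cancel_right])
  also have "(cmp (cmp \<alpha> \<gamma>) (inv_path \<gamma>), cmp (cmp \<beta> \<gamma>) (inv_path \<gamma>)) \<in> r"
    using assms by (intro cmp_r[OF assms(1)] refl_r) (auto simp: cmp_simps)
  also have "(cmp (cmp \<beta> \<gamma>) (inv_path \<gamma>), \<beta>) \<in> r"
    using assms by (intro cmp_cancel_right)
  finally show ?thesis .
qed

definition cls :: "'p \<Rightarrow> 'p set" where
  "cls \<alpha> = r `` {\<alpha>}"

lemma cls_eq_iff: "\<alpha> \<in> P \<Longrightarrow> \<beta> \<in> P \<Longrightarrow> cls \<alpha> = cls \<beta> \<longleftrightarrow> (\<alpha>, \<beta>) \<in> r"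
  unfolding cls_def using eq_equiv_class_iff[OF equiv_r] by blast

definition fibre :: "'o \<Rightarrow> 'o \<Rightarrow> 'p set set" where
  "fibre x y = {cls \<alpha> | \<alpha>. \<alpha> \<in> P \<and> src \<alpha> = x \<and> tgt \<alpha> = y}"

definition cls_cmp :: "'p set \<Rightarrow> 'p \<Rightarrow> 'p set" where
  "cls_cmp A \<beta> = (\<Union>\<alpha>\<in>A. cls (cmp \<alpha> \<beta>))"

lemma cls_cmp_cls:
  assumes "\<alpha> \<in> P" "\<beta> \<in> P" "tgt \<alpha> = src \<beta>"
  shows "cls_cmp (cls \<alpha>) \<beta> = cls (cmp \<alpha> \<beta>)"
proof -
  have "cls (cmp \<alpha>' \<beta>) = cls (cmp \<alpha> \<beta>)" if "\<alpha>' \<in> cls \<alpha>" for \<alpha>'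
  proof -
    have "(\<alpha>, \<alpha>') \<in> r"
      using that by (simp add: cls_def)
    then have "(cmp \<alpha>' \<beta>, cmp \<alpha> \<beta>) \<in> r"
      using assms by (intro sym_r[OF cmp_r] refl_r)
    then show ?thesis
      using cls_eq_iff in_r by blast
  qed
  moreover have "\<alpha> \<in> cls \<alpha>"
    using assms refl_r by (simp add: cls_def)
  ultimately show ?thesis
    unfolding cls_cmp_def by blast
qed

text \<open>A cocycle \<open>c\<close> with values in the groupoid acts on path classes with a fixed source.\<close>

lemma poset_system_fibre:
  fixes Q :: "'q set" and le :: "'q \<Rightarrow> 'q \<Rightarrow> bool" and c :: "'q \<Rightarrow> 'q \<Rightarrow> 'p"
  assumes refl: "\<And>q. q \<in> Q \<Longrightarrow> le q q"
    and trans: "\<And>q s t. \<lbrakk>q \<in> Q; s \<in> Q; t \<in> Q; le q s; le s t\<rbrakk> \<Longrightarrow> le q t"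
    and c: "\<And>q s. \<lbrakk>q \<in> Q; s \<in> Q; le q s\<rbrakk> \<Longrightarrow> c q s \<in> P \<and> src (c q s) = vert q \<and> tgt (c q s) = vert s"
    and cocycle: "\<And>q s t. \<lbrakk>q \<in> Q; s \<in> Q; t \<in> Q; le q s; le s t\<rbrakk> \<Longrightarrow> (cmp (c q s) (c s t), c q t) \<in> r"
  shows "poset_system Q le (\<lambda>q. fibre x (vert q)) (\<lambda>q s A. cls_cmp A (c q s))"
proof
  have tr: "cls_cmp (cls \<alpha>) (c q s) = cls (cmp \<alpha> (c q s))"
    if "q \<in> Q" "s \<in> Q" "le q s" "\<alpha> \<in> P" "tgt \<alpha> = vert q" for q s \<alpha>
    using that c[of q s] by (intro cls_cmp_cls) auto
  fix q assume q: "q \<in> Q"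
  show "cls_cmp m (c q q) = m" if m: "m \<in> fibre x (vert q)" for m
  proof -
    obtain \<alpha> where \<alpha>: "m = cls \<alpha>" "\<alpha> \<in> P" "tgt \<alpha> = vert q"
      using m unfolding fibre_def by blast
    have cq: "c q q \<in> P" "src (c q q) = vert q" "tgt (c q q) = vert q"
      using c[OF q q refl[OF q]] by auto
    \<comment> \<open>The cocycle law makes \<open>c q q\<close> idempotent, and an idempotent of a
      groupoid is an identity.\<close>
    have "(c q q, idp (vert q)) \<in> r"
    proof (rule cmp_left_cancel)
      have "(cmp (c q q) (c q q), c q q) \<in> r"
        using cocycle q refl by blast
      also have "(c q q, cmp (idp (vert q)) (c q q)) \<in> r"
        using sym_r[OF idp_left[OF cq(1)]] cq by simp
      finally show "(cmp (c q q) (c q q), cmp (idp (vert q)) (c q q)) \<in> r" .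
    qed (use cq src_ob[OF cq(1)] in \<open>auto simp: cmp_simps idp_in\<close>)
    then have "(cmp \<alpha> (c q q), cmp \<alpha> (idp (tgt \<alpha>))) \<in> r"
      using \<alpha> cq by (intro cmp_r refl_r) auto
    also have "(cmp \<alpha> (idp (tgt \<alpha>)), \<alpha>) \<in> r"
      using \<alpha> by (intro idp_right)
    finally have "cls (cmp \<alpha> (c q q)) = cls \<alpha>"
      using cls_eq_iff in_r by blast
    then show ?thesis
      using \<alpha> tr q refl by simp
  qed
  fix s assume s: "s \<in> Q" "le q s"
  have cs: "c q s \<in> P" "src (c q s) = vert q" "tgt (c q s) = vert s"
    using c[OF q s] by auto
  show "bij_betw (\<lambda>A. cls_cmp A (c q s)) (fibre x (vert q)) (fibre x (vert s))"
  proof (intro bij_betwI[where g = "\<lambda>A. cls_cmp A (inv_path (c q s))"])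
    show "(\<lambda>A. cls_cmp A (c q s)) \<in> fibre x (vert q) \<rightarrow> fibre x (vert s)"
      using cs unfolding fibre_def by (force simp: cls_cmp_cls cmp_simps)
    show "(\<lambda>A. cls_cmp A (inv_path (c q s))) \<in> fibre x (vert s) \<rightarrow> fibre x (vert q)"
      using cs unfolding fibre_def by (force simp: cls_cmp_cls cmp_simps)
  next
    fix A assume "A \<in> fibre x (vert q)"
    then obtain \<alpha> where \<alpha>: "A = cls \<alpha>" "\<alpha> \<in> P" "tgt \<alpha> = vert q"
      unfolding fibre_def by blast
    have "cls (cmp (cmp \<alpha> (c q s)) (inv_path (c q s))) = cls \<alpha>"
      using cmp_cancel_right[of \<alpha> "c q s"] \<alpha> cs cls_eq_iff in_r by metis
    then show "cls_cmp (cls_cmp A (c q s)) (inv_path (c q s)) = A"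
      using \<alpha> cs by (simp add: cls_cmp_cls cmp_simps)
  next
    fix A assume "A \<in> fibre x (vert s)"
    then obtain \<alpha> where \<alpha>: "A = cls \<alpha>" "\<alpha> \<in> P" "tgt \<alpha> = vert s"
      unfolding fibre_def by blast
    have "cls (cmp (cmp \<alpha> (inv_path (c q s))) (c q s)) = cls \<alpha>"
      using cmp_cancel_right'[of \<alpha> "c q s"] \<alpha> cs cls_eq_iff in_r by metis
    then show "cls_cmp (cls_cmp A (inv_path (c q s))) (c q s) = A"
      using \<alpha> cs by (simp add: cls_cmp_cls cmp_simps)
  qed
  fix t assume t: "t \<in> Q" "le s t"
  have ct: "c s t \<in> P" "src (c s t) = vert s" "tgt (c s t) = vert t"
    using c[OF s(1) t] by auto
  show "cls_cmp (cls_cmp m (c q s)) (c s t) = cls_cmp m (c q t)" if m: "m \<in> fibre x (vert q)" for m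
  proof -
    obtain \<alpha> where \<alpha>: "m = cls \<alpha>" "\<alpha> \<in> P" "tgt \<alpha> = vert q"
      using m unfolding fibre_def by blast
    have "(cmp (cmp \<alpha> (c q s)) (c s t), cmp \<alpha> (cmp (c q s) (c s t))) \<in> r"
      using \<alpha> cs ct by (intro assoc_r) auto
    also have "(cmp \<alpha> (cmp (c q s) (c s t)), cmp \<alpha> (c q t)) \<in> r"
      using \<alpha> cs ct cocycle[OF q s(1) t(1) s(2) t(2)] by (intro cmp_r refl_r) (auto simp: cmp_simps)
    finally have "cls (cmp (cmp \<alpha> (c q s)) (c s t)) = cls (cmp \<alpha> (c q t))"
      using cls_eq_iff in_r by blast
    then show ?thesis
      using \<alpha> cs ct tr[OF q t(1) trans[OF q s(1) t(1) s(2) t(2)] \<alpha>(2,3)] by (simp add: cls_cmp_cls cmp_simps)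
  qed
qed (use refl trans in blast)+

end

section \<open>Sign vectors of faces\<close>

definition is_hyperplane :: "'a::euclidean_space set \<Rightarrow> bool" where
  "is_hyperplane H \<longleftrightarrow> (\<exists>a b. a \<noteq> 0 \<and> H = {x. a \<bullet> x = b})"

text \<open>One equation is chosen per hyperplane so that signs become a function of the hyperplane.
  Notions that quantify over all equations are reduced to the chosen one by
  \<open>sgn_eq_iff_side\<close>.\<close>

definition hyperplane_coords :: "'a::euclidean_space set \<Rightarrow> 'a \<times> real" where
  "hyperplane_coords H = (SOME p. fst p \<noteq> 0 \<and> H = {x. fst p \<bullet> x = snd p})"

definition level :: "'a::euclidean_space set \<Rightarrow> 'a \<Rightarrow> real" where
  "level H x = fst (hyperplane_coords H) \<bullet> x - snd (hyperplane_coords H)"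

definition side :: "'a::euclidean_space set \<Rightarrow> 'a \<Rightarrow> real" where
  "side H x = sgn (level H x)"

lemma hyperplane_coords:
  assumes "is_hyperplane H"
  shows "fst (hyperplane_coords H) \<noteq> 0" "H = {x. fst (hyperplane_coords H) \<bullet> x = snd (hyperplane_coords H)}"
proof -
  have "\<exists>p. fst p \<noteq> 0 \<and> H = {x. fst p \<bullet> x = snd p}"
    using assms unfolding is_hyperplane_def by auto
  from someI_ex[OF this]
  show "fst (hyperplane_coords H) \<noteq> 0" "H = {x. fst (hyperplane_coords H) \<bullet> x = snd (hyperplane_coords H)}"
    unfolding hyperplane_coords_def by blast+
qed

lemma level_eq_0_iff: "is_hyperplane H \<Longrightarrow> level H x = 0 \<longleftrightarrow> x \<in> H"
  using hyperplane_coords(2) by (fastforce simp: level_def)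

lemma side_eq_0_iff: "is_hyperplane H \<Longrightarrow> side H x = 0 \<longleftrightarrow> x \<in> H"
  by (simp add: side_def sgn_eq_0_iff level_eq_0_iff)

lemma level_affine: "level H ((1 - t) *\<^sub>R x + t *\<^sub>R y) = (1 - t) * level H x + t * level H y"
  by (simp add: level_def inner_add_right algebra_simps)

lemma continuous_on_level [continuous_intros]: "continuous_on S f \<Longrightarrow> continuous_on S (\<lambda>x. level H (f x))"
  unfolding level_def by (intro continuous_intros)

lemma side_cases: "side H x = -1 \<or> side H x = 0 \<or> side H x = 1"
  by (simp add: side_def sgn_if)

lemma side_eq_iff_level:
  "side H x = 1 \<longleftrightarrow> level H x > 0" "side H x = -1 \<longleftrightarrow> level H x < 0" "side H x = 0 \<longleftrightarrow> level H x = 0"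
  by (auto simp: side_def sgn_if)

lemma open_side:
  assumes "s \<noteq> 0"
  shows "open {x. side H x = s}"
proof (cases "s = 1 \<or> s = -1")
  case True
  have "open {x. level H x > 0}" "open {x. level H x < 0}"
    by (intro open_Collect_less continuous_intros)+
  with True show ?thesis
    by (auto simp: side_eq_iff_level)
next
  case False
  with assms have "{x. side H x = s} = {}"
    using side_cases by fastforce
  then show ?thesis
    by (metis open_empty)
qed

lemma convex_side: "convex {x. side H x = s}"
proof -
  have "convex {x. level H x > 0}" "convex {x. level H x < 0}" "convex {x. level H x = 0}"
    using convex_halfspace_gt[of "snd (hyperplane_coords H)" "fst (hyperplane_coords H)"]
      convex_halfspace_lt[of "fst (hyperplane_coords H)" "snd (hyperplane_coords H)"]
      convex_hyperplane[of "fst (hyperplane_coords H)" "snd (hyperplane_coords H)"]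
    by (simp_all add: level_def)
  moreover have "{x. side H x = s} = {}" if "s \<notin> {0, 1, -1}"
    using that side_cases by fastforce
  ultimately show ?thesis
    by (cases "s \<in> {0, 1, -1}") (auto simp: side_eq_iff_level)
qed

text \<open>Two equations of the same hyperplane are proportional.\<close>

lemma sgn_eq_iff_side:
  fixes a :: "'a::euclidean_space"
  assumes "a \<noteq> 0" and H: "H = {z. a \<bullet> z = b}"
  shows "sgn (a \<bullet> x - b) = sgn (a \<bullet> y - b) \<longleftrightarrow> side H x = side H y"
proof -
  have hyp: "is_hyperplane H"
    using assms unfolding is_hyperplane_def by blast
  define n c where "n = fst (hyperplane_coords H)" and "c = snd (hyperplane_coords H)"
  define k where "k = (n \<bullet> a) / (a \<bullet> a)"
  have n: "n \<noteq> 0" "H = {z. n \<bullet> z = c}"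
    using hyperplane_coords[OF hyp] by (auto simp: n_def c_def)
  have aa: "a \<bullet> a \<noteq> 0"
    using assms by simp
  have lev: "level H x = k * (a \<bullet> x - b)" for x
  proof -
    \<comment> \<open>The orthogonal projection of \<open>x\<close> to the hyperplane satisfies both
      equations; evaluating the chosen one there exhibits \<open>level H\<close> as \<open>k\<close>
      times the given one.\<close>
    have "a \<bullet> (x - ((a \<bullet> x - b) / (a \<bullet> a)) *\<^sub>R a) = b"
      using aa by (simp add: inner_diff_right)
    then have "n \<bullet> (x - ((a \<bullet> x - b) / (a \<bullet> a)) *\<^sub>R a) = c"
      using n(2) H by blast
    then show ?thesis
      by (simp add: level_def n_def[symmetric] c_def[symmetric] inner_diff_right k_def field_simps)
  qed
  have "k \<noteq> 0"
  proof
    assume "k = 0"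
    then have *: "n \<bullet> z = c" for z
      using lev[of z] by (simp add: level_def n_def c_def)
    show False
      using *[of 0] *[of n] n(1) by simp
  qed
  then show ?thesis
    by (simp add: side_def lev sgn_mult sgn_eq_0_iff)
qed

text \<open>The arrangement \<open>\<B>\<close> is a parameter because the chambers of localizations
  are needed besides the faces of \<open>\<A>\<close>.\<close>

definition cell :: "'a::euclidean_space set set \<Rightarrow> 'a \<Rightarrow> 'a set" where
  "cell \<B> x = {y. \<forall>H\<in>\<B>. side H y = side H x}"

lemma cell_self: "x \<in> cell \<B> x"
  by (simp add: cell_def)

lemma cell_eq: "y \<in> cell \<B> x \<Longrightarrow> cell \<B> y = cell \<B> x"
  by (auto simp: cell_def)

lemma convex_cell: "convex (cell \<B> x)"
proof -
  have "cell \<B> x = (\<Inter>H\<in>\<B>. {y. side H y = side H x})"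
    by (auto simp: cell_def)
  moreover have "convex (\<Inter>H\<in>\<B>. {y. side H y = side H x})"
    by (intro convex_INT convex_side)
  ultimately show ?thesis
    by simp
qed

text \<open>A cell is convex, hence connected. Conversely a connected set avoiding all hyperplanes
  cannot change a sign, by the intermediate value theorem for \<open>level\<close>.\<close>

lemma chambers_eq_cells:
  assumes "\<forall>H\<in>\<B>. is_hyperplane H"
  shows "chambers \<B> = cell \<B> ` (- \<Union>\<B>)"
proof -
  have "connected_component_set (- \<Union>\<B>) x = cell \<B> x" if x: "x \<in> - \<Union>\<B>" for x
  proof
    have "cell \<B> x \<subseteq> - \<Union>\<B>"
    proof
      fix y assume y: "y \<in> cell \<B> x"
      have "y \<notin> H" if "H \<in> \<B>" for H
        using side_eq_0_iff[of H x] side_eq_0_iff[of H y] that assms x y by (auto simp: cell_def)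
      then show "y \<in> - \<Union>\<B>"
        by blast
    qed
    then show "cell \<B> x \<subseteq> connected_component_set (- \<Union>\<B>) x"
      by (intro connected_component_maximal cell_self convex_connected convex_cell)
    show "connected_component_set (- \<Union>\<B>) x \<subseteq> cell \<B> x"
    proof
      fix y assume "y \<in> connected_component_set (- \<Union>\<B>) x"
      then obtain T where T: "connected T" "T \<subseteq> - \<Union>\<B>" "x \<in> T" "y \<in> T"
        unfolding connected_component_def by blast
      have "side H y = side H x" if H: "H \<in> \<B>" for H
      proof (rule ccontr)
        assume ne: "side H y \<noteq> side H x"
        have hyp: "is_hyperplane H"
          using assms H by blast
        have nz: "level H z \<noteq> 0" if "z \<in> T" for z
          using that T H hyp level_eq_0_iff by blast
        have "level H x < 0 \<and> 0 < level H y \<or> level H y < 0 \<and> 0 < level H x"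
          using ne nz[OF T(3)] nz[OF T(4)] by (auto simp: side_def sgn_if split: if_splits)
        then have "\<exists>z\<in>T. level H z = 0"
          using connected_ivt_hyperplane[OF T(1,3,4), of "fst (hyperplane_coords H)" "snd (hyperplane_coords H)"]
            connected_ivt_hyperplane[OF T(1,4,3), of "fst (hyperplane_coords H)" "snd (hyperplane_coords H)"]
          by (fastforce simp: level_def)
        then show False
          using nz by blast
      qed
      then show "y \<in> cell \<B> x"
        by (simp add: cell_def)
    qed
  qed
  then show ?thesis
    unfolding chambers_def components_def by (auto intro!: image_cong)
qed

locale arrangement =
  fixes \<A> :: "'a::euclidean_space set set"
  assumes arrangement: "hyperplane_arrangement \<A>"
begin

lemma finite_arrangement: "finite \<A>"
  using arrangement by (simp add: hyperplane_arrangement_def)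

lemma hyperplane: "H \<in> \<A> \<Longrightarrow> is_hyperplane H"
  using arrangement by (auto simp: hyperplane_arrangement_def is_hyperplane_def)

lemma faces_eq_cells: "faces \<A> = range (cell \<A>)"
proof -
  have "(\<forall>a b. {z. a \<bullet> z = b} \<in> \<A> \<longrightarrow> sgn (a \<bullet> x - b) = sgn (a \<bullet> y - b)) \<longleftrightarrow>
      (\<forall>H\<in>\<A>. side H x = side H y)" for x y
  proof
    assume *: "\<forall>a b. {z. a \<bullet> z = b} \<in> \<A> \<longrightarrow> sgn (a \<bullet> x - b) = sgn (a \<bullet> y - b)"
    show "\<forall>H\<in>\<A>. side H x = side H y"
    proof
      fix H assume H: "H \<in> \<A>"
      then obtain a b where ab: "a \<noteq> 0" "H = {z. a \<bullet> z = b}"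
        using hyperplane[OF H] by (auto simp: is_hyperplane_def)
      then show "side H x = side H y"
        using sgn_eq_iff_side[OF ab] * H by blast
    qed
  next
    assume *: "\<forall>H\<in>\<A>. side H x = side H y"
    show "\<forall>a b. {z. a \<bullet> z = b} \<in> \<A> \<longrightarrow> sgn (a \<bullet> x - b) = sgn (a \<bullet> y - b)"
    proof (intro allI impI)
      fix a b assume H: "{z. a \<bullet> z = b} \<in> \<A>"
      show "sgn (a \<bullet> x - b) = sgn (a \<bullet> y - b)"
      \<comment> \<open>The quantifier also ranges over degenerate equations; for a zero normal both
        signs are that of \<open>- b\<close>.\<close>
      proof (cases "a = 0")
        case False
        from sgn_eq_iff_side[OF this refl] * H show ?thesis
          by blast
      qed simp
    qed
  qed
  then have "faces \<A> = UNIV // {(x, y). \<forall>H\<in>\<A>. side H x = side H y}"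
    unfolding faces_def by simp
  moreover have "{(x, y). \<forall>H\<in>\<A>. side H x = side H y} `` {x} = cell \<A> x" for x
    unfolding cell_def by fastforce
  ultimately show ?thesis
    by (auto simp: quotient_def)
qed

definition sd :: "'a set \<Rightarrow> 'a set \<Rightarrow> real" where
  "sd F H = side H (SOME x. x \<in> F)"

lemma face_cell: "F \<in> faces \<A> \<Longrightarrow> x \<in> F \<Longrightarrow> F = cell \<A> x"
  using cell_eq by (auto simp: faces_eq_cells)

lemma face_nonempty: "F \<in> faces \<A> \<Longrightarrow> \<exists>x. x \<in> F"
  using cell_self by (auto simp: faces_eq_cells)

lemma cell_face: "cell \<A> x \<in> faces \<A>"
  by (simp add: faces_eq_cells)

lemma sd_eq:
  assumes "F \<in> faces \<A>" "x \<in> F" "H \<in> \<A>"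
  shows "sd F H = side H x"
proof -
  have "(SOME x. x \<in> F) \<in> F"
    using assms(2) by (rule someI)
  then show ?thesis
    using face_cell[OF assms(1,2)] assms(3) by (auto simp: sd_def cell_def)
qed

lemma sd_cell: "H \<in> \<A> \<Longrightarrow> sd (cell \<A> x) H = side H x"
  by (rule sd_eq[OF cell_face cell_self])

lemma mem_face_iff: "F \<in> faces \<A> \<Longrightarrow> x \<in> F \<longleftrightarrow> (\<forall>H\<in>\<A>. side H x = sd F H)"
proof -
  assume F: "F \<in> faces \<A>"
  obtain z where z: "z \<in> F"
    using face_nonempty[OF F] by blast
  have "x \<in> F \<longleftrightarrow> (\<forall>H\<in>\<A>. side H x = side H z)"
    unfolding face_cell[OF F z] by (simp add: cell_def)
  then show ?thesis
    using sd_eq[OF F z] by simp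
qed

lemma face_eqI:
  assumes "F \<in> faces \<A>" "G \<in> faces \<A>" "\<And>H. H \<in> \<A> \<Longrightarrow> sd F H = sd G H"
  shows "F = G"
  using mem_face_iff[OF assms(1)] mem_face_iff[OF assms(2)] assms(3) by auto

lemma sd_cases: "sd F H = -1 \<or> sd F H = 0 \<or> sd F H = 1"
  by (simp add: sd_def side_cases)

text \<open>A nonzero sign is an open condition, so points of \<open>G\<close> close to
  \<open>x\<close> share it. Conversely, if the nonzero signs of \<open>x\<close> are those of
  \<open>G\<close>, then the open segment from \<open>x\<close> to any point of \<open>G\<close>
  lies in \<open>G\<close>.\<close>

lemma mem_closure_face_iff:
  assumes G: "G \<in> faces \<A>"
  shows "x \<in> closure G \<longleftrightarrow> (\<forall>H\<in>\<A>. side H x \<noteq> 0 \<longrightarrow> sd G H = side H x)"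
proof
  assume x: "x \<in> closure G"
  show "\<forall>H\<in>\<A>. side H x \<noteq> 0 \<longrightarrow> sd G H = side H x"
  proof (intro ballI impI)
    fix H assume H: "H \<in> \<A>" "side H x \<noteq> 0"
    have "{y. side H y = side H x} \<inter> closure G \<noteq> {}"
      using x by auto
    then obtain y where "y \<in> G" "side H y = side H x"
      using open_Int_closure_eq_empty[OF open_side[OF H(2), of H], of G] by blast
    then show "sd G H = side H x"
      using sd_eq G H by metis
  qed
next
  assume *: "\<forall>H\<in>\<A>. side H x \<noteq> 0 \<longrightarrow> sd G H = side H x"
  obtain g where g: "g \<in> G"
    using face_nonempty[OF G] by blast
  show "x \<in> closure G"
  proof (cases "x = g")
    case True
    then show ?thesis
      using g closure_subset by blast
  next
    case False
    have "open_segment x g \<subseteq> G"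
    proof
      fix y assume "y \<in> open_segment x g"
      then obtain t where t: "0 < t" "t < 1" "y = (1 - t) *\<^sub>R x + t *\<^sub>R g"
        by (auto simp: in_segment)
      have "side H y = sd G H" if H: "H \<in> \<A>" for H
      proof -
        have lev: "level H y = (1 - t) * level H x + t * level H g"
          by (simp add: t level_affine)
        have g': "side H g = sd G H"
          using sd_eq[OF G g H] by simp
        show ?thesis
        proof (cases "side H x = 0")
          case True
          then have "level H x = 0"
            by (simp add: side_eq_iff_level)
          then show ?thesis
            using lev t g' by (simp add: side_def sgn_mult)
        next
          case False
          then have eq: "side H x = side H g"
            using * H g' by simp
          then consider "level H x > 0" "level H g > 0" | "level H x < 0" "level H g < 0"
            using False by (auto simp: side_def sgn_if split: if_splits)
          then show ?thesis
          proof cases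
            case 1
            then have "level H y > 0"
              using lev t by (simp add: add_pos_pos)
            then show ?thesis
              using 1 g' by (simp add: side_def)
          next
            case 2
            then have "level H y < 0"
              using lev t by (simp add: add_neg_neg mult_pos_neg)
            then show ?thesis
              using 2 g' by (simp add: side_def)
          qed
        qed
      qed
      then show "y \<in> G"
        using mem_face_iff[OF G] by blast
    qed
    then have "closure (open_segment x g) \<subseteq> closure G"
      by (rule closure_mono)
    then show ?thesis
      using False by (auto simp: closure_open_segment)
  qed
qed

text \<open>The reversed order in terms of sign vectors: going down replaces zeros by signs and
  keeps all signs already present. Membership in a closure only depends on signs, so a single point
  of \<open>F\<close> decides the inclusion.\<close>

lemma face_le_iff:
  assumes F: "F \<in> faces \<A>" and G: "G \<in> faces \<A>"
  shows "face_le G F \<longleftrightarrow> (\<forall>H\<in>\<A>. sd F H \<noteq> 0 \<longrightarrow> sd G H = sd F H)"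
proof
  obtain x where x: "x \<in> F"
    using face_nonempty[OF F] by blast
  assume "face_le G F"
  then have "x \<in> closure G"
    using x closure_subset by (auto simp: face_le_def)
  then show "\<forall>H\<in>\<A>. sd F H \<noteq> 0 \<longrightarrow> sd G H = sd F H"
    using mem_closure_face_iff[OF G] sd_eq[OF F x] by auto
next
  assume *: "\<forall>H\<in>\<A>. sd F H \<noteq> 0 \<longrightarrow> sd G H = sd F H"
  show "face_le G F"
    unfolding face_le_def
  proof
    fix y assume "y \<in> closure F"
    then show "y \<in> closure G"
      using * mem_closure_face_iff[OF F, of y] mem_closure_face_iff[OF G, of y] by metis
  qed
qed

lemma face_le_refl: "face_le F F"
  by (simp add: face_le_def)

lemma face_le_trans: "face_le F G \<Longrightarrow> face_le G K \<Longrightarrow> face_le F K"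
  by (auto simp: face_le_def)

lemma face_le_antisym:
  assumes "F \<in> faces \<A>" "G \<in> faces \<A>" "face_le F G" "face_le G F"
  shows "F = G"
  using assms by (intro face_eqI) (metis face_le_iff)+

lemma subset_closure_iff: "F \<in> faces \<A> \<Longrightarrow> G \<in> faces \<A> \<Longrightarrow> F \<subseteq> closure G \<longleftrightarrow> face_le G F"
  unfolding face_le_def by (meson closed_closure closure_minimal closure_subset order_trans)

text \<open>Continuity of the map from points to cells, for the face order reversed once more: only
  finitely many strict signs are imposed. This makes the Euclidean space itself a stratified
  space.\<close>

lemma open_faces_below:
  assumes "F \<in> faces \<A>"
  shows "open {y. face_le (cell \<A> y) F}"
proof -
  have "{y. face_le (cell \<A> y) F} = (\<Inter>H\<in>{H \<in> \<A>. sd F H \<noteq> 0}. {y. side H y = sd F H})"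
    using assms by (auto simp: face_le_iff cell_face sd_cell)
  then show ?thesis
    using finite_arrangement by (auto intro: open_INT open_side)
qed

lemma chamber_iff: "C \<in> chambers \<A> \<longleftrightarrow> C \<in> faces \<A> \<and> (\<forall>H\<in>\<A>. sd C H \<noteq> 0)"
proof -
  have eq: "chambers \<A> = cell \<A> ` (- \<Union>\<A>)"
    by (rule chambers_eq_cells) (auto intro: hyperplane)
  have "(\<forall>H\<in>\<A>. sd (cell \<A> x) H \<noteq> 0) \<longleftrightarrow> x \<notin> \<Union>\<A>" for x
    using hyperplane by (auto simp: sd_cell side_eq_0_iff)
  then show ?thesis
    unfolding eq faces_eq_cells by auto
qed

lemma chamber_face: "C \<in> chambers \<A> \<Longrightarrow> C \<in> faces \<A>"
  by (simp add: chamber_iff)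

lemma localization_eq:
  assumes F: "F \<in> faces \<A>"
  shows "localization \<A> F = {H \<in> \<A>. sd F H = 0}"
proof -
  have "affine hull F \<subseteq> H \<longleftrightarrow> sd F H = 0" if H: "H \<in> \<A>" for H
  proof -
    have "affine H"
      using hyperplane_coords(2)[OF hyperplane[OF H]] affine_hyperplane by metis
    then have "affine hull F \<subseteq> H \<longleftrightarrow> F \<subseteq> H"
      by (meson hull_minimal hull_subset order_trans)
    also have "\<dots> \<longleftrightarrow> sd F H = 0"
      using face_nonempty[OF F] sd_eq[OF F _ H] side_eq_0_iff[OF hyperplane[OF H]] by (metis subset_iff)
    finally show ?thesis .
  qed
  then show ?thesis
    by (auto simp: localization_def)
qed

text \<open>The face with sign vector \<open>F \<circ> G\<close>, found by moving slightly from \<open>F\<close> towards \<open>G\<close>.\<close>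

lemma face_product:
  assumes F: "F \<in> faces \<A>" and G: "G \<in> faces \<A>"
  obtains K where "K \<in> faces \<A>" "\<And>H. H \<in> \<A> \<Longrightarrow> sd K H = (if sd F H = 0 then sd G H else sd F H)"
proof -
  obtain x where x: "x \<in> F"
    using face_nonempty[OF F] by blast
  obtain g where g: "g \<in> G"
    using face_nonempty[OF G] by blast
  define p where "p \<epsilon> = (1 - \<epsilon>) *\<^sub>R x + \<epsilon> *\<^sub>R g" for \<epsilon> :: real
  have "\<forall>\<^sub>F \<epsilon> in at_right 0. side H (p \<epsilon>) = (if sd F H = 0 then sd G H else sd F H)" if H: "H \<in> \<A>" for H
  proof (cases "sd F H = 0")
    case True
    then have "level H x = 0"
      using sd_eq[OF F x H] by (simp add: side_eq_iff_level)
    then have "side H (p \<epsilon>) = side H g" if "\<epsilon> > 0" for \<epsilon>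
      using that by (simp add: p_def side_def level_affine sgn_mult)
    then have "\<forall>\<^sub>F \<epsilon> in at_right 0. side H (p \<epsilon>) = side H g"
      by (intro eventually_at_right_less[THEN eventually_mono]) auto
    then show ?thesis
      using True sd_eq[OF G g H] by simp
  next
    case False
    then have "side H x \<noteq> 0"
      using sd_eq[OF F x H] by simp
    have "(p \<longlongrightarrow> p 0) (at_right 0)"
      unfolding p_def by (intro tendsto_intros)
    then have "\<forall>\<^sub>F \<epsilon> in at_right 0. p \<epsilon> \<in> {y. side H y = side H x}"
      by (rule topological_tendstoD) (auto simp: p_def open_side[OF \<open>side H x \<noteq> 0\<close>])
    then show ?thesis
      using False sd_eq[OF F x H] by simp
  qed
  then have "\<forall>\<^sub>F \<epsilon> in at_right 0. \<forall>H\<in>\<A>. side H (p \<epsilon>) = (if sd F H = 0 then sd G H else sd F H)"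
    using finite_arrangement by (simp add: eventually_ball_finite_distrib)
  then obtain \<epsilon> where "\<forall>H\<in>\<A>. side H (p \<epsilon>) = (if sd F H = 0 then sd G H else sd F H)"
    using eventually_happens' trivial_limit_at_right_real by blast
  then show ?thesis
    by (intro that[of "cell \<A> (p \<epsilon>)"]) (auto simp: cell_face sd_cell)
qed

text \<open>The chamber \<open>C\<^sub>F\<close> has the product sign vector
  \<open>F \<circ> C\<close>. Having \<open>F\<close> in the closure forces the nonzero signs of
  \<open>F\<close>; lying in the same chamber of the localization forces the signs of
  \<open>C\<close> at the zeros of \<open>F\<close>. Together they fix every sign, which justifies
  the definite description.\<close>

lemma chamber_at:
  assumes F: "F \<in> faces \<A>" and C: "C \<in> chambers \<A>"
  shows "chamber_at \<A> C F \<in> chambers \<A>"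
    "H \<in> \<A> \<Longrightarrow> sd (chamber_at \<A> C F) H = (if sd F H = 0 then sd C H else sd F H)"
proof -
  let ?P = "\<lambda>C'. C' \<in> chambers \<A> \<and> F \<subseteq> closure C' \<and> (\<exists>K \<in> chambers (localization \<A> F). C \<subseteq> K \<and> C' \<subseteq> K)"
  have Cf: "C \<in> faces \<A>"
    using C chamber_face by blast
  have loc: "chambers (localization \<A> F) = cell (localization \<A> F) ` (- \<Union>(localization \<A> F))"
    by (rule chambers_eq_cells) (auto simp: localization_def intro: hyperplane)
  obtain C' where C': "C' \<in> faces \<A>" "\<And>H. H \<in> \<A> \<Longrightarrow> sd C' H = (if sd F H = 0 then sd C H else sd F H)"
    using face_product[OF F Cf] by blast
  have C'c: "C' \<in> chambers \<A>"
    using C C' by (auto simp: chamber_iff)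
  obtain c where c: "c \<in> C"
    using face_nonempty[OF Cf] by blast
  have "\<exists>K \<in> chambers (localization \<A> F). C \<subseteq> K \<and> C' \<subseteq> K"
    unfolding loc
  proof (rule bexI)
    show "C \<subseteq> cell (localization \<A> F) c \<and> C' \<subseteq> cell (localization \<A> F) c"
    proof (intro conjI subsetI)
      fix y assume "y \<in> C"
      then have "side H y = side H c" if "H \<in> \<A>" for H
        using sd_eq[OF Cf _ that] c by metis
      then show "y \<in> cell (localization \<A> F) c"
        by (auto simp: cell_def localization_eq[OF F])
    next
      fix y assume "y \<in> C'"
      then have "side H y = side H c" if "H \<in> \<A>" "sd F H = 0" for H
        using sd_eq[OF C'(1) _ that(1)] sd_eq[OF Cf c that(1)] C'(2)[OF that(1)] that(2) by auto
      then show "y \<in> cell (localization \<A> F) c"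
        by (auto simp: cell_def localization_eq[OF F])
    qed
    have "c \<notin> H" if "H \<in> \<A>" for H
      using C c that sd_eq[OF Cf c that] side_eq_0_iff[OF hyperplane[OF that]] by (auto simp: chamber_iff)
    then have "c \<in> - \<Union>(localization \<A> F)"
      by (auto simp: localization_def)
    then show "cell (localization \<A> F) c \<in> cell (localization \<A> F) ` (- \<Union>(localization \<A> F))"
      by (rule imageI)
  qed
  then have ex: "?P C'"
    using C'c C' subset_closure_iff[OF F C'(1)] face_le_iff[OF F C'(1)] by auto
  have uniq: "D = C'" if D: "?P D" for D
  proof (rule face_eqI)
    show Df: "D \<in> faces \<A>"
      using D chamber_face by blast
    show "C' \<in> faces \<A>"
      by (rule C'(1))
    fix H assume H: "H \<in> \<A>"
    show "sd D H = sd C' H"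
    proof (cases "sd F H = 0")
      case True
      obtain K where K: "K \<in> chambers (localization \<A> F)" "C \<subseteq> K" "D \<subseteq> K"
        using D by blast
      then obtain z where z: "K = cell (localization \<A> F) z"
        using loc by blast
      obtain d where d: "d \<in> D"
        using face_nonempty[OF Df] by blast
      have "H \<in> localization \<A> F"
        using H True localization_eq[OF F] by simp
      then have "side H d = side H c"
        using d c K z by (fastforce simp: cell_def)
      then show ?thesis
        using sd_eq[OF Df d H] sd_eq[OF Cf c H] C'(2)[OF H] True by simp
    next
      case False
      have "face_le D F"
        using D subset_closure_iff[OF F Df] by simp
      then show ?thesis
        using face_le_iff[OF F Df] H False C'(2)[OF H] by simp
    qed
  qed
  have eq: "chamber_at \<A> C F = C'"
    unfolding chamber_at_def by (rule the_equality, rule ex, rule uniq)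
  show "chamber_at \<A> C F \<in> chambers \<A>"
    using C'c by (simp add: eq)
  show "H \<in> \<A> \<Longrightarrow> sd (chamber_at \<A> C F) H = (if sd F H = 0 then sd C H else sd F H)"
    using C'(2) by (simp add: eq)
qed

lemma chamber_at_le: "F \<in> faces \<A> \<Longrightarrow> C \<in> chambers \<A> \<Longrightarrow> face_le (chamber_at \<A> C F) F"
  using chamber_at[of F C] by (simp add: face_le_iff chamber_face)

lemma chamber_at_eq_self:
  assumes "F \<in> faces \<A>" "C \<in> chambers \<A>" "face_le C F"
  shows "chamber_at \<A> C F = C"
  using assms chamber_at[OF assms(1,2)] face_le_iff[OF assms(1) chamber_face[OF assms(2)]]
  by (intro face_eqI chamber_face) auto

text \<open>Every zero of \<open>G\<close> is a zero of \<open>F\<close>, and there the passage from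
  \<open>C\<close> to its chamber at \<open>F\<close> changes no sign.\<close>

lemma chamber_at_chamber_at:
  assumes "F \<in> faces \<A>" "G \<in> faces \<A>" "C \<in> chambers \<A>" "face_le G F"
  shows "chamber_at \<A> (chamber_at \<A> C F) G = chamber_at \<A> C G"
  using assms chamber_at[of F C] chamber_at[of G C] chamber_at[of G "chamber_at \<A> C F"] face_le_iff[of F G]
  by (intro face_eqI chamber_face) auto

section \<open>Minimal positive paths\<close>

definition sep :: "'a set \<Rightarrow> 'a set \<Rightarrow> 'a set set" where
  "sep A B = {H \<in> \<A>. sd A H \<noteq> sd B H}"

lemma finite_sep: "finite (sep A B)"
  using finite_arrangement by (simp add: sep_def)

lemma separating_eq:
  assumes A: "A \<in> chambers \<A>" and B: "B \<in> chambers \<A>"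
  shows "separating \<A> A B = sep A B"
proof -
  have AB: "A \<in> faces \<A>" "B \<in> faces \<A>"
    using A B chamber_face by auto
  obtain x y where xy: "x \<in> A" "y \<in> B"
    using AB face_nonempty by blast
  have "(\<exists>a b. H = {x. a \<bullet> x = b} \<and> A \<subseteq> {x. a \<bullet> x < b} \<and> B \<subseteq> {x. b < a \<bullet> x}) \<longleftrightarrow> sd A H \<noteq> sd B H"
    if H: "H \<in> \<A>" for H
  proof
    assume "\<exists>a b. H = {x. a \<bullet> x = b} \<and> A \<subseteq> {x. a \<bullet> x < b} \<and> B \<subseteq> {x. b < a \<bullet> x}"
    then obtain a b where ab: "H = {x. a \<bullet> x = b}" "A \<subseteq> {x. a \<bullet> x < b}" "B \<subseteq> {x. b < a \<bullet> x}"
      by blast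
    then have "a \<bullet> x < b" "b < a \<bullet> y"
      using xy by auto
    then have "a \<noteq> 0" "sgn (a \<bullet> x - b) \<noteq> sgn (a \<bullet> y - b)"
      by auto
    then have "side H x \<noteq> side H y"
      using sgn_eq_iff_side[of a H b x y] ab by blast
    then show "sd A H \<noteq> sd B H"
      using sd_eq AB xy H by metis
  next
    assume ne: "sd A H \<noteq> sd B H"
    let ?n = "fst (hyperplane_coords H)" and ?c = "snd (hyperplane_coords H)"
    have H': "H = {x. ?n \<bullet> x = ?c}"
      using hyperplane_coords(2)[OF hyperplane[OF H]] .
    have sA: "side H z = sd A H" if "z \<in> A" for z
      using sd_eq[OF AB(1) that H] by simp
    have sB: "side H z = sd B H" if "z \<in> B" for z
      using sd_eq[OF AB(2) that H] by simp
    have "sd A H \<noteq> 0" "sd B H \<noteq> 0"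
      using A B H by (auto simp: chamber_iff)
    then consider "sd A H = -1" "sd B H = 1" | "sd A H = 1" "sd B H = -1"
      using ne sd_cases[of A H] sd_cases[of B H] by auto
    then show "\<exists>a b. H = {x. a \<bullet> x = b} \<and> A \<subseteq> {x. a \<bullet> x < b} \<and> B \<subseteq> {x. b < a \<bullet> x}"
    proof cases
      case 1
      then have "A \<subseteq> {x. ?n \<bullet> x < ?c}" "B \<subseteq> {x. ?c < ?n \<bullet> x}"
        using sA sB by (auto simp: side_eq_iff_level level_def)
      then show ?thesis
        using H' by blast
    next
      case 2
      \<comment> \<open>\<open>separating\<close> wants its first chamber on the negative side; if
        the chosen equation is oriented the other way, its negative serves.\<close>
      then have "A \<subseteq> {x. (- ?n) \<bullet> x < - ?c}" "B \<subseteq> {x. - ?c < (- ?n) \<bullet> x}"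
        using sA sB by (auto simp: side_eq_iff_level level_def)
      moreover have "H = {x. (- ?n) \<bullet> x = - ?c}"
        using H' by auto
      ultimately show ?thesis
        by blast
    qed
  qed
  then show ?thesis
    by (auto simp: separating_def sep_def)
qed

lemma parcs_iff: "(A, B) \<in> parcs (arrangement_graph \<A>) \<longleftrightarrow>
    A \<in> chambers \<A> \<and> B \<in> chambers \<A> \<and> card (sep A B) = 1"
  by (auto simp: arrangement_graph_def separating_eq)

lemma pverts_eq: "pverts (arrangement_graph \<A>) = chambers \<A>"
  by (simp add: arrangement_graph_def)

text \<open>The wall is the cell of the point where a segment from \<open>A\<close> to
  \<open>B\<close> meets \<open>H\<close>. The remaining signs agree at both ends of the segment and
  are therefore constant along it.\<close>

lemma wall:
  assumes A: "A \<in> chambers \<A>" and B: "B \<in> chambers \<A>" and H: "sep A B = {H}"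
  obtains W where "W \<in> faces \<A>" "sd W H = 0" "\<And>H'. H' \<in> \<A> \<Longrightarrow> H' \<noteq> H \<Longrightarrow> sd W H' = sd A H'"
proof -
  have AB: "A \<in> faces \<A>" "B \<in> faces \<A>"
    using A B chamber_face by auto
  obtain x y where xy: "x \<in> A" "y \<in> B"
    using AB face_nonempty by blast
  have HA: "H \<in> \<A>"
    using H by (auto simp: sep_def)
  have nz: "level H x \<noteq> 0" "level H y \<noteq> 0" and ne: "side H x \<noteq> side H y"
    using A B H HA sd_eq[OF AB(1) xy(1) HA] sd_eq[OF AB(2) xy(2) HA]
    by (auto simp: chamber_iff sep_def simp flip: side_eq_iff_level(3))
  define t where "t = level H x / (level H x - level H y)"
  define z where "z = (1 - t) *\<^sub>R x + t *\<^sub>R y"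
  have signs: "level H x > 0 \<and> level H y < 0 \<or> level H x < 0 \<and> level H y > 0"
    using nz ne by (auto simp: side_def sgn_if split: if_splits)
  then have t: "0 \<le> t" "t \<le> 1"
    by (auto simp: t_def field_simps)
  have "level H z = level H x - t * (level H x - level H y)"
    unfolding z_def level_affine by (simp add: algebra_simps)
  also have "\<dots> = 0"
    using signs by (auto simp: t_def)
  finally have z0: "side H z = 0"
    by (simp add: side_def)
  have "side H' z = sd A H'" if H': "H' \<in> \<A>" "H' \<noteq> H" for H'
  proof -
    have "sd A H' = sd B H'"
      using H H' by (auto simp: sep_def)
    then have "side H' y = side H' x"
      using sd_eq[OF AB(1) xy(1) H'(1)] sd_eq[OF AB(2) xy(2) H'(1)] by simp
    then have "x \<in> {w. side H' w = side H' x}" "y \<in> {w. side H' w = side H' x}"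
      by auto
    then have "z \<in> {w. side H' w = side H' x}"
      unfolding z_def using convex_side[of H' "side H' x"] t by (auto simp: convex_alt)
    then show ?thesis
      using sd_eq[OF AB(1) xy(1) H'(1)] by simp
  qed
  then show ?thesis
    using z0 HA by (intro that[of "cell \<A> z"]) (auto simp: cell_face sd_cell)
qed

text \<open>A generic segment crosses the separating hyperplanes one at a time.\<close>

lemma adjacent_towards:
  assumes A: "A \<in> chambers \<A>" and B: "B \<in> chambers \<A>" and ne: "sep A B \<noteq> {}"
  obtains D H where "D \<in> chambers \<A>" "H \<in> sep A B" "sep A D = {H}"
proof -
  have AB: "A \<in> faces \<A>" "B \<in> faces \<A>"
    using A B chamber_face by auto
  obtain b where b: "b \<in> B"
    using AB face_nonempty by blast
  have lb: "level H b \<noteq> 0" if "H \<in> \<A>" for H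
    using B that sd_eq[OF AB(2) b that] by (auto simp: chamber_iff simp flip: side_eq_iff_level(3))
  \<comment> \<open>On the segment from \<open>a\<close> to \<open>b\<close>, the crossing parameter
    of \<open>H\<close> is \<open>level H a / (level H a - level H b)\<close>. Two parameters
    coincide exactly when the cross products of levels agree, and for fixed \<open>b\<close> this is
    an affine equation in \<open>a\<close>.\<close>
  define bad where "bad p = {a. level (fst p) a * level (snd p) b = level (snd p) a * level (fst p) b}"
    for p :: "'a set \<times> 'a set"
  let ?pairs = "{p \<in> \<A> \<times> \<A>. fst p \<noteq> snd p}"
  have "negligible (bad p)" if p: "p \<in> ?pairs" for p
  proof -
    obtain H H' where HH: "p = (H, H')" "H \<in> \<A>" "H' \<in> \<A>" "H \<noteq> H'"
      using p by (cases p) auto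
    define n c n' c' where "n = fst (hyperplane_coords H)" "c = snd (hyperplane_coords H)"
      "n' = fst (hyperplane_coords H')" "c' = snd (hyperplane_coords H')"
    define \<beta> \<beta>' where "\<beta> = level H b" "\<beta>' = level H' b"
    have \<beta>: "\<beta> \<noteq> 0" "\<beta>' \<noteq> 0"
      using lb HH by (auto simp: \<beta>_\<beta>'_def)
    have "bad p = {a. (\<beta>' *\<^sub>R n - \<beta> *\<^sub>R n') \<bullet> a = \<beta>' * c - \<beta> * c'}"
      unfolding bad_def HH fst_conv snd_conv \<beta>_\<beta>'_def[symmetric]
      unfolding level_def n_c_n'_c'_def[symmetric]
      by (auto simp: inner_diff_left algebra_simps)
    \<comment> \<open>The affine equation is not vacuous: otherwise the two hyperplanes would have
      proportional equations and coincide.\<close>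
    moreover have "\<beta>' *\<^sub>R n - \<beta> *\<^sub>R n' \<noteq> 0 \<or> \<beta>' * c - \<beta> * c' \<noteq> 0"
    proof (rule ccontr)
      assume "\<not> ?thesis"
      then have e: "\<beta>' *\<^sub>R n = \<beta> *\<^sub>R n'" "\<beta>' * c = \<beta> * c'"
        by auto
      have "n \<bullet> x = c \<longleftrightarrow> n' \<bullet> x = c'" for x
      proof -
        have "n \<bullet> x = c \<longleftrightarrow> (\<beta>' *\<^sub>R n) \<bullet> x = \<beta>' * c"
          using \<beta> by simp
        also have "\<dots> \<longleftrightarrow> n' \<bullet> x = c'"
          unfolding e using \<beta> by simp
        finally show ?thesis .
      qed
      then have "H = H'"
        using hyperplane_coords(2)[OF hyperplane[OF HH(2)]] hyperplane_coords(2)[OF hyperplane[OF HH(3)]]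
        unfolding n_c_n'_c'_def by blast
      then show False
        using HH by blast
    qed
    ultimately show ?thesis
      using negligible_hyperplane by metis
  qed
  then have "negligible (\<Union>(bad ` ?pairs))"
    using finite_arrangement by (intro negligible_Union) auto
  \<comment> \<open>A chamber is open and nonempty, so finitely many negligible sets do not cover it
    and a generic starting point exists.\<close>
  moreover have "\<not> negligible A"
  proof (rule open_not_negligible)
    have "A = (\<Inter>H\<in>\<A>. {y. side H y = sd A H})"
      using mem_face_iff[OF AB(1)] by auto
    moreover have "open (\<Inter>H\<in>\<A>. {y. side H y = sd A H})"
      using A finite_arrangement by (intro open_INT) (auto simp: chamber_iff intro: open_side)
    ultimately show "open A"
      by metis
    show "A \<noteq> {}"
      using face_nonempty[OF AB(1)] by blast
  qed
  ultimately have "\<not> A \<subseteq> \<Union>(bad ` ?pairs)"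
    using negligible_subset by blast
  then obtain a where a: "a \<in> A" "\<And>p. p \<in> ?pairs \<Longrightarrow> a \<notin> bad p"
    by blast
  define \<tau> where "\<tau> H = level H a / (level H a - level H b)" for H
  have la: "level H a \<noteq> 0" if "H \<in> \<A>" for H
    using A that sd_eq[OF AB(1) a(1) that] by (auto simp: chamber_iff simp flip: side_eq_iff_level(3))
  have sepD: "H \<in> \<A>" "level H a > 0 \<and> level H b < 0 \<or> level H a < 0 \<and> level H b > 0" if "H \<in> sep A B" for H
  proof -
    show H: "H \<in> \<A>"
      using that by (simp add: sep_def)
    have "side H a \<noteq> side H b"
      using that sd_eq[OF AB(1) a(1) H] sd_eq[OF AB(2) b H] by (simp add: sep_def)
    then show "level H a > 0 \<and> level H b < 0 \<or> level H a < 0 \<and> level H b > 0"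
      using la[OF H] lb[OF H] by (auto simp: side_def sgn_if split: if_splits)
  qed
  have \<tau>: "0 < \<tau> H" "\<tau> H < 1" if "H \<in> sep A B" for H
    using sepD(2)[OF that] by (auto simp: \<tau>_def field_simps)
  have \<tau>_inj: "\<tau> H \<noteq> \<tau> H'" if "H \<in> sep A B" "H' \<in> sep A B" "H \<noteq> H'" for H H'
  proof
    assume "\<tau> H = \<tau> H'"
    moreover have "level H a - level H b \<noteq> 0" "level H' a - level H' b \<noteq> 0"
      using sepD(2)[OF that(1)] sepD(2)[OF that(2)] by auto
    ultimately have "level H a * (level H' a - level H' b) = level H' a * (level H a - level H b)"
      by (simp add: \<tau>_def frac_eq_eq)
    then have "a \<in> bad (H, H')"
      by (simp add: bad_def algebra_simps)
    then show False
      using a(2)[of "(H, H')"] that sepD(1) by auto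
  qed
  obtain H where H: "H \<in> sep A B" "\<And>H'. H' \<in> sep A B \<Longrightarrow> \<tau> H \<le> \<tau> H'"
    using ne finite_sep[of A B] by (metis arg_min_if_finite(1) arg_min_least)
  \<comment> \<open>The point \<open>y\<close> is to be taken after the first crossing and before
    the next one. Inserting \<open>1\<close> keeps the minimum defined when there is no next
    crossing, and keeps \<open>y\<close> short of \<open>b\<close>.\<close>
  let ?T = "insert 1 (\<tau> ` (sep A B - {H}))"
  have fin: "finite ?T"
    using finite_sep by auto
  have "\<tau> H < Min ?T"
    using fin \<tau>[OF H(1)] H \<tau>_inj by (subst Min_gr_iff) (auto simp: order.strict_iff_order)
  then obtain t where t: "\<tau> H < t" "t < Min ?T"
    using dense by blast
  then have t1: "t < 1" "0 < t" and t': "t < \<tau> H'" if "H' \<in> sep A B" "H' \<noteq> H" for H'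
    using fin \<tau>[OF H(1)] that by auto
  have t1: "t < 1" "0 < t"
    using t fin \<tau>[OF H(1)] by auto
  define y where "y = (1 - t) *\<^sub>R a + t *\<^sub>R b"
  have lev: "level H' y = level H' a - t * (level H' a - level H' b)" for H'
    unfolding y_def level_affine by (simp add: algebra_simps)
  have "side H y \<noteq> side H a \<and> side H y \<noteq> 0"
    using sepD(2)[OF H(1)] t(1) unfolding \<tau>_def
    by (auto simp: side_def sgn_if lev field_simps)
  moreover have "side H' y = side H' a" if H': "H' \<in> \<A>" "H' \<noteq> H" for H'
  proof (cases "H' \<in> sep A B")
    case True
    show ?thesis
      using sepD(2)[OF True] t'[OF True H'(2)] unfolding \<tau>_def
      by (auto simp: side_def sgn_if lev field_simps)
  next
    case False
    then have "side H' b = side H' a"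
      using H'(1) sd_eq[OF AB(1) a(1) H'(1)] sd_eq[OF AB(2) b H'(1)] by (simp add: sep_def)
    then have "a \<in> {w. side H' w = side H' a}" "b \<in> {w. side H' w = side H' a}"
      by auto
    then have "y \<in> {w. side H' w = side H' a}"
      unfolding y_def using convex_side[of H' "side H' a"] t1 by (auto simp: convex_alt)
    then show ?thesis
      by simp
  qed
  moreover have "side H' a \<noteq> 0" if "H' \<in> \<A>" for H'
    using la[OF that] by (simp add: side_eq_iff_level)
  ultimately have "side H' y \<noteq> 0" "side H' a = side H' y \<longleftrightarrow> H' \<noteq> H" if "H' \<in> \<A>" for H'
    using that by metis+
  then have "cell \<A> y \<in> chambers \<A>" "sep A (cell \<A> y) = {H}"
    using sd_eq[OF AB(1) a(1)] sepD(1)[OF H(1)]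
    by (auto simp: chamber_iff cell_face sd_cell sep_def)
  then show ?thesis
    using that H(1) by blast
qed

lemma sep_triangle: "sep A C \<subseteq> sep A B \<union> sep B C"
  by (auto simp: sep_def)

lemma card_sep_triangle: "card (sep A C) \<le> card (sep A B) + card (sep B C)"
  by (meson card_Un_le card_mono finite_UnI finite_sep order_trans sep_triangle)

lemma sep_empty_iff: "A \<in> chambers \<A> \<Longrightarrow> B \<in> chambers \<A> \<Longrightarrow> sep A B = {} \<longleftrightarrow> A = B"
  using face_eqI[of A B] by (auto simp: sep_def chamber_face)

lemma card_sep_eq_0_iff: "A \<in> chambers \<A> \<Longrightarrow> B \<in> chambers \<A> \<Longrightarrow> card (sep A B) = 0 \<longleftrightarrow> A = B"
  using sep_empty_iff finite_sep by simp

text \<open>Each positive edge crosses exactly one hyperplane, so the triangle inequality for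
  separating sets bounds the length from below.\<close>

lemma card_sep_le_length:
  assumes "signed_walk (arrangement_graph \<A>) A es" "positive_path (A, es)"
  shows "card (sep A (path_end (A, es))) \<le> length es"
  using assms
proof (induction es arbitrary: A)
  case Nil
  then show ?case
    by (simp add: path_end_def sep_def)
next
  case (Cons e es)
  obtain B where e: "e = ((A, B), True)"
    using Cons.prems by (cases e) (auto simp: positive_path_def step_begin_def split: if_splits)
  then have "card (sep A B) = 1" "signed_walk (arrangement_graph \<A>) B es"
    using Cons.prems by (auto simp: parcs_iff step_end_def)
  moreover have "positive_path (B, es)"
    using Cons.prems by (simp add: positive_path_def)
  moreover have "path_end (A, e # es) = path_end (B, es)"
    by (simp add: path_end_def e step_end_def)
  ultimately show ?case
    using Cons.IH[of B] card_sep_triangle[of A "path_end (B, es)" B] by simp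
qed

text \<open>Induction on the number of separating hyperplanes: the neighbour provided by
  \<open>adjacent_towards\<close> removes exactly the hyperplane just crossed.\<close>

lemma minimal_walk_exists:
  assumes "A \<in> chambers \<A>" "B \<in> chambers \<A>"
  obtains es where "signed_walk (arrangement_graph \<A>) A es" "positive_path (A, es)"
    "path_end (A, es) = B" "length es = card (sep A B)"
proof -
  have "\<exists>es. signed_walk (arrangement_graph \<A>) A es \<and> positive_path (A, es) \<and> path_end (A, es) = B \<and>
      length es = card (sep A B)"
    using assms(1)
  proof (induction "card (sep A B)" arbitrary: A)
    case 0
    then have "A = B"
      using card_sep_eq_0_iff assms(2) by simp
    then show ?case
      using 0 by (intro exI[of _ "[]"]) (auto simp: pverts_eq positive_path_def path_end_def)
  next
    case (Suc n)
    then have "sep A B \<noteq> {}"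
      by auto
    then obtain D H where D: "D \<in> chambers \<A>" "H \<in> sep A B" "sep A D = {H}"
      using adjacent_towards[OF Suc.prems assms(2)] by blast
    have AD: "sd A H' = sd D H' \<longleftrightarrow> H' \<noteq> H" if "H' \<in> \<A>" for H'
      using D(3) that by (auto simp: sep_def)
    have "sd A H \<noteq> 0" "sd B H \<noteq> 0" "sd D H \<noteq> 0" "sd A H \<noteq> sd B H" "H \<in> \<A>"
      using Suc.prems assms(2) D by (auto simp: chamber_iff sep_def)
    \<comment> \<open>Chambers have only two possible signs at \<open>H\<close>, so leaving the side
      of \<open>A\<close> means reaching the side of \<open>B\<close>.\<close>
    then have "sd D H = sd B H" "H \<in> \<A>"
      using AD[of H] sd_cases[of A H] sd_cases[of B H] sd_cases[of D H] by auto
    then have "sd D H' \<noteq> sd B H' \<longleftrightarrow> sd A H' \<noteq> sd B H' \<and> H' \<noteq> H" if "H' \<in> \<A>" for H'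
      using AD[OF that] by (cases "H' = H") simp_all
    then have "sep D B = sep A B - {H}"
      unfolding sep_def by blast
    then have "card (sep D B) = n"
      using Suc.hyps(2) D(2) finite_sep by (simp add: card_Diff_singleton)
    then obtain es where es: "signed_walk (arrangement_graph \<A>) D es" "positive_path (D, es)"
      "path_end (D, es) = B" "length es = n"
      using Suc.hyps(1) D(1) by auto
    then show ?case
      using D Suc.prems Suc.hyps(2)
      by (intro exI[of _ "((A, D), True) # es"])
        (auto simp: parcs_iff step_begin_def step_end_def positive_path_def path_end_def)
  qed
  then show ?thesis
    using that by blast
qed

text \<open>Minimality becomes a count of hyperplanes. A concatenation of minimal paths can then be
  recognized as minimal by adding cardinalities.\<close>

lemma minimal_positive_paths_iff:
  assumes "A \<in> chambers \<A>" "B \<in> chambers \<A>"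
  shows "\<alpha> \<in> minimal_positive_paths (arrangement_graph \<A>) A B \<longleftrightarrow>
    \<alpha> \<in> signed_paths (arrangement_graph \<A>) \<and> positive_path \<alpha> \<and> path_begin \<alpha> = A \<and> path_end \<alpha> = B \<and>
    length (snd \<alpha>) = card (sep A B)"
proof -
  obtain es where es: "signed_walk (arrangement_graph \<A>) A es" "positive_path (A, es)"
    "path_end (A, es) = B" "length es = card (sep A B)"
    using minimal_walk_exists[OF assms] .
  then have "(A, es) \<in> signed_paths (arrangement_graph \<A>)" "path_begin (A, es) = A"
    by (auto simp: signed_paths_def path_begin_def)
  have low: "card (sep A B) \<le> length (snd \<beta>)"
    if "\<beta> \<in> signed_paths (arrangement_graph \<A>)" "positive_path \<beta>" "path_begin \<beta> = A" "path_end \<beta> = B" for \<beta>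
    using card_sep_le_length[of A "snd \<beta>"] that by (cases \<beta>) (auto simp: signed_paths_def path_begin_def)
  have up: "length (snd \<alpha>) \<le> card (sep A B)" if "\<alpha> \<in> minimal_positive_paths (arrangement_graph \<A>) A B" for \<alpha>
    using that es \<open>(A, es) \<in> _\<close> \<open>path_begin (A, es) = A\<close> unfolding minimal_positive_paths_def by fastforce
  show ?thesis
  proof
    assume \<alpha>: "\<alpha> \<in> minimal_positive_paths (arrangement_graph \<A>) A B"
    then have "\<alpha> \<in> signed_paths (arrangement_graph \<A>) \<and> positive_path \<alpha> \<and> path_begin \<alpha> = A \<and> path_end \<alpha> = B"
      by (simp add: minimal_positive_paths_def)
    then show "\<alpha> \<in> signed_paths (arrangement_graph \<A>) \<and> positive_path \<alpha> \<and> path_begin \<alpha> = A \<and>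
        path_end \<alpha> = B \<and> length (snd \<alpha>) = card (sep A B)"
      using low up[OF \<alpha>] by (simp add: antisym)
  qed (simp add: minimal_positive_paths_def low)
qed

text \<open>The hyperplanes crossed on the way to a face and from there to a smaller face are distinct.\<close>

lemma card_sep_chamber_at:
  assumes "F \<in> faces \<A>" "G \<in> faces \<A>" "C \<in> chambers \<A>" "face_le G F"
  shows "card (sep C (chamber_at \<A> C F)) + card (sep (chamber_at \<A> C F) (chamber_at \<A> C G)) =
    card (sep C (chamber_at \<A> C G))"
proof -
  let ?CF = "chamber_at \<A> C F" and ?CG = "chamber_at \<A> C G"
  note at = chamber_at(2)[OF assms(1,3)] chamber_at(2)[OF assms(2,3)]
  have le: "sd F H \<noteq> 0 \<Longrightarrow> sd G H = sd F H" if "H \<in> \<A>" for H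
    using assms(4) face_le_iff[OF assms(1,2)] that by blast
  have "sep C ?CF \<inter> sep ?CF ?CG = {}" "sep C ?CF \<union> sep ?CF ?CG = sep C ?CG"
    unfolding sep_def using at le by (auto split: if_splits)
  then show ?thesis
    using card_Un_disjoint[of "sep C ?CF" "sep ?CF ?CG"] finite_sep by simp
qed

end

section \<open>Signed walks and oriented systems\<close>

lemma path_end_Nil [simp]: "path_end (u, []) = u"
  by (simp add: path_end_def)

lemma path_end_Cons [simp]: "path_end (u, e # es) = path_end (step_end e, es)"
  by (simp add: path_end_def)

lemma path_end_append [simp]: "path_end (u, es @ fs) = path_end (path_end (u, es), fs)"
  by (induction es arbitrary: u) auto

lemma path_comp_assoc: "\<alpha> \<bullet>\<^sub>p \<beta> \<bullet>\<^sub>p \<gamma> = \<alpha> \<bullet>\<^sub>p (\<beta> \<bullet>\<^sub>p \<gamma>)"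
  by (simp add: path_comp_def)

lemma path_begin_comp [simp]: "path_begin (\<alpha> \<bullet>\<^sub>p \<beta>) = path_begin \<alpha>"
  by (simp add: path_begin_def path_comp_def)

lemma path_end_comp [simp]: "path_end \<alpha> = path_begin \<beta> \<Longrightarrow> path_end (\<alpha> \<bullet>\<^sub>p \<beta>) = path_end \<beta>"
  by (cases \<alpha>; cases \<beta>) (simp add: path_begin_def path_comp_def)

lemma path_const [simp]: "path_begin (const_path u) = u" "path_end (const_path u) = u"
  by (auto simp: const_path_def path_begin_def)

lemma path_comp_const [simp]: "\<alpha> \<bullet>\<^sub>p const_path u = \<alpha>" "path_begin \<alpha> = u \<Longrightarrow> const_path u \<bullet>\<^sub>p \<alpha> = \<alpha>"
  by (auto simp: path_comp_def const_path_def path_begin_def)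

lemma path_begin_inverse [simp]: "path_begin (path_inverse \<alpha>) = path_end \<alpha>"
  by (simp add: path_begin_def path_inverse_def)

lemma path_inverse_comp:
  "path_end \<alpha> = path_begin \<beta> \<Longrightarrow> path_inverse (\<alpha> \<bullet>\<^sub>p \<beta>) = path_inverse \<beta> \<bullet>\<^sub>p path_inverse \<alpha>"
  by (simp add: path_inverse_def) (simp add: path_comp_def)

lemma path_inverse_const [simp]: "path_inverse (const_path u) = const_path u"
  by (simp add: path_inverse_def const_path_def)

abbreviation flip_step :: "('v \<times> 'v) \<times> bool \<Rightarrow> ('v \<times> 'v) \<times> bool" where
  "flip_step \<equiv> (\<lambda>(e, s). (e, \<not> s))"

lemma step_flip [simp]: "step_begin (flip_step e) = step_end e" "step_end (flip_step e) = step_begin e"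
  by (auto simp: step_begin_def step_end_def split: prod.splits)

lemma positive_path_comp [simp]: "positive_path (\<alpha> \<bullet>\<^sub>p \<beta>) \<longleftrightarrow> positive_path \<alpha> \<and> positive_path \<beta>"
  by (auto simp: positive_path_def path_comp_def)

context pair_wf_digraph
begin

lemma signed_walk_start: "signed_walk G u es \<Longrightarrow> u \<in> pverts G"
  by (cases es) (auto simp: step_begin_def dest: in_arcsD1 in_arcsD2 split: if_splits)

lemma signed_walk_append:
  "signed_walk G u (es @ fs) \<longleftrightarrow> signed_walk G u es \<and> signed_walk G (path_end (u, es)) fs"
  by (induction es arbitrary: u) (auto dest: signed_walk_start)

lemma signed_walk_end: "signed_walk G u es \<Longrightarrow> path_end (u, es) \<in> pverts G"
  by (induction es arbitrary: u) auto

lemma signed_walk_reverse: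
  "signed_walk G u es \<Longrightarrow> signed_walk G (path_end (u, es)) (rev (map flip_step es)) \<and>
     path_end (path_end (u, es), rev (map flip_step es)) = u"
proof (induction es arbitrary: u)
  case (Cons e es)
  have "signed_walk G (step_end e) [flip_step e]"
    using Cons.prems signed_walk_start[of u "e # es"] by (auto split: prod.splits simp: step_begin_def step_end_def)
  then show ?case
    using Cons by (auto simp: signed_walk_append)
qed simp

lemma signed_paths_comp: "\<alpha> \<in> signed_paths G \<Longrightarrow> \<beta> \<in> signed_paths G \<Longrightarrow> path_end \<alpha> = path_begin \<beta> \<Longrightarrow>
    \<alpha> \<bullet>\<^sub>p \<beta> \<in> signed_paths G"
  by (cases \<alpha>; cases \<beta>) (auto simp: signed_paths_def path_comp_def signed_walk_append path_begin_def)

lemma signed_paths_inverse: "\<alpha> \<in> signed_paths G \<Longrightarrow> path_inverse \<alpha> \<in> signed_paths G"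
  by (cases \<alpha>) (auto simp: signed_paths_def path_inverse_def signed_walk_reverse)

lemma path_end_inverse: "\<alpha> \<in> signed_paths G \<Longrightarrow> path_end (path_inverse \<alpha>) = path_begin \<alpha>"
  by (cases \<alpha>) (auto simp: signed_paths_def path_inverse_def path_begin_def signed_walk_reverse)

lemma path_inverse_inverse: "\<alpha> \<in> signed_paths G \<Longrightarrow> path_inverse (path_inverse \<alpha>) = \<alpha>"
  using path_end_inverse[of \<alpha>]
  by (cases \<alpha>) (auto simp: path_inverse_def path_begin_def rev_map split_def o_def)

lemma signed_paths_begin: "\<alpha> \<in> signed_paths G \<Longrightarrow> path_begin \<alpha> \<in> pverts G"
  by (auto simp: signed_paths_def path_begin_def signed_walk_start)

lemma signed_paths_end: "\<alpha> \<in> signed_paths G \<Longrightarrow> path_end \<alpha> \<in> pverts G"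
  by (cases \<alpha>) (auto simp: signed_paths_def signed_walk_end)

lemma const_path_in: "u \<in> pverts G \<Longrightarrow> const_path u \<in> signed_paths G"
  by (simp add: signed_paths_def const_path_def)

lemma generated_relation_paths:
  assumes "(\<alpha>, \<beta>) \<in> generated_relation G S"
    and "\<And>\<alpha> \<beta>. (\<alpha>, \<beta>) \<in> S \<Longrightarrow> path_begin \<alpha> = path_begin \<beta> \<and> path_end \<alpha> = path_end \<beta>"
  shows "\<alpha> \<in> signed_paths G \<and> \<beta> \<in> signed_paths G \<and> path_begin \<alpha> = path_begin \<beta> \<and> path_end \<alpha> = path_end \<beta>"
  using assms(1)
proof induction
  case (gen_cancel \<alpha>)
  then show ?case
    by (simp add: signed_paths_comp signed_paths_inverse path_end_inverse const_path_in signed_paths_begin)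
next
  case (gen_inverse \<alpha> \<beta>)
  then show ?case
    by (simp add: signed_paths_inverse path_end_inverse)
next
  case (gen_composition \<alpha> \<beta> \<gamma>\<^sub>1 \<gamma>\<^sub>2)
  then show ?case
    by (simp add: signed_paths_comp)
qed (auto simp: assms(2))

end

context oriented_system
begin

sublocale paths: path_groupoid "signed_paths \<Psi>" R "pverts \<Psi>" path_begin path_end path_comp path_inverse const_path
proof
  fix \<alpha> \<alpha>' \<beta> \<beta>' assume r: "(\<alpha>, \<alpha>') \<in> R" "(\<beta>, \<beta>') \<in> R" and e: "path_end \<alpha> = path_begin \<beta>"
  have in_paths: "\<alpha> \<in> signed_paths \<Psi>" "\<alpha>' \<in> signed_paths \<Psi>" "\<beta> \<in> signed_paths \<Psi>" "\<beta>' \<in> signed_paths \<Psi>"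
    using r equiv_type[OF equiv_paths] by auto
  \<comment> \<open>The axiom \<open>composition\<close> replaces a middle factor. The two factors
    are therefore changed one at a time, a constant path filling the free outer place.\<close>
  have "(const_path (path_begin \<alpha>) \<bullet>\<^sub>p \<alpha> \<bullet>\<^sub>p \<beta>, const_path (path_begin \<alpha>) \<bullet>\<^sub>p \<alpha>' \<bullet>\<^sub>p \<beta>) \<in> R"
    using r e in_paths by (intro composition) (auto simp: const_path_in signed_paths_begin)
  then have 1: "(\<alpha> \<bullet>\<^sub>p \<beta>, \<alpha>' \<bullet>\<^sub>p \<beta>) \<in> R"
    using same_begin[OF r(1)] by simp
  have "(\<alpha>' \<bullet>\<^sub>p \<beta> \<bullet>\<^sub>p const_path (path_end \<beta>), \<alpha>' \<bullet>\<^sub>p \<beta>' \<bullet>\<^sub>p const_path (path_end \<beta>)) \<in> R"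
    using r e in_paths same_end[OF r(1)] by (intro composition) (auto simp: const_path_in signed_paths_end)
  then have 2: "(\<alpha>' \<bullet>\<^sub>p \<beta>, \<alpha>' \<bullet>\<^sub>p \<beta>') \<in> R"
    by simp
  show "(\<alpha> \<bullet>\<^sub>p \<beta>, \<alpha>' \<bullet>\<^sub>p \<beta>') \<in> R"
    using equiv_paths 1 2 by (meson equivE transD)
next
  have refl: "(\<alpha>, \<alpha>) \<in> R" if "\<alpha> \<in> signed_paths \<Psi>" for \<alpha>
    using equiv_paths that by (meson equivE refl_onD)
  show "(\<alpha> \<bullet>\<^sub>p \<beta> \<bullet>\<^sub>p \<gamma>, \<alpha> \<bullet>\<^sub>p (\<beta> \<bullet>\<^sub>p \<gamma>)) \<in> R"
    if "\<alpha> \<in> signed_paths \<Psi>" "\<beta> \<in> signed_paths \<Psi>" "\<gamma> \<in> signed_paths \<Psi>"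
      "path_end \<alpha> = path_begin \<beta>" "path_end \<beta> = path_begin \<gamma>" for \<alpha> \<beta> \<gamma>
    using that unfolding path_comp_assoc by (intro refl signed_paths_comp) auto
  show "(const_path (path_begin \<alpha>) \<bullet>\<^sub>p \<alpha>, \<alpha>) \<in> R" "(\<alpha> \<bullet>\<^sub>p const_path (path_end \<alpha>), \<alpha>) \<in> R"
    if "\<alpha> \<in> signed_paths \<Psi>" for \<alpha>
    using that refl by auto
qed (auto simp: equiv_paths same_begin same_end signed_paths_begin signed_paths_end signed_paths_comp
    const_path_in signed_paths_inverse path_end_inverse cancel path_inverse_inverse)

text \<open>The rules generating the homotopy relation of the graph are among the axioms of an
  oriented system. Hence \<open>R\<close> descends to the fundamental group of the graph.\<close>

lemma generated_relation_subset:
  assumes "(\<alpha>, \<beta>) \<in> generated_relation \<Psi> {}"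
  shows "(\<alpha>, \<beta>) \<in> R"
  using assms
proof induction
  case (gen_composition \<alpha> \<beta> \<gamma>\<^sub>1 \<gamma>\<^sub>2)
  then show ?case
    by (intro composition)
qed (auto simp: paths.refl_r cancel inverse intro: paths.sym_r paths.trans_r)

end

section \<open>Lifts of minimal paths\<close>

lemma map_path_simps [simp]:
  "path_begin (map_path \<rho> \<alpha>) = \<rho> (path_begin \<alpha>)"
  "length (snd (map_path \<rho> \<alpha>)) = length (snd \<alpha>)"
  "map_path \<rho> (\<alpha> \<bullet>\<^sub>p \<beta>) = map_path \<rho> \<alpha> \<bullet>\<^sub>p map_path \<rho> \<beta>"
  "map_path \<rho> (const_path u) = const_path (\<rho> u)"
  "positive_path (map_path \<rho> \<alpha>) \<longleftrightarrow> positive_path \<alpha>"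
  by (auto simp: map_path_def path_begin_def path_comp_def const_path_def positive_path_def split_def)

lemma path_end_map_path [simp]: "path_end (map_path \<rho> \<alpha>) = \<rho> (path_end \<alpha>)"
proof -
  have "path_end (map_path \<rho> (u, es)) = \<rho> (path_end (u, es))" for u es
    by (induction es arbitrary: u) (auto simp: map_path_def step_end_def)
  then show ?thesis
    by (cases \<alpha>) simp
qed

lemma map_path_inverse [simp]: "map_path \<rho> (path_inverse \<alpha>) = path_inverse (map_path \<rho> \<alpha>)"
  by (simp add: path_inverse_def) (auto simp: map_path_def path_inverse_def rev_map split_def)

locale arrangement_cover =
  arrangement \<A> + oriented_cover \<Theta> R "arrangement_graph \<A>" "arrangement_relation \<A>" \<rho>
  for \<A> :: "'a::euclidean_space set set" and \<Theta> :: "'v pair_pre_digraph" and R and \<rho>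
begin

sublocale \<Gamma>: pair_wf_digraph "arrangement_graph \<A>"
  by unfold_locales (auto simp: arrangement_graph_def)

lemma chamber_vertex: "v \<in> pverts \<Theta> \<Longrightarrow> \<rho> v \<in> chambers \<A>"
  using vertex_map by (simp add: pverts_eq)

lemma signed_paths_map: "\<alpha> \<in> signed_paths \<Theta> \<Longrightarrow> map_path \<rho> \<alpha> \<in> signed_paths (arrangement_graph \<A>)"
proof -
  have "signed_walk \<Theta> u es \<Longrightarrow> map_path \<rho> (u, es) \<in> signed_paths (arrangement_graph \<A>)" for u es
    by (induction es arbitrary: u)
      (auto simp: map_path_def signed_paths_def step_begin_def step_end_def vertex_map edge_map split: if_splits)
  then show "\<alpha> \<in> signed_paths \<Theta> \<Longrightarrow> map_path \<rho> \<alpha> \<in> signed_paths (arrangement_graph \<A>)"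
    by (cases \<alpha>) (simp add: signed_paths_def)
qed

lemma lift_exists:
  assumes "v \<in> pverts \<Theta>" "\<alpha> \<in> signed_paths (arrangement_graph \<A>)" "path_begin \<alpha> = \<rho> v"
  obtains \<beta> where "\<beta> \<in> signed_paths \<Theta>" "path_begin \<beta> = v" "map_path \<rho> \<beta> = \<alpha>" "path_lift \<Theta> \<rho> v \<alpha> = \<beta>"
proof -
  obtain \<beta> where \<beta>: "\<beta> \<in> signed_paths \<Theta>" "path_begin \<beta> = v" "map_path \<rho> \<beta> = \<alpha>"
    using unique_lift[OF assms] by blast
  moreover have "path_lift \<Theta> \<rho> v \<alpha> = \<beta>"
    unfolding path_lift_def using unique_lift[OF assms] \<beta> by (intro the1_equality) auto
  ultimately show ?thesis
    using that by blast
qed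

lemma lift_unique:
  assumes "\<alpha> \<in> signed_paths \<Theta>" "\<beta> \<in> signed_paths \<Theta>" "path_begin \<alpha> = path_begin \<beta>" "map_path \<rho> \<alpha> = map_path \<rho> \<beta>"
  shows "\<alpha> = \<beta>"
proof -
  have "\<exists>!\<gamma>. \<gamma> \<in> signed_paths \<Theta> \<and> path_begin \<gamma> = path_begin \<alpha> \<and> map_path \<rho> \<gamma> = map_path \<rho> \<alpha>"
    using assms(1) by (intro unique_lift signed_paths_map signed_paths_begin) simp_all
  then show ?thesis
    using assms by metis
qed

text \<open>These are the lifts of minimal positive paths, described inside the cover: the length is
  compared with the number of hyperplanes separating the images of the endpoints.\<close>

definition minimal_path :: "'v \<Rightarrow> 'v signed_path \<Rightarrow> 'v \<Rightarrow> bool" where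
  "minimal_path u \<gamma> w \<longleftrightarrow> \<gamma> \<in> signed_paths \<Theta> \<and> positive_path \<gamma> \<and> path_begin \<gamma> = u \<and> path_end \<gamma> = w \<and>
     length (snd \<gamma>) = card (sep (\<rho> u) (\<rho> w))"

lemma minimal_path_vertices: "minimal_path u \<gamma> w \<Longrightarrow> u \<in> pverts \<Theta> \<and> w \<in> pverts \<Theta>"
  unfolding minimal_path_def using signed_paths_begin signed_paths_end by metis

lemma minimal_path_map:
  assumes "minimal_path u \<gamma> w"
  shows "map_path \<rho> \<gamma> \<in> minimal_positive_paths (arrangement_graph \<A>) (\<rho> u) (\<rho> w)"
  using assms minimal_path_vertices[OF assms] signed_paths_map
  by (subst minimal_positive_paths_iff) (auto simp: chamber_vertex minimal_path_def)

lemma minimal_path_of_lift: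
  assumes "\<gamma> \<in> signed_paths \<Theta>" "path_begin \<gamma> = u"
    "map_path \<rho> \<gamma> \<in> minimal_positive_paths (arrangement_graph \<A>) (\<rho> u) B" "B \<in> chambers \<A>"
  shows "minimal_path u \<gamma> (path_end \<gamma>)" "\<rho> (path_end \<gamma>) = B"
  using assms signed_paths_begin[OF assms(1)]
  by (auto simp: minimal_path_def minimal_positive_paths_iff chamber_vertex)

lemma minimal_path_exists:
  assumes "u \<in> pverts \<Theta>" "B \<in> chambers \<A>"
  obtains \<gamma> w where "minimal_path u \<gamma> w" "\<rho> w = B"
proof -
  obtain es where "signed_walk (arrangement_graph \<A>) (\<rho> u) es" "positive_path (\<rho> u, es)"
    "path_end (\<rho> u, es) = B" "length es = card (sep (\<rho> u) B)"
    using minimal_walk_exists assms chamber_vertex by metis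
  then have \<alpha>: "(\<rho> u, es) \<in> minimal_positive_paths (arrangement_graph \<A>) (\<rho> u) B"
    "(\<rho> u, es) \<in> signed_paths (arrangement_graph \<A>)" "path_begin (\<rho> u, es) = \<rho> u"
    using assms by (auto simp: minimal_positive_paths_iff chamber_vertex signed_paths_def path_begin_def)
  then obtain \<gamma> where "\<gamma> \<in> signed_paths \<Theta>" "path_begin \<gamma> = u" "map_path \<rho> \<gamma> = (\<rho> u, es)"
    using lift_exists[OF assms(1)] by metis
  with \<alpha> minimal_path_of_lift[of \<gamma> u B] assms(2) show ?thesis
    using that by metis
qed

text \<open>The images have the same ends downstairs and both are minimal, so they form a generating
  pair of the arrangement relation. The induced relation brings this back to the cover, where
  related paths have equal ends.\<close>

lemma minimal_path_unique:
  assumes "minimal_path u \<gamma> w" "minimal_path u \<gamma>' w'" "\<rho> w = \<rho> w'"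
  shows "(\<gamma>, \<gamma>') \<in> R" "w = w'"
proof -
  have "(map_path \<rho> \<gamma>, map_path \<rho> \<gamma>') \<in> arrangement_relation \<A>"
    unfolding arrangement_relation_def
    using minimal_path_map[OF assms(1)] minimal_path_map[OF assms(2)] assms
    by (intro gen_base) (auto simp: minimal_path_def intro!: signed_paths_map)
  then show r: "(\<gamma>, \<gamma>') \<in> R"
    using assms by (subst induced_relation) (auto simp: minimal_path_def)
  show "w = w'"
    using same_end[OF r] assms by (simp add: minimal_path_def)
qed

lemma minimal_path_const: "u \<in> pverts \<Theta> \<Longrightarrow> minimal_path u (const_path u) u"
  by (simp add: minimal_path_def const_path_in sep_def) (simp add: const_path_def positive_path_def)

lemma minimal_path_comp:
  assumes "minimal_path u \<alpha> v" "minimal_path v \<beta> w"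
    and "card (sep (\<rho> u) (\<rho> v)) + card (sep (\<rho> v) (\<rho> w)) = card (sep (\<rho> u) (\<rho> w))"
  shows "minimal_path u (\<alpha> \<bullet>\<^sub>p \<beta>) w"
  using assms by (auto simp: minimal_path_def signed_paths_comp) (auto simp: path_comp_def)

text \<open>The diagram map into the space of \<open>G\<close> does not depend on the face it starts from, so any value, here
  the empty set, may stand for the latter.\<close>

definition act :: "'a set \<Rightarrow> 'v \<Rightarrow> 'v" where
  "act G v = cover_map \<A> \<Theta> \<rho> {} G v"

lemma cover_map_eq_act: "cover_map \<A> \<Theta> \<rho> F G v = act G v"
  by (simp add: act_def cover_map_def)

text \<open>This discharges the definite description in \<open>cover_map\<close>: every minimal path
  to the prescribed chamber lifts to a minimal path of the cover, and all of these share their end.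
  Exhibiting one of them computes \<open>act\<close>.\<close>

lemma act_eqI:
  assumes "minimal_path v \<gamma> w" "\<rho> w = chamber_at \<A> (\<rho> v) G" "G \<in> faces \<A>"
  shows "act G v = w"
  unfolding act_def cover_map_def
proof (rule the_equality)
  let ?B = "chamber_at \<A> (\<rho> v) G"
  have v: "v \<in> pverts \<Theta>"
    using minimal_path_vertices[OF assms(1)] by blast
  have B: "?B \<in> chambers \<A>"
    using assms(3) v by (intro chamber_at chamber_vertex)
  have map: "map_path \<rho> \<gamma> \<in> minimal_positive_paths (arrangement_graph \<A>) (\<rho> v) ?B"
    using minimal_path_map[OF assms(1)] assms(2) by simp
  have lift: "w' = w" if "\<alpha> \<in> minimal_positive_paths (arrangement_graph \<A>) (\<rho> v) ?B"
    "w' = path_end (path_lift \<Theta> \<rho> v \<alpha>)" for \<alpha> w'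
  proof -
    have "\<alpha> \<in> signed_paths (arrangement_graph \<A>)" "path_begin \<alpha> = \<rho> v"
      using that(1) by (auto simp: minimal_positive_paths_def)
    then obtain \<beta> where \<beta>: "\<beta> \<in> signed_paths \<Theta>" "path_begin \<beta> = v" "map_path \<rho> \<beta> = \<alpha>" "path_lift \<Theta> \<rho> v \<alpha> = \<beta>"
      using lift_exists[OF v] by metis
    then show ?thesis
      using minimal_path_of_lift[of \<beta> v ?B] minimal_path_unique(2)[OF _ assms(1), of \<beta> "path_end \<beta>"] that assms(2) B by simp
  qed
  then show "w' = w" if "\<exists>\<alpha>\<in>minimal_positive_paths (arrangement_graph \<A>) (\<rho> v) ?B. w' = path_end (path_lift \<Theta> \<rho> v \<alpha>)" for w'
    using that by blast
  show "\<exists>\<alpha>\<in>minimal_positive_paths (arrangement_graph \<A>) (\<rho> v) ?B. w = path_end (path_lift \<Theta> \<rho> v \<alpha>)"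
    using map lift by blast
qed

lemma act_minimal_path:
  assumes "v \<in> pverts \<Theta>" "G \<in> faces \<A>"
  obtains \<gamma> where "minimal_path v \<gamma> (act G v)" "\<rho> (act G v) = chamber_at \<A> (\<rho> v) G"
proof -
  have "chamber_at \<A> (\<rho> v) G \<in> chambers \<A>"
    using assms by (intro chamber_at chamber_vertex)
  then obtain \<gamma> w where "minimal_path v \<gamma> w" "\<rho> w = chamber_at \<A> (\<rho> v) G"
    using minimal_path_exists[OF assms(1)] by metis
  then show ?thesis
    using act_eqI assms(2) that by metis
qed

lemma \<rho>_act: "v \<in> pverts \<Theta> \<Longrightarrow> G \<in> faces \<A> \<Longrightarrow> \<rho> (act G v) = chamber_at \<A> (\<rho> v) G"
  using act_minimal_path by metis

lemma act_vertex: "v \<in> pverts \<Theta> \<Longrightarrow> G \<in> faces \<A> \<Longrightarrow> act G v \<in> pverts \<Theta>"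
  using act_minimal_path minimal_path_vertices by metis

lemma act_le: "v \<in> pverts \<Theta> \<Longrightarrow> G \<in> faces \<A> \<Longrightarrow> face_le (\<rho> (act G v)) G"
  by (simp add: \<rho>_act chamber_at_le chamber_vertex)

lemma act_self: "v \<in> pverts \<Theta> \<Longrightarrow> G \<in> faces \<A> \<Longrightarrow> face_le (\<rho> v) G \<Longrightarrow> act G v = v"
  using act_eqI[OF minimal_path_const] by (simp add: chamber_at_eq_self chamber_vertex)

text \<open>The hyperplanes crossed on the two legs are disjoint and add up, by
  \<open>card_sep_chamber_at\<close>, so the detour through \<open>act F v\<close> is still minimal.
  This is the source of functoriality of the diagram.\<close>

lemma minimal_path_act_act:
  assumes "v \<in> pverts \<Theta>" "F \<in> faces \<A>" "G \<in> faces \<A>" "face_le G F"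
    and "minimal_path v \<alpha> (act F v)" "minimal_path (act F v) \<beta> (act G (act F v))"
  shows "minimal_path v (\<alpha> \<bullet>\<^sub>p \<beta>) (act G (act F v))"
  using assms by (intro minimal_path_comp[of v _ "act F v"])
    (simp_all add: \<rho>_act act_vertex chamber_at_chamber_at chamber_vertex card_sep_chamber_at)

lemma act_act:
  assumes "v \<in> pverts \<Theta>" "F \<in> faces \<A>" "G \<in> faces \<A>" "face_le G F"
  shows "act G (act F v) = act G v"
proof -
  obtain \<alpha> where \<alpha>: "minimal_path v \<alpha> (act F v)"
    using act_minimal_path assms(1,2) by metis
  obtain \<beta> where \<beta>: "minimal_path (act F v) \<beta> (act G (act F v))"
    using act_minimal_path[OF act_vertex] assms by metis
  show ?thesis
    using minimal_path_act_act[OF assms \<alpha> \<beta>] assms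
    by (intro act_eqI[symmetric]) (auto simp: \<rho>_act act_vertex chamber_at_chamber_at chamber_vertex)
qed

definition act_path :: "'a set \<Rightarrow> 'v \<Rightarrow> 'v signed_path" where
  "act_path G v = (SOME \<gamma>. minimal_path v \<gamma> (act G v))"

lemma act_path: "v \<in> pverts \<Theta> \<Longrightarrow> G \<in> faces \<A> \<Longrightarrow> minimal_path v (act_path G v) (act G v)"
  unfolding act_path_def using act_minimal_path by (metis someI_ex)

lemma act_path_simps:
  assumes "v \<in> pverts \<Theta>" "G \<in> faces \<A>"
  shows "act_path G v \<in> signed_paths \<Theta>" "path_begin (act_path G v) = v" "path_end (act_path G v) = act G v"
  using act_path[OF assms] by (auto simp: minimal_path_def)

lemma act_path_comp:
  assumes "v \<in> pverts \<Theta>" "F \<in> faces \<A>" "G \<in> faces \<A>" "face_le G F"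
  shows "(act_path F v \<bullet>\<^sub>p act_path G (act F v), act_path G v) \<in> R"
  using minimal_path_act_act[OF assms act_path act_path] assms act_path[of v G]
  by (intro minimal_path_unique(1)[of v _ "act G v"]) (simp_all add: act_vertex act_act)

section \<open>The poset of the homotopy colimit\<close>

definition hoposet :: "('a set \<times> 'v) set" where
  "hoposet = {(F, v). F \<in> faces \<A> \<and> v \<in> pverts \<Theta> \<and> face_le (\<rho> v) F}"

definition hole :: "'a set \<times> 'v \<Rightarrow> 'a set \<times> 'v \<Rightarrow> bool" where
  "hole q p \<longleftrightarrow> face_le (fst q) (fst p) \<and> act (fst q) (snd p) = snd q"

lemma hoposetD: "q \<in> hoposet \<Longrightarrow> fst q \<in> faces \<A> \<and> snd q \<in> pverts \<Theta> \<and> face_le (\<rho> (snd q)) (fst q)"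
  by (auto simp: hoposet_def)

lemma hole_refl: "q \<in> hoposet \<Longrightarrow> hole q q"
  by (auto simp: hole_def hoposet_def face_le_refl act_self)

lemma hole_trans: "q \<in> hoposet \<Longrightarrow> p \<in> hoposet \<Longrightarrow> s \<in> hoposet \<Longrightarrow> hole q p \<Longrightarrow> hole p s \<Longrightarrow> hole q s"
  using act_act hoposetD face_le_trans unfolding hole_def by metis

lemma act_in_hoposet: "v \<in> pverts \<Theta> \<Longrightarrow> G \<in> faces \<A> \<Longrightarrow> (G, act G v) \<in> hoposet"
  by (simp add: hoposet_def act_vertex act_le)

lemma chamber_in_hoposet: "v \<in> pverts \<Theta> \<Longrightarrow> (\<rho> v, v) \<in> hoposet"
  by (simp add: hoposet_def chamber_vertex chamber_face face_le_refl)

text \<open>Strata rise near a point, so transport must lead from the lower pair \<open>q\<close> to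
  the upper pair \<open>p\<close>, against the direction of the diagram map; hence the
  inverse.\<close>

definition hopath :: "'a set \<times> 'v \<Rightarrow> 'a set \<times> 'v \<Rightarrow> 'v signed_path" where
  "hopath q p = path_inverse (act_path (fst q) (snd p))"

definition ho_tr :: "'a set \<times> 'v \<Rightarrow> 'a set \<times> 'v \<Rightarrow> 'v signed_path set \<Rightarrow> 'v signed_path set" where
  "ho_tr q p A = paths.cls_cmp A (hopath q p)"

lemma hopath_simps:
  assumes "q \<in> hoposet" "p \<in> hoposet" "hole q p"
  shows "hopath q p \<in> signed_paths \<Theta>" "path_begin (hopath q p) = snd q" "path_end (hopath q p) = snd p"
  using assms act_path_simps[of "snd p" "fst q"] hoposetD[OF assms(1)] hoposetD[OF assms(2)]
  by (auto simp: hopath_def hole_def signed_paths_inverse path_end_inverse)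

lemma hopath_cocycle:
  assumes "q \<in> hoposet" "p \<in> hoposet" "s \<in> hoposet" "hole q p" "hole p s"
  shows "(hopath q p \<bullet>\<^sub>p hopath p s, hopath q s) \<in> R"
proof -
  have s: "snd p = act (fst p) (snd s)" "face_le (fst q) (fst p)"
    using assms by (auto simp: hole_def)
  have "(act_path (fst p) (snd s) \<bullet>\<^sub>p act_path (fst q) (snd p), act_path (fst q) (snd s)) \<in> R"
    unfolding s(1) using assms s(2) hoposetD by (intro act_path_comp) auto
  moreover have "path_end (act_path (fst p) (snd s)) = path_begin (act_path (fst q) (snd p))"
    using assms s(1) hoposetD act_path_simps by metis
  ultimately show ?thesis
    unfolding hopath_def using inverse path_inverse_comp by metis
qed

lemma poset_system_ho: "poset_system hoposet hole (\<lambda>q. paths.fibre u (snd q)) ho_tr"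
  unfolding ho_tr_def
  by (rule paths.poset_system_fibre) (auto simp: hole_refl hopath_simps hopath_cocycle intro: hole_trans)

end

section \<open>The topology of the homotopy colimit\<close>

definition barycentric :: "'p set \<Rightarrow> ('p \<Rightarrow> real) set" where
  "barycentric K = {t. (\<forall>F. 0 \<le> t F) \<and> (\<forall>F. F \<notin> K \<longrightarrow> t F = 0) \<and> sum t K = 1}"

definition corner :: "'p \<Rightarrow> 'p \<Rightarrow> real" where
  "corner F = (\<lambda>G. if G = F then 1 else 0)"

definition mix :: "real \<Rightarrow> ('p \<Rightarrow> real) \<Rightarrow> ('p \<Rightarrow> real) \<Rightarrow> 'p \<Rightarrow> real" where
  "mix s t u = (\<lambda>F. (1 - s) * t F + s * u F)"

lemma corner_in_barycentric: "finite K \<Longrightarrow> F \<in> K \<Longrightarrow> corner F \<in> barycentric K"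
  by (auto simp: barycentric_def corner_def)

lemma mix_in_barycentric:
  assumes "t \<in> barycentric K" "u \<in> barycentric K" "s \<in> {0..1}"
  shows "mix s t u \<in> barycentric K"
  using assms by (auto simp: barycentric_def mix_def sum.distrib simp flip: sum_distrib_left)

lemma mix_simps [simp]: "mix 0 t u = t" "mix 1 t u = u" "mix s t t = t"
  by (auto simp: mix_def algebra_simps)

lemma mix_flip: "mix (1 - s) t u = mix s u t"
  by (auto simp: mix_def)

text \<open>A product with a discrete space is a disjoint union of slices. The spaces of the diagram
  are discrete, so openness can be tested on one simplex space at a time.\<close>

lemma openin_prod_discrete:
  "openin (prod_topology (discrete_topology D) T) W \<longleftrightarrow>
     W \<subseteq> D \<times> topspace T \<and> (\<forall>x\<in>D. openin T {t. (x, t) \<in> W})"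
proof
  assume W: "openin (prod_topology (discrete_topology D) T) W"
  then have sub: "W \<subseteq> D \<times> topspace T"
    using openin_subset by fastforce
  moreover have "openin T {t. (x, t) \<in> W}" if "x \<in> D" for x
  proof -
    have "continuous_map T (prod_topology (discrete_topology D) T) (\<lambda>t. (x, t))"
      using that by (simp add: continuous_map_pairwise o_def)
    from openin_continuous_map_preimage[OF this W]
    have "openin T {t \<in> topspace T. (x, t) \<in> W}" .
    moreover have "{t \<in> topspace T. (x, t) \<in> W} = {t. (x, t) \<in> W}"
      using sub by auto
    ultimately show ?thesis
      by simp
  qed
  ultimately show "W \<subseteq> D \<times> topspace T \<and> (\<forall>x\<in>D. openin T {t. (x, t) \<in> W})"
    by blast
next
  assume W: "W \<subseteq> D \<times> topspace T \<and> (\<forall>x\<in>D. openin T {t. (x, t) \<in> W})"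
  then have "W = (\<Union>x\<in>D. {x} \<times> {t. (x, t) \<in> W})"
    by auto
  moreover have "openin (prod_topology (discrete_topology D) T) (\<Union>x\<in>D. {x} \<times> {t. (x, t) \<in> W})"
    using W by (intro openin_Union) (auto simp: openin_prod_Times_iff)
  ultimately show "openin (prod_topology (discrete_topology D) T) W"
    by simp
qed

lemma continuous_map_locally:
  assumes "\<And>x. x \<in> topspace X \<Longrightarrow> \<exists>U. openin X U \<and> x \<in> U \<and> continuous_map (subtopology X U) Y f"
  shows "continuous_map X Y f"
  unfolding continuous_map_def
proof (intro conjI allI impI)
  show "f \<in> topspace X \<rightarrow> topspace Y"
  proof
    fix x assume "x \<in> topspace X"
    then obtain U where "openin X U" "x \<in> U" "continuous_map (subtopology X U) Y f"
      using assms by blast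
    then show "f x \<in> topspace Y"
      using openin_subset by (fastforce simp: continuous_map_def)
  qed
  fix V assume V: "openin Y V"
  show "openin X {x \<in> topspace X. f x \<in> V}"
  proof (subst openin_subopen, intro ballI)
    fix x assume x: "x \<in> {x \<in> topspace X. f x \<in> V}"
    then obtain U where U: "openin X U" "x \<in> U" "continuous_map (subtopology X U) Y f"
      using assms by blast
    have "openin (subtopology X U) {y \<in> topspace (subtopology X U). f y \<in> V}"
      by (rule openin_continuous_map_preimage[OF U(3) V])
    then have "openin X {y \<in> topspace (subtopology X U). f y \<in> V}"
      using U(1) openin_open_subtopology by blast
    then show "\<exists>T. openin X T \<and> x \<in> T \<and> T \<subseteq> {x \<in> topspace X. f x \<in> V}"
      using x U(2) by (intro exI[of _ "{y \<in> topspace (subtopology X U). f y \<in> V}"]) auto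
  qed
qed

context arrangement_cover
begin

abbreviation Faces :: "'a set set" where
  "Faces \<equiv> faces \<A>"

definition oc :: "'a set \<Rightarrow> ('a set \<Rightarrow> real) topology" where
  "oc p = order_complex {q \<in> Faces. face_le q p} face_le"

abbreviation hosum :: "('a set \<times> 'v \<times> ('a set \<Rightarrow> real)) topology" where
  "hosum \<equiv> hocolim_sum Faces face_le (cover_space \<Theta> \<rho>)"

abbreviation hospace :: "('a set \<times> 'v \<times> ('a set \<Rightarrow> real)) set topology" where
  "hospace \<equiv> cover_hocolim \<A> \<Theta> \<rho>"

abbreviation hostep where
  "hostep \<equiv> hocolim_step Faces face_le (cover_space \<Theta> \<rho>) (cover_map \<A> \<Theta> \<rho>)"

definition horel :: "('a set \<times> 'v \<times> ('a set \<Rightarrow> real)) rel" where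
  "horel = {(a, b). a \<in> topspace hosum \<and> b \<in> topspace hosum \<and> equivclp hostep a b}"

definition pt :: "'a set \<Rightarrow> 'v \<Rightarrow> ('a set \<Rightarrow> real) \<Rightarrow> ('a set \<times> 'v \<times> ('a set \<Rightarrow> real)) set" where
  "pt p x t = horel `` {(p, x, t)}"

abbreviation over :: "'a set \<Rightarrow> 'v set" where
  "over p \<equiv> {v \<in> pverts \<Theta>. face_le (\<rho> v) p}"

lemma hospace_eq: "hospace = quotient_topology hosum horel"
  by (simp add: cover_hocolim_def hocolim_def horel_def)

lemma topspace_hosum: "topspace hosum = {(p, x, t). p \<in> Faces \<and> x \<in> over p \<and> t \<in> topspace (oc p)}"
  by (auto simp: hocolim_sum_def cover_space_def oc_def)

lemma openin_hosum_iff: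
  "openin hosum W \<longleftrightarrow> W \<subseteq> topspace hosum \<and> (\<forall>p\<in>Faces. \<forall>x\<in>over p. openin (oc p) {t. (p, x, t) \<in> W})"
proof -
  have "openin hosum W \<longleftrightarrow> W \<subseteq> topspace hosum \<and>
      (\<forall>p\<in>Faces. openin (prod_topology (discrete_topology (over p)) (oc p)) {xt. (p, xt) \<in> W})"
    unfolding hocolim_sum_def openin_sum_topology topspace_sum_topology cover_space_def oc_def by simp
  then show ?thesis
    unfolding openin_prod_discrete topspace_hosum by auto
qed

definition face_chain :: "'a set set \<Rightarrow> bool" where
  "face_chain K \<longleftrightarrow> finite K \<and> K \<subseteq> Faces \<and> Complete_Partial_Order.chain face_le K"

lemma face_chain_subset: "face_chain K \<Longrightarrow> L \<subseteq> K \<Longrightarrow> face_chain L"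
  by (auto simp: face_chain_def Complete_Partial_Order.chain_def intro: finite_subset)

lemma topspace_oc: "t \<in> topspace (oc p) \<longleftrightarrow> face_chain {F. t F \<noteq> 0} \<and> t \<in> barycentric {F. t F \<noteq> 0} \<and>
    (\<forall>F. t F \<noteq> 0 \<longrightarrow> face_le F p)"
  by (auto simp: oc_def order_complex_def barycentric_def face_chain_def)

lemma continuous_map_into_oc:
  assumes "continuous_map T (powertop_real UNIV) f" "f \<in> topspace T \<rightarrow> topspace (oc p)"
  shows "continuous_map T (oc p) f"
  using assms unfolding oc_def order_complex_def by (intro continuous_map_into_subtopology) auto

lemma barycentric_subset_oc:
  assumes "face_chain K" "t \<in> barycentric K" "\<And>F. F \<in> K \<Longrightarrow> face_le F p"
  shows "t \<in> topspace (oc p)"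
proof -
  have sub: "{F. t F \<noteq> 0} \<subseteq> K"
    using assms(2) by (auto simp: barycentric_def)
  have "sum t {F. t F \<noteq> 0} = sum t K"
    using assms(1) sub by (intro sum.mono_neutral_left) (auto simp: face_chain_def)
  then show ?thesis
    using assms sub face_chain_subset[OF assms(1) sub] by (auto simp: topspace_oc barycentric_def)
qed

text \<open>The largest face in the support of \<open>t\<close>. It is the least index whose simplex
  space contains \<open>t\<close>, so every gluing of \<open>t\<close> into a lower space stops
  there.\<close>

definition top_face :: "('a set \<Rightarrow> real) \<Rightarrow> 'a set" where
  "top_face t = (SOME F. t F \<noteq> 0 \<and> (\<forall>G. t G \<noteq> 0 \<longrightarrow> face_le G F))"

lemma chain_top:
  assumes "face_chain K" "K \<noteq> {}"
  shows "\<exists>F\<in>K. \<forall>G\<in>K. face_le G F"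
proof -
  have "finite K"
    using assms by (simp add: face_chain_def)
  then show ?thesis
    using assms(2,1)
  proof (induction K rule: finite_ne_induct)
    case (insert x K)
    then obtain F where F: "F \<in> K" "\<forall>G\<in>K. face_le G F"
      using face_chain_subset[of "insert x K" K] by auto
    then have "face_le x F \<or> face_le F x"
      using insert.prems by (auto simp: face_chain_def Complete_Partial_Order.chain_def)
    then show ?case
      using F face_le_refl face_le_trans by (metis insert_iff)
  qed (auto simp: face_le_refl)
qed

lemma top_face:
  assumes "t \<in> topspace (oc p)"
  shows "t (top_face t) \<noteq> 0" "t G \<noteq> 0 \<Longrightarrow> face_le G (top_face t)" "top_face t \<in> Faces" "face_le (top_face t) p"
proof -
  have "sum t {F. t F \<noteq> 0} = 1"
    using assms by (simp add: topspace_oc barycentric_def)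
  then have "{F. t F \<noteq> 0} \<noteq> {}"
    by (metis sum.empty zero_neq_one)
  then have "\<exists>F. t F \<noteq> 0 \<and> (\<forall>G. t G \<noteq> 0 \<longrightarrow> face_le G F)"
    using chain_top[of "{F. t F \<noteq> 0}"] assms by (auto simp: topspace_oc)
  from someI_ex[OF this]
  have *: "t (top_face t) \<noteq> 0 \<and> (\<forall>G. t G \<noteq> 0 \<longrightarrow> face_le G (top_face t))"
    unfolding top_face_def .
  then show "t (top_face t) \<noteq> 0" "t G \<noteq> 0 \<Longrightarrow> face_le G (top_face t)" "top_face t \<in> Faces" "face_le (top_face t) p"
    using assms by (auto simp: topspace_oc face_chain_def)
qed

lemma top_face_eqI:
  assumes "t \<in> topspace (oc p)" "t F \<noteq> 0" "\<And>G. t G \<noteq> 0 \<Longrightarrow> face_le G F"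
  shows "top_face t = F"
  using assms top_face[OF assms(1)] by (intro face_le_antisym) (auto simp: topspace_oc face_chain_def)

lemma face_in_Faces: "t \<in> topspace (oc p) \<Longrightarrow> t F \<noteq> 0 \<Longrightarrow> F \<in> Faces"
  by (auto simp: topspace_oc face_chain_def)

lemma oc_mono: "t \<in> topspace (oc p) \<Longrightarrow> face_le p q \<Longrightarrow> t \<in> topspace (oc q)"
  by (auto simp: topspace_oc intro: face_le_trans)

lemma oc_top: "t \<in> topspace (oc p) \<Longrightarrow> t \<in> topspace (oc (top_face t))"
  using top_face(2)[of t p] by (auto simp: topspace_oc)

text \<open>Every class contains exactly one triple \<open>(p, x, t)\<close> for which \<open>p\<close> is the top face of \<open>t\<close>.\<close>

definition canon :: "'a set \<times> 'v \<times> ('a set \<Rightarrow> real) \<Rightarrow> 'a set \<times> 'v \<times> ('a set \<Rightarrow> real)" where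
  "canon = (\<lambda>(p, x, t). (top_face t, act (top_face t) x, t))"

lemma hostep_iff: "hostep (p, x, t) (q, y, s) \<longleftrightarrow> p \<in> Faces \<and> q \<in> Faces \<and> face_le q p \<and> q \<noteq> p \<and>
    x \<in> over p \<and> t \<in> topspace (oc q) \<and> y = act q x \<and> s = t"
  by (auto simp: hocolim_step_def cover_space_def oc_def cover_map_eq_act)

text \<open>A gluing from \<open>p\<close> to \<open>q\<close> acts by \<open>act q\<close>. The top
  face of \<open>t\<close> lies below \<open>q\<close>, so acting by it afterwards absorbs that
  change by \<open>act_act\<close>.\<close>

lemma canon_step:
  assumes "hostep a b"
  shows "canon a = canon b"
proof -
  obtain p x t q y s where ab: "a = (p, x, t)" "b = (q, y, s)"
    by (metis prod_cases3)
  then have *: "p \<in> Faces" "q \<in> Faces" "face_le q p" "x \<in> over p" "t \<in> topspace (oc q)" "y = act q x" "s = t"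
    using assms by (auto simp: hostep_iff)
  then have "act (top_face t) (act q x) = act (top_face t) x"
    using top_face[OF *(5)] by (intro act_act) auto
  then show ?thesis
    using * by (simp add: ab canon_def)
qed

lemma equivclp_canon: "equivclp hostep a b \<Longrightarrow> canon a = canon b"
  by (induction rule: equivclp_induct) (auto dest: canon_step)

lemma equivclp_to_canon:
  assumes "a \<in> topspace hosum"
  shows "equivclp hostep a (canon a)"
proof -
  obtain p x t where a: "a = (p, x, t)" "p \<in> Faces" "x \<in> over p" "t \<in> topspace (oc p)"
    using assms by (auto simp: topspace_hosum)
  show ?thesis
  proof (cases "top_face t = p")
    case True
    then have "canon a = a"
      using a by (simp add: canon_def act_self)
    then show ?thesis
      by (metis equivp_evquivclp equivp_reflp)
  next
    case False
    then have "hostep a (canon a)"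
      using a top_face[OF a(4)] oc_top[OF a(4)] by (simp add: canon_def hostep_iff)
    then show ?thesis
      by blast
  qed
qed

lemma horel_iff: "(a, b) \<in> horel \<longleftrightarrow> a \<in> topspace hosum \<and> b \<in> topspace hosum \<and> canon a = canon b"
proof -
  have "equivclp hostep a b" if a: "a \<in> topspace hosum" and b: "b \<in> topspace hosum" and eq: "canon a = canon b"
  proof -
    have "equivclp hostep (canon b) b"
      by (rule equivclp_sym[OF equivclp_to_canon[OF b]])
    then show ?thesis
      using equivclp_to_canon[OF a] eq transpD[OF transp_equivclp] by metis
  qed
  then show ?thesis
    unfolding horel_def using equivclp_canon by blast
qed

lemma equiv_horel: "equiv (topspace hosum) horel"
  by (intro equivI refl_onI symI transI) (auto simp: horel_iff)

lemma pt_eq_iff: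
  assumes "(p, x, t) \<in> topspace hosum" "(q, y, s) \<in> topspace hosum"
  shows "pt p x t = pt q y s \<longleftrightarrow> t = s \<and> act (top_face t) x = act (top_face t) y"
  unfolding pt_def using eq_equiv_class_iff[OF equiv_horel assms] assms by (auto simp: horel_iff canon_def)

lemma pt_in: "(p, x, t) \<in> topspace hosum \<Longrightarrow> pt p x t \<in> topspace hospace"
  by (auto simp: hospace_eq topspace_quotient_topology pt_def intro: quotientI)

lemma hospaceE:
  assumes "z \<in> topspace hospace"
  obtains p x t where "(p, x, t) \<in> topspace hosum" "z = pt p x t"
  using assms that by (force simp: hospace_eq topspace_quotient_topology pt_def quotient_def)

text \<open>Combines the quotient, the disjoint union and the product with a discrete factor:
  openness proofs in the homotopy colimit become statements about barycentric coordinates with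
  \<open>p\<close> and \<open>x\<close> fixed.\<close>

lemma openin_hospace_iff:
  "openin hospace U \<longleftrightarrow> U \<subseteq> topspace hospace \<and> (\<forall>p\<in>Faces. \<forall>x\<in>over p. openin (oc p) {t \<in> topspace (oc p). pt p x t \<in> U})"
proof -
  have "{t. (p, x, t) \<in> {a \<in> topspace hosum. horel `` {a} \<in> U}} = {t \<in> topspace (oc p). pt p x t \<in> U}"
    if "p \<in> Faces" "x \<in> over p" for p x
    using that by (auto simp: topspace_hosum pt_def)
  then show ?thesis
    unfolding hospace_eq openin_quotient_topology topspace_quotient_topology openin_hosum_iff by auto
qed

lemma quotient_map_hospace: "quotient_map hosum hospace (\<lambda>(p, x, t). pt p x t)"
  using quotient_map_quotient_topology[of hosum horel] by (simp add: hospace_eq pt_def case_prod_unfold)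

lemma continuous_map_pt:
  assumes "p \<in> Faces" "x \<in> over p"
  shows "continuous_map (oc p) hospace (pt p x)"
  using assms pt_in unfolding continuous_map_def by (auto simp: openin_hospace_iff topspace_hosum)

section \<open>The stratification of the homotopy colimit\<close>

definition representative :: "('a set \<times> 'v \<times> ('a set \<Rightarrow> real)) set \<Rightarrow> 'a set \<times> 'v \<times> ('a set \<Rightarrow> real)" where
  "representative z = (SOME a. a \<in> topspace hosum \<and> z = pt (fst a) (fst (snd a)) (snd (snd a)))"

lemma representative_pt:
  assumes a: "(p, x, t) \<in> topspace hosum"
  obtains p' x' where "representative (pt p x t) = (p', x', t)" "(p', x', t) \<in> topspace hosum"
    "act (top_face t) x' = act (top_face t) x"
proof -
  let ?P = "\<lambda>a. a \<in> topspace hosum \<and> pt p x t = pt (fst a) (fst (snd a)) (snd (snd a))"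
  have "?P (p, x, t)"
    using a by simp
  then have "?P (representative (pt p x t))"
    unfolding representative_def by (rule someI)
  moreover obtain p' x' t' where eq: "representative (pt p x t) = (p', x', t')"
    by (metis prod_cases3)
  ultimately have a': "(p', x', t') \<in> topspace hosum" "pt p x t = pt p' x' t'"
    by simp_all
  then show ?thesis
    using pt_eq_iff[OF a a'(1)] eq that by metis
qed

text \<open>The first two entries of the canonical triple, that is, the top vertex of the open
  simplex that contains \<open>z\<close>.\<close>

definition stratum :: "('a set \<times> 'v \<times> ('a set \<Rightarrow> real)) set \<Rightarrow> 'a set \<times> 'v" where
  "stratum z = (case representative z of (p, x, t) \<Rightarrow> (top_face t, act (top_face t) x))"

lemma stratum_pt:
  assumes "(p, x, t) \<in> topspace hosum"
  shows "stratum (pt p x t) = (top_face t, act (top_face t) x)"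
  by (rule representative_pt[OF assms]) (simp add: stratum_def)

lemma continuous_map_coordinate: "continuous_map (oc p) euclideanreal (\<lambda>t. t F)"
  unfolding oc_def order_complex_def
  by (intro continuous_map_from_subtopology continuous_map_product_projection) simp

lemma continuous_map_hosum_coordinate: "continuous_map hosum euclideanreal (\<lambda>a. snd (snd a) F)"
proof -
  have "openin hosum {a \<in> topspace hosum. snd (snd a) F \<in> V}" if V: "open V" for V
    unfolding openin_hosum_iff
  proof (intro conjI ballI)
    fix p x assume "p \<in> Faces" "x \<in> over p"
    then have "{t. (p, x, t) \<in> {a \<in> topspace hosum. snd (snd a) F \<in> V}} = {t \<in> topspace (oc p). t F \<in> V}"
      by (auto simp: topspace_hosum)
    then show "openin (oc p) {t. (p, x, t) \<in> {a \<in> topspace hosum. snd (snd a) F \<in> V}}"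
      using openin_continuous_map_preimage[OF continuous_map_coordinate, of V p F] V by simp
  qed auto
  then show ?thesis
    by (simp add: continuous_map_def)
qed

lemma openin_positive: "openin (oc p) {t \<in> topspace (oc p). t F > 0}"
  using openin_continuous_map_preimage[OF continuous_map_coordinate, of "{0<..}" p F] by simp

lemma oc_nonneg: "t \<in> topspace (oc p) \<Longrightarrow> t F > 0 \<longleftrightarrow> t F \<noteq> 0"
  by (auto simp: topspace_oc barycentric_def order.strict_iff_order)

lemma stratum_in: "z \<in> topspace hospace \<Longrightarrow> stratum z \<in> hoposet"
proof -
  assume "z \<in> topspace hospace"
  then obtain p x t where z: "(p, x, t) \<in> topspace hosum" "z = pt p x t"
    using hospaceE by blast
  then show ?thesis
    using top_face by (auto simp: stratum_pt topspace_hosum intro: act_in_hoposet)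
qed

text \<open>In a slice the vertex condition does not involve \<open>t\<close>, because
  \<open>act_act\<close> reduces \<open>act G (act (top_face t) x)\<close> to
  \<open>act G x\<close>. The face condition says that some coordinate at a face above
  \<open>G\<close> is positive, a union of open conditions.\<close>

lemma stratification_hospace: "stratification hospace hoposet hole stratum"
proof
  fix q assume q: "q \<in> hoposet"
  obtain G w where Gw: "q = (G, w)" "G \<in> Faces"
    using q by (auto simp: hoposet_def)
  show "openin hospace {z \<in> topspace hospace. hole q (stratum z)}"
    unfolding openin_hospace_iff
  proof (intro conjI ballI)
    fix p x assume p: "p \<in> Faces" and x: "x \<in> over p"
    have "pt p x t \<in> {z \<in> topspace hospace. hole q (stratum z)} \<longleftrightarrow>
        act G x = w \<and> (\<exists>M\<in>Faces. face_le G M \<and> t M > 0)" if t: "t \<in> topspace (oc p)" for t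
    proof -
      have a: "(p, x, t) \<in> topspace hosum"
        using p x t by (simp add: topspace_hosum)
      have "pt p x t \<in> {z \<in> topspace hospace. hole q (stratum z)} \<longleftrightarrow>
          face_le G (top_face t) \<and> act G (act (top_face t) x) = w"
        using pt_in[OF a] by (simp add: stratum_pt[OF a] hole_def Gw)
      also have "\<dots> \<longleftrightarrow> act G x = w \<and> face_le G (top_face t)"
        using act_act[of x "top_face t" G] x top_face(3)[OF t] Gw(2) by auto
      also have "face_le G (top_face t) \<longleftrightarrow> (\<exists>M\<in>Faces. face_le G M \<and> t M > 0)"
        using top_face[OF t] oc_nonneg[OF t] face_le_trans by metis
      finally show ?thesis .
    qed
    then have "{t \<in> topspace (oc p). pt p x t \<in> {z \<in> topspace hospace. hole q (stratum z)}} =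
        (if act G x = w then \<Union>M\<in>{M \<in> Faces. face_le G M}. {t \<in> topspace (oc p). t M > 0} else {})"
      by auto
    then show "openin (oc p) {t \<in> topspace (oc p). pt p x t \<in> {z \<in> topspace hospace. hole q (stratum z)}}"
      using openin_positive by auto
  qed auto
qed (rule stratum_in)

section \<open>Paths in the homotopy colimit\<close>

definition spath :: "'a set \<Rightarrow> 'v \<Rightarrow> ('a set \<Rightarrow> real) \<Rightarrow> ('a set \<Rightarrow> real) \<Rightarrow> real \<Rightarrow>
    ('a set \<times> 'v \<times> ('a set \<Rightarrow> real)) set" where
  "spath p x t u = (\<lambda>s. pt p x (mix s t u))"

lemma spath_ends [simp]: "spath p x t u 0 = pt p x t" "spath p x t u 1 = pt p x u"
  by (auto simp: spath_def)

lemma spath_reverse [simp]: "path_reverse (spath p x t u) = spath p x u t"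
  by (simp add: path_reverse_def spath_def mix_flip)

text \<open>The plane triangle \<open>C\<close> is mapped affinely into a closed simplex, its
  corners going to \<open>t\<close>, \<open>u\<close> and \<open>v\<close>. Two sides are homotopic
  to the third one already in \<open>C\<close>, by convexity.\<close>

lemma spath_triangle:
  assumes K: "face_chain K" "\<And>F. F \<in> K \<Longrightarrow> face_le F p" and px: "p \<in> Faces" "x \<in> over p"
    and t: "t \<in> barycentric K" "u \<in> barycentric K" "v \<in> barycentric K"
  shows "path_homotopic hospace (path_join (spath p x t u) (spath p x u v)) (spath p x t v)"
proof -
  define C where "C = {z :: real \<times> real. 0 \<le> fst z \<and> 0 \<le> snd z \<and> fst z + snd z \<le> 1}"
  define L where "L z = (\<lambda>F. (1 - fst z - snd z) * t F + fst z * u F + snd z * v F)" for z :: "real \<times> real"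
  have in_oc: "L z \<in> topspace (oc p)" if "z \<in> C" for z
  proof (rule barycentric_subset_oc[OF K(1) _ K(2)])
    have "sum (L z) K = (1 - fst z - snd z) * sum t K + fst z * sum u K + snd z * sum v K"
      by (simp add: L_def sum.distrib sum_distrib_left)
    then show "L z \<in> barycentric K"
      using t that by (auto simp: barycentric_def L_def C_def)
  qed auto
  have "continuous_map (top_of_set C) (oc p) L"
    using in_oc unfolding oc_def order_complex_def
    by (auto simp: continuous_map_in_subtopology continuous_map_componentwise_UNIV L_def intro!: continuous_intros)
  from continuous_map_compose[OF this continuous_map_pt[OF px]]
  have cont: "continuous_map (top_of_set C) hospace (pt p x \<circ> L)" .
  have conv: "convex C"
    unfolding C_def convex_def
  proof (intro ballI allI impI)
    fix y z :: "real \<times> real" and a b :: real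
    assume y: "y \<in> {z. 0 \<le> fst z \<and> 0 \<le> snd z \<and> fst z + snd z \<le> 1}"
      and z: "z \<in> {z. 0 \<le> fst z \<and> 0 \<le> snd z \<and> fst z + snd z \<le> 1}" and ab: "0 \<le> a" "0 \<le> b" "a + b = 1"
    have "a * (fst y + snd y) + b * (fst z + snd z) \<le> a * 1 + b * 1"
      using y z ab by (intro add_mono mult_left_mono) auto
    then show "a *\<^sub>R y + b *\<^sub>R z \<in> {z. 0 \<le> fst z \<and> 0 \<le> snd z \<and> fst z + snd z \<le> 1}"
      using y z ab by (simp add: algebra_simps)
  qed
  have pts: "(0, 0) \<in> C" "(1, 0) \<in> C" "(0, 1) \<in> C"
    by (auto simp: C_def)
  have seg: "closed_segment y z \<subseteq> C" if "y \<in> C" "z \<in> C" for y z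
    using conv that by (simp add: closed_segment_subset)
  have "path_homotopic hospace ((pt p x \<circ> L) \<circ> (linepath (0, 0) (1, 0) +++ linepath (1, 0) (0, 1)))
      ((pt p x \<circ> L) \<circ> linepath (0, 0) (0, 1))"
    using seg pts by (intro path_homotopic_convex[OF cont conv]) (auto simp: path_image_join)
  moreover have "(pt p x \<circ> L) \<circ> linepath (0, 0) (1, 0) = spath p x t u"
    "(pt p x \<circ> L) \<circ> linepath (1, 0) (0, 1) = spath p x u v"
    "(pt p x \<circ> L) \<circ> linepath (0, 0) (0, 1) = spath p x t v"
    unfolding spath_def o_def
    by (intro ext arg_cong[where f = "pt p x"]; simp add: fun_eq_iff mix_def L_def linepath_def algebra_simps)+
  ultimately show ?thesis
    by (simp add: path_compose_path_join)
qed

lemma mix_in_oc: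
  assumes "face_chain K" "\<And>F. F \<in> K \<Longrightarrow> face_le F p" "t \<in> barycentric K" "u \<in> barycentric K" "s \<in> {0..1}"
  shows "mix s t u \<in> topspace (oc p)"
  using assms by (intro barycentric_subset_oc[of K] mix_in_barycentric)

text \<open>The path is the third side of a degenerate triangle whose last two corners
  coincide.\<close>

lemma pathin_spath:
  assumes "face_chain K" "\<And>F. F \<in> K \<Longrightarrow> face_le F p" "p \<in> Faces" "x \<in> over p" "t \<in> barycentric K" "u \<in> barycentric K"
  shows "pathin hospace (spath p x t u)"
  using path_homotopic_pathin(2)[OF spath_triangle[OF assms(1-6) assms(6)]] .

text \<open>If the simplex of the segment lies below \<open>q\<close>, all its points are glued from
  the slice over \<open>p\<close> into the slice over \<open>q\<close>.\<close>

lemma spath_change: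
  assumes "face_chain K" "\<And>F. F \<in> K \<Longrightarrow> face_le F q" "p \<in> Faces" "x \<in> over p" "q \<in> Faces" "face_le q p"
    and "t \<in> barycentric K" "u \<in> barycentric K" "s \<in> {0..1}"
  shows "spath p x t u s = spath q (act q x) t u s"
proof -
  let ?m = "mix s t u"
  have m: "?m \<in> topspace (oc q)"
    using assms by (intro mix_in_oc) auto
  then have "?m \<in> topspace (oc p)"
    using assms oc_mono by blast
  then show ?thesis
    unfolding spath_def using assms m top_face[OF m]
    by (subst pt_eq_iff) (auto simp: topspace_hosum act_vertex act_le act_act)
qed

lemma pt_change:
  assumes "p \<in> Faces" "x \<in> over p" "q \<in> Faces" "face_le q p" "t \<in> topspace (oc q)"
  shows "pt p x t = pt q (act q x) t"
  using assms oc_mono top_face[OF assms(5)]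
  by (subst pt_eq_iff) (auto simp: topspace_hosum act_vertex act_le act_act)

definition vtx :: "'a set \<times> 'v \<Rightarrow> ('a set \<times> 'v \<times> ('a set \<Rightarrow> real)) set" where
  "vtx q = pt (fst q) (snd q) (corner (fst q))"

lemma corner_in_oc: "G \<in> Faces \<Longrightarrow> face_le G p \<Longrightarrow> corner G \<in> topspace (oc p)"
  by (intro barycentric_subset_oc[of "{G}"]) (auto simp: face_chain_def Complete_Partial_Order.chain_def face_le_refl corner_in_barycentric)

lemma top_face_corner: "G \<in> Faces \<Longrightarrow> top_face (corner G) = G"
  using corner_in_oc[OF _ face_le_refl] by (intro top_face_eqI) (auto simp: corner_def face_le_refl split: if_splits)

lemma vtx_in: "q \<in> hoposet \<Longrightarrow> vtx q \<in> topspace hospace"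
  unfolding vtx_def by (intro pt_in) (auto simp: topspace_hosum hoposet_def corner_in_oc face_le_refl)

lemma stratum_vtx: "q \<in> hoposet \<Longrightarrow> stratum (vtx q) = q"
  unfolding vtx_def
  by (subst stratum_pt) (auto simp: topspace_hosum hoposet_def corner_in_oc face_le_refl top_face_corner act_self)

lemma pt_corner:
  assumes "q \<in> hoposet" "p \<in> hoposet" "hole q p"
  shows "pt (fst p) (snd p) (corner (fst q)) = vtx q"
proof -
  have "pt (fst p) (snd p) (corner (fst q)) = pt (fst q) (act (fst q) (snd p)) (corner (fst q))"
    using assms by (intro pt_change) (auto simp: hole_def hoposet_def corner_in_oc face_le_refl)
  then show ?thesis
    using assms by (simp add: vtx_def hole_def)
qed

text \<open>The open star of a vertex contracts to it along straight lines.\<close>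

definition star :: "'a set \<times> 'v \<Rightarrow> ('a set \<times> 'v \<times> ('a set \<Rightarrow> real)) set set" where
  "star q = {pt p x t | p x t. (p, x, t) \<in> topspace hosum \<and> t (fst q) > 0 \<and> act (fst q) x = snd q}"

text \<open>The criterion must not depend on the triple chosen for a point. Two triples agree after
  acting by the top face, and a positive coordinate at \<open>fst q\<close> puts that face below the
  top one.\<close>

lemma pt_in_star_iff:
  assumes "(p, x, t) \<in> topspace hosum"
  shows "pt p x t \<in> star q \<longleftrightarrow> t (fst q) > 0 \<and> act (fst q) x = snd q"
proof
  assume "pt p x t \<in> star q"
  then obtain p' x' t' where *: "pt p x t = pt p' x' t'" "(p', x', t') \<in> topspace hosum" "t' (fst q) > 0" "act (fst q) x' = snd q"
    unfolding star_def by blast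
  then have eq: "t = t'" "act (top_face t) x = act (top_face t) x'"
    using pt_eq_iff[OF assms *(2)] by auto
  have t: "t \<in> topspace (oc p)" "x \<in> pverts \<Theta>" "x' \<in> pverts \<Theta>"
    using assms *(2) by (auto simp: topspace_hosum)
  have "fst q \<in> Faces" "face_le (fst q) (top_face t)"
    using *(3) eq face_in_Faces[OF t(1)] top_face(2)[OF t(1)] by auto
  then have "act (fst q) x = act (fst q) x'"
    using eq(2) act_act[OF t(2) top_face(3)[OF t(1)], of "fst q"] act_act[OF t(3) top_face(3)[OF t(1)], of "fst q"] by simp
  then show "t (fst q) > 0 \<and> act (fst q) x = snd q"
    using * eq by simp
qed (use assms in \<open>auto simp: star_def\<close>)

lemma star_subset: "star q \<subseteq> topspace hospace"
  unfolding star_def using pt_in by blast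

lemma openin_star: "openin hospace (star q)"
  unfolding openin_hospace_iff
proof (intro conjI ballI star_subset)
  fix p x assume p: "p \<in> Faces" and x: "x \<in> over p"
  have "{t \<in> topspace (oc p). pt p x t \<in> star q} =
      (if act (fst q) x = snd q then {t \<in> topspace (oc p). t (fst q) > 0} else {})"
    using p x by (auto simp: pt_in_star_iff topspace_hosum)
  then show "openin (oc p) {t \<in> topspace (oc p). pt p x t \<in> star q}"
    using openin_positive by auto
qed

lemma in_star_stratum:
  assumes "z \<in> topspace hospace"
  shows "z \<in> star (stratum z)"
proof -
  obtain p x t where z: "(p, x, t) \<in> topspace hosum" "z = pt p x t"
    using assms hospaceE by blast
  then have "t \<in> topspace (oc p)"
    by (auto simp: topspace_hosum)
  then show ?thesis
    using z top_face(1) oc_nonneg by (simp add: pt_in_star_iff stratum_pt)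
qed

text \<open>Defined through an arbitrary representative and meant for points of the star. There the
  corner and the support of \<open>t\<close> span a simplex, and \<open>contraction_pt\<close>
  removes the dependence on the choice.\<close>

definition contraction :: "'a set \<times> 'v \<Rightarrow> real \<times> ('a set \<times> 'v \<times> ('a set \<Rightarrow> real)) set \<Rightarrow>
    ('a set \<times> 'v \<times> ('a set \<Rightarrow> real)) set" where
  "contraction q = (\<lambda>(s, z). case representative z of (p, x, t) \<Rightarrow> pt p x (mix s t (corner (fst q))))"

lemma mix_corner_in:
  assumes "t \<in> topspace (oc p)" "t G > 0" "s \<in> {0..1}"
  shows "mix s t (corner G) \<in> topspace (oc p)"
proof -
  have "face_chain {F. t F \<noteq> 0}" "t \<in> barycentric {F. t F \<noteq> 0}" "\<And>F. F \<in> {F. t F \<noteq> 0} \<Longrightarrow> face_le F p"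
    using assms(1) by (auto simp: topspace_oc)
  then show ?thesis
    using assms by (intro mix_in_oc[of "{F. t F \<noteq> 0}"] corner_in_barycentric) (auto simp: face_chain_def)
qed

lemma contraction_pt:
  assumes a: "(p, x, t) \<in> topspace hosum" and G: "t (fst q) > 0" and s: "s \<in> {0..1}"
  shows "contraction q (s, pt p x t) = pt p x (mix s t (corner (fst q)))"
proof -
  obtain p' x' where rep: "representative (pt p x t) = (p', x', t)" and a': "(p', x', t) \<in> topspace hosum"
    and eqs: "act (top_face t) x' = act (top_face t) x"
    using representative_pt[OF a] .
  have t: "t \<in> topspace (oc p)" "t \<in> topspace (oc p')" "x \<in> pverts \<Theta>" "x' \<in> pverts \<Theta>"
    using a a' by (auto simp: topspace_hosum)
  let ?m = "mix s t (corner (fst q))"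
  have m: "?m \<in> topspace (oc p)" "?m \<in> topspace (oc p')" "?m \<in> topspace (oc (top_face t))"
    using mix_corner_in[where G = "fst q" and t = t and s = s] G s t oc_top[OF t(1)] by auto
  have le: "top_face ?m \<in> Faces" "face_le (top_face ?m) (top_face t)"
    using top_face[OF m(3)] by auto
  have "act (top_face ?m) x = act (top_face ?m) x'"
    using act_act[OF t(3) top_face(3)[OF t(1)] le] act_act[OF t(4) top_face(3)[OF t(1)] le] eqs by simp
  then have "pt p x ?m = pt p' x' ?m"
    using a a' m by (subst pt_eq_iff) (auto simp: topspace_hosum)
  then show ?thesis
    unfolding contraction_def by (simp add: rep)
qed

text \<open>Continuity is checked before passing to the quotient, where the contraction is affine in
  the coordinates of each slice. This is legitimate because the star is open, so that the quotient
  map restricts to it, and because the product of this restriction with the interval is again a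
  quotient map.\<close>

lemma continuous_contraction:
  "continuous_map (prod_topology (top_of_set {0..1}) (subtopology hospace (star q))) hospace (contraction q)"
proof -
  let ?\<pi> = "\<lambda>(p, x, t). pt p x t"
  let ?U = "{a \<in> topspace hosum. ?\<pi> a \<in> star q}"
  let ?I = "top_of_set {0..1::real}"
  have "quotient_map (subtopology hosum ?U) (subtopology hospace (star q)) ?\<pi>"
    by (rule quotient_map_restriction[OF quotient_map_hospace refl]) (simp add: openin_star)
  \<comment> \<open>Multiplying a quotient map by the interval preserves quotient maps because the
    interval is locally compact and Hausdorff.\<close>
  then have quo: "quotient_map (prod_topology ?I (subtopology hosum ?U)) (prod_topology ?I (subtopology hospace (star q)))
      (\<lambda>(s, a). (s, ?\<pi> a))"
    by (intro quotient_map_prod_right compact_imp_locally_compact_space)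
      (auto intro!: compact_space_subtopology Hausdorff_space_subtopology)
  show ?thesis
  proof (rule continuous_compose_quotient_map[OF quo], rule continuous_map_locally)
    let ?f = "contraction q \<circ> (\<lambda>(s, a). (s, ?\<pi> a))"
    fix y assume y: "y \<in> topspace (prod_topology ?I (subtopology hosum ?U))"
    obtain s p x t where y_eq: "y = (s, p, x, t)"
      by (metis prod_cases4)
    have a: "s \<in> {0..1}" "(p, x, t) \<in> topspace hosum" "t (fst q) > 0" "act (fst q) x = snd q"
      using y pt_in_star_iff[of p x t q] by (auto simp: y_eq)
    have px: "p \<in> Faces" "x \<in> over p"
      using a by (auto simp: topspace_hosum)
    \<comment> \<open>A neighbourhood on which \<open>p\<close> and \<open>x\<close> are constant;
      only the coordinates and the time vary there.\<close>
    let ?W = "{p} \<times> ({x} \<times> {t \<in> topspace (oc p). t (fst q) > 0})"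
    have "openin hosum ?W"
      unfolding openin_hosum_iff
    proof (intro conjI ballI)
      show "?W \<subseteq> topspace hosum"
        using px by (auto simp: topspace_hosum)
      fix p' x' assume "p' \<in> Faces" "x' \<in> over p'"
      have "{t. (p', x', t) \<in> ?W} = (if p' = p \<and> x' = x then {t \<in> topspace (oc p). t (fst q) > 0} else {})"
        by auto
      then show "openin (oc p') {t. (p', x', t) \<in> ?W}"
        using openin_positive by auto
    qed
    moreover have WU: "?W \<subseteq> ?U"
    proof
      fix b assume "b \<in> ?W"
      then obtain t' where b: "b = (p, x, t')" "t' \<in> topspace (oc p)" "t' (fst q) > 0"
        by blast
      then have "(p, x, t') \<in> topspace hosum"
        using px by (simp add: topspace_hosum)
      then show "b \<in> ?U"
        using b a(4) pt_in_star_iff[of p x t' q] by simp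
    qed
    ultimately have "openin hosum ?W \<and> ?W = ?W \<inter> ?U"
      by blast
    then have "openin (subtopology hosum ?U) ?W"
      unfolding openin_subtopology by blast
    then have op: "openin (prod_topology ?I (subtopology hosum ?U)) ({0..1} \<times> ?W)"
      by (simp add: openin_prod_Times_iff)
    moreover have "y \<in> {0..1} \<times> ?W"
      using a by (auto simp: y_eq topspace_hosum)
    moreover have "continuous_map (subtopology (prod_topology ?I (subtopology hosum ?U)) ({0..1} \<times> ?W)) hospace ?f"
    proof -
      let ?T = "subtopology (prod_topology ?I (subtopology hosum ?U)) ({0..1} \<times> ?W)"
      have top: "topspace ?T = {0..1} \<times> ?W"
        unfolding topspace_subtopology[of "prod_topology ?I (subtopology hosum ?U)"]
        by (rule Int_absorb1[OF openin_subset[OF op]])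
      have coord: "continuous_map ?T euclideanreal (\<lambda>z. snd (snd (snd z)) F)" for F
        using continuous_map_compose[OF continuous_map_snd continuous_map_from_subtopology[OF continuous_map_hosum_coordinate[of F]]]
        by (intro continuous_map_from_subtopology) (simp add: o_def)
      have fst: "continuous_map ?T euclideanreal fst"
        by (intro continuous_map_from_subtopology continuous_map_into_fulltopology[OF continuous_map_fst])
      have "continuous_map ?T (oc p) (\<lambda>z. mix (fst z) (snd (snd (snd z))) (corner (fst q)))"
      proof (rule continuous_map_into_oc)
        show "continuous_map ?T (powertop_real UNIV) (\<lambda>z. mix (fst z) (snd (snd (snd z))) (corner (fst q)))"
          unfolding continuous_map_componentwise_UNIV mix_def
          by (intro allI continuous_map_add continuous_map_real_mult continuous_map_diff fst coord)
            auto
        have "mix (fst z) (snd (snd (snd z))) (corner (fst q)) \<in> topspace (oc p)" if "z \<in> topspace ?T" for z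
          using that unfolding top by (intro mix_corner_in) auto
        then show "(\<lambda>z. mix (fst z) (snd (snd (snd z))) (corner (fst q))) \<in> topspace ?T \<rightarrow> topspace (oc p)"
          by (rule funcsetI)
      qed
      from continuous_map_compose[OF this continuous_map_pt[OF px]]
      show ?thesis
      proof (rule continuous_map_eq)
        fix z assume "z \<in> topspace ?T"
        then obtain s t where z: "z = (s, p, x, t)" "s \<in> {0..1}" "t \<in> topspace (oc p)" "t (fst q) > 0"
          unfolding top by auto
        then show "(pt p x \<circ> (\<lambda>z. mix (fst z) (snd (snd (snd z))) (corner (fst q)))) z = ?f z"
          using contraction_pt[of p x t q s] px by (simp add: topspace_hosum)
      qed
    qed
    ultimately show "\<exists>U. openin (prod_topology ?I (subtopology hosum ?U)) U \<and> y \<in> U \<and>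
        continuous_map (subtopology (prod_topology ?I (subtopology hosum ?U)) U) hospace ?f"
      by blast
  qed
qed

end

section \<open>The fundamental groupoid as a local system\<close>

lemma path_groupoid_homotopy:
  "path_groupoid {g. pathin X g} {(g, h). path_homotopic X g h} (topspace X) (\<lambda>g. g 0) (\<lambda>g. g 1)
     path_join path_reverse (\<lambda>x _. x)"
proof
  show "equiv {g. pathin X g} {(g, h). path_homotopic X g h}"
  proof (rule equivI)
    show "{(g, h). path_homotopic X g h} \<subseteq> {g. pathin X g} \<times> {g. pathin X g}"
      using path_homotopic_pathin by blast
    show "refl_on {g. pathin X g} {(g, h). path_homotopic X g h}"
      by (auto simp: refl_on_def path_homotopic_refl)
    show "sym {(g, h). path_homotopic X g h}"
      by (auto simp: sym_def intro: path_homotopic_sym)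
    show "trans {(g, h). path_homotopic X g h}"
      by (auto simp: trans_def intro: path_homotopic_trans)
  qed
qed (auto simp: path_homotopic_ends path_start_in_topspace path_finish_in_topspace pathin_join path_homotopic_join
    path_homotopic_assoc pathin_reverse path_homotopic_const_left path_homotopic_const_right path_homotopic_reverse_right)

context path_groupoid
begin

lemma cmp_r_left: "(\<alpha>, \<alpha>') \<in> r \<Longrightarrow> \<beta> \<in> P \<Longrightarrow> tgt \<alpha> = src \<beta> \<Longrightarrow> (cmp \<alpha> \<beta>, cmp \<alpha>' \<beta>) \<in> r"
  by (intro cmp_r refl_r)

lemma cmp_r_right: "(\<beta>, \<beta>') \<in> r \<Longrightarrow> \<alpha> \<in> P \<Longrightarrow> tgt \<alpha> = src \<beta> \<Longrightarrow> (cmp \<alpha> \<beta>, cmp \<alpha> \<beta>') \<in> r"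
  by (intro cmp_r refl_r)

lemma cls_eqI: "(\<alpha>, \<beta>) \<in> r \<Longrightarrow> cls \<alpha> = cls \<beta>"
  using cls_eq_iff in_r by blast

lemma in_fibre: "\<alpha> \<in> P \<Longrightarrow> src \<alpha> = x \<Longrightarrow> tgt \<alpha> = y \<Longrightarrow> cls \<alpha> \<in> fibre x y"
  by (auto simp: fibre_def)

lemma fibreE:
  assumes "A \<in> fibre x y"
  obtains \<alpha> where "A = cls \<alpha>" "\<alpha> \<in> P" "src \<alpha> = x" "tgt \<alpha> = y"
  using assms unfolding fibre_def by blast

text \<open>The diagram chase of one infinitesimal step of transport. In its use \<open>a\<close>
  and \<open>b\<close> are the path up to the old and the new time, \<open>s\<close> is the piece in
  between, \<open>u\<close> and \<open>w\<close> are the rays of the two points to the centres of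
  their own strata, \<open>v\<close> is the ray of the new point to the old centre, and
  \<open>e\<close> is the edge from the old to the new centre.\<close>

lemma square_transfer:
  assumes P: "a \<in> P" "s \<in> P" "b \<in> P" "w \<in> P" "v \<in> P" "e \<in> P" "u \<in> P"
    and ends: "tgt a = src s" "tgt s = src v" "tgt w = tgt e" "tgt v = src e" "tgt a = src u" "tgt u = src e"
      "tgt b = src w" "tgt b = src v"
    and 1: "(cmp a s, b) \<in> r" and 2: "(cmp s v, u) \<in> r" and 3: "(cmp w (inv_path e), v) \<in> r"
  shows "(cmp (cmp a u) e, cmp b w) \<in> r"
proof -
  have "(cmp a u, cmp a (cmp s v)) \<in> r"
    using P ends by (intro cmp_r_right sym_r[OF 2]) auto
  also have "(cmp a (cmp s v), cmp (cmp a s) v) \<in> r"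
    using P ends by (intro sym_r[OF assoc_r]) auto
  also have "(cmp (cmp a s) v, cmp b v) \<in> r"
    using P ends by (intro cmp_r_left 1) (auto simp: cmp_simps)
  also have "(cmp b v, cmp b (cmp w (inv_path e))) \<in> r"
    using P ends by (intro cmp_r_right sym_r[OF 3]) auto
  also have "(cmp b (cmp w (inv_path e)), cmp (cmp b w) (inv_path e)) \<in> r"
    using P ends by (intro sym_r[OF assoc_r]) (auto simp: cmp_simps)
  finally have "(cmp (cmp a u) e, cmp (cmp (cmp b w) (inv_path e)) e) \<in> r"
    using P ends by (intro cmp_r_left) (auto simp: cmp_simps)
  also have "(cmp (cmp (cmp b w) (inv_path e)) e, cmp b w) \<in> r"
    using P ends by (intro cmp_cancel_right') (auto simp: cmp_simps)
  finally show ?thesis .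
qed

end

context arrangement_cover
begin

sublocale hp: path_groupoid "{g. pathin hospace g}" "{(g, h). path_homotopic hospace g h}" "topspace hospace"
    "\<lambda>g. g 0" "\<lambda>g. g 1" path_join path_reverse "\<lambda>x _. x"
  by (rule path_groupoid_homotopy)

text \<open>The segment is drawn in the slice over \<open>p\<close>. Of \<open>q\<close> and
  \<open>q'\<close> only the faces enter; their vertices are supplied by the gluing, which for
  \<open>hole q p\<close> identifies the corner with \<open>vtx q\<close>.\<close>

definition edge :: "'a set \<times> 'v \<Rightarrow> 'a set \<times> 'v \<Rightarrow> 'a set \<times> 'v \<Rightarrow> real \<Rightarrow>
    ('a set \<times> 'v \<times> ('a set \<Rightarrow> real)) set" where
  "edge p q q' = spath (fst p) (snd p) (corner (fst q)) (corner (fst q'))"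

lemma edge_ends:
  assumes "p \<in> hoposet" "q \<in> hoposet" "hole q p"
  shows "edge p q q' 0 = vtx q" "edge p q' q 1 = vtx q"
  using assms by (auto simp: edge_def pt_corner)

lemma edge_reverse [simp]: "path_reverse (edge p q q') = edge p q' q"
  by (simp add: edge_def)

lemma face_chain_pair:
  assumes "F \<in> Faces" "G \<in> Faces" "face_le F G"
  shows "face_chain {F, G}"
  using assms by (auto simp: face_chain_def Complete_Partial_Order.chain_def face_le_refl)

lemma edge_triangle:
  assumes p: "p \<in> hoposet" and K: "face_chain {fst q, fst q', fst q''}"
    and le: "face_le (fst q) (fst p)" "face_le (fst q') (fst p)" "face_le (fst q'') (fst p)"
  shows "path_homotopic hospace (path_join (edge p q q') (edge p q' q'')) (edge p q q'')"
  unfolding edge_def using assms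
  by (intro spath_triangle[OF K]) (auto simp: hoposet_def face_chain_def intro!: corner_in_barycentric)

lemma edge_change:
  assumes "p \<in> hoposet" "p' \<in> hoposet" "hole p' p" "face_chain {fst q, fst q'}"
    and "face_le (fst q) (fst p')" "face_le (fst q') (fst p')" "s \<in> {0..1}"
  shows "edge p q q' s = edge p' q q' s"
proof -
  have "snd p' = act (fst p') (snd p)" "face_le (fst p') (fst p)"
    using assms(3) by (auto simp: hole_def)
  then show ?thesis
    unfolding edge_def using assms
    by (subst spath_change[of "{fst q, fst q'}" "fst p'" "fst p"])
      (auto simp: hoposet_def face_chain_def intro!: corner_in_barycentric)
qed

lemma pathin_edge:
  assumes "p \<in> hoposet" "face_chain {fst q, fst q'}" "face_le (fst q) (fst p)" "face_le (fst q') (fst p)"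
  shows "pathin hospace (edge p q q')"
  unfolding edge_def using assms
  by (intro pathin_spath[of "{fst q, fst q'}"]) (auto simp: hoposet_def face_chain_def intro!: corner_in_barycentric)

lemma pathin_edge_top:
  assumes "p \<in> hoposet" "q \<in> hoposet" "hole q p"
  shows "pathin hospace (edge p q p)" "pathin hospace (edge p p q)"
proof -
  have "face_chain {fst q, fst p}" "face_chain {fst p, fst q}" "face_le (fst q) (fst p)"
    using assms face_chain_pair[of "fst q" "fst p"] by (auto simp: hole_def hoposet_def insert_commute)
  then show "pathin hospace (edge p q p)" "pathin hospace (edge p p q)"
    using assms by (auto intro!: pathin_edge face_le_refl)
qed

lemma face_chain_triple:
  assumes "q \<in> hoposet" "p \<in> hoposet" "s \<in> hoposet" "hole q p" "hole p s"
  shows "face_chain {fst q, fst p, fst s}"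
  using assms by (auto simp: face_chain_def Complete_Partial_Order.chain_def hoposet_def hole_def face_le_refl
    intro: face_le_trans)

text \<open>All three sides are drawn as a triangle in the slice of the largest pair
  \<open>s\<close>; the side joining \<open>q\<close> and \<open>p\<close> is then moved to the
  slice of \<open>p\<close> by \<open>edge_change\<close>.\<close>

lemma edge_cocycle:
  assumes h: "q \<in> hoposet" "p \<in> hoposet" "s \<in> hoposet" "hole q p" "hole p s"
  shows "path_homotopic hospace (path_join (edge p q p) (edge s p s)) (edge s q s)"
    "path_homotopic hospace (path_join (edge s s p) (edge p p q)) (edge s s q)"
proof -
  have K: "face_chain {fst q, fst p, fst s}" "face_chain {fst s, fst p, fst q}"
    using face_chain_triple[OF h] by (auto simp: insert_commute)
  have le: "face_le (fst q) (fst p)" "face_le (fst p) (fst s)" "face_le (fst q) (fst s)"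
    using h face_le_trans by (auto simp: hole_def)
  have c: "face_chain {fst q, fst p}" "face_chain {fst p, fst q}"
    using face_chain_subset[OF K(1), of "{fst q, fst p}"] by (auto simp: insert_commute)
  have eq: "edge s q p t = edge p q p t" if "t \<in> {0..1}" for t
    by (rule edge_change) (use h le c that in \<open>simp_all add: face_le_refl\<close>)
  have eq': "edge s p q t = edge p p q t" if "t \<in> {0..1}" for t
    by (rule edge_change) (use h le c that in \<open>simp_all add: face_le_refl\<close>)
  have "path_homotopic hospace (path_join (edge s q p) (edge s p s)) (edge s q s)"
    using h le K by (intro edge_triangle) (auto simp: face_le_refl)
  then show "path_homotopic hospace (path_join (edge p q p) (edge s p s)) (edge s q s)"
    by (rule path_homotopic_cong) (simp_all add: path_join_def eq eq')
  have "path_homotopic hospace (path_join (edge s s p) (edge s p q)) (edge s s q)"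
    using h le K by (intro edge_triangle) (auto simp: face_le_refl)
  then show "path_homotopic hospace (path_join (edge s s p) (edge p p q)) (edge s s q)"
    by (rule path_homotopic_cong) (simp_all add: path_join_def eq eq')
qed

definition edge_tr where
  "edge_tr q p A = hp.cls_cmp A (edge p q p)"

lemma stratified_system_edge:
  "stratified_system hospace hoposet hole stratum (\<lambda>q. hp.fibre x (vtx q)) edge_tr"
proof -
  have "poset_system hoposet hole (\<lambda>q. hp.fibre x (vtx q)) edge_tr"
    unfolding edge_tr_def[abs_def]
    by (rule hp.poset_system_fibre)
      (auto simp: hole_refl edge_ends pathin_edge_top edge_cocycle(1) intro: hole_trans)
  then show ?thesis
    by (intro stratified_system.intro stratification_hospace)
qed

section \<open>Transport of homotopy classes\<close>

definition ray :: "'a set \<times> 'v \<Rightarrow> ('a set \<times> 'v \<times> ('a set \<Rightarrow> real)) set \<Rightarrow> real \<Rightarrow>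
    ('a set \<times> 'v \<times> ('a set \<Rightarrow> real)) set" where
  "ray q z = (\<lambda>s. contraction q (s, z))"

lemma starE:
  assumes "z \<in> star q"
  obtains p x t where "(p, x, t) \<in> topspace hosum" "z = pt p x t" "t (fst q) > 0" "act (fst q) x = snd q"
  using assms unfolding star_def by blast

lemma ray_pt:
  assumes "(p, x, t) \<in> topspace hosum" "t (fst q) > 0" "s \<in> {0..1}"
  shows "ray q (pt p x t) s = spath p x t (corner (fst q)) s"
  unfolding ray_def spath_def by (rule contraction_pt[OF assms])

lemma pathin_ray:
  assumes "z \<in> star q"
  shows "pathin hospace (ray q z)"
proof -
  have "continuous_map (top_of_set {0..1}) (prod_topology (top_of_set {0..1}) (subtopology hospace (star q))) (\<lambda>s. (s, z))"
    using assms subsetD[OF star_subset assms] by (auto simp: continuous_map_pairwise o_def)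
  from continuous_map_compose[OF this continuous_contraction] show ?thesis
    by (simp add: pathin_def ray_def o_def)
qed

lemma star_vertex:
  assumes "(p, x, t) \<in> topspace hosum" "t (fst q) > 0" "act (fst q) x = snd q"
  shows "pt p x (corner (fst q)) = vtx q" "q \<in> hoposet" "face_le (fst q) (top_face t)" "hole q (stratum (pt p x t))"
proof -
  have t: "t \<in> topspace (oc p)" "p \<in> Faces" "x \<in> over p"
    using assms(1) by (auto simp: topspace_hosum)
  have G: "fst q \<in> Faces" "face_le (fst q) p" "face_le (fst q) (top_face t)"
    using face_in_Faces[OF t(1)] top_face(2)[OF t(1)] t(1) assms(2) by (auto simp: topspace_oc)
  show "q \<in> hoposet"
    using act_in_hoposet[of x "fst q"] t G assms(3) by simp
  show "face_le (fst q) (top_face t)"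
    by (rule G)
  show "pt p x (corner (fst q)) = vtx q"
    using pt_change[OF t(2,3) G(1,2) corner_in_oc[OF G(1) face_le_refl]] assms(3) by (simp add: vtx_def)
  show "hole q (stratum (pt p x t))"
    using act_act[of x "top_face t" "fst q"] t G top_face(3)[OF t(1)] assms(3) by (simp add: stratum_pt[OF assms(1)] hole_def)
qed

lemma ray_ends:
  assumes "z \<in> star q"
  shows "ray q z 0 = z" "ray q z 1 = vtx q"
  by (rule starE[OF assms]; simp add: ray_pt star_vertex)+

lemma star_hole:
  assumes "z \<in> star q"
  shows "q \<in> hoposet" "hole q (stratum z)"
  by (rule starE[OF assms]; use star_vertex in blast)+

text \<open>Passing from one open star to another: the triangle lies in a simplex.\<close>

lemma ray_change:
  assumes "z \<in> star q"
  shows "path_homotopic hospace (path_join (ray (stratum z) z) (edge (stratum z) (stratum z) q)) (ray q z)"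
proof -
  obtain p x t where a: "(p, x, t) \<in> topspace hosum" "z = pt p x t" "t (fst q) > 0" "act (fst q) x = snd q"
    using starE[OF assms] .
  then have t: "t \<in> topspace (oc p)" "p \<in> Faces" "x \<in> over p"
    by (auto simp: topspace_hosum)
  have s: "stratum z = (top_face t, act (top_face t) x)"
    using stratum_pt[OF a(1)] a(2) by simp
  have M: "t (top_face t) > 0" "top_face t \<in> Faces" "face_le (top_face t) p"
    using top_face[OF t(1)] oc_nonneg[OF t(1)] by auto
  let ?K = "{F. t F \<noteq> 0}"
  have K: "face_chain ?K" "t \<in> barycentric ?K" "\<And>F. F \<in> ?K \<Longrightarrow> face_le F p"
    using t(1) by (auto simp: topspace_oc)
  have corners: "corner (top_face t) \<in> barycentric ?K" "corner (fst q) \<in> barycentric ?K"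
    using K(1) M a(3) by (auto intro!: corner_in_barycentric simp: face_chain_def)
  have "path_homotopic hospace (path_join (spath p x t (corner (top_face t))) (spath p x (corner (top_face t)) (corner (fst q))))
      (spath p x t (corner (fst q)))"
    using t K(2) corners by (intro spath_triangle[OF K(1,3)]) auto
  then show ?thesis
  proof (rule path_homotopic_cong)
    fix \<tau> :: real assume \<tau>: "\<tau> \<in> {0..1}"
    show "spath p x t (corner (fst q)) \<tau> = ray q z \<tau>"
      using ray_pt[OF a(1,3) \<tau>] a(2) by simp
    have "ray (stratum z) z \<sigma> = spath p x t (corner (top_face t)) \<sigma>" if "\<sigma> \<in> {0..1}" for \<sigma>
      using ray_pt[OF a(1) _ that, of "stratum z"] a(2) M s by simp
    moreover have "edge (stratum z) (stratum z) q \<sigma> = spath p x (corner (top_face t)) (corner (fst q)) \<sigma>"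
      if "\<sigma> \<in> {0..1}" for \<sigma>
    proof -
      have "spath p x (corner (top_face t)) (corner (fst q)) \<sigma> =
          spath (top_face t) (act (top_face t) x) (corner (top_face t)) (corner (fst q)) \<sigma>"
      proof (rule spath_change)
        show "face_chain {top_face t, fst q}"
          using face_chain_subset[OF K(1), of "{top_face t, fst q}"] M a(3) by auto
        show "face_le F (top_face t)" if "F \<in> {top_face t, fst q}" for F
          using that star_vertex(3)[OF a(1,3,4)] face_le_refl by auto
      qed (use t M that in \<open>simp_all add: corner_in_barycentric\<close>)
      then show ?thesis
        by (simp add: s edge_def)
    qed
    ultimately show "path_join (spath p x t (corner (top_face t))) (spath p x (corner (top_face t)) (corner (fst q))) \<tau> =
        path_join (ray (stratum z) z) (edge (stratum z) (stratum z) q) \<tau>"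
      using \<tau> by (intro path_join_cong) auto
  qed
qed

text \<open>Contracting the whole path gives a square whose sides are \<open>g\<close>, the two
  rays, and a constant side at the vertex. The two ways around the square are homotopic.\<close>

lemma star_path_contracts:
  assumes g: "pathin hospace g" and star: "\<And>t. t \<in> {0..1} \<Longrightarrow> g t \<in> star q"
  shows "path_homotopic hospace (path_join g (ray q (g 1))) (ray q (g 0))"
proof -
  let ?C = "{0..1::real} \<times> {0..1::real}"
  let ?K = "\<lambda>z. contraction q (fst z, g (snd z))"
  have g': "continuous_map (top_of_set {0..1}) (subtopology hospace (star q)) g"
    using g star by (auto simp: pathin_def continuous_map_in_subtopology)
  have "continuous_map (top_of_set ?C) (top_of_set {0..1}) fst" "continuous_map (top_of_set ?C) (top_of_set {0..1}) snd"
    by (auto simp: continuous_map_in_subtopology intro!: continuous_intros)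
  then have "continuous_map (top_of_set ?C) (prod_topology (top_of_set {0..1}) (subtopology hospace (star q)))
      (\<lambda>z. (fst z, g (snd z)))"
    using continuous_map_compose[OF _ g', of "top_of_set ?C" snd] by (auto simp: continuous_map_pairwise o_def)
  from continuous_map_compose[OF this continuous_contraction]
  have K: "continuous_map (top_of_set ?C) hospace ?K"
    by (simp add: o_def)
  have conv: "convex ?C"
    by (intro convex_Times) auto
  have seg: "closed_segment y z \<subseteq> ?C" if "y \<in> ?C" "z \<in> ?C" for y z
    using conv that by (simp add: closed_segment_subset)
  have "path_homotopic hospace (?K \<circ> (linepath (0, 0) (0, 1) +++ linepath (0, 1) (1, 1)))
      (?K \<circ> (linepath (0, 0) (1, 0) +++ linepath (1, 0) (1, 1)))"
    using seg by (intro path_homotopic_convex[OF K conv]) (auto simp: path_image_join)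
  then have "path_homotopic hospace (path_join (?K \<circ> linepath (0, 0) (0, 1)) (?K \<circ> linepath (0, 1) (1, 1)))
      (path_join (?K \<circ> linepath (0, 0) (1, 0)) (?K \<circ> linepath (1, 0) (1, 1)))"
    by (simp add: path_compose_path_join)
  then have "path_homotopic hospace (path_join g (ray q (g 1))) (path_join (ray q (g 0)) (\<lambda>_. ray q (g 0) 1))"
  proof (rule path_homotopic_cong)
    have K: "(?K \<circ> linepath (0, 0) (0, 1)) t = g t" "(?K \<circ> linepath (0, 1) (1, 1)) t = ray q (g 1) t"
      "(?K \<circ> linepath (0, 0) (1, 0)) t = ray q (g 0) t" "(?K \<circ> linepath (1, 0) (1, 1)) t = ray q (g 0) 1"
      if "t \<in> {0..1}" for t
      using that ray_ends[OF star[OF that]] ray_ends[OF star[of 0]]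
      by (simp_all add: linepath_def ray_def)
    fix t :: real assume t: "t \<in> {0..1}"
    show "path_join (?K \<circ> linepath (0, 0) (0, 1)) (?K \<circ> linepath (0, 1) (1, 1)) t = path_join g (ray q (g 1)) t"
      using K t by (intro path_join_cong)
    show "path_join (?K \<circ> linepath (0, 0) (1, 0)) (?K \<circ> linepath (1, 0) (1, 1)) t =
        path_join (ray q (g 0)) (\<lambda>_. ray q (g 0) 1) t"
      using K t by (intro path_join_cong)
  qed
  also have "path_homotopic hospace (path_join (ray q (g 0)) (\<lambda>_. ray q (g 0) 1)) (ray q (g 0))"
    using star by (intro path_homotopic_const_right pathin_ray) auto
  finally show ?thesis .
qed

abbreviation ray_top where
  "ray_top z \<equiv> ray (stratum z) z"

lemma ray_top:
  assumes "z \<in> topspace hospace"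
  shows "pathin hospace (ray_top z)" "ray_top z 0 = z" "ray_top z 1 = vtx (stratum z)"
  using in_star_stratum[OF assms] by (auto simp: pathin_ray ray_ends)

lemma pathin_affine:
  assumes "pathin X g" "a \<in> {0..1}" "b \<in> {0..1}"
  shows "pathin X (g \<circ> linepath a b)"
proof -
  have "closed_segment a b \<subseteq> {0..1}"
    using assms by (intro closed_segment_subset) auto
  then have "continuous_map (top_of_set {0..1}) (top_of_set {0..1}) (linepath a b)"
    using path_linepath[of a b] path_image_linepath[of a b]
    by (auto simp: continuous_map_in_subtopology path_def path_image_def)
  from continuous_map_compose[OF this] assms(1) show ?thesis
    by (simp add: pathin_def)
qed

text \<open>Transport in the system of homotopy classes is tautological: it appends the path itself.
  This is what lets a transport determine the homotopy class of the loop along which it is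
  taken.\<close>

lemma transports_edge:
  assumes g: "pathin hospace g"
  shows "stratified_system.transports hospace hole stratum (\<lambda>q. hp.fibre (g 0) (vtx q)) edge_tr g
    (hp.cls (ray_top (g 0))) (hp.cls (path_join g (ray_top (g 1))))"
proof -
  interpret E: stratified_system hospace hoposet hole stratum "\<lambda>q. hp.fibre (g 0) (vtx q)" edge_tr
    by (rule stratified_system_edge)
  define sub where "sub t = g \<circ> linepath 0 t" for t
  have X: "g t \<in> topspace hospace" if "t \<in> {0..1}" for t
    using path_image_subset_topspace[OF g] that by (auto simp: Pi_iff)
  have sub: "pathin hospace (sub t)" "sub t 0 = g 0" "sub t 1 = g t" if "t \<in> {0..1}" for t
    unfolding sub_def using that pathin_affine[OF g, of 0 t] by (auto simp: linepath_def)
  \<comment> \<open>The section at time \<open>t\<close> is the part of \<open>g\<close> up to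
    \<open>t\<close>, closed up by the ray to the vertex of the current stratum.\<close>
  define A where "A t = hp.cls (path_join (sub t) (ray_top (g t)))" for t
  have "E.potential {0..1} g A"
    unfolding E.potential_def
  proof (intro ballI conjI)
    fix t :: real assume t: "t \<in> {0..1}"
    show "g t \<in> topspace hospace"
      by (rule X[OF t])
    show "A t \<in> hp.fibre (g 0) (vtx (stratum (g t)))"
      unfolding A_def using sub[OF t] ray_top[OF X[OF t]] by (intro hp.in_fibre) (auto intro: pathin_join)
    let ?q = "stratum (g t)"
    have "openin (top_of_set {0..1}) {w \<in> topspace (top_of_set {0..1}). g w \<in> star ?q}"
      using openin_continuous_map_preimage[OF g[unfolded pathin_def] openin_star] .
    then obtain U where U: "open U" "{w \<in> topspace (top_of_set {0..1}). g w \<in> star ?q} = {0..1} \<inter> U"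
      unfolding openin_open by blast
    have "t \<in> U"
      using U(2) t in_star_stratum[OF X[OF t]] by auto
    then obtain e where e: "e > 0" "ball t e \<subseteq> U"
      using U(1) open_contains_ball by metis
    have "hole ?q (stratum (g w)) \<and> A w = edge_tr ?q (stratum (g w)) (A t)" if w: "w \<in> {0..1} \<inter> ball t e" for w
    proof -
      have w01: "w \<in> {0..1}"
        using w by blast
      \<comment> \<open>Working in a ball keeps not only \<open>g w\<close> but the whole piece of
        path between the two times inside the star, as \<open>star_path_contracts\<close>
        requires.\<close>
      have "closed_segment t w \<subseteq> {0..1} \<inter> ball t e"
        using w t e by (intro closed_segment_subset convex_Int) auto
      then have star: "g s \<in> star ?q" if "s \<in> closed_segment t w" for s
        using that e U(2) by auto
      then have gw: "g w \<in> star ?q"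
        by auto
      note hole = star_hole[OF gw]
      let ?p = "stratum (g w)" and ?s = "g \<circ> linepath t w"
      have p: "?p \<in> hoposet"
        using stratum_in[OF X[OF w01]] .
      have s: "pathin hospace ?s" "?s 0 = g t" "?s 1 = g w"
        using pathin_affine[OF g t w01] by (auto simp: linepath_def)
      have s_star: "?s \<sigma> \<in> star ?q" if "\<sigma> \<in> {0..1}" for \<sigma>
        using star[OF linepath_in_path[OF that]] by simp
      have "path_homotopic hospace (g \<circ> (linepath 0 t +++ linepath t w)) (g \<circ> linepath 0 w)"
        using g t w01 by (intro path_homotopic_convex[of "{0..1}"])
          (auto simp: pathin_def path_image_join closed_segment_eq_real_ivl)
      then have 1: "path_homotopic hospace (path_join (sub t) ?s) (sub w)"
        by (simp add: sub_def path_compose_path_join)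
      have 2: "path_homotopic hospace (path_join ?s (ray ?q (g w))) (ray_top (g t))"
        using star_path_contracts[OF s(1) s_star, unfolded s(2,3)] .
      have 3: "path_homotopic hospace (path_join (ray_top (g w)) (path_reverse (edge ?p ?q ?p))) (ray ?q (g w))"
        using ray_change[OF gw] by simp
      have e: "pathin hospace (edge ?p ?q ?p)" "edge ?p ?q ?p 0 = vtx ?q" "edge ?p ?q ?p 1 = vtx ?p"
        using hole p by (auto simp: pathin_edge_top edge_ends hole_refl)
      note ends = e s sub[OF t] sub[OF w01] ray_top[OF X[OF t]] ray_top[OF X[OF w01]] pathin_ray[OF gw] ray_ends[OF gw]
      have H: "(path_join (path_join (sub t) (ray_top (g t))) (edge ?p ?q ?p), path_join (sub w) (ray_top (g w)))
          \<in> {(g, h). path_homotopic hospace g h}"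
        by (rule hp.square_transfer[where s = ?s and v = "ray ?q (g w)"])
          (simp_all only: mem_Collect_eq case_prod_conv ends 1 2 3)
      have "A w = hp.cls (path_join (path_join (sub t) (ray_top (g t))) (edge ?p ?q ?p))"
        unfolding A_def by (rule hp.cls_eqI[OF hp.sym_r[OF H]])
      also have "\<dots> = edge_tr ?q ?p (A t)"
        unfolding A_def edge_tr_def using e sub[OF t] ray_top[OF X[OF t]]
        by (intro hp.cls_cmp_cls[symmetric]) (auto intro: pathin_join)
      finally show ?thesis
        using hole by blast
    qed
    then have near: "\<forall>w\<in>{0..1} \<inter> ball t e. hole ?q (stratum (g w)) \<and> A w = edge_tr ?q (stratum (g w)) (A t)"
      by (rule ballI)
    show "\<exists>T. open T \<and> t \<in> T \<and> (\<forall>w\<in>{0..1} \<inter> T. hole ?q (stratum (g w)) \<and> A w = edge_tr ?q (stratum (g w)) (A t))"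
      using e(1) by (intro exI[of _ "ball t e"] conjI near open_ball) simp
  qed
  moreover have "A 0 = hp.cls (ray_top (g 0))"
  proof -
    have "sub 0 = (\<lambda>_. ray_top (g 0) 0)"
      using ray_top[OF X[of 0]] by (auto simp: sub_def linepath_def)
    then show ?thesis
      unfolding A_def using path_homotopic_const_left[OF ray_top(1)[OF X[of 0]]] by (intro hp.cls_eqI) simp
  qed
  moreover have "A 1 = hp.cls (path_join g (ray_top (g 1)))"
  proof -
    have "sub 1 = g"
      by (auto simp: sub_def linepath_def)
    then show ?thesis
      by (simp add: A_def)
  qed
  ultimately show ?thesis
    unfolding E.transports_def by blast
qed

section \<open>Triviality over the face poset\<close>

text \<open>The faces \<open>F\<close> of the arrangement, each with the chamber vertex \<open>act F u\<close>, form a copy of the face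
  poset in \<open>hoposet\<close>. Since the ambient Euclidean space is contractible, transport of path classes
  over this copy is path independent.\<close>

lemma section_hole:
  assumes "u \<in> pverts \<Theta>" "F \<in> Faces" "G \<in> Faces" "face_le G F"
  shows "hole (G, act G u) (F, act F u)"
  using assms by (simp add: hole_def act_act)

text \<open>The homotopy classes of paths from the base chamber to the vertices over the faces form
  a local system over the face poset. Pulled back to the Euclidean space it has a global section,
  and \<open>B\<close> is that section read off cell by cell.\<close>

lemma section_potential:
  assumes u: "u \<in> pverts \<Theta>"
  obtains B where "B (\<rho> u) = hp.cls (\<lambda>_. vtx (\<rho> u, u))"
    "\<And>F. F \<in> Faces \<Longrightarrow> B F \<in> hp.fibre (vtx (\<rho> u, u)) (vtx (F, act F u))"
    "\<And>F G. F \<in> Faces \<Longrightarrow> G \<in> Faces \<Longrightarrow> face_le G F \<Longrightarrow>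
       B G = hp.cls_cmp (B F) (edge (F, act F u) (F, act F u) (G, act G u))"
proof -
  let ?v = "\<lambda>F. (F, act F u)"
  let ?c = "\<lambda>F G. edge (?v F) (?v F) (?v G)"
  \<comment> \<open>Cells near a point of \<open>F\<close> lie below \<open>F\<close> in the face
    order. The order is therefore reversed here, and the structure maps append edges leading down
    from \<open>F\<close>.\<close>
  let ?le = "\<lambda>F G. face_le G F"
  let ?fib = "\<lambda>F. hp.fibre (vtx (\<rho> u, u)) (vtx (?v F))" and ?tr = "\<lambda>F G A. hp.cls_cmp A (?c F G)"
  have v: "?v F \<in> hoposet" if "F \<in> Faces" for F
    using act_in_hoposet[OF u that] .
  have "poset_system Faces ?le ?fib ?tr"
    by (rule hp.poset_system_fibre)
      (use v section_hole[OF u] hole_refl in \<open>auto simp: face_le_refl edge_ends pathin_edge_top intro: face_le_trans edge_cocycle(2)\<close>)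
  moreover have "stratification euclidean Faces ?le (cell \<A>)"
    by unfold_locales (auto simp: cell_face open_faces_below)
  ultimately have sys: "stratified_system euclidean Faces ?le (cell \<A>) ?fib ?tr"
    by (rule stratified_system.intro)
  have \<rho>u: "\<rho> u \<in> Faces" "act (\<rho> u) u = u"
    using u by (auto simp: chamber_vertex chamber_face act_self face_le_refl)
  obtain b where b: "b \<in> \<rho> u"
    using face_nonempty \<rho>u by blast
  have cb: "cell \<A> b = \<rho> u"
    using face_cell[OF \<rho>u(1) b] by simp
  have base: "hp.cls (\<lambda>_. vtx (\<rho> u, u)) \<in> ?fib (cell \<A> b)"
    unfolding cb using \<rho>u vtx_in[OF chamber_in_hoposet[OF u]] by (intro hp.in_fibre) auto
  have "\<exists>A. A b = hp.cls (\<lambda>_. vtx (\<rho> u, u)) \<and> (\<forall>y. A y \<in> ?fib (cell \<A> y)) \<and>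
      (\<forall>y. \<exists>T. open T \<and> y \<in> T \<and> (\<forall>w\<in>T. A w = ?tr (cell \<A> y) (cell \<A> w) (A y))) \<and>
      (\<forall>S y w. connected S \<longrightarrow> y \<in> S \<longrightarrow> w \<in> S \<longrightarrow> (\<forall>z\<in>S. cell \<A> z = cell \<A> y) \<longrightarrow> A w = A y)"
    (is "\<exists>A. ?P A")
  proof (rule global_potential[OF sys base])
    fix A assume 1: "A b = hp.cls (\<lambda>_. vtx (\<rho> u, u))" and 2: "\<And>y. A y \<in> ?fib (cell \<A> y)"
      and 3: "\<And>y. \<exists>T. open T \<and> y \<in> T \<and> (\<forall>w\<in>T. A w = ?tr (cell \<A> y) (cell \<A> w) (A y))"
      and 4: "\<And>S y w. connected S \<Longrightarrow> y \<in> S \<Longrightarrow> w \<in> S \<Longrightarrow> (\<And>z. z \<in> S \<Longrightarrow> cell \<A> z = cell \<A> y) \<Longrightarrow> A w = A y"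
    have "?P A"
    proof (intro conjI)
      show "A b = hp.cls (\<lambda>_. vtx (\<rho> u, u))"
        by (rule 1)
      show "\<forall>y. A y \<in> ?fib (cell \<A> y)"
        by (rule allI, rule 2)
      show "\<forall>y. \<exists>T. open T \<and> y \<in> T \<and> (\<forall>w\<in>T. A w = ?tr (cell \<A> y) (cell \<A> w) (A y))"
        by (rule allI, rule 3)
      show "\<forall>S y w. connected S \<longrightarrow> y \<in> S \<longrightarrow> w \<in> S \<longrightarrow> (\<forall>z\<in>S. cell \<A> z = cell \<A> y) \<longrightarrow> A w = A y"
      proof (intro allI impI)
        fix S y w assume S: "connected S" "y \<in> S" "w \<in> S" and const: "\<forall>z\<in>S. cell \<A> z = cell \<A> y"
        show "A w = A y"
          by (rule 4[OF S const[rule_format]])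
      qed
    qed
    then show "\<exists>A. ?P A"
      by (rule exI[where P = ?P and x = A])
  qed
  then obtain A where A: "?P A"
    by (rule exE)
  note A1 = A[THEN conjunct1] and A2 = A[THEN conjunct2, THEN conjunct1, rule_format]
    and A3 = A[THEN conjunct2, THEN conjunct2, THEN conjunct1, THEN spec]
    and A4 = A[THEN conjunct2, THEN conjunct2, THEN conjunct2, THEN spec, THEN spec, THEN spec, THEN mp, THEN mp, THEN mp, THEN mp]
  \<comment> \<open>The section is constant on each cell, because cells are connected; hence the
    choice of the point is immaterial.\<close>
  define B where "B F = A (SOME y. y \<in> F)" for F
  have B: "A y = B F" if F: "F \<in> Faces" and y: "y \<in> F" for F y
  proof -
    have some: "(SOME y. y \<in> F) \<in> F"
      using y by (rule someI)
    have conn: "connected F"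
      using face_cell[OF F y] convex_cell[of \<A> y] convex_connected by metis
    have "cell \<A> z = cell \<A> (SOME y. y \<in> F)" if "z \<in> F" for z
      using face_cell[OF F that] face_cell[OF F some] by simp
    then have "\<forall>z\<in>F. cell \<A> z = cell \<A> (SOME y. y \<in> F)"
      by blast
    then show ?thesis
      unfolding B_def by (rule A4[OF conn some y])
  qed
  show ?thesis
  proof
    show "B (\<rho> u) = hp.cls (\<lambda>_. vtx (\<rho> u, u))"
      using B[OF \<rho>u(1) b] A1 by simp
    fix F assume F: "F \<in> Faces"
    obtain y where y: "y \<in> F"
      using face_nonempty[OF F] by blast
    have cy: "cell \<A> y = F"
      using face_cell[OF F y] by simp
    show "B F \<in> ?fib F"
      using A2[of y] B[OF F y] cy by simp
    fix G assume G: "G \<in> Faces" "face_le G F"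
    obtain T where T: "open T" "y \<in> T" "\<forall>w\<in>T. A w = ?tr (cell \<A> y) (cell \<A> w) (A y)"
      using A3[of y] by blast
    \<comment> \<open>The order relation says that \<open>F\<close> lies in the closure of
      \<open>G\<close>, so the neighbourhood on which the section is known from \<open>y\<close>
      contains a point of \<open>G\<close>.\<close>
    have "y \<in> closure G"
      using G(2) y closure_subset by (auto simp: face_le_def)
    then obtain w where w: "w \<in> G" "w \<in> T"
      using T(2) open_Int_closure_eq_empty[OF T(1), of G] by blast
    have "A w = ?tr (cell \<A> y) (cell \<A> w) (A y)"
      using T w by blast
    then show "B G = hp.cls_cmp (B F) (?c F G)"
      using B[OF F y] B[OF G(1) w(1)] cy face_cell[OF G(1) w(1)] by simp
  qed
qed

end

context path_groupoid
begin

lemma left_inverse_unique: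
  assumes "(cmp \<beta> \<epsilon>, idp x) \<in> r" "\<beta> \<in> P" "\<epsilon> \<in> P" "tgt \<beta> = src \<epsilon>"
  shows "(\<beta>, inv_path \<epsilon>) \<in> r"
proof (rule cmp_left_cancel)
  have x: "x = tgt \<epsilon>"
    using tgt_r[OF assms(1)] assms by (simp add: cmp_simps)
  have "(cmp \<beta> \<epsilon>, idp x) \<in> r"
    by (rule assms)
  also have "(idp x, cmp (inv_path \<epsilon>) \<epsilon>) \<in> r"
    unfolding x by (rule sym_r[OF inv_left[OF assms(3)]])
  finally show "(cmp \<beta> \<epsilon>, cmp (inv_path \<epsilon>) \<epsilon>) \<in> r" .
qed (use assms in \<open>auto simp: cmp_simps\<close>)

end

section \<open>Realization of paths of the cover\<close>

context arrangement_cover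
begin

definition base :: "'v \<Rightarrow> 'a set \<times> 'v" where
  "base u = (\<rho> u, u)"

lemma base_simps [simp]: "fst (base u) = \<rho> u" "snd (base u) = u"
  by (simp_all add: base_def)

lemma base_in: "u \<in> pverts \<Theta> \<Longrightarrow> base u \<in> hoposet"
  by (simp add: base_def chamber_in_hoposet)

lemma base_hole: "p \<in> hoposet \<Longrightarrow> hole (base (snd p)) p"
  by (auto simp: hole_def hoposet_def act_self chamber_vertex chamber_face face_le_refl)

definition wall_face :: "'v \<Rightarrow> 'v \<Rightarrow> 'a set" where
  "wall_face u w = (SOME W. W \<in> Faces \<and>
     (\<forall>H\<in>\<A>. sd W H = (if H \<in> sep (\<rho> u) (\<rho> w) then 0 else sd (\<rho> u) H)))"

lemma edge_vertices:
  assumes "(u, w) \<in> parcs \<Theta>"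
  shows "u \<in> pverts \<Theta>" "w \<in> pverts \<Theta>"
  using assms in_arcsD1 in_arcsD2 by auto

lemma card_sep_edge: "(u, w) \<in> parcs \<Theta> \<Longrightarrow> card (sep (\<rho> u) (\<rho> w)) = 1"
  using edge_map parcs_iff by blast

lemma wall_face:
  assumes "(u, w) \<in> parcs \<Theta>"
  shows "wall_face u w \<in> Faces"
    "H \<in> \<A> \<Longrightarrow> sd (wall_face u w) H = (if H \<in> sep (\<rho> u) (\<rho> w) then 0 else sd (\<rho> u) H)"
proof -
  obtain H where H: "sep (\<rho> u) (\<rho> w) = {H}"
    using card_sep_edge[OF assms] card_1_singletonE by blast
  obtain W where "W \<in> Faces" "sd W H = 0" "\<And>H'. H' \<in> \<A> \<Longrightarrow> H' \<noteq> H \<Longrightarrow> sd W H' = sd (\<rho> u) H'"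
    using wall[OF _ _ H] edge_vertices[OF assms] chamber_vertex by metis
  then have "W \<in> Faces \<and> (\<forall>H\<in>\<A>. sd W H = (if H \<in> sep (\<rho> u) (\<rho> w) then 0 else sd (\<rho> u) H))"
    using H by auto
  from someI[of "\<lambda>W. W \<in> Faces \<and> (\<forall>H\<in>\<A>. sd W H = (if H \<in> sep (\<rho> u) (\<rho> w) then 0 else sd (\<rho> u) H))", OF this]
  show "wall_face u w \<in> Faces"
    "H \<in> \<A> \<Longrightarrow> sd (wall_face u w) H = (if H \<in> sep (\<rho> u) (\<rho> w) then 0 else sd (\<rho> u) H)" for H
    unfolding wall_face_def by blast+
qed

lemma wall_face_le:
  assumes "(u, w) \<in> parcs \<Theta>"
  shows "face_le (\<rho> u) (wall_face u w)" "face_le (\<rho> w) (wall_face u w)"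
  using wall_face[OF assms] edge_vertices[OF assms]
  by (auto simp: face_le_iff chamber_vertex chamber_face sep_def split: if_splits)

lemma wall_vertex_in: "(u, w) \<in> parcs \<Theta> \<Longrightarrow> (wall_face u w, u) \<in> hoposet"
  using edge_vertices wall_face wall_face_le by (simp add: hoposet_def)

lemma chamber_at_chamber:
  assumes "C \<in> chambers \<A>" "D \<in> chambers \<A>"
  shows "chamber_at \<A> C D = D"
  using assms chamber_at[of D C] by (intro face_eqI) (auto simp: chamber_face chamber_iff)

text \<open>The chamber at a chamber \<open>D\<close> is \<open>D\<close> itself. So a minimal path
  from \<open>u\<close> ends at the vertex that the copy of the face poset through \<open>u\<close>
  has over its end chamber.\<close>

lemma minimal_path_act:
  assumes "minimal_path u \<gamma> w"
  shows "act (\<rho> w) u = w"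
  using minimal_path_vertices[OF assms]
  by (intro act_eqI[OF assms]) (auto simp: chamber_at_chamber chamber_vertex chamber_face)

abbreviation arrow :: "'v \<Rightarrow> 'v \<Rightarrow> 'v signed_path" where
  "arrow u w \<equiv> (u, [((u, w), True)])"

lemma minimal_path_arrow:
  assumes "(u, w) \<in> parcs \<Theta>"
  shows "minimal_path u (arrow u w) w"
  using assms card_sep_edge[OF assms] edge_vertices[OF assms]
  by (simp add: minimal_path_def signed_paths_def positive_path_def path_begin_def step_begin_def step_end_def)

lemma wall_hole:
  assumes "(u, w) \<in> parcs \<Theta>"
  shows "hole (base u) (wall_face u w, u)" "hole (base w) (wall_face u w, u)"
  using base_hole[OF wall_vertex_in[OF assms]] wall_face_le[OF assms] minimal_path_act[OF minimal_path_arrow[OF assms]]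
  by (auto simp: hole_def)

definition arc_path :: "'v \<Rightarrow> 'v \<Rightarrow> real \<Rightarrow> ('a set \<times> 'v \<times> ('a set \<Rightarrow> real)) set" where
  "arc_path u w = (let p = (wall_face u w, u) in path_join (edge p (base u) p) (edge p p (base w)))"

definition step_path :: "('v \<times> 'v) \<times> bool \<Rightarrow> real \<Rightarrow> ('a set \<times> 'v \<times> ('a set \<Rightarrow> real)) set" where
  "step_path e = (if snd e then arc_path (fst (fst e)) (snd (fst e)) else path_reverse (arc_path (fst (fst e)) (snd (fst e))))"

fun rpath :: "'v \<Rightarrow> (('v \<times> 'v) \<times> bool) list \<Rightarrow> real \<Rightarrow> ('a set \<times> 'v \<times> ('a set \<Rightarrow> real)) set" where
  "rpath u [] = (\<lambda>_. vtx (base u))"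
| "rpath u (e # es) = path_join (step_path e) (rpath (step_end e) es)"

definition realize :: "'v signed_path \<Rightarrow> real \<Rightarrow> ('a set \<times> 'v \<times> ('a set \<Rightarrow> real)) set" where
  "realize \<alpha> = rpath (fst \<alpha>) (snd \<alpha>)"

lemma arc_path:
  assumes "(u, w) \<in> parcs \<Theta>"
  shows "pathin hospace (arc_path u w)" "arc_path u w 0 = vtx (base u)" "arc_path u w 1 = vtx (base w)"
proof -
  let ?p = "(wall_face u w, u)"
  note p = wall_vertex_in[OF assms] base_in[OF edge_vertices(1)[OF assms]] base_in[OF edge_vertices(2)[OF assms]]
    wall_hole[OF assms] hole_refl[OF wall_vertex_in[OF assms]]
  show "pathin hospace (arc_path u w)"
    unfolding arc_path_def Let_def
    by (intro pathin_join pathin_edge_top) (use p in \<open>simp_all only: edge_ends\<close>)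
  show "arc_path u w 0 = vtx (base u)" "arc_path u w 1 = vtx (base w)"
    unfolding arc_path_def Let_def path_join_0 path_join_1 by (use p in \<open>simp_all only: edge_ends\<close>)
qed

lemma step_path:
  assumes "fst e \<in> parcs \<Theta>"
  shows "pathin hospace (step_path e)" "step_path e 0 = vtx (base (step_begin e))" "step_path e 1 = vtx (base (step_end e))"
  using assms arc_path[of "fst (fst e)" "snd (fst e)"]
  by (auto simp: step_path_def step_begin_def step_end_def pathin_reverse)

lemma step_path_flip: "step_path (flip_step e) = path_reverse (step_path e)"
  by (auto simp: step_path_def split: prod.splits)

lemma rpath:
  assumes "signed_walk \<Theta> u es"
  shows "pathin hospace (rpath u es)" "rpath u es 0 = vtx (base u)" "rpath u es 1 = vtx (base (path_end (u, es)))"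
proof -
  have "pathin hospace (rpath u es) \<and> rpath u es 0 = vtx (base u) \<and> rpath u es 1 = vtx (base (path_end (u, es)))"
    using assms
  proof (induction es arbitrary: u)
    case Nil
    then show ?case
      by (simp add: vtx_in base_in)
  next
    case (Cons e es)
    then show ?case
      using step_path[of e] by (auto intro!: pathin_join)
  qed
  then show "pathin hospace (rpath u es)" "rpath u es 0 = vtx (base u)" "rpath u es 1 = vtx (base (path_end (u, es)))"
    by auto
qed

lemma realize:
  assumes "\<alpha> \<in> signed_paths \<Theta>"
  shows "pathin hospace (realize \<alpha>)" "realize \<alpha> 0 = vtx (base (path_begin \<alpha>))" "realize \<alpha> 1 = vtx (base (path_end \<alpha>))"
  using assms rpath[of "fst \<alpha>" "snd \<alpha>"] by (cases \<alpha>; simp add: realize_def signed_paths_def path_begin_def)+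

lemma rpath_append:
  assumes "signed_walk \<Theta> u (es @ fs)"
  shows "path_homotopic hospace (rpath u (es @ fs)) (path_join (rpath u es) (rpath (path_end (u, es)) fs))"
  using assms
proof (induction es arbitrary: u)
  case Nil
  then show ?case
    using path_homotopic_sym[OF path_homotopic_const_left[OF rpath(1)[of u fs]]] rpath(2)[of u fs] by simp
next
  case (Cons e es)
  have e: "fst e \<in> parcs \<Theta>"
    and walks: "signed_walk \<Theta> (step_end e) es" "signed_walk \<Theta> (path_end (step_end e, es)) fs"
    using Cons.prems by (auto simp: signed_walk_append)
  note s = step_path[OF e] rpath[OF walks(1)] rpath[OF walks(2)]
  have "path_homotopic hospace (path_join (step_path e) (rpath (step_end e) (es @ fs)))
      (path_join (step_path e) (path_join (rpath (step_end e) es) (rpath (path_end (step_end e, es)) fs)))"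
    using Cons s by (intro path_homotopic_join path_homotopic_refl Cons.IH) (auto simp: rpath(2))
  also have "path_homotopic hospace \<dots>
      (path_join (path_join (step_path e) (rpath (step_end e) es)) (rpath (path_end (step_end e, es)) fs))"
    using s by (intro path_homotopic_sym[OF path_homotopic_assoc]) auto
  finally show ?case
    by simp
qed

lemma realize_comp:
  assumes "\<alpha> \<in> signed_paths \<Theta>" "\<beta> \<in> signed_paths \<Theta>" "path_end \<alpha> = path_begin \<beta>"
  shows "path_homotopic hospace (realize (\<alpha> \<bullet>\<^sub>p \<beta>)) (path_join (realize \<alpha>) (realize \<beta>))"
proof -
  obtain u es v fs where ab: "\<alpha> = (u, es)" "\<beta> = (v, fs)"
    by fastforce
  then have "signed_walk \<Theta> u (es @ fs)" "path_end (u, es) = v"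
    using assms by (auto simp: signed_paths_def signed_walk_append path_begin_def)
  then show ?thesis
    using rpath_append[of u es fs] by (simp add: ab realize_def path_comp_def)
qed

lemma realize_const: "realize (const_path u) = (\<lambda>_. vtx (base u))"
  by (simp add: realize_def const_path_def)

lemma realize_arrow: "(u, w) \<in> parcs \<Theta> \<Longrightarrow> path_homotopic hospace (realize (arrow u w)) (arc_path u w)"
  using path_homotopic_const_right[OF arc_path(1)[of u w]] arc_path(3)[of u w]
  by (simp add: realize_def step_path_def step_end_def)

text \<open>The realization of an inverse path differs from the reversed realization in its
  bracketing and its constant tail. The induction peels off the first step, which is the last one of
  the inverse, and cancels from the inside out.\<close>

lemma realize_inverse:
  assumes "\<alpha> \<in> signed_paths \<Theta>"
  shows "path_homotopic hospace (path_join (realize \<alpha>) (realize (path_inverse \<alpha>))) (\<lambda>_. vtx (base (path_begin \<alpha>)))"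
proof -
  have "path_homotopic hospace (path_join (rpath u es) (rpath (path_end (u, es)) (rev (map flip_step es)))) (\<lambda>_. vtx (base u))"
    if "signed_walk \<Theta> u es" for u es
    using that
  proof (induction es arbitrary: u)
    case Nil
    then show ?case
      using path_homotopic_const_left[of hospace "\<lambda>_. vtx (base u)"] vtx_in[OF base_in] by simp
  next
    case (Cons e es)
    let ?v = "step_end e" and ?w = "path_end (step_end e, es)" and ?fs = "rev (map flip_step es)"
    have e: "fst e \<in> parcs \<Theta>" "step_begin e = u" and w: "signed_walk \<Theta> ?v es"
      using Cons.prems by auto
    have rw: "signed_walk \<Theta> ?w ?fs" "path_end (?w, ?fs) = ?v"
      using signed_walk_reverse[OF w] by auto
    have flip: "fst (flip_step e) \<in> parcs \<Theta>" "signed_walk \<Theta> ?v [flip_step e]"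
      using e Cons.prems signed_walk_start[OF Cons.prems] by (auto split: prod.splits simp: step_begin_def step_end_def)
    have rw': "signed_walk \<Theta> ?w (?fs @ [flip_step e])"
      using rw flip by (simp add: signed_walk_append)
    let ?s = "step_path e" and ?a = "rpath ?v es" and ?b = "rpath ?w ?fs"
    note s = step_path[OF e(1)] pathin_reverse[OF step_path(1)[OF e(1)]] and a = rpath[OF w] and b = rpath[OF rw(1)]
    have "path_homotopic hospace (rpath ?w (?fs @ [flip_step e])) (path_join ?b (rpath ?v [flip_step e]))"
      using rpath_append[OF rw'] rw(2) by simp
    also have "path_homotopic hospace (path_join ?b (rpath ?v [flip_step e])) (path_join ?b (path_reverse ?s))"
    proof -
      have "path_homotopic hospace (path_join (path_reverse ?s) (\<lambda>_. path_reverse ?s 1)) (path_reverse ?s)"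
        by (rule path_homotopic_const_right[OF s(4)])
      then have "path_homotopic hospace (rpath ?v [flip_step e]) (path_reverse ?s)"
        using s e by (simp add: step_path_flip)
      then show ?thesis
        using b rw(2) s rpath(2)[OF flip(2)] by (intro path_homotopic_join path_homotopic_refl) auto
    qed
    finally have "path_homotopic hospace (path_join (path_join ?s ?a) (rpath ?w (?fs @ [flip_step e])))
        (path_join (path_join ?s ?a) (path_join ?b (path_reverse ?s)))"
      using s a rpath(2)[OF rw'] by (intro path_homotopic_join path_homotopic_refl pathin_join) auto
    also have "path_homotopic hospace \<dots> (path_join (path_join (path_join ?s ?a) ?b) (path_reverse ?s))"
      using s a b rw(2) by (intro path_homotopic_sym[OF path_homotopic_assoc] pathin_join) auto
    also have "path_homotopic hospace \<dots> (path_join ?s (path_reverse ?s))"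
    proof -
      have "path_homotopic hospace (path_join (path_join ?s ?a) ?b) (path_join ?s (path_join ?a ?b))"
        using s a b by (intro path_homotopic_assoc) auto
      also have "path_homotopic hospace \<dots> (path_join ?s (\<lambda>_. ?s 1))"
        using s a Cons.IH[OF w] by (intro path_homotopic_join path_homotopic_refl) auto
      also have "path_homotopic hospace \<dots> ?s"
        by (rule path_homotopic_const_right[OF s(1)])
      finally show ?thesis
        using s b rw(2) by (intro path_homotopic_join path_homotopic_refl) auto
    qed
    also have "path_homotopic hospace \<dots> (\<lambda>_. ?s 0)"
      by (rule path_homotopic_reverse_right[OF s(1)])
    finally show ?case
      using s e by simp
  qed
  then show ?thesis
    using assms by (cases \<alpha>) (simp add: signed_paths_def realize_def path_inverse_def path_begin_def)
qed

text \<open>A minimal path starting at \<open>u\<close> is realized inside the copy of the face poset through \<open>u\<close>.\<close>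

lemma realize_minimal:
  assumes B0: "B (\<rho> u) = hp.cls (\<lambda>_. vtx (base u))"
    and B1: "\<And>F. F \<in> Faces \<Longrightarrow> B F \<in> hp.fibre (vtx (base u)) (vtx (F, act F u))"
    and B2: "\<And>F G. F \<in> Faces \<Longrightarrow> G \<in> Faces \<Longrightarrow> face_le G F \<Longrightarrow>
       B G = hp.cls_cmp (B F) (edge (F, act F u) (F, act F u) (G, act G u))"
    and min: "minimal_path u \<gamma> w"
  shows "hp.cls (realize \<gamma>) = B (\<rho> w)"
proof -
  have "hp.cls (rpath u es) = B (\<rho> w)" if "minimal_path u (u, es) w" for es w
    using that
  proof (induction es arbitrary: w rule: rev_induct)
    case Nil
    then show ?case
      using B0 by (auto simp: minimal_path_def path_begin_def)
  next
    case (snoc e es)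
    define v where "v = path_end (u, es)"
    have walk: "signed_walk \<Theta> u es" "signed_walk \<Theta> v [e]" and whole: "signed_walk \<Theta> u (es @ [e])"
      and pos: "positive_path (u, es)" "snd e"
      and w: "path_end (v, [e]) = w" and len: "Suc (length es) = card (sep (\<rho> u) (\<rho> w))"
      using snoc.prems by (auto simp: minimal_path_def signed_paths_def signed_walk_append positive_path_def v_def)
    have e: "e = ((v, w), True)"
      using walk(2) pos(2) w by (cases e) (auto simp: step_begin_def step_end_def)
    have arrow: "(v, w) \<in> parcs \<Theta>"
      using walk(2) e by simp
    obtain H where H: "sep (\<rho> v) (\<rho> w) = {H}" "H \<in> \<A>"
      using card_sep_edge[OF arrow] by (metis (no_types, lifting) card_1_singletonE insertI1 mem_Collect_eq sep_def)
    have chs: "\<rho> u \<in> chambers \<A>" "\<rho> v \<in> chambers \<A>" "\<rho> w \<in> chambers \<A>"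
      using signed_walk_start[OF walk(1)] edge_vertices[OF arrow] chamber_vertex by auto
    have le: "card (sep (\<rho> u) (\<rho> v)) \<le> length es"
    proof -
      have "map_path \<rho> (u, es) \<in> signed_paths (arrangement_graph \<A>)"
        using walk(1) by (intro signed_paths_map) (simp add: signed_paths_def)
      then have "signed_walk (arrangement_graph \<A>) (\<rho> u) (snd (map_path \<rho> (u, es)))"
        by (simp add: signed_paths_def map_path_def)
      moreover have "(\<rho> u, snd (map_path \<rho> (u, es))) = map_path \<rho> (u, es)"
        by (simp add: map_path_def)
      moreover have "length (snd (map_path \<rho> (u, es))) = length es"
        by (simp add: map_path_def)
      ultimately show ?thesis
        using card_sep_le_length[of "\<rho> u" "snd (map_path \<rho> (u, es))"] pos(1) by (simp add: v_def)
    qed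
    \<comment> \<open>Dropping the last edge of a minimal path leaves a minimal path: the triangle
      inequality supplies the bound opposite to \<open>le\<close>.\<close>
    have card_v: "card (sep (\<rho> u) (\<rho> v)) = length es"
      using le card_sep_triangle[of "\<rho> u" "\<rho> w" "\<rho> v"] H(1) len by simp
    then have min_v: "minimal_path u (u, es) v"
      using walk(1) pos(1) by (simp add: minimal_path_def signed_paths_def path_begin_def v_def)
    \<comment> \<open>Had \<open>H\<close> been crossed before, the last edge would return to the
      side of \<open>u\<close>, and then \<open>w\<close> would be separated from \<open>u\<close>
      by no more hyperplanes than \<open>v\<close>, which the length excludes.\<close>
    have not_sep: "H \<notin> sep (\<rho> u) (\<rho> v)"
    proof
      assume Huv: "H \<in> sep (\<rho> u) (\<rho> v)"
      have "sd (\<rho> v) H \<noteq> sd (\<rho> w) H" "sd (\<rho> u) H \<noteq> sd (\<rho> v) H"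
        using Huv H by (auto simp: sep_def)
      moreover have "sd (\<rho> u) H \<noteq> 0" "sd (\<rho> v) H \<noteq> 0" "sd (\<rho> w) H \<noteq> 0"
        using chs H(2) by (auto simp: chamber_iff)
      ultimately have "sd (\<rho> u) H = sd (\<rho> w) H"
        using sd_cases[of "\<rho> u" H] sd_cases[of "\<rho> v" H] sd_cases[of "\<rho> w" H] by auto
      moreover have "sd (\<rho> v) H' = sd (\<rho> w) H'" if "H' \<in> \<A>" "H' \<noteq> H" for H'
        using H(1) that by (auto simp: sep_def)
      ultimately have "sd (\<rho> u) H' \<noteq> sd (\<rho> v) H'" if "H' \<in> \<A>" "sd (\<rho> u) H' \<noteq> sd (\<rho> w) H'" for H'
        using that by (cases "H' = H") simp_all
      then have "sep (\<rho> u) (\<rho> w) \<subseteq> sep (\<rho> u) (\<rho> v)"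
        by (auto simp: sep_def)
      then have "card (sep (\<rho> u) (\<rho> w)) \<le> card (sep (\<rho> u) (\<rho> v))"
        by (intro card_mono finite_sep)
      then show False
        using card_v len by simp
    qed
    let ?W = "wall_face v w"
    let ?p = "(?W, v)"
    note W = wall_face[OF arrow] and le_W = wall_face_le[OF arrow]
    \<comment> \<open>The wall has its only zero at \<open>H\<close>, and there \<open>v\<close> has
      the sign of \<open>u\<close>. So the copy of the face poset through \<open>u\<close> contains
      the wall together with the vertex \<open>v\<close>.\<close>
    have "\<rho> v = chamber_at \<A> (\<rho> u) ?W"
    proof (rule face_eqI)
      fix H' assume H': "H' \<in> \<A>"
      show "sd (\<rho> v) H' = sd (chamber_at \<A> (\<rho> u) ?W) H'"
      proof (cases "H' = H")
        case True
        then have "sd ?W H' = 0" "sd (\<rho> v) H' = sd (\<rho> u) H'"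
          using W(2)[OF H'] H not_sep by (auto simp: sep_def)
        then show ?thesis
          using chamber_at(2)[OF W(1) chs(1) H'] by simp
      next
        case False
        then have "sd ?W H' = sd (\<rho> v) H'" "sd (\<rho> v) H' \<noteq> 0"
          using W(2)[OF H'] H(1) chs(2) H' by (simp_all add: chamber_iff)
        then show ?thesis
          using chamber_at(2)[OF W(1) chs(1) H'] by simp
      qed
    qed (use chs chamber_at(1)[OF W(1) chs(1)] in \<open>simp_all add: chamber_face\<close>)
    then have act_W: "act ?W u = v"
      by (intro act_eqI[OF min_v _ W(1)])
    have act_v: "act (\<rho> v) u = v" and act_w: "act (\<rho> w) u = w"
      using minimal_path_act[OF min_v] minimal_path_act[OF snoc.prems] by auto
    obtain \<beta> where \<beta>: "B ?W = hp.cls \<beta>" "pathin hospace \<beta>" "\<beta> 0 = vtx (base u)" "\<beta> 1 = vtx ?p"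
      using B1[OF W(1)] act_W by (auto elim: hp.fibreE)
    let ?e1 = "edge ?p ?p (base v)" and ?e2 = "edge ?p ?p (base w)"
    have in_ho: "?p \<in> hoposet" "base v \<in> hoposet" "base w \<in> hoposet" "hole (base v) ?p" "hole (base w) ?p" "hole ?p ?p"
      using wall_vertex_in[OF arrow] wall_hole[OF arrow] edge_vertices[OF arrow] by (auto simp: base_in hole_refl)
    have e12: "pathin hospace ?e1" "?e1 0 = vtx ?p" "?e1 1 = vtx (base v)"
      "pathin hospace ?e2" "?e2 0 = vtx ?p" "?e2 1 = vtx (base w)"
      "edge ?p (base v) ?p 0 = vtx (base v)" "edge ?p (base v) ?p 1 = vtx ?p"
      using in_ho by (auto simp: pathin_edge_top edge_ends)
    \<comment> \<open>At both chambers the section is its value at the wall followed by an edge. The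
      arc from \<open>v\<close> to \<open>w\<close> backtracks the first of these edges and follows
      the second.\<close>
    have Bv: "B (\<rho> v) = hp.cls (path_join \<beta> ?e1)"
      using B2[OF W(1) chamber_face[OF chs(2)] le_W(1)] \<beta> e12 act_W act_v
      by (simp add: hp.cls_cmp_cls base_def)
    have Bw: "B (\<rho> w) = hp.cls (path_join \<beta> ?e2)"
      using B2[OF W(1) chamber_face[OF chs(3)] le_W(2)] \<beta> e12 act_W act_w
      by (simp add: hp.cls_cmp_cls base_def)
    note r = rpath[OF walk(1), folded v_def] and re = rpath[OF walk(2)]
    have IH: "path_homotopic hospace (rpath u es) (path_join \<beta> ?e1)"
    proof -
      have "hp.cls (rpath u es) = hp.cls (path_join \<beta> ?e1)"
        using snoc.IH[OF min_v] Bv by simp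
      then show ?thesis
        using hp.cls_eq_iff[of "rpath u es" "path_join \<beta> ?e1"] r \<beta> e12 by (simp add: pathin_join)
    qed
    have "path_homotopic hospace (rpath u (es @ [e])) (path_join (rpath u es) (rpath v [e]))"
      using rpath_append[OF whole] by (simp add: v_def)
    also have "path_homotopic hospace \<dots> (path_join (path_join \<beta> ?e1) (path_join (path_reverse ?e1) ?e2))"
    proof -
      have "path_homotopic hospace (rpath v [e]) (arc_path v w)"
        using realize_arrow[OF arrow] by (simp add: realize_def e)
      then have "path_homotopic hospace (rpath v [e]) (path_join (path_reverse ?e1) ?e2)"
        by (simp add: arc_path_def Let_def)
      then show ?thesis
        using IH r re by (intro path_homotopic_join) auto
    qed
    also have "path_homotopic hospace \<dots> (path_join (path_join (path_join \<beta> ?e1) (path_reverse ?e1)) ?e2)"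
      using \<beta> e12 by (intro path_homotopic_sym[OF path_homotopic_assoc] pathin_join pathin_reverse) auto
    also have "path_homotopic hospace \<dots> (path_join \<beta> ?e2)"
    proof -
      have "path_homotopic hospace (path_join (path_join \<beta> ?e1) (path_reverse ?e1)) \<beta>"
        using hp.cmp_cancel_right[of \<beta> ?e1] \<beta> e12 by simp
      then show ?thesis
        using e12 \<beta> by (intro path_homotopic_join path_homotopic_refl) auto
    qed
    finally show ?case
      unfolding Bw by (intro hp.cls_eqI) simp
  qed
  moreover have "\<gamma> = (u, snd \<gamma>)"
    using min by (cases \<gamma>) (auto simp: minimal_path_def path_begin_def)
  ultimately show ?thesis
    using min unfolding realize_def by (metis fst_conv)
qed

text \<open>Both realizations represent the value of one and the same section at the end
  chamber.\<close>

lemma realize_minimal_unique: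
  assumes "minimal_path u \<alpha> w" "minimal_path u \<beta> w"
  shows "path_homotopic hospace (realize \<alpha>) (realize \<beta>)"
proof -
  have u: "u \<in> pverts \<Theta>"
    using minimal_path_vertices[OF assms(1)] by blast
  have "hp.cls (realize \<alpha>) = hp.cls (realize \<beta>)"
  proof (rule section_potential[OF u])
    fix B assume B: "B (\<rho> u) = hp.cls (\<lambda>_. vtx (\<rho> u, u))"
      "\<And>F. F \<in> Faces \<Longrightarrow> B F \<in> hp.fibre (vtx (\<rho> u, u)) (vtx (F, act F u))"
      "\<And>F G. F \<in> Faces \<Longrightarrow> G \<in> Faces \<Longrightarrow> face_le G F \<Longrightarrow>
         B G = hp.cls_cmp (B F) (edge (F, act F u) (F, act F u) (G, act G u))"
    have "hp.cls (realize \<gamma>) = B (\<rho> w)" if "minimal_path u \<gamma> w" for \<gamma>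
      by (rule realize_minimal[OF _ _ B(3) that]) (use B(1,2) in \<open>simp_all add: base_def\<close>)
    then show ?thesis
      using assms by metis
  qed
  then show ?thesis
    using assms hp.cls_eq_iff[of "realize \<alpha>" "realize \<beta>"] by (simp add: realize minimal_path_def)
qed

text \<open>Induction on the relation of the arrangement, for all lifts with a common beginning.
  Intermediate paths exist only downstairs, so each rule has to lift them and match their ends; that
  related lifts end together is provided by \<open>R\<close>.\<close>

lemma realize_lift_relation:
  assumes "(a, b) \<in> arrangement_relation \<A>"
  shows "\<alpha> \<in> signed_paths \<Theta> \<Longrightarrow> \<beta> \<in> signed_paths \<Theta> \<Longrightarrow> path_begin \<alpha> = path_begin \<beta> \<Longrightarrow>
    map_path \<rho> \<alpha> = a \<Longrightarrow> map_path \<rho> \<beta> = b \<Longrightarrow> path_homotopic hospace (realize \<alpha>) (realize \<beta>)"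
  using assms unfolding arrangement_relation_def
proof (induction arbitrary: \<alpha> \<beta>)
  case (gen_base a b)
  then obtain A B where ab: "a \<in> minimal_positive_paths (arrangement_graph \<A>) A B"
    "b \<in> minimal_positive_paths (arrangement_graph \<A>) A B"
    by blast
  have AB: "A = \<rho> (path_begin \<alpha>)" "B = \<rho> (path_end \<alpha>)"
    using ab(1) gen_base.prems by (auto simp: minimal_positive_paths_def)
  have B: "B \<in> chambers \<A>"
    unfolding AB(2) by (rule chamber_vertex[OF signed_paths_end[OF gen_base.prems(1)]])
  have "map_path \<rho> \<alpha> \<in> minimal_positive_paths (arrangement_graph \<A>) (\<rho> (path_begin \<alpha>)) B"
    using ab(1) gen_base.prems(4) AB(1) by simp
  note \<alpha> = minimal_path_of_lift[OF gen_base.prems(1) refl this B]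
  have "map_path \<rho> \<beta> \<in> minimal_positive_paths (arrangement_graph \<A>) (\<rho> (path_begin \<alpha>)) B"
    using ab(2) gen_base.prems(5) AB(1) by simp
  note \<beta> = minimal_path_of_lift[OF gen_base.prems(2) gen_base.prems(3)[symmetric] this B]
  have "path_end \<alpha> = path_end \<beta>"
    using minimal_path_unique(2)[OF \<alpha>(1) \<beta>(1)] \<alpha>(2) \<beta>(2) by simp
  then show ?case
    using realize_minimal_unique[OF \<alpha>(1)] \<beta>(1) by simp
next
  case (gen_refl a)
  then have "\<alpha> = \<beta>"
    by (intro lift_unique) simp_all
  then show ?case
    using path_homotopic_refl[OF realize(1)[OF gen_refl.prems(1)]] by simp
next
  case (gen_sym a b)
  then show ?case
    by (intro path_homotopic_sym[OF gen_sym.IH]) auto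
next
  case (gen_trans a b c)
  have "b \<in> signed_paths (arrangement_graph \<A>)" "path_begin b = \<rho> (path_begin \<alpha>)"
    using \<Gamma>.generated_relation_paths[OF gen_trans.hyps(1)] gen_trans.prems by (auto simp: minimal_positive_paths_def)
  then obtain \<gamma> where "\<gamma> \<in> signed_paths \<Theta>" "path_begin \<gamma> = path_begin \<alpha>" "map_path \<rho> \<gamma> = b"
    using lift_exists[OF signed_paths_begin[OF gen_trans.prems(1)]] by metis
  then show ?case
    using path_homotopic_trans[OF gen_trans.IH(1)[of \<alpha> \<gamma>] gen_trans.IH(2)[of \<gamma> \<beta>]] gen_trans.prems by simp
next
  case (gen_cancel a)
  then have a: "path_begin a = \<rho> (path_begin \<alpha>)"
    by (metis map_path_simps(1) path_begin_comp)
  obtain \<gamma> where \<gamma>: "\<gamma> \<in> signed_paths \<Theta>" "path_begin \<gamma> = path_begin \<alpha>" "map_path \<rho> \<gamma> = a"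
    using lift_exists[OF signed_paths_begin[OF gen_cancel.prems(1)] gen_cancel.hyps a] by metis
  have \<alpha>: "\<alpha> = \<gamma> \<bullet>\<^sub>p path_inverse \<gamma>"
    using \<gamma> gen_cancel.prems by (intro lift_unique) (auto simp: signed_paths_comp signed_paths_inverse)
  have "\<beta> = const_path (path_begin \<alpha>)"
    using gen_cancel.prems a by (intro lift_unique) (auto simp: const_path_in signed_paths_begin)
  then have \<beta>: "realize \<beta> = (\<lambda>_. vtx (base (path_begin \<gamma>)))"
    by (simp add: realize_const \<gamma>(2))
  have "path_homotopic hospace (realize (\<gamma> \<bullet>\<^sub>p path_inverse \<gamma>)) (path_join (realize \<gamma>) (realize (path_inverse \<gamma>)))"
    using \<gamma> by (intro realize_comp) (auto simp: signed_paths_inverse)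
  from path_homotopic_trans[OF this realize_inverse[OF \<gamma>(1)]] show ?case
    unfolding \<alpha>[symmetric] \<beta> .
next
  case (gen_inverse a b)
  have ab: "a \<in> signed_paths (arrangement_graph \<A>)" "b \<in> signed_paths (arrangement_graph \<A>)"
    "path_begin a = path_begin b" "path_end a = path_end b"
    using \<Gamma>.generated_relation_paths[OF gen_inverse.hyps(1)] by (auto simp: minimal_positive_paths_def)
  let ?\<alpha> = "path_inverse \<alpha>" and ?\<beta> = "path_inverse \<beta>"
  have inv: "?\<alpha> \<in> signed_paths \<Theta>" "?\<beta> \<in> signed_paths \<Theta>" "map_path \<rho> ?\<alpha> = a" "map_path \<rho> ?\<beta> = b"
    using gen_inverse.prems ab by (auto simp: signed_paths_inverse \<Gamma>.path_inverse_inverse)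
  have "path_begin b = \<rho> (path_begin ?\<alpha>)"
    using inv(3) ab(3) by (metis map_path_simps(1))
  then obtain \<gamma> where \<gamma>: "\<gamma> \<in> signed_paths \<Theta>" "path_begin \<gamma> = path_begin ?\<alpha>" "map_path \<rho> \<gamma> = b"
    using lift_exists[OF signed_paths_begin[OF inv(1)] ab(2)] by metis
  \<comment> \<open>The lift \<open>\<gamma>\<close> of \<open>b\<close> starts where the inverse of
    \<open>\<alpha>\<close> starts. Being related to that inverse, it also ends with it, so its own
    inverse begins like \<open>\<beta>\<close> and is \<open>\<beta>\<close> by uniqueness of
    lifts.\<close>
  have "(?\<alpha>, \<gamma>) \<in> R"
    using inv \<gamma> gen_inverse.hyps by (subst induced_relation) (simp add: arrangement_relation_def)
  from same_end[OF this] have "path_end \<gamma> = path_begin \<alpha>"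
    by (simp add: path_end_inverse[OF gen_inverse.prems(1)])
  then have "path_inverse \<gamma> = \<beta>"
    using \<gamma> gen_inverse.prems by (intro lift_unique) (auto simp: signed_paths_inverse)
  then have \<gamma>\<beta>: "\<gamma> = ?\<beta>"
    using path_inverse_inverse[OF \<gamma>(1)] by simp
  have IH: "path_homotopic hospace (realize ?\<alpha>) (realize ?\<beta>)"
    using gen_inverse.IH[OF inv(1) \<gamma>(1)] inv \<gamma> \<gamma>\<beta> by simp
  have ends: "path_end \<alpha> = path_end \<beta>"
    using \<gamma>(2) \<gamma>\<beta> by simp
  have ra: "path_homotopic hospace (path_join (realize \<alpha>) (realize ?\<alpha>)) (\<lambda>_. vtx (base (path_begin \<alpha>)))"
    and rb: "path_homotopic hospace (path_join (realize \<beta>) (realize ?\<beta>)) (\<lambda>_. vtx (base (path_begin \<alpha>)))"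
    using realize_inverse[OF gen_inverse.prems(1)] realize_inverse[OF gen_inverse.prems(2)] gen_inverse.prems(3) by simp_all
  note R = realize[OF gen_inverse.prems(1)] realize[OF gen_inverse.prems(2)] realize[OF inv(1)] realize[OF inv(2)]
  have "path_homotopic hospace (path_join (realize \<alpha>) (realize ?\<beta>)) (path_join (realize \<alpha>) (realize ?\<alpha>))"
    using R by (intro path_homotopic_join path_homotopic_refl path_homotopic_sym[OF IH]) (auto simp: ends)
  also have "path_homotopic hospace \<dots> (path_join (realize \<beta>) (realize ?\<beta>))"
    by (rule path_homotopic_trans[OF ra path_homotopic_sym[OF rb]])
  finally show ?case
    using hp.cmp_left_cancel[of "realize \<alpha>" "realize ?\<beta>" "realize \<beta>"] R by (simp add: ends)
next
  case (gen_composition a b c1 c2)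
  have ab: "a \<in> signed_paths (arrangement_graph \<A>)" "b \<in> signed_paths (arrangement_graph \<A>)"
    "path_begin a = path_begin b" "path_end a = path_end b"
    using \<Gamma>.generated_relation_paths[OF gen_composition.hyps(1)] by (auto simp: minimal_positive_paths_def)
  have u: "path_begin \<alpha> \<in> pverts \<Theta>" "path_begin c1 = \<rho> (path_begin \<alpha>)"
    using signed_paths_begin[OF gen_composition.prems(1)] arg_cong[OF gen_composition.prems(4), of path_begin] by simp_all
  obtain \<gamma>1 where g1: "\<gamma>1 \<in> signed_paths \<Theta>" "path_begin \<gamma>1 = path_begin \<alpha>" "map_path \<rho> \<gamma>1 = c1"
    using lift_exists[OF u(1) gen_composition.hyps(2) u(2)] by metis
  have mid: "path_end \<gamma>1 \<in> pverts \<Theta>" "path_begin a = \<rho> (path_end \<gamma>1)" "path_begin b = \<rho> (path_end \<gamma>1)"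
    using g1 signed_paths_end gen_composition.hyps(4) ab(3) by auto
  obtain \<alpha>' where a': "\<alpha>' \<in> signed_paths \<Theta>" "path_begin \<alpha>' = path_end \<gamma>1" "map_path \<rho> \<alpha>' = a"
    using lift_exists[OF mid(1) ab(1) mid(2)] by metis
  obtain \<beta>' where b': "\<beta>' \<in> signed_paths \<Theta>" "path_begin \<beta>' = path_end \<gamma>1" "map_path \<rho> \<beta>' = b"
    using lift_exists[OF mid(1) ab(2) mid(3)] by metis
  \<comment> \<open>The middle factors lift to related paths and so end at one vertex; a single lift
    of the last factor then serves both sides.\<close>
  have "(\<alpha>', \<beta>') \<in> R"
    using a' b' gen_composition.hyps(1) by (subst induced_relation) (simp add: arrangement_relation_def)
  then have ends: "path_end \<alpha>' = path_end \<beta>'"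
    by (rule same_end)
  have last: "path_end \<alpha>' \<in> pverts \<Theta>" "path_begin c2 = \<rho> (path_end \<alpha>')"
    using a' signed_paths_end gen_composition.hyps(5) by auto
  obtain \<gamma>2 where g2: "\<gamma>2 \<in> signed_paths \<Theta>" "path_begin \<gamma>2 = path_end \<alpha>'" "map_path \<rho> \<gamma>2 = c2"
    using lift_exists[OF last(1) gen_composition.hyps(3) last(2)] by metis
  have \<alpha>: "\<alpha> = \<gamma>1 \<bullet>\<^sub>p \<alpha>' \<bullet>\<^sub>p \<gamma>2"
    using g1 g2 a' gen_composition.prems by (intro lift_unique) (auto simp: signed_paths_comp)
  have \<beta>: "\<beta> = \<gamma>1 \<bullet>\<^sub>p \<beta>' \<bullet>\<^sub>p \<gamma>2"
    using g1 g2 b' ends gen_composition.prems by (intro lift_unique) (auto simp: signed_paths_comp)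
  have split: "path_homotopic hospace (realize (\<gamma>1 \<bullet>\<^sub>p \<delta> \<bullet>\<^sub>p \<gamma>2)) (path_join (path_join (realize \<gamma>1) (realize \<delta>)) (realize \<gamma>2))"
    if "\<delta> \<in> signed_paths \<Theta>" "path_begin \<delta> = path_end \<gamma>1" "path_end \<delta> = path_begin \<gamma>2" for \<delta>
  proof -
    have "path_homotopic hospace (realize (\<gamma>1 \<bullet>\<^sub>p \<delta> \<bullet>\<^sub>p \<gamma>2)) (path_join (realize (\<gamma>1 \<bullet>\<^sub>p \<delta>)) (realize \<gamma>2))"
      using that g1 g2 by (intro realize_comp) (auto simp: signed_paths_comp)
    also have "path_homotopic hospace \<dots> (path_join (path_join (realize \<gamma>1) (realize \<delta>)) (realize \<gamma>2))"
      using that g1 g2 by (intro path_homotopic_join path_homotopic_refl realize_comp)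
        (auto simp: realize signed_paths_comp)
    finally show ?thesis .
  qed
  have "path_homotopic hospace (path_join (path_join (realize \<gamma>1) (realize \<alpha>')) (realize \<gamma>2))
      (path_join (path_join (realize \<gamma>1) (realize \<beta>')) (realize \<gamma>2))"
    using g1 g2 a' b' gen_composition.IH[of \<alpha>' \<beta>'] by (intro path_homotopic_join path_homotopic_refl) (auto simp: realize)
  from path_homotopic_trans[OF split[OF a'(1,2) g2(2)[symmetric]] this]
  have "path_homotopic hospace (realize \<alpha>) (path_join (path_join (realize \<gamma>1) (realize \<beta>')) (realize \<gamma>2))"
    by (simp add: \<alpha>)
  moreover have "path_end \<beta>' = path_begin \<gamma>2"
    using g2(2) ends by simp
  from path_homotopic_sym[OF split[OF b'(1,2) this]]
  have "path_homotopic hospace (path_join (path_join (realize \<gamma>1) (realize \<beta>')) (realize \<gamma>2)) (realize \<beta>)"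
    by (simp add: \<beta>)
  ultimately show ?case
    by (rule path_homotopic_trans)
qed

lemma realize_relation:
  assumes "(\<alpha>, \<beta>) \<in> R"
  shows "path_homotopic hospace (realize \<alpha>) (realize \<beta>)"
proof -
  have "\<alpha> \<in> signed_paths \<Theta> \<and> \<beta> \<in> signed_paths \<Theta> \<and> path_begin \<alpha> = path_begin \<beta> \<and>
      (map_path \<rho> \<alpha>, map_path \<rho> \<beta>) \<in> arrangement_relation \<A>"
    using assms by (subst (asm) induced_relation) simp
  then show ?thesis
    using realize_lift_relation by blast
qed

end

section \<open>The comparison of local systems\<close>

context arrangement_cover
begin

lemma stratified_system_ho:
  "stratified_system hospace hoposet hole stratum (\<lambda>q. paths.fibre u (snd q)) ho_tr"
  by (intro stratified_system.intro poset_system_ho stratification_hospace)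

lemma ho_tr_cls:
  assumes "q \<in> hoposet" "p \<in> hoposet" "hole q p" "\<alpha> \<in> signed_paths \<Theta>" "path_end \<alpha> = snd q"
  shows "ho_tr q p (paths.cls \<alpha>) = paths.cls (\<alpha> \<bullet>\<^sub>p hopath q p)"
  unfolding ho_tr_def using assms hopath_simps[OF assms(1-3)] by (intro paths.cls_cmp_cls) auto

lemma edge_tr_cls:
  assumes "q \<in> hoposet" "p \<in> hoposet" "hole q p" "pathin hospace g" "g 1 = vtx q"
  shows "edge_tr q p (hp.cls g) = hp.cls (path_join g (edge p q p))"
  unfolding edge_tr_def using assms by (intro hp.cls_cmp_cls) (auto simp: pathin_edge_top edge_ends)

text \<open>The pair \<open>p\<close> and the two base chambers lie in the copy of the face poset
  through \<open>snd p\<close>, where a section fixes the classes of paths. Hence the realized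
  minimal path followed by the edge up to \<open>p\<close> is homotopic to the direct edge up;
  composing with the inverse gives the claim.\<close>

lemma realize_hopath:
  assumes q: "q \<in> hoposet" and p: "p \<in> hoposet" and qp: "hole q p"
  shows "path_homotopic hospace (path_join (realize (hopath q p)) (edge p (base (snd p)) p)) (edge p (base (snd q)) p)"
proof -
  let ?u = "snd p" and ?w = "snd q" and ?\<gamma> = "act_path (fst q) (snd p)"
  let ?eu = "edge p p (base ?u)" and ?ew = "edge p p (base ?w)"
  have u: "?u \<in> pverts \<Theta>" "fst p \<in> Faces" "act (fst p) ?u = ?u" and w: "?w \<in> pverts \<Theta>" "fst q \<in> Faces"
    using hoposetD[OF p] hoposetD[OF q] act_self by auto
  have \<gamma>: "minimal_path ?u ?\<gamma> ?w"
    using act_path[OF u(1) w(2)] qp by (simp add: hole_def)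
  have \<gamma>': "?\<gamma> \<in> signed_paths \<Theta>" "path_begin ?\<gamma> = ?u" "path_end ?\<gamma> = ?w"
    using \<gamma> by (auto simp: minimal_path_def)
  have holes: "hole (base ?u) p" "hole (base ?w) p" "hole p p"
    using base_hole[OF p] hole_trans[OF base_in[OF w(1)] q p base_hole[OF q] qp] hole_refl[OF p] by auto
  have e: "pathin hospace ?eu" "?eu 0 = vtx p" "?eu 1 = vtx (base ?u)"
    "pathin hospace ?ew" "?ew 0 = vtx p" "?ew 1 = vtx (base ?w)"
    "edge p (base ?u) p 0 = vtx (base ?u)" "edge p (base ?u) p 1 = vtx p" "pathin hospace (edge p (base ?u) p)"
    "edge p (base ?w) p 0 = vtx (base ?w)" "edge p (base ?w) p 1 = vtx p" "pathin hospace (edge p (base ?w) p)"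
    using holes p u w base_in by (auto simp: pathin_edge_top edge_ends)
  have le: "face_le (\<rho> ?u) (fst p)" "face_le (\<rho> ?w) (fst p)"
    using holes by (auto simp: hole_def)
  have main: "path_homotopic hospace (path_join (realize ?\<gamma>) (edge p (base ?w) p)) (edge p (base ?u) p)"
  proof (rule section_potential[OF u(1)])
    fix B assume B: "B (\<rho> ?u) = hp.cls (\<lambda>_. vtx (\<rho> ?u, ?u))"
      "\<And>F. F \<in> Faces \<Longrightarrow> B F \<in> hp.fibre (vtx (\<rho> ?u, ?u)) (vtx (F, act F ?u))"
      "\<And>F G. F \<in> Faces \<Longrightarrow> G \<in> Faces \<Longrightarrow> face_le G F \<Longrightarrow>
         B G = hp.cls_cmp (B F) (edge (F, act F ?u) (F, act F ?u) (G, act G ?u))"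
    have min: "hp.cls (realize ?\<gamma>) = B (\<rho> ?w)"
      by (rule realize_minimal[OF _ _ B(3) \<gamma>]) (use B(1,2) in \<open>simp_all add: base_def\<close>)
    have pp: "(fst p, act (fst p) ?u) = p"
      using u by (simp add: prod_eq_iff)
    obtain \<beta> where \<beta>: "B (fst p) = hp.cls \<beta>" "pathin hospace \<beta>" "\<beta> 0 = vtx (base ?u)" "\<beta> 1 = vtx p"
      using B(2)[OF u(2)] pp by (auto simp: base_def elim: hp.fibreE)
    have "(\<rho> ?u, act (\<rho> ?u) ?u) = base ?u" "(\<rho> ?w, act (\<rho> ?w) ?u) = base ?w"
      using minimal_path_act[OF minimal_path_const[OF u(1)]] minimal_path_act[OF \<gamma>] by (auto simp: base_def)
    then have "B (\<rho> ?u) = hp.cls (path_join \<beta> ?eu)" "B (\<rho> ?w) = hp.cls (path_join \<beta> ?ew)"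
      using B(3)[OF u(2) chamber_face[OF chamber_vertex[OF u(1)]] le(1)]
        B(3)[OF u(2) chamber_face[OF chamber_vertex[OF w(1)]] le(2)] \<beta> e pp
      by (simp_all add: hp.cls_cmp_cls)
    then have cls: "hp.cls (path_join \<beta> ?eu) = hp.cls (\<lambda>_. vtx (base ?u))" "hp.cls (realize ?\<gamma>) = hp.cls (path_join \<beta> ?ew)"
      using B(1) min by (simp_all add: base_def)
    have 1: "path_homotopic hospace (path_join \<beta> ?eu) (\<lambda>_. vtx (base ?u))"
      using cls(1) hp.cls_eq_iff[of "path_join \<beta> ?eu" "\<lambda>_. vtx (base ?u)"] \<beta> e vtx_in[OF base_in[OF u(1)]]
      by (simp add: pathin_join)
    have 2: "path_homotopic hospace (realize ?\<gamma>) (path_join \<beta> ?ew)"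
      using cls(2) hp.cls_eq_iff[of "realize ?\<gamma>" "path_join \<beta> ?ew"] \<beta> e realize[OF \<gamma>'(1)]
      by (simp add: pathin_join)
    have "path_homotopic hospace \<beta> (edge p (base ?u) p)"
      using hp.left_inverse_unique[of \<beta> ?eu "vtx (base ?u)"] 1 \<beta> e by simp
    moreover have "path_homotopic hospace (path_join (realize ?\<gamma>) (edge p (base ?w) p)) (path_join (path_join \<beta> ?ew) (edge p (base ?w) p))"
      using 2 e realize[OF \<gamma>'(1)] \<gamma>' by (intro path_homotopic_join path_homotopic_refl) auto
    moreover have "path_homotopic hospace (path_join (path_join \<beta> ?ew) (edge p (base ?w) p)) \<beta>"
      using hp.cmp_cancel_right[of \<beta> ?ew] \<beta> e by simp
    ultimately show ?thesis
      using path_homotopic_trans by blast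
  qed
  let ?i = "realize (hopath q p)"
  note i = realize[OF hopath_simps(1)[OF q p qp]] hopath_simps[OF q p qp]
  note r = realize[OF \<gamma>'(1)] \<gamma>'
  have inv: "path_homotopic hospace (path_join ?i (realize ?\<gamma>)) (\<lambda>_. vtx (base ?w))"
    using realize_inverse[OF signed_paths_inverse[OF \<gamma>'(1)]] \<gamma>' by (simp add: hopath_def path_inverse_inverse)
  have "path_homotopic hospace (path_join ?i (edge p (base ?u) p)) (path_join ?i (path_join (realize ?\<gamma>) (edge p (base ?w) p)))"
    using i e by (intro path_homotopic_join path_homotopic_refl path_homotopic_sym[OF main]) auto
  also have "path_homotopic hospace \<dots> (path_join (path_join ?i (realize ?\<gamma>)) (edge p (base ?w) p))"
    using i r e by (intro path_homotopic_sym[OF path_homotopic_assoc]) auto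
  also have "path_homotopic hospace \<dots> (path_join (\<lambda>_. edge p (base ?w) p 0) (edge p (base ?w) p))"
    using inv i r e by (intro path_homotopic_join path_homotopic_refl) auto
  also have "path_homotopic hospace \<dots> (edge p (base ?w) p)"
    using e by (intro path_homotopic_const_left)
  finally show ?thesis .
qed

section \<open>Comparison of the two local systems at a base point\<close>

context
  fixes x u
  assumes x: "x \<in> topspace hospace" and u: "u = snd (stratum x)"
begin

definition to_base :: "real \<Rightarrow> ('a set \<times> 'v \<times> ('a set \<Rightarrow> real)) set" where
  "to_base = path_join (ray_top x) (edge (stratum x) (stratum x) (base u))"

lemma stratum_x: "stratum x \<in> hoposet" "u \<in> pverts \<Theta>" "hole (base u) (stratum x)" "hole (stratum x) (stratum x)"
  using stratum_in[OF x] hoposetD[OF stratum_in[OF x]] base_hole[OF stratum_in[OF x]] by (auto simp: u hole_refl)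

lemma stratum_edges:
  "pathin hospace (edge (stratum x) (stratum x) (base u))" "edge (stratum x) (stratum x) (base u) 0 = vtx (stratum x)"
  "edge (stratum x) (stratum x) (base u) 1 = vtx (base u)"
  "pathin hospace (edge (stratum x) (base u) (stratum x))" "edge (stratum x) (base u) (stratum x) 0 = vtx (base u)"
  "edge (stratum x) (base u) (stratum x) 1 = vtx (stratum x)"
  using stratum_x base_in by (auto simp: pathin_edge_top edge_ends)

lemma to_base: "pathin hospace to_base" "to_base 0 = x" "to_base 1 = vtx (base u)"
  unfolding to_base_def using ray_top[OF x] stratum_edges by (auto intro: pathin_join)

definition comparison_path :: "'a set \<times> 'v \<Rightarrow> 'v signed_path \<Rightarrow> real \<Rightarrow> ('a set \<times> 'v \<times> ('a set \<Rightarrow> real)) set" where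
  "comparison_path q \<alpha> = path_join (path_join to_base (realize \<alpha>)) (edge q (base (snd q)) q)"

definition comparison :: "'a set \<times> 'v \<Rightarrow> 'v signed_path set \<Rightarrow> (real \<Rightarrow> ('a set \<times> 'v \<times> ('a set \<Rightarrow> real)) set) set" where
  "comparison q A = (\<Union>\<alpha>\<in>A. hp.cls (comparison_path q \<alpha>))"

lemma comparison_path:
  assumes "q \<in> hoposet" "\<alpha> \<in> signed_paths \<Theta>" "path_begin \<alpha> = u" "path_end \<alpha> = snd q"
  shows "pathin hospace (comparison_path q \<alpha>)" "comparison_path q \<alpha> 0 = x" "comparison_path q \<alpha> 1 = vtx q"
proof -
  have e: "pathin hospace (edge q (base (snd q)) q)" "edge q (base (snd q)) q 0 = vtx (base (snd q))" "edge q (base (snd q)) q 1 = vtx q"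
    using assms base_hole[OF assms(1)] hoposetD[OF assms(1)] by (auto simp: pathin_edge_top edge_ends base_in hole_refl)
  show "pathin hospace (comparison_path q \<alpha>)" "comparison_path q \<alpha> 0 = x" "comparison_path q \<alpha> 1 = vtx q"
    unfolding comparison_path_def using to_base realize[OF assms(2)] assms e by (auto intro!: pathin_join)
qed

lemma comparison_path_relation:
  assumes "q \<in> hoposet" "(\<alpha>, \<beta>) \<in> R" "path_begin \<alpha> = u" "path_end \<alpha> = snd q"
  shows "path_homotopic hospace (comparison_path q \<alpha>) (comparison_path q \<beta>)"
proof -
  have \<alpha>: "\<alpha> \<in> signed_paths \<Theta>"
    using paths.in_r[OF assms(2)] by blast
  have e: "pathin hospace (edge q (base (snd q)) q)" "edge q (base (snd q)) q 0 = vtx (base (snd q))"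
    using assms base_hole[OF assms(1)] hoposetD[OF assms(1)] by (auto simp: pathin_edge_top edge_ends base_in hole_refl)
  show ?thesis
    unfolding comparison_path_def using to_base realize[OF \<alpha>] realize_relation[OF assms(2)] assms e
    by (intro path_homotopic_join path_homotopic_refl) auto
qed

lemma comparison_cls:
  assumes "q \<in> hoposet" "\<alpha> \<in> signed_paths \<Theta>" "path_begin \<alpha> = u" "path_end \<alpha> = snd q"
  shows "comparison q (paths.cls \<alpha>) = hp.cls (comparison_path q \<alpha>)"
proof -
  have "hp.cls (comparison_path q \<beta>) = hp.cls (comparison_path q \<alpha>)" if "\<beta> \<in> paths.cls \<alpha>" for \<beta>
  proof -
    have "(\<alpha>, \<beta>) \<in> R"
      using that by (simp add: paths.cls_def)
    from path_homotopic_sym[OF comparison_path_relation[OF assms(1) this assms(3,4)]]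
    show ?thesis
      by (intro hp.cls_eqI) simp
  qed
  moreover have "\<alpha> \<in> paths.cls \<alpha>"
    using assms(2) by (simp add: paths.cls_def paths.refl_r)
  ultimately show ?thesis
    unfolding comparison_def by blast
qed

text \<open>Naturality along \<open>hole q p\<close> is a triangle of edges:
  \<open>realize_hopath\<close> replaces the realized structure map and the edge over
  \<open>snd p\<close> by one edge from \<open>base (snd q)\<close>, which
  \<open>edge_cocycle\<close> factors through \<open>q\<close>.\<close>

lemma system_morphism_comparison:
  "system_morphism hospace hoposet hole stratum (\<lambda>q. paths.fibre u (snd q)) ho_tr (\<lambda>q. hp.fibre x (vtx q)) edge_tr comparison"
proof (intro system_morphism.intro system_morphism_axioms.intro stratified_system_ho stratified_system_edge)
  fix q A assume q: "q \<in> hoposet" and "A \<in> paths.fibre u (snd q)"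
  then obtain \<alpha> where \<alpha>: "A = paths.cls \<alpha>" "\<alpha> \<in> signed_paths \<Theta>" "path_begin \<alpha> = u" "path_end \<alpha> = snd q"
    using paths.fibreE by blast
  show "comparison q A \<in> hp.fibre x (vtx q)"
    using comparison_path[OF q \<alpha>(2-4)] unfolding \<alpha>(1) comparison_cls[OF q \<alpha>(2-4)] by (intro hp.in_fibre) auto
  fix p assume p: "p \<in> hoposet" and qp: "hole q p"
  note h = hopath_simps[OF q p qp]
  have \<alpha>h: "\<alpha> \<bullet>\<^sub>p hopath q p \<in> signed_paths \<Theta>" "path_begin (\<alpha> \<bullet>\<^sub>p hopath q p) = u" "path_end (\<alpha> \<bullet>\<^sub>p hopath q p) = snd p"
    using \<alpha> h by (auto simp: signed_paths_comp)
  let ?\<kappa> = to_base and ?a = "realize \<alpha>" and ?i = "realize (hopath q p)"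
  let ?ep = "edge p (base (snd p)) p" and ?eq = "edge q (base (snd q)) q" and ?ew = "edge p (base (snd q)) p"
  have vs: "base (snd p) \<in> hoposet" "base (snd q) \<in> hoposet" "hole (base (snd p)) p" "hole (base (snd q)) q" "hole (base (snd q)) p"
    "hole p p" "hole q q"
    using hoposetD[OF p] hoposetD[OF q] base_hole[OF p] base_hole[OF q] hole_trans[OF _ q p _ qp] p q
    by (auto simp: base_in hole_refl)
  have e: "pathin hospace ?ep" "?ep 0 = vtx (base (snd p))" "pathin hospace ?eq" "?eq 0 = vtx (base (snd q))" "?eq 1 = vtx q"
    "pathin hospace ?ew" "?ew 0 = vtx (base (snd q))" "pathin hospace (edge p q p)" "edge p q p 0 = vtx q"
    using vs p q qp by (auto simp: pathin_edge_top edge_ends)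
  note r = to_base realize[OF \<alpha>(2)] realize[OF h(1)] \<alpha>(3,4) h(2,3)
  have "path_homotopic hospace (comparison_path p (\<alpha> \<bullet>\<^sub>p hopath q p)) (path_join (path_join ?\<kappa> (path_join ?a ?i)) ?ep)"
    unfolding comparison_path_def using r e \<alpha> h realize[OF \<alpha>h(1)] \<alpha>h
    by (intro path_homotopic_join path_homotopic_refl realize_comp) auto
  also have "path_homotopic hospace \<dots> (path_join (path_join (path_join ?\<kappa> ?a) ?i) ?ep)"
    using r e by (intro path_homotopic_join path_homotopic_refl path_homotopic_sym[OF path_homotopic_assoc]) auto
  also have "path_homotopic hospace \<dots> (path_join (path_join ?\<kappa> ?a) (path_join ?i ?ep))"
    using r e by (intro path_homotopic_assoc pathin_join) auto
  also have "path_homotopic hospace \<dots> (path_join (path_join ?\<kappa> ?a) (path_join ?eq (edge p q p)))"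
  proof -
    have triangle: "path_homotopic hospace (path_join ?i ?ep) (path_join ?eq (edge p q p))"
      using path_homotopic_trans[OF realize_hopath[OF q p qp] path_homotopic_sym[OF edge_cocycle(1)[OF vs(2) q p vs(4) qp]]] .
    show ?thesis
      using r e by (intro path_homotopic_join[OF path_homotopic_refl triangle] pathin_join) auto
  qed
  also have "path_homotopic hospace \<dots> (path_join (comparison_path q \<alpha>) (edge p q p))"
    unfolding comparison_path_def using r e by (intro path_homotopic_sym[OF path_homotopic_assoc] pathin_join) auto
  finally have "hp.cls (comparison_path p (\<alpha> \<bullet>\<^sub>p hopath q p)) = hp.cls (path_join (comparison_path q \<alpha>) (edge p q p))"
    by (intro hp.cls_eqI) simp
  then show "comparison p (ho_tr q p A) = edge_tr q p (comparison q A)"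
    unfolding \<alpha>(1) ho_tr_cls[OF q p qp \<alpha>(2,4)] comparison_cls[OF q \<alpha>(2-4)] comparison_cls[OF p \<alpha>h]
    using edge_tr_cls[OF q p qp comparison_path(1,3)[OF q \<alpha>(2-4)]] by simp
qed

interpretation H: stratified_system hospace hoposet hole stratum "\<lambda>q. paths.fibre u (snd q)" ho_tr
  by (rule stratified_system_ho)

definition loop_of :: "'v signed_path \<Rightarrow> real \<Rightarrow> ('a set \<times> 'v \<times> ('a set \<Rightarrow> real)) set" where
  "loop_of \<alpha> = path_join (comparison_path (stratum x) \<alpha>) (path_reverse (ray_top x))"

lemma loop_of:
  assumes "\<alpha> \<in> signed_paths \<Theta>" "path_begin \<alpha> = u" "path_end \<alpha> = u"
  shows "pathin hospace (loop_of \<alpha>)" "loop_of \<alpha> 0 = x" "loop_of \<alpha> 1 = x"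
  unfolding loop_of_def using comparison_path[OF stratum_x(1) assms(1,2)] assms(3) ray_top[OF x]
  by (auto simp: u intro!: pathin_join pathin_reverse)

text \<open>The comparison sends the constant path to the ray of \<open>x\<close> and
  \<open>\<alpha>\<close> to its comparison path. In the system of homotopy classes the ray is
  transported to \<open>g\<close> followed by the ray, so uniqueness of transport identifies the
  two; cancelling the ray leaves \<open>g\<close>.\<close>

lemma transports_loop:
  assumes g: "pathin hospace g" "g 0 = x" "g 1 = x"
    and \<alpha>: "\<alpha> \<in> signed_paths \<Theta>" "path_begin \<alpha> = u" "path_end \<alpha> = u"
    and tr: "H.transports g (paths.cls (const_path u)) (paths.cls \<alpha>)"
  shows "path_homotopic hospace g (loop_of \<alpha>)"
proof -
  interpret M: system_morphism hospace hoposet hole stratum "\<lambda>q. paths.fibre u (snd q)" ho_tr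
    "\<lambda>q. hp.fibre x (vtx q)" edge_tr comparison
    by (rule system_morphism_comparison)
  let ?q = "stratum x" and ?r = "ray_top x"
  let ?e = "edge ?q ?q (base u)" and ?c = "const_path u"
  have c: "?c \<in> signed_paths \<Theta>" "path_begin ?c = u" "path_end ?c = snd ?q"
    using stratum_x by (auto simp: const_path_in u)
  have \<alpha>': "path_end \<alpha> = snd ?q"
    using \<alpha> u by simp
  have cc: "comparison ?q (paths.cls ?c) = hp.cls ?r"
  proof -
    have "path_homotopic hospace (comparison_path ?q ?c) (path_join to_base (edge ?q (base u) ?q))"
      unfolding comparison_path_def realize_const using path_homotopic_const_right[OF to_base(1)] to_base stratum_edges
      by (intro path_homotopic_join) (auto simp: u[symmetric] intro: path_homotopic_refl)
    also have "path_homotopic hospace \<dots> ?r"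
      unfolding to_base_def using hp.cmp_cancel_right[of ?r ?e] ray_top[OF x] stratum_edges by simp
    finally show ?thesis
      unfolding comparison_cls[OF stratum_x(1) c] by (intro hp.cls_eqI) simp
  qed
  have "M.T.transports g (hp.cls ?r) (hp.cls (comparison_path ?q \<alpha>))"
    using M.transports_map[OF tr] g cc comparison_cls[OF stratum_x(1) \<alpha>(1,2) \<alpha>'] by simp
  moreover have "M.T.transports g (hp.cls ?r) (hp.cls (path_join g ?r))"
    using transports_edge[OF g(1)] g by simp
  ultimately have "hp.cls (path_join g ?r) = hp.cls (comparison_path ?q \<alpha>)"
    using M.T.transports_unique by blast
  then have 1: "path_homotopic hospace (path_join g ?r) (comparison_path ?q \<alpha>)"
    using hp.cls_eq_iff[of "path_join g ?r" "comparison_path ?q \<alpha>"] comparison_path[OF stratum_x(1) \<alpha>(1,2) \<alpha>'] g ray_top[OF x]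
    by (simp add: pathin_join)
  have "path_homotopic hospace g (path_join (path_join g ?r) (path_reverse ?r))"
    using path_homotopic_sym hp.cmp_cancel_right[of g ?r] g ray_top[OF x] by simp
  also have "path_homotopic hospace \<dots> (loop_of \<alpha>)"
    unfolding loop_of_def using 1 ray_top[OF x] by (intro path_homotopic_join path_homotopic_refl pathin_reverse) auto
  finally show ?thesis .
qed

lemma loop_of_relation:
  assumes "(\<alpha>, \<beta>) \<in> R" "path_begin \<alpha> = u" "path_end \<alpha> = u"
  shows "path_homotopic hospace (loop_of \<alpha>) (loop_of \<beta>)"
proof -
  have "\<alpha> \<in> signed_paths \<Theta>"
    using paths.in_r[OF assms(1)] by blast
  then show ?thesis
    unfolding loop_of_def using comparison_path_relation[OF stratum_x(1) assms(1,2)] assms(2,3) ray_top[OF x]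
      comparison_path[OF stratum_x(1)]
    by (intro path_homotopic_join path_homotopic_refl pathin_reverse) (auto simp: u)
qed

section \<open>Transport along realized loops\<close>

lemma stratum_edge_path:
  assumes "q \<in> hoposet" "p \<in> hoposet" "hole q p" "t \<in> {0..1}"
  shows "hole q (stratum (edge p q p t))"
proof (cases "t = 0")
  case True
  then show ?thesis
    using assms by (simp add: edge_ends stratum_vtx hole_refl)
next
  case False
  let ?m = "mix t (corner (fst q)) (corner (fst p))"
  have K: "face_chain {fst q, fst p}" "face_le (fst q) (fst p)"
    using assms face_chain_pair[of "fst q" "fst p"] by (auto simp: hole_def hoposet_def)
  have m: "?m \<in> topspace (oc (fst p))"
    using assms K by (intro mix_in_oc[OF K(1)]) (auto simp: face_chain_def face_le_refl intro: corner_in_barycentric)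
  \<comment> \<open>For positive time the coordinate at \<open>fst p\<close> is positive, so the
    edge leaves the stratum \<open>q\<close> at once and stays in the stratum
    \<open>p\<close>.\<close>
  have "top_face ?m = fst p"
    using m K(2) False assms(4) by (intro top_face_eqI[OF m]) (auto simp: mix_def corner_def face_le_refl split: if_splits)
  moreover have "(fst p, snd p, ?m) \<in> topspace hosum"
    using m assms(2) by (auto simp: topspace_hosum hoposet_def)
  ultimately have "stratum (edge p q p t) = (fst p, act (fst p) (snd p))"
    unfolding edge_def spath_def by (simp add: stratum_pt)
  also have "\<dots> = p"
    using assms(2) by (simp add: hoposet_def act_self split: prod.splits)
  finally show ?thesis
    using assms(3) by simp
qed

lemma transports_edge_path:
  assumes q: "q \<in> hoposet" and p: "p \<in> hoposet" and qp: "hole q p"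
    and \<alpha>: "\<alpha> \<in> signed_paths \<Theta>" "path_begin \<alpha> = u" "path_end \<alpha> = snd q"
  shows "H.transports (edge p q p) (paths.cls \<alpha>) (paths.cls (\<alpha> \<bullet>\<^sub>p hopath q p))"
proof -
  have ends: "edge p q p 0 = vtx q" "edge p q p 1 = vtx p"
    using p q qp by (auto simp: edge_ends hole_refl)
  have "H.transports (edge p q p) (paths.cls \<alpha>) (ho_tr (stratum (edge p q p 0)) (stratum (edge p q p 1)) (paths.cls \<alpha>))"
    using stratum_edge_path[OF q p qp] q p qp \<alpha>
    by (intro H.transports_star pathin_edge_top) (auto simp: ends stratum_vtx intro: paths.in_fibre)
  then show ?thesis
    using ho_tr_cls[OF q p qp \<alpha>(1,3)] by (simp add: ends stratum_vtx p q)
qed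

text \<open>The minimal path behind \<open>hopath\<close> was an arbitrary choice; modulo
  \<open>R\<close> any explicit one may take its place.\<close>

lemma hopath_minimal:
  assumes "q \<in> hoposet" "p \<in> hoposet" "hole q p" "minimal_path (snd p) \<gamma> (snd q)"
  shows "(hopath q p, path_inverse \<gamma>) \<in> R"
proof -
  have "minimal_path (snd p) (act_path (fst q) (snd p)) (snd q)"
    using act_path[of "snd p" "fst q"] hoposetD[OF assms(1)] hoposetD[OF assms(2)] assms(3) by (simp add: hole_def)
  then show ?thesis
    unfolding hopath_def by (intro inverse minimal_path_unique(1)[OF _ assms(4)]) simp_all
qed

lemma transports_edge_base:
  assumes p: "p \<in> hoposet" and \<alpha>: "\<alpha> \<in> signed_paths \<Theta>" "path_begin \<alpha> = u" "path_end \<alpha> = snd p"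
  shows "H.transports (edge p (base (snd p)) p) (paths.cls \<alpha>) (paths.cls \<alpha>)"
proof -
  have v: "snd p \<in> pverts \<Theta>"
    using hoposetD[OF p] by blast
  have "(hopath (base (snd p)) p, path_inverse (const_path (snd p))) \<in> R"
    using p v by (intro hopath_minimal base_in base_hole) (auto simp: minimal_path_const)
  then have "(\<alpha> \<bullet>\<^sub>p hopath (base (snd p)) p, \<alpha> \<bullet>\<^sub>p const_path (snd p)) \<in> R"
    using \<alpha> v by (intro paths.cmp_r_right) (auto simp: same_begin)
  then have "paths.cls (\<alpha> \<bullet>\<^sub>p hopath (base (snd p)) p) = paths.cls \<alpha>"
    by (intro paths.cls_eqI) simp
  then show ?thesis
    using transports_edge_path[OF base_in[OF v] p base_hole[OF p] \<alpha>(1,2)] \<alpha>(3) by simp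
qed

text \<open>The first half of the arc changes nothing. Reversing its second half transports
  \<open>\<alpha>\<close> followed by the arrow back to \<open>\<alpha>\<close>, because the arrow
  is cancelled by its inverse; the arc therefore appends the arrow.\<close>

lemma transports_arc_path:
  assumes arc: "(v, w) \<in> parcs \<Theta>" and \<alpha>: "\<alpha> \<in> signed_paths \<Theta>" "path_begin \<alpha> = u" "path_end \<alpha> = v"
  shows "H.transports (arc_path v w) (paths.cls \<alpha>) (paths.cls (\<alpha> \<bullet>\<^sub>p arrow v w))"
proof -
  let ?p = "(wall_face v w, v)" and ?\<gamma> = "arrow v w"
  note p = wall_vertex_in[OF arc] and vs = edge_vertices[OF arc]
  have \<gamma>: "?\<gamma> \<in> signed_paths \<Theta>" "path_begin ?\<gamma> = v" "path_end ?\<gamma> = w"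
    using minimal_path_arrow[OF arc] by (auto simp: minimal_path_def)
  have \<alpha>\<gamma>: "\<alpha> \<bullet>\<^sub>p ?\<gamma> \<in> signed_paths \<Theta>" "path_begin (\<alpha> \<bullet>\<^sub>p ?\<gamma>) = u" "path_end (\<alpha> \<bullet>\<^sub>p ?\<gamma>) = w"
    using \<alpha> \<gamma> by (auto simp: signed_paths_comp)
  have h: "(hopath (base w) ?p, path_inverse ?\<gamma>) \<in> R"
    using minimal_path_arrow[OF arc] by (intro hopath_minimal base_in vs p wall_hole[OF arc]) simp
  have "((\<alpha> \<bullet>\<^sub>p ?\<gamma>) \<bullet>\<^sub>p hopath (base w) ?p, (\<alpha> \<bullet>\<^sub>p ?\<gamma>) \<bullet>\<^sub>p path_inverse ?\<gamma>) \<in> R"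
    using h \<alpha>\<gamma> \<gamma> same_begin[OF h] by (intro paths.cmp_r_right) auto
  also have "((\<alpha> \<bullet>\<^sub>p ?\<gamma>) \<bullet>\<^sub>p path_inverse ?\<gamma>, \<alpha>) \<in> R"
    using \<alpha> \<gamma> by (intro paths.cmp_cancel_right) auto
  finally have "paths.cls ((\<alpha> \<bullet>\<^sub>p ?\<gamma>) \<bullet>\<^sub>p hopath (base w) ?p) = paths.cls \<alpha>"
    by (rule paths.cls_eqI)
  then have "H.transports (edge ?p (base w) ?p) (paths.cls (\<alpha> \<bullet>\<^sub>p ?\<gamma>)) (paths.cls \<alpha>)"
    using transports_edge_path[OF base_in[OF vs(2)] p wall_hole(2)[OF arc] \<alpha>\<gamma>(1,2)] \<alpha>\<gamma>(3) by simp
  from H.transports_reverse[OF this]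
  have 2: "H.transports (edge ?p ?p (base w)) (paths.cls \<alpha>) (paths.cls (\<alpha> \<bullet>\<^sub>p ?\<gamma>))"
    by simp
  have 1: "H.transports (edge ?p (base v) ?p) (paths.cls \<alpha>) (paths.cls \<alpha>)"
    using transports_edge_base[OF p \<alpha>(1,2)] \<alpha>(3) by simp
  show ?thesis
    unfolding arc_path_def Let_def
    using p vs wall_hole[OF arc] by (intro H.transports_join[OF 1 2]) (simp add: edge_ends base_in hole_refl)
qed

lemma transports_step_path:
  assumes e: "fst e \<in> parcs \<Theta>" and \<alpha>: "\<alpha> \<in> signed_paths \<Theta>" "path_begin \<alpha> = u" "path_end \<alpha> = step_begin e"
  shows "H.transports (step_path e) (paths.cls \<alpha>) (paths.cls (\<alpha> \<bullet>\<^sub>p (step_begin e, [e])))"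
proof -
  obtain v w s where vw: "e = ((v, w), s)"
    by (metis prod.collapse)
  have arc: "(v, w) \<in> parcs \<Theta>"
    using e vw by simp
  have \<gamma>: "arrow v w \<in> signed_paths \<Theta>" "path_begin (arrow v w) = v" "path_end (arrow v w) = w"
    using minimal_path_arrow[OF arc] by (auto simp: minimal_path_def)
  show ?thesis
  proof (cases s)
    case True
    then show ?thesis
      using transports_arc_path[OF arc \<alpha>(1,2)] \<alpha>(3) by (simp add: vw step_path_def step_begin_def)
  next
    case False
    let ?\<delta> = "path_inverse (arrow v w)"
    have \<delta>: "?\<delta> = (step_begin e, [e])" "step_begin e = w"
      using False by (simp_all add: path_inverse_def vw step_begin_def step_end_def)
    have \<alpha>\<delta>: "\<alpha> \<bullet>\<^sub>p ?\<delta> \<in> signed_paths \<Theta>" "path_begin (\<alpha> \<bullet>\<^sub>p ?\<delta>) = u" "path_end (\<alpha> \<bullet>\<^sub>p ?\<delta>) = v"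
      using \<alpha> \<gamma> \<delta>(2) by (simp_all add: signed_paths_comp signed_paths_inverse path_end_inverse)
    have "paths.cls (\<alpha> \<bullet>\<^sub>p ?\<delta> \<bullet>\<^sub>p arrow v w) = paths.cls \<alpha>"
      using paths.cmp_cancel_right'[OF \<alpha>(1) \<gamma>(1)] \<alpha>(3) \<gamma>(3) \<delta>(2) by (intro paths.cls_eqI) simp
    then have "H.transports (arc_path v w) (paths.cls (\<alpha> \<bullet>\<^sub>p ?\<delta>)) (paths.cls \<alpha>)"
      using transports_arc_path[OF arc \<alpha>\<delta>] by simp
    from H.transports_reverse[OF this] show ?thesis
      using False by (simp add: \<delta>(1) step_path_def vw)
  qed
qed

lemma transports_rpath:
  assumes "signed_walk \<Theta> v es" "\<alpha> \<in> signed_paths \<Theta>" "path_begin \<alpha> = u" "path_end \<alpha> = v"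
  shows "H.transports (rpath v es) (paths.cls \<alpha>) (paths.cls (\<alpha> \<bullet>\<^sub>p (v, es)))"
  using assms
proof (induction es arbitrary: v \<alpha>)
  case Nil
  then have v: "base v \<in> hoposet" "vtx (base v) \<in> topspace hospace"
    by (auto intro: base_in vtx_in)
  have mem: "paths.cls \<alpha> \<in> paths.fibre u (snd (stratum (vtx (base v))))"
    using Nil v by (intro paths.in_fibre) (auto simp: stratum_vtx)
  have "H.transports (\<lambda>_. vtx (base v)) (paths.cls \<alpha>) (ho_tr (base v) (base v) (paths.cls \<alpha>))"
    using H.transports_star[of "\<lambda>_. vtx (base v)", OF _ mem] v by (simp add: stratum_vtx hole_refl)
  moreover have "ho_tr (base v) (base v) (paths.cls \<alpha>) = paths.cls \<alpha>"
    using H.tr_id[OF v(1)] mem v by (simp add: stratum_vtx)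
  moreover have "\<alpha> \<bullet>\<^sub>p (v, []) = \<alpha>"
    by (simp add: path_comp_def)
  ultimately show ?case
    by simp
next
  case (Cons e es)
  have e: "fst e \<in> parcs \<Theta>" "step_begin e = v" and w: "signed_walk \<Theta> (step_end e) es"
    using Cons.prems by auto
  have e': "(v, [e]) \<in> signed_paths \<Theta>" "path_begin (v, [e]) = v" "path_end (v, [e]) = step_end e"
    using e w signed_walk_start by (auto simp: signed_paths_def path_begin_def)
  have \<alpha>e: "\<alpha> \<bullet>\<^sub>p (v, [e]) \<in> signed_paths \<Theta>" "path_begin (\<alpha> \<bullet>\<^sub>p (v, [e])) = u" "path_end (\<alpha> \<bullet>\<^sub>p (v, [e])) = step_end e"
    using Cons.prems e' by (auto simp: signed_paths_comp)
  have 1: "H.transports (step_path e) (paths.cls \<alpha>) (paths.cls (\<alpha> \<bullet>\<^sub>p (v, [e])))"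
    using transports_step_path[OF e(1) Cons.prems(2,3)] Cons.prems(4) e(2) by simp
  have 2: "H.transports (rpath (step_end e) es) (paths.cls (\<alpha> \<bullet>\<^sub>p (v, [e]))) (paths.cls (\<alpha> \<bullet>\<^sub>p (v, [e]) \<bullet>\<^sub>p (step_end e, es)))"
    by (rule Cons.IH[OF w \<alpha>e])
  have "H.transports (path_join (step_path e) (rpath (step_end e) es)) (paths.cls \<alpha>)
      (paths.cls (\<alpha> \<bullet>\<^sub>p (v, [e]) \<bullet>\<^sub>p (step_end e, es)))"
    using step_path[OF e(1)] rpath(2)[OF w] by (intro H.transports_join[OF 1 2]) simp
  moreover have "\<alpha> \<bullet>\<^sub>p (v, [e]) \<bullet>\<^sub>p (step_end e, es) = \<alpha> \<bullet>\<^sub>p (v, e # es)"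
    by (simp add: path_comp_def)
  ultimately show ?case
    by simp
qed

text \<open>Moving towards the corner of the top face keeps the coordinate there positive and
  creates no further support, so the point stays in its stratum.\<close>

lemma stratum_ray_top:
  assumes "t \<in> {0..1}"
  shows "stratum (ray_top x t) = stratum x"
proof -
  obtain p y s where a: "(p, y, s) \<in> topspace hosum" "x = pt p y s"
    using hospaceE[OF x] .
  have s: "s \<in> topspace (oc p)"
    using a by (auto simp: topspace_hosum)
  let ?M = "top_face s"
  have M: "s ?M > 0" "?M \<in> Faces"
    using top_face[OF s] oc_nonneg[OF s] by auto
  have st: "stratum x = (?M, act ?M y)"
    using stratum_pt[OF a(1)] a(2) by simp
  let ?m = "mix t s (corner ?M)"
  have m: "?m \<in> topspace (oc p)"
    using mix_corner_in[OF s M(1) assms] .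
  have nonneg: "0 \<le> s F" for F
    using s by (auto simp: topspace_oc barycentric_def)
  have "0 < ?m ?M"
    using M(1) assms by (cases "t = 1") (auto simp: mix_def corner_def add_pos_nonneg)
  then have "top_face ?m = ?M"
    using top_face(2)[OF s] by (intro top_face_eqI[OF m]) (auto simp: mix_def corner_def face_le_refl split: if_splits)
  moreover have "ray_top x t = pt p y ?m"
  proof -
    have fst: "fst (stratum x) = ?M"
      by (simp add: st)
    have "ray (stratum x) (pt p y s) t = spath p y s (corner (fst (stratum x))) t"
      by (rule ray_pt[OF a(1) _ assms]) (simp add: fst M)
    then show ?thesis
      by (simp only: a(2)[symmetric] fst spath_def)
  qed
  ultimately show ?thesis
    using stratum_pt[of p y ?m] a(1) m st by (auto simp: topspace_hosum)
qed

lemma transports_ray_top: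
  assumes "\<alpha> \<in> signed_paths \<Theta>" "path_begin \<alpha> = u" "path_end \<alpha> = u"
  shows "H.transports (ray_top x) (paths.cls \<alpha>) (paths.cls \<alpha>)"
proof -
  have mem: "paths.cls \<alpha> \<in> paths.fibre u (snd (stratum (ray_top x 0)))"
    using assms stratum_ray_top[of 0] by (intro paths.in_fibre) (auto simp: u)
  have "H.transports (ray_top x) (paths.cls \<alpha>) (ho_tr (stratum (ray_top x 0)) (stratum (ray_top x 1)) (paths.cls \<alpha>))"
    using ray_top[OF x] stratum_ray_top stratum_x mem by (intro H.transports_star) simp_all
  then show ?thesis
    using H.tr_id[OF stratum_x(1)] mem stratum_ray_top[of 0] stratum_ray_top[of 1] by simp
qed

text \<open>The rays and the edges between the stratum of \<open>x\<close> and \<open>base u\<close>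
  act trivially on classes, so that the realized loop alone contributes, by appending
  \<open>\<alpha>\<close>.\<close>

lemma transports_loop_of:
  assumes \<alpha>: "\<alpha> \<in> signed_paths \<Theta>" "path_begin \<alpha> = u" "path_end \<alpha> = u"
  shows "H.transports (loop_of \<alpha>) (paths.cls (const_path u)) (paths.cls \<alpha>)"
proof -
  let ?q = "stratum x" and ?c = "const_path u"
  have c: "?c \<in> signed_paths \<Theta>" "path_begin ?c = u" "path_end ?c = u"
    using stratum_x by (auto simp: const_path_in)
  have e: "H.transports (edge ?q (base u) ?q) (paths.cls \<beta>) (paths.cls \<beta>)"
    if "\<beta> \<in> signed_paths \<Theta>" "path_begin \<beta> = u" "path_end \<beta> = u" for \<beta>
    using transports_edge_base[OF stratum_x(1) that(1,2)] that(3) by (simp add: u[symmetric])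
  have "H.transports (edge ?q ?q (base u)) (paths.cls ?c) (paths.cls ?c)"
    using H.transports_reverse[OF e[OF c]] by simp
  then have 1: "H.transports to_base (paths.cls ?c) (paths.cls ?c)"
    unfolding to_base_def using ray_top[OF x] stratum_edges by (intro H.transports_join[OF transports_ray_top[OF c]]) simp_all
  have "signed_walk \<Theta> u (snd \<alpha>)" "?c \<bullet>\<^sub>p (u, snd \<alpha>) = \<alpha>" "fst \<alpha> = u"
    using \<alpha> by (cases \<alpha>; simp add: signed_paths_def path_begin_def path_comp_def const_path_def)+
  then have 2: "H.transports (realize \<alpha>) (paths.cls ?c) (paths.cls \<alpha>)"
    using transports_rpath[of u "snd \<alpha>" ?c] c by (simp add: realize_def)
  have 3: "H.transports (comparison_path ?q \<alpha>) (paths.cls ?c) (paths.cls \<alpha>)"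
    unfolding comparison_path_def u[symmetric]
    using to_base realize[OF \<alpha>(1)] \<alpha> stratum_edges
    by (intro H.transports_join[OF H.transports_join[OF 1 2] e[OF \<alpha>]]) simp_all
  show ?thesis
    unfolding loop_of_def using comparison_path[OF stratum_x(1) \<alpha>(1,2)] \<alpha>(3) ray_top[OF x]
    by (intro H.transports_join[OF 3 H.transports_reverse[OF transports_ray_top[OF \<alpha>]]]) (simp add: u[symmetric])
qed

text \<open>Precomposition with a loop \<open>\<gamma>\<close> commutes with the structure maps,
  which act on the right; it is an endomorphism of the local system. Multiplicativity of the
  transport of loops comes from here.\<close>

lemma transports_left:
  assumes \<gamma>: "\<gamma> \<in> signed_paths \<Theta>" "path_begin \<gamma> = u" "path_end \<gamma> = u"
    and \<alpha>: "\<alpha> \<in> signed_paths \<Theta>" "path_begin \<alpha> = u" "path_end \<alpha> = u"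
    and g: "g 0 = x" "g 1 = x" and tr: "H.transports g (paths.cls (const_path u)) (paths.cls \<alpha>)"
  shows "H.transports g (paths.cls \<gamma>) (paths.cls (\<gamma> \<bullet>\<^sub>p \<alpha>))"
proof -
  define L where "L A = (\<Union>\<alpha>\<in>A. paths.cls (\<gamma> \<bullet>\<^sub>p \<alpha>))" for A
  have L: "L (paths.cls \<beta>) = paths.cls (\<gamma> \<bullet>\<^sub>p \<beta>)" if "\<beta> \<in> signed_paths \<Theta>" "path_begin \<beta> = u" for \<beta>
  proof -
    have "paths.cls (\<gamma> \<bullet>\<^sub>p \<beta>') = paths.cls (\<gamma> \<bullet>\<^sub>p \<beta>)" if "\<beta>' \<in> paths.cls \<beta>" for \<beta>'
    proof -
      have "(\<beta>, \<beta>') \<in> R"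
        using that by (simp add: paths.cls_def)
      then show ?thesis
        using \<gamma> \<open>path_begin \<beta> = u\<close> by (intro paths.cls_eqI paths.sym_r[OF paths.cmp_r_right]) auto
    qed
    moreover have "\<beta> \<in> paths.cls \<beta>"
      using that by (simp add: paths.cls_def paths.refl_r)
    ultimately show ?thesis
      unfolding L_def by blast
  qed
  interpret M: system_morphism hospace hoposet hole stratum "\<lambda>q. paths.fibre u (snd q)" ho_tr
    "\<lambda>q. paths.fibre u (snd q)" ho_tr "\<lambda>_. L"
  proof (intro system_morphism.intro system_morphism_axioms.intro stratified_system_ho)
    fix q A assume q: "q \<in> hoposet" and "A \<in> paths.fibre u (snd q)"
    then obtain \<beta> where \<beta>: "A = paths.cls \<beta>" "\<beta> \<in> signed_paths \<Theta>" "path_begin \<beta> = u" "path_end \<beta> = snd q"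
      using paths.fibreE by blast
    have \<gamma>\<beta>: "\<gamma> \<bullet>\<^sub>p \<beta> \<in> signed_paths \<Theta>" "path_begin (\<gamma> \<bullet>\<^sub>p \<beta>) = u" "path_end (\<gamma> \<bullet>\<^sub>p \<beta>) = snd q"
      using \<gamma> \<beta> by (auto simp: signed_paths_comp)
    show "L A \<in> paths.fibre u (snd q)"
      unfolding \<beta>(1) L[OF \<beta>(2,3)] using \<gamma>\<beta> by (intro paths.in_fibre)
    fix p assume p: "p \<in> hoposet" and qp: "hole q p"
    have \<beta>h: "\<beta> \<bullet>\<^sub>p hopath q p \<in> signed_paths \<Theta>" "path_begin (\<beta> \<bullet>\<^sub>p hopath q p) = u"
      using \<beta> hopath_simps[OF q p qp] by (auto simp: signed_paths_comp)
    show "L (ho_tr q p A) = ho_tr q p (L A)"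
      unfolding \<beta>(1) L[OF \<beta>(2,3)] ho_tr_cls[OF q p qp \<beta>(2,4)] ho_tr_cls[OF q p qp \<gamma>\<beta>(1,3)] L[OF \<beta>h]
      by (simp add: path_comp_assoc)
  qed
  have "L (paths.cls (const_path u)) = paths.cls \<gamma>"
    using stratum_x \<gamma> by (subst L) (auto simp: const_path_in)
  then show ?thesis
    using M.transports_map[OF tr] L[OF \<alpha>(1,2)] by simp
qed

lemma transport_exists:
  assumes "pathin hospace g" "g 0 = x" "g 1 = x"
  obtains \<alpha> where "\<alpha> \<in> signed_paths \<Theta>" "path_begin \<alpha> = u" "path_end \<alpha> = u"
    "H.transports g (paths.cls (const_path u)) (paths.cls \<alpha>)"
proof -
  have "paths.cls (const_path u) \<in> paths.fibre u (snd (stratum (g 0)))"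
    using stratum_x assms by (intro paths.in_fibre) (auto simp: const_path_in u)
  then obtain A where A: "H.transports g (paths.cls (const_path u)) A"
    using H.transports_exists[OF assms(1)] by blast
  then have "A \<in> paths.fibre u u"
    using H.transports_in[OF A] assms(3) u by simp
  then obtain \<alpha> where "A = paths.cls \<alpha>" "\<alpha> \<in> signed_paths \<Theta>" "path_begin \<alpha> = u" "path_end \<alpha> = u"
    using paths.fibreE by blast
  then show ?thesis
    using that A by blast
qed

text \<open>The map \<open>\<Phi>\<close> selects a representative of the transported constant path.
  Homotopy invariance gives one implication and \<open>transports_loop\<close> with
  \<open>loop_of_relation\<close> the other; products follow from \<open>transports_left\<close>,
  surjectivity from \<open>loop_of\<close>.\<close>

lemma loop_correspondence:
  obtains \<Phi> where
    "\<And>g. pathin hospace g \<Longrightarrow> g 0 = x \<Longrightarrow> g 1 = x \<Longrightarrow>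
       \<Phi> g \<in> signed_paths \<Theta> \<and> path_begin (\<Phi> g) = u \<and> path_end (\<Phi> g) = u"
    "\<And>g h. pathin hospace g \<Longrightarrow> g 0 = x \<Longrightarrow> g 1 = x \<Longrightarrow> pathin hospace h \<Longrightarrow> h 0 = x \<Longrightarrow> h 1 = x \<Longrightarrow>
       path_homotopic hospace g h \<longleftrightarrow> (\<Phi> g, \<Phi> h) \<in> R"
    "\<And>g h. pathin hospace g \<Longrightarrow> g 0 = x \<Longrightarrow> g 1 = x \<Longrightarrow> pathin hospace h \<Longrightarrow> h 0 = x \<Longrightarrow> h 1 = x \<Longrightarrow>
       (\<Phi> (path_join g h), \<Phi> g \<bullet>\<^sub>p \<Phi> h) \<in> R"
    "\<And>\<alpha>. \<alpha> \<in> signed_paths \<Theta> \<Longrightarrow> path_begin \<alpha> = u \<Longrightarrow> path_end \<alpha> = u \<Longrightarrow>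
       \<exists>g. pathin hospace g \<and> g 0 = x \<and> g 1 = x \<and> (\<Phi> g, \<alpha>) \<in> R"
proof -
  define P where "P g \<alpha> \<longleftrightarrow> \<alpha> \<in> signed_paths \<Theta> \<and> path_begin \<alpha> = u \<and> path_end \<alpha> = u \<and>
    H.transports g (paths.cls (const_path u)) (paths.cls \<alpha>)" for g \<alpha>
  define \<Phi> where "\<Phi> g = (SOME \<alpha>. P g \<alpha>)" for g
  have \<Phi>: "P g (\<Phi> g)" if "pathin hospace g" "g 0 = x" "g 1 = x" for g
  proof -
    have "\<exists>\<alpha>. P g \<alpha>"
      using transport_exists[OF that] unfolding P_def by blast
    then show ?thesis
      unfolding \<Phi>_def by (rule someI_ex)
  qed
  have P_unique: "(\<alpha>, \<beta>) \<in> R" if "P g \<alpha>" "P g \<beta>" for g \<alpha> \<beta>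
  proof -
    have "paths.cls \<alpha> = paths.cls \<beta>"
      using that H.transports_unique unfolding P_def by blast
    then show ?thesis
      using that paths.cls_eq_iff unfolding P_def by blast
  qed
  show ?thesis
  proof
    fix g assume g: "pathin hospace g" "g 0 = x" "g 1 = x"
    show "\<Phi> g \<in> signed_paths \<Theta> \<and> path_begin (\<Phi> g) = u \<and> path_end (\<Phi> g) = u"
      using \<Phi>[OF g] unfolding P_def by blast
    fix h assume h: "pathin hospace h" "h 0 = x" "h 1 = x"
    show "path_homotopic hospace g h \<longleftrightarrow> (\<Phi> g, \<Phi> h) \<in> R"
    proof
      assume "path_homotopic hospace g h"
      then have "P h (\<Phi> g)"
        using \<Phi>[OF g] H.transports_path_homotopic unfolding P_def by blast
      then show "(\<Phi> g, \<Phi> h) \<in> R"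
        using P_unique \<Phi>[OF h] by blast
    next
      assume r: "(\<Phi> g, \<Phi> h) \<in> R"
      have "path_homotopic hospace g (loop_of (\<Phi> g))" "path_homotopic hospace h (loop_of (\<Phi> h))"
        using transports_loop[OF g] transports_loop[OF h] \<Phi>[OF g] \<Phi>[OF h] unfolding P_def by blast+
      moreover have "path_homotopic hospace (loop_of (\<Phi> g)) (loop_of (\<Phi> h))"
        using loop_of_relation[OF r] \<Phi>[OF g] unfolding P_def by blast
      ultimately show "path_homotopic hospace g h"
        using path_homotopic_trans path_homotopic_sym by blast
    qed
    have gh: "pathin hospace (path_join g h)" "path_join g h 0 = x" "path_join g h 1 = x"
      using g h by (auto intro: pathin_join)
    have "H.transports h (paths.cls (\<Phi> g)) (paths.cls (\<Phi> g \<bullet>\<^sub>p \<Phi> h))"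
      using transports_left[of "\<Phi> g" "\<Phi> h" h] \<Phi>[OF g] \<Phi>[OF h] h unfolding P_def by blast
    moreover have "H.transports g (paths.cls (const_path u)) (paths.cls (\<Phi> g))" "g 1 = h 0"
      using \<Phi>[OF g] g h unfolding P_def by simp_all
    ultimately have "H.transports (path_join g h) (paths.cls (const_path u)) (paths.cls (\<Phi> g \<bullet>\<^sub>p \<Phi> h))"
      using H.transports_join by blast
    then have "P (path_join g h) (\<Phi> g \<bullet>\<^sub>p \<Phi> h)"
      using \<Phi>[OF g] \<Phi>[OF h] unfolding P_def by (simp add: signed_paths_comp)
    then show "(\<Phi> (path_join g h), \<Phi> g \<bullet>\<^sub>p \<Phi> h) \<in> R"
      using P_unique \<Phi>[OF gh] by blast
  next
    fix \<alpha> assume \<alpha>: "\<alpha> \<in> signed_paths \<Theta>" "path_begin \<alpha> = u" "path_end \<alpha> = u"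
    then have "P (loop_of \<alpha>) \<alpha>"
      using transports_loop_of unfolding P_def by blast
    then have "(\<Phi> (loop_of \<alpha>), \<alpha>) \<in> R"
      by (rule P_unique[OF \<Phi>[OF loop_of[OF \<alpha>]]])
    then show "\<exists>g. pathin hospace g \<and> g 0 = x \<and> g 1 = x \<and> (\<Phi> g, \<alpha>) \<in> R"
      using loop_of[OF \<alpha>] by (intro exI[of _ "loop_of \<alpha>"]) simp
  qed
qed

end

end

section \<open>Quotients of groups of loops\<close>

lemma quotient_monoid_mult:
  assumes r: "equiv (carrier M) r"
    and r_mult: "\<And>a a' b b'. (a, a') \<in> r \<Longrightarrow> (b, b') \<in> r \<Longrightarrow> (a \<otimes>\<^bsub>M\<^esub> b, a' \<otimes>\<^bsub>M\<^esub> b') \<in> r"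
    and a: "a \<in> carrier M" and b: "b \<in> carrier M"
  shows "r `` {a} \<otimes>\<^bsub>quotient_monoid M r\<^esub> r `` {b} = r `` {a \<otimes>\<^bsub>M\<^esub> b}"
proof -
  have "r `` {x \<otimes>\<^bsub>M\<^esub> y} = r `` {a \<otimes>\<^bsub>M\<^esub> b}" if "x \<in> r `` {a}" "y \<in> r `` {b}" for x y
    using that equiv_class_eq[OF r r_mult] by blast
  moreover have "a \<in> r `` {a}" "b \<in> r `` {b}"
    using equiv_class_self[OF r] a b by auto
  ultimately have "(\<Union>x\<in>r `` {a}. \<Union>y\<in>r `` {b}. r `` {x \<otimes>\<^bsub>M\<^esub> y}) = r `` {a \<otimes>\<^bsub>M\<^esub> b}"
    by blast
  then show ?thesis
    by (simp add: quotient_monoid_def)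
qed

text \<open>The relation \<open>s\<close> absorbs all choices, so \<open>\<phi>\<close> may be
  picked pointwise on representatives and need only be multiplicative and surjective modulo
  \<open>s\<close>.\<close>

lemma quotient_monoid_iso:
  fixes M :: "('a, 'm) monoid_scheme" and N :: "('b, 'n) monoid_scheme"
  assumes r: "equiv (carrier M) r"
    and r_mult: "\<And>a a' b b'. (a, a') \<in> r \<Longrightarrow> (b, b') \<in> r \<Longrightarrow> (a \<otimes>\<^bsub>M\<^esub> b, a' \<otimes>\<^bsub>M\<^esub> b') \<in> r"
    and s: "equiv (carrier N) s"
    and s_mult: "\<And>a a' b b'. (a, a') \<in> s \<Longrightarrow> (b, b') \<in> s \<Longrightarrow> (a \<otimes>\<^bsub>N\<^esub> b, a' \<otimes>\<^bsub>N\<^esub> b') \<in> s"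
    and closed: "\<And>a b. a \<in> carrier M \<Longrightarrow> b \<in> carrier M \<Longrightarrow> a \<otimes>\<^bsub>M\<^esub> b \<in> carrier M"
    and \<phi>: "\<And>a. a \<in> carrier M \<Longrightarrow> \<phi> a \<in> carrier N"
    and \<phi>_iff: "\<And>a b. a \<in> carrier M \<Longrightarrow> b \<in> carrier M \<Longrightarrow> (a, b) \<in> r \<longleftrightarrow> (\<phi> a, \<phi> b) \<in> s"
    and \<phi>_mult: "\<And>a b. a \<in> carrier M \<Longrightarrow> b \<in> carrier M \<Longrightarrow> (\<phi> (a \<otimes>\<^bsub>M\<^esub> b), \<phi> a \<otimes>\<^bsub>N\<^esub> \<phi> b) \<in> s"
    and surj: "\<And>b. b \<in> carrier N \<Longrightarrow> \<exists>a\<in>carrier M. (\<phi> a, b) \<in> s"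
  shows "quotient_monoid M r \<cong> quotient_monoid N s"
proof -
  define f where "f A = s `` {\<phi> (SOME a. a \<in> A)}" for A
  have f: "f (r `` {a}) = s `` {\<phi> a}" if a: "a \<in> carrier M" for a
  proof -
    have "a \<in> r `` {a}"
      using equiv_class_self[OF r a] .
    then have "(SOME b. b \<in> r `` {a}) \<in> r `` {a}"
      by (rule someI)
    then have "(a, SOME b. b \<in> r `` {a}) \<in> r"
      by simp
    moreover from this have "(SOME b. b \<in> r `` {a}) \<in> carrier M"
      using equiv_type[OF r] by blast
    ultimately have "(\<phi> a, \<phi> (SOME b. b \<in> r `` {a})) \<in> s"
      using \<phi>_iff a by blast
    then show ?thesis
      unfolding f_def using equiv_class_eq[OF s] by metis
  qed
  have carriers: "carrier (quotient_monoid M r) = carrier M // r" "carrier (quotient_monoid N s) = carrier N // s"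
    by (simp_all add: quotient_monoid_def)
  have "f \<in> iso (quotient_monoid M r) (quotient_monoid N s)"
  proof (rule isoI)
    show "f \<in> hom (quotient_monoid M r) (quotient_monoid N s)"
    proof (rule homI)
      fix A assume "A \<in> carrier (quotient_monoid M r)"
      then obtain a where a: "A = r `` {a}" "a \<in> carrier M"
        unfolding carriers by (rule quotientE)
      show "f A \<in> carrier (quotient_monoid N s)"
        unfolding carriers a(1) f[OF a(2)] by (rule quotientI[OF \<phi>[OF a(2)]])
      fix B assume "B \<in> carrier (quotient_monoid M r)"
      then obtain b where b: "B = r `` {b}" "b \<in> carrier M"
        unfolding carriers by (rule quotientE)
      have "f (A \<otimes>\<^bsub>quotient_monoid M r\<^esub> B) = s `` {\<phi> (a \<otimes>\<^bsub>M\<^esub> b)}"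
        using quotient_monoid_mult[OF r r_mult a(2) b(2)] f[OF closed[OF a(2) b(2)]] unfolding a(1) b(1) by simp
      also have "\<dots> = s `` {\<phi> a \<otimes>\<^bsub>N\<^esub> \<phi> b}"
        by (rule equiv_class_eq[OF s \<phi>_mult[OF a(2) b(2)]])
      also have "\<dots> = f A \<otimes>\<^bsub>quotient_monoid N s\<^esub> f B"
        unfolding a(1) b(1) f[OF a(2)] f[OF b(2)] using quotient_monoid_mult[OF s s_mult \<phi>[OF a(2)] \<phi>[OF b(2)]] by simp
      finally show "f (A \<otimes>\<^bsub>quotient_monoid M r\<^esub> B) = f A \<otimes>\<^bsub>quotient_monoid N s\<^esub> f B" .
    qed
    show "bij_betw f (carrier (quotient_monoid M r)) (carrier (quotient_monoid N s))"
      unfolding carriers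
    proof (rule bij_betw_imageI)
      show "inj_on f (carrier M // r)"
      proof (rule inj_onI)
        fix A B assume "A \<in> carrier M // r" "B \<in> carrier M // r" and eq: "f A = f B"
        then obtain a b where a: "A = r `` {a}" "a \<in> carrier M" and b: "B = r `` {b}" "b \<in> carrier M"
          by (metis quotientE)
        have "(\<phi> a, \<phi> b) \<in> s"
          using eq unfolding a(1) b(1) f[OF a(2)] f[OF b(2)]
          using eq_equiv_class_iff[OF s \<phi>[OF a(2)] \<phi>[OF b(2)]] by blast
        then have "(a, b) \<in> r"
          using \<phi>_iff a(2) b(2) by blast
        then show "A = B"
          unfolding a(1) b(1) by (rule equiv_class_eq[OF r])
      qed
      show "f ` (carrier M // r) = carrier N // s"
      proof (intro equalityI subsetI)
        fix B assume "B \<in> f ` (carrier M // r)"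
        then obtain a where "B = f (r `` {a})" "a \<in> carrier M"
          by (auto elim!: quotientE)
        then show "B \<in> carrier N // s"
          using f quotientI \<phi> by metis
      next
        fix B assume "B \<in> carrier N // s"
        then obtain b where b: "B = s `` {b}" "b \<in> carrier N"
          by (rule quotientE)
        then obtain a where a: "a \<in> carrier M" "(\<phi> a, b) \<in> s"
          using surj by blast
        have "B = f (r `` {a})"
          unfolding b(1) f[OF a(1)] by (rule equiv_class_eq[OF s a(2), symmetric])
        then show "B \<in> f ` (carrier M // r)"
          using quotientI[OF a(1)] by (rule image_eqI)
      qed
    qed
  qed
  then show ?thesis
    by (auto simp: is_iso_def)
qed

context oriented_system
begin

lemma oriented_system_generated: "oriented_system \<Psi> (generated_relation \<Psi> {})"
proof unfold_locales
  have in_paths: "\<alpha> \<in> signed_paths \<Psi> \<and> \<beta> \<in> signed_paths \<Psi>" if "(\<alpha>, \<beta>) \<in> generated_relation \<Psi> {}" for \<alpha> \<beta>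
    using generated_relation_paths[OF that] by blast
  show "equiv (signed_paths \<Psi>) (generated_relation \<Psi> {})"
    using in_paths by (intro equivI refl_onI symI transI) (auto intro: gen_refl gen_sym gen_trans)
qed (use nonempty connected_graph generated_relation_paths[of _ _ "{}"] in
    \<open>auto intro: gen_cancel gen_inverse gen_composition\<close>)

lemma carrier_edge_loops:
  "\<alpha> \<in> carrier (edge_loops \<Psi> v) \<longleftrightarrow> \<alpha> \<in> signed_paths \<Psi> \<and> path_begin \<alpha> = v \<and> path_end \<alpha> = v"
  by (simp add: edge_loops_def)

text \<open>The group of an oriented system is a quotient of a quotient. The outer relation compares
  classes through some representatives, and since the graph relation is contained in
  \<open>R\<close> this is the same as comparing any representatives by \<open>R\<close>.\<close>

lemma system_fundamental_group_iso:
  fixes M :: "('a, 'm) monoid_scheme"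
  assumes r: "equiv (carrier M) r"
    and r_mult: "\<And>a a' b b'. (a, a') \<in> r \<Longrightarrow> (b, b') \<in> r \<Longrightarrow> (a \<otimes>\<^bsub>M\<^esub> b, a' \<otimes>\<^bsub>M\<^esub> b') \<in> r"
    and closed: "\<And>a b. a \<in> carrier M \<Longrightarrow> b \<in> carrier M \<Longrightarrow> a \<otimes>\<^bsub>M\<^esub> b \<in> carrier M"
    and \<phi>: "\<And>a. a \<in> carrier M \<Longrightarrow> \<phi> a \<in> carrier (edge_loops \<Psi> v)"
    and \<phi>_iff: "\<And>a b. a \<in> carrier M \<Longrightarrow> b \<in> carrier M \<Longrightarrow> (a, b) \<in> r \<longleftrightarrow> (\<phi> a, \<phi> b) \<in> R"
    and \<phi>_mult: "\<And>a b. a \<in> carrier M \<Longrightarrow> b \<in> carrier M \<Longrightarrow> (\<phi> (a \<otimes>\<^bsub>M\<^esub> b), \<phi> a \<bullet>\<^sub>p \<phi> b) \<in> R"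
    and surj: "\<And>\<beta>. \<beta> \<in> carrier (edge_loops \<Psi> v) \<Longrightarrow> \<exists>a\<in>carrier M. (\<phi> a, \<beta>) \<in> R"
  shows "quotient_monoid M r \<cong> system_fundamental_group \<Psi> R v"
proof -
  interpret gen: oriented_system \<Psi> "generated_relation \<Psi> {}"
    by (rule oriented_system_generated)
  let ?C = "carrier (edge_loops \<Psi> v)"
  define g where "g = generated_relation \<Psi> {} \<inter> ?C \<times> ?C"
  have mult: "\<alpha> \<otimes>\<^bsub>edge_loops \<Psi> v\<^esub> \<beta> = \<alpha> \<bullet>\<^sub>p \<beta>" for \<alpha> \<beta>
    by (simp add: edge_loops_def)
  have C_mult: "\<alpha> \<bullet>\<^sub>p \<beta> \<in> ?C" if "\<alpha> \<in> ?C" "\<beta> \<in> ?C" for \<alpha> \<beta>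
    using that by (auto simp: carrier_edge_loops signed_paths_comp)
  have g: "equiv ?C g"
    unfolding g_def
    by (intro equivI refl_onI symI transI)
      (auto simp: carrier_edge_loops intro: gen.paths.refl_r gen.paths.sym_r gen.paths.trans_r)
  have g_mult: "(\<alpha> \<otimes>\<^bsub>edge_loops \<Psi> v\<^esub> \<beta>, \<alpha>' \<otimes>\<^bsub>edge_loops \<Psi> v\<^esub> \<beta>') \<in> g" if "(\<alpha>, \<alpha>') \<in> g" "(\<beta>, \<beta>') \<in> g" for \<alpha> \<alpha>' \<beta> \<beta>'
    using that C_mult unfolding g_def mult by (auto intro!: gen.paths.cmp_r simp: carrier_edge_loops)
  define N where "N = graph_fundamental_group \<Psi> v"
  have N: "N = quotient_monoid (edge_loops \<Psi> v) g"
    by (simp add: N_def graph_fundamental_group_def g_def)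
  have carrier_N: "carrier N = ?C // g"
    by (simp add: N quotient_monoid_def)
  define s where "s = {(X, Y). X \<in> carrier N \<and> Y \<in> carrier N \<and> (\<exists>\<alpha>\<in>X. \<exists>\<beta>\<in>Y. (\<alpha>, \<beta>) \<in> R)}"
  have g_R: "(\<alpha>, \<beta>) \<in> R" if "(\<alpha>, \<beta>) \<in> g" for \<alpha> \<beta>
    using that generated_relation_subset by (auto simp: g_def)
  have s_iff: "(g `` {\<alpha>}, g `` {\<beta>}) \<in> s \<longleftrightarrow> (\<alpha>, \<beta>) \<in> R" if \<alpha>: "\<alpha> \<in> ?C" and \<beta>: "\<beta> \<in> ?C" for \<alpha> \<beta>
  proof
    assume "(g `` {\<alpha>}, g `` {\<beta>}) \<in> s"
    then obtain \<alpha>' \<beta>' where "(\<alpha>, \<alpha>') \<in> g" "(\<beta>, \<beta>') \<in> g" "(\<alpha>', \<beta>') \<in> R"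
      by (auto simp: s_def)
    then show "(\<alpha>, \<beta>) \<in> R"
      using g_R paths.trans_r paths.sym_r by metis
  next
    assume "(\<alpha>, \<beta>) \<in> R"
    moreover have "\<alpha> \<in> g `` {\<alpha>}" "\<beta> \<in> g `` {\<beta>}"
      using equiv_class_self[OF g] \<alpha> \<beta> by auto
    moreover have "g `` {\<alpha>} \<in> carrier N" "g `` {\<beta>} \<in> carrier N"
      unfolding carrier_N using \<alpha> \<beta> by (auto intro: quotientI)
    ultimately show "(g `` {\<alpha>}, g `` {\<beta>}) \<in> s"
      unfolding s_def by blast
  qed
  have repr: "\<exists>\<alpha>\<in>?C. X = g `` {\<alpha>}" if "X \<in> carrier N" for X
    using that unfolding carrier_N by (auto elim: quotientE)
  have s_sub: "X \<in> carrier N \<and> Y \<in> carrier N" if "(X, Y) \<in> s" for X Y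
    using that by (auto simp: s_def)
  have C_refl: "(\<alpha>, \<alpha>) \<in> R" if "\<alpha> \<in> ?C" for \<alpha>
    using that paths.refl_r by (simp add: carrier_edge_loops)
  have s: "equiv (carrier N) s"
  proof (intro equivI refl_onI symI transI)
    show "s \<subseteq> carrier N \<times> carrier N"
      using s_sub by auto
    show "(X, X) \<in> s" if "X \<in> carrier N" for X
      using repr[OF that] s_iff C_refl by auto
    show "(Y, X) \<in> s" if "(X, Y) \<in> s" for X Y
      using that paths.sym_r unfolding s_def by blast
    show "(X, Z) \<in> s" if XY: "(X, Y) \<in> s" and YZ: "(Y, Z) \<in> s" for X Y Z
    proof -
      obtain \<alpha> \<beta> \<gamma> where reps: "X = g `` {\<alpha>}" "Y = g `` {\<beta>}" "Z = g `` {\<gamma>}" "\<alpha> \<in> ?C" "\<beta> \<in> ?C" "\<gamma> \<in> ?C"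
        using repr s_sub[OF XY] s_sub[OF YZ] by metis
      then show ?thesis
        using XY YZ s_iff paths.trans_r by metis
    qed
  qed
  have N_mult: "g `` {\<alpha>} \<otimes>\<^bsub>N\<^esub> g `` {\<beta>} = g `` {\<alpha> \<bullet>\<^sub>p \<beta>}" if "\<alpha> \<in> ?C" "\<beta> \<in> ?C" for \<alpha> \<beta>
    using quotient_monoid_mult[OF g g_mult that] unfolding N mult by simp
  have "quotient_monoid M r \<cong> quotient_monoid N s"
  proof (rule quotient_monoid_iso[where \<phi> = "\<lambda>a. g `` {\<phi> a}", OF r r_mult s _ closed])
    fix X X' Y Y' assume XX: "(X, X') \<in> s" and YY: "(Y, Y') \<in> s"
    obtain \<alpha> \<alpha>' \<beta> \<beta>' where reps: "X = g `` {\<alpha>}" "X' = g `` {\<alpha>'}" "Y = g `` {\<beta>}" "Y' = g `` {\<beta>'}"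
      "\<alpha> \<in> ?C" "\<alpha>' \<in> ?C" "\<beta> \<in> ?C" "\<beta>' \<in> ?C"
      using repr s_sub[OF XX] s_sub[OF YY] by metis
    have "(\<alpha>, \<alpha>') \<in> R" "(\<beta>, \<beta>') \<in> R"
      using XX YY reps s_iff by auto
    then have "(\<alpha> \<bullet>\<^sub>p \<beta>, \<alpha>' \<bullet>\<^sub>p \<beta>') \<in> R"
      using reps(5-8) by (intro paths.cmp_r) (auto simp: carrier_edge_loops)
    then show "(X \<otimes>\<^bsub>N\<^esub> Y, X' \<otimes>\<^bsub>N\<^esub> Y') \<in> s"
      unfolding reps(1-4) N_mult[OF reps(5,7)] N_mult[OF reps(6,8)]
      using s_iff[OF C_mult[OF reps(5,7)] C_mult[OF reps(6,8)]] by blast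
  next
    fix a assume a: "a \<in> carrier M"
    show "g `` {\<phi> a} \<in> carrier N"
      unfolding carrier_N by (rule quotientI[OF \<phi>[OF a]])
    fix b assume b: "b \<in> carrier M"
    show "(a, b) \<in> r \<longleftrightarrow> (g `` {\<phi> a}, g `` {\<phi> b}) \<in> s"
      using s_iff[OF \<phi>[OF a] \<phi>[OF b]] \<phi>_iff[OF a b] by simp
    show "(g `` {\<phi> (a \<otimes>\<^bsub>M\<^esub> b)}, g `` {\<phi> a} \<otimes>\<^bsub>N\<^esub> g `` {\<phi> b}) \<in> s"
      unfolding N_mult[OF \<phi>[OF a] \<phi>[OF b]]
      using s_iff[OF \<phi>[OF closed[OF a b]] C_mult[OF \<phi>[OF a] \<phi>[OF b]]] \<phi>_mult[OF a b] by blast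
  next
    fix X assume "X \<in> carrier N"
    then obtain \<beta> where \<beta>: "X = g `` {\<beta>}" "\<beta> \<in> ?C"
      using repr by blast
    then obtain a where a: "a \<in> carrier M" "(\<phi> a, \<beta>) \<in> R"
      using surj by blast
    then show "\<exists>a\<in>carrier M. (g `` {\<phi> a}, X) \<in> s"
      using s_iff[OF \<phi>[OF a(1)] \<beta>(2)] by (intro bexI[of _ a]) (simp_all add: \<beta>(1))
  qed
  then show ?thesis
    unfolding system_fundamental_group_def N_def s_def .
qed

end

lemma carrier_loop_structure: "g \<in> carrier (loop_structure X x) \<longleftrightarrow> pathin X g \<and> g 0 = x \<and> g 1 = x"
  by (simp add: loop_structure_def)

lemma loop_homotopy_iff:
  "(g, h) \<in> loop_homotopy X x \<longleftrightarrow> g \<in> carrier (loop_structure X x) \<and> h \<in> carrier (loop_structure X x) \<and> path_homotopic X g h"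
proof (cases "g \<in> carrier (loop_structure X x) \<and> h \<in> carrier (loop_structure X x)")
  case True
  then have "pathin X g" "pathin X h" "g 0 = x" "g 1 = x" "h 0 = x" "h 1 = x"
    unfolding carrier_loop_structure by blast+
  then show ?thesis
    using True by (simp add: loop_homotopy_def path_homotopic_def)
next
  case False
  then show ?thesis
    unfolding loop_homotopy_def by blast
qed

theorem proposition6p2:
  fixes \<A> :: "'a::euclidean_space set set"
    and \<Theta> :: "'v pair_pre_digraph"
    and R :: "'v signed_path rel"
    and \<rho> :: "'v \<Rightarrow> 'a set"
  assumes "hyperplane_arrangement \<A>"
    and "oriented_cover \<Theta> R (arrangement_graph \<A>) (arrangement_relation \<A>) \<rho>"
    and "x \<in> topspace (cover_hocolim \<A> \<Theta> \<rho>)"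
    and "v \<in> pverts \<Theta>"
  shows "fundamental_group (cover_hocolim \<A> \<Theta> \<rho>) x \<cong> system_fundamental_group \<Theta> R v"
proof -
  interpret arrangement_cover \<A> \<Theta> R \<rho>
    using assms(1,2) by (intro arrangement_cover.intro arrangement.intro)
  let ?X = "cover_hocolim \<A> \<Theta> \<rho>" and ?u = "snd (stratum x)"
  let ?L = "loop_structure ?X x"
  have u: "?u \<in> pverts \<Theta>"
    using stratum_in[OF assms(3)] hoposetD by blast
  \<comment> \<open>Transport yields loops at the vertex \<open>?u\<close> of the stratum of
    \<open>x\<close>, whereas \<open>v\<close> is arbitrary; connectedness provides a path along
    which to conjugate.\<close>
  obtain \<delta> where \<delta>: "\<delta> \<in> signed_paths \<Theta>" "path_begin \<delta> = v" "path_end \<delta> = ?u"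
    using connected_graph[OF assms(4) u] by blast
  let ?\<epsilon> = "path_inverse \<delta>"
  have \<epsilon>: "?\<epsilon> \<in> signed_paths \<Theta>" "path_begin ?\<epsilon> = ?u" "path_end ?\<epsilon> = v"
    using \<delta> by (auto simp: signed_paths_inverse path_end_inverse)
  show ?thesis
  proof (rule loop_correspondence[OF assms(3) refl])
    fix \<Phi> assume \<Phi>_in: "\<And>g. pathin ?X g \<Longrightarrow> g 0 = x \<Longrightarrow> g 1 = x \<Longrightarrow>
         \<Phi> g \<in> signed_paths \<Theta> \<and> path_begin (\<Phi> g) = ?u \<and> path_end (\<Phi> g) = ?u"
      and \<Phi>_iff: "\<And>g h. pathin ?X g \<Longrightarrow> g 0 = x \<Longrightarrow> g 1 = x \<Longrightarrow> pathin ?X h \<Longrightarrow> h 0 = x \<Longrightarrow> h 1 = x \<Longrightarrow>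
         path_homotopic ?X g h \<longleftrightarrow> (\<Phi> g, \<Phi> h) \<in> R"
      and \<Phi>_mult: "\<And>g h. pathin ?X g \<Longrightarrow> g 0 = x \<Longrightarrow> g 1 = x \<Longrightarrow> pathin ?X h \<Longrightarrow> h 0 = x \<Longrightarrow> h 1 = x \<Longrightarrow>
         (\<Phi> (path_join g h), \<Phi> g \<bullet>\<^sub>p \<Phi> h) \<in> R"
      and \<Phi>_surj: "\<And>\<alpha>. \<alpha> \<in> signed_paths \<Theta> \<Longrightarrow> path_begin \<alpha> = ?u \<Longrightarrow> path_end \<alpha> = ?u \<Longrightarrow>
         \<exists>g. pathin ?X g \<and> g 0 = x \<and> g 1 = x \<and> (\<Phi> g, \<alpha>) \<in> R"
    define conj where "conj \<alpha> = \<delta> \<bullet>\<^sub>p \<alpha> \<bullet>\<^sub>p ?\<epsilon>" for \<alpha>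
    have conj_in: "conj \<alpha> \<in> signed_paths \<Theta>" "path_begin (conj \<alpha>) = v" "path_end (conj \<alpha>) = v"
      if "\<alpha> \<in> signed_paths \<Theta>" "path_begin \<alpha> = ?u" "path_end \<alpha> = ?u" for \<alpha>
      using that \<delta> \<epsilon> by (auto simp: conj_def signed_paths_comp)
    have conj_R: "(conj \<alpha>, conj \<beta>) \<in> R" if "(\<alpha>, \<beta>) \<in> R" "path_begin \<alpha> = ?u" "path_end \<alpha> = ?u" for \<alpha> \<beta>
      unfolding conj_def using that \<delta> \<epsilon> by (intro composition) auto
    have "(?\<epsilon> \<bullet>\<^sub>p \<delta>, const_path ?u) \<in> R"
      using cancel[OF \<epsilon>(1)] \<epsilon>(2) \<delta>(1) by (simp add: path_inverse_inverse)
    have unconj: "(?\<epsilon> \<bullet>\<^sub>p conj \<alpha> \<bullet>\<^sub>p \<delta>, \<alpha>) \<in> R"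
      if \<alpha>: "\<alpha> \<in> signed_paths \<Theta>" "path_begin \<alpha> = ?u" "path_end \<alpha> = ?u" for \<alpha>
    proof -
      \<comment> \<open>Composition of edge paths is strictly associative. Regrouping exposes two
        null loops \<open>?\<epsilon> \<bullet>\<^sub>p \<delta>\<close>, which are removed one
        after the other.\<close>
      have "?\<epsilon> \<bullet>\<^sub>p conj \<alpha> \<bullet>\<^sub>p \<delta> = const_path ?u \<bullet>\<^sub>p (?\<epsilon> \<bullet>\<^sub>p \<delta>) \<bullet>\<^sub>p (\<alpha> \<bullet>\<^sub>p (?\<epsilon> \<bullet>\<^sub>p \<delta>))"
        using \<epsilon>(2) by (simp add: conj_def path_comp_assoc)
      also have "(\<dots>, const_path ?u \<bullet>\<^sub>p const_path ?u \<bullet>\<^sub>p (\<alpha> \<bullet>\<^sub>p (?\<epsilon> \<bullet>\<^sub>p \<delta>))) \<in> R"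
        using \<open>(?\<epsilon> \<bullet>\<^sub>p \<delta>, const_path ?u) \<in> R\<close> \<alpha> \<delta> \<epsilon> u by (intro composition) (auto simp: const_path_in signed_paths_comp)
      also have "const_path ?u \<bullet>\<^sub>p const_path ?u \<bullet>\<^sub>p (\<alpha> \<bullet>\<^sub>p (?\<epsilon> \<bullet>\<^sub>p \<delta>)) = \<alpha> \<bullet>\<^sub>p (?\<epsilon> \<bullet>\<^sub>p \<delta>)"
        using \<alpha> by simp
      also have "(\<alpha> \<bullet>\<^sub>p (?\<epsilon> \<bullet>\<^sub>p \<delta>), \<alpha> \<bullet>\<^sub>p const_path ?u) \<in> R"
        using \<open>(?\<epsilon> \<bullet>\<^sub>p \<delta>, const_path ?u) \<in> R\<close> \<alpha> \<epsilon> by (intro paths.cmp_r_right) auto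
      finally show ?thesis
        by simp
    qed
    have conj_iff: "(\<alpha>, \<beta>) \<in> R \<longleftrightarrow> (conj \<alpha>, conj \<beta>) \<in> R"
      if \<alpha>: "\<alpha> \<in> signed_paths \<Theta>" "path_begin \<alpha> = ?u" "path_end \<alpha> = ?u"
        and \<beta>: "\<beta> \<in> signed_paths \<Theta>" "path_begin \<beta> = ?u" "path_end \<beta> = ?u" for \<alpha> \<beta>
    proof
      assume "(conj \<alpha>, conj \<beta>) \<in> R"
      then have "(?\<epsilon> \<bullet>\<^sub>p conj \<alpha> \<bullet>\<^sub>p \<delta>, ?\<epsilon> \<bullet>\<^sub>p conj \<beta> \<bullet>\<^sub>p \<delta>) \<in> R"
        using \<delta> \<epsilon> conj_in[OF \<alpha>] by (intro composition) auto
      then show "(\<alpha>, \<beta>) \<in> R"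
        using unconj[OF \<alpha>] unconj[OF \<beta>] paths.trans_r paths.sym_r by metis
    qed (use conj_R \<alpha> in blast)
    have conj_mult: "(conj (\<alpha> \<bullet>\<^sub>p \<beta>), conj \<alpha> \<bullet>\<^sub>p conj \<beta>) \<in> R"
      if \<alpha>: "\<alpha> \<in> signed_paths \<Theta>" "path_begin \<alpha> = ?u" "path_end \<alpha> = ?u"
        and \<beta>: "\<beta> \<in> signed_paths \<Theta>" "path_begin \<beta> = ?u" "path_end \<beta> = ?u" for \<alpha> \<beta>
    proof -
      have "conj (\<alpha> \<bullet>\<^sub>p \<beta>) = (\<delta> \<bullet>\<^sub>p \<alpha>) \<bullet>\<^sub>p const_path ?u \<bullet>\<^sub>p (\<beta> \<bullet>\<^sub>p ?\<epsilon>)"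
        using \<beta> by (simp add: conj_def path_comp_assoc)
      also have "(\<dots>, (\<delta> \<bullet>\<^sub>p \<alpha>) \<bullet>\<^sub>p (?\<epsilon> \<bullet>\<^sub>p \<delta>) \<bullet>\<^sub>p (\<beta> \<bullet>\<^sub>p ?\<epsilon>)) \<in> R"
        using \<open>(?\<epsilon> \<bullet>\<^sub>p \<delta>, const_path ?u) \<in> R\<close> \<alpha> \<beta> \<delta> \<epsilon>
        by (intro composition paths.sym_r[of _ "const_path ?u"]) (auto simp: signed_paths_comp)
      also have "(\<delta> \<bullet>\<^sub>p \<alpha>) \<bullet>\<^sub>p (?\<epsilon> \<bullet>\<^sub>p \<delta>) \<bullet>\<^sub>p (\<beta> \<bullet>\<^sub>p ?\<epsilon>) = conj \<alpha> \<bullet>\<^sub>p conj \<beta>"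
        by (simp add: conj_def path_comp_assoc)
      finally show ?thesis .
    qed
    have \<Phi>: "\<Phi> g \<in> signed_paths \<Theta>" "path_begin (\<Phi> g) = ?u" "path_end (\<Phi> g) = ?u" if "g \<in> carrier ?L" for g
      using \<Phi>_in that unfolding carrier_loop_structure by blast+
    have L_closed: "path_join g h \<in> carrier ?L" if "g \<in> carrier ?L" "h \<in> carrier ?L" for g h
      using that by (auto simp: carrier_loop_structure intro: pathin_join)
    have L_mult: "g \<otimes>\<^bsub>?L\<^esub> h = path_join g h" for g h
      by (simp add: loop_structure_def)
    have "quotient_monoid ?L (loop_homotopy ?X x) \<cong> system_fundamental_group \<Theta> R v"
    proof (rule system_fundamental_group_iso[where \<phi> = "\<lambda>g. conj (\<Phi> g)"])
      show "equiv (carrier ?L) (loop_homotopy ?X x)"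
      proof (intro equivI refl_onI symI transI)
        show "loop_homotopy ?X x \<subseteq> carrier ?L \<times> carrier ?L"
          by (auto simp: loop_homotopy_iff)
        show "(g, g) \<in> loop_homotopy ?X x" if "g \<in> carrier ?L" for g
          using that by (simp add: loop_homotopy_iff carrier_loop_structure path_homotopic_refl)
        show "(h, g) \<in> loop_homotopy ?X x" if "(g, h) \<in> loop_homotopy ?X x" for g h
          using that by (simp add: loop_homotopy_iff path_homotopic_sym)
        show "(g, k) \<in> loop_homotopy ?X x" if "(g, h) \<in> loop_homotopy ?X x" "(h, k) \<in> loop_homotopy ?X x" for g h k
          using that path_homotopic_trans unfolding loop_homotopy_iff by blast
      qed
      show "(g \<otimes>\<^bsub>?L\<^esub> h, g' \<otimes>\<^bsub>?L\<^esub> h') \<in> loop_homotopy ?X x"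
        if "(g, g') \<in> loop_homotopy ?X x" "(h, h') \<in> loop_homotopy ?X x" for g g' h h'
        using that L_closed unfolding L_mult loop_homotopy_iff
        by (auto simp: carrier_loop_structure intro: path_homotopic_join)
      fix g assume g: "g \<in> carrier ?L"
      show "conj (\<Phi> g) \<in> carrier (edge_loops \<Theta> v)"
        using conj_in[OF \<Phi>[OF g]] by (simp add: carrier_edge_loops)
      fix h assume h: "h \<in> carrier ?L"
      show "g \<otimes>\<^bsub>?L\<^esub> h \<in> carrier ?L"
        unfolding L_mult by (rule L_closed[OF g h])
      have "(g, h) \<in> loop_homotopy ?X x \<longleftrightarrow> (\<Phi> g, \<Phi> h) \<in> R"
        using \<Phi>_iff g h by (simp add: loop_homotopy_iff carrier_loop_structure)
      also have "\<dots> \<longleftrightarrow> (conj (\<Phi> g), conj (\<Phi> h)) \<in> R"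
        by (rule conj_iff[OF \<Phi>[OF g] \<Phi>[OF h]])
      finally show "(g, h) \<in> loop_homotopy ?X x \<longleftrightarrow> (conj (\<Phi> g), conj (\<Phi> h)) \<in> R" .
      have "(\<Phi> (path_join g h), \<Phi> g \<bullet>\<^sub>p \<Phi> h) \<in> R"
        using \<Phi>_mult g h by (simp add: carrier_loop_structure)
      then have "(conj (\<Phi> (path_join g h)), conj (\<Phi> g \<bullet>\<^sub>p \<Phi> h)) \<in> R"
        using \<Phi>[OF L_closed[OF g h]] by (intro conj_R)
      also have "(conj (\<Phi> g \<bullet>\<^sub>p \<Phi> h), conj (\<Phi> g) \<bullet>\<^sub>p conj (\<Phi> h)) \<in> R"
        by (rule conj_mult[OF \<Phi>[OF g] \<Phi>[OF h]])
      finally show "(conj (\<Phi> (g \<otimes>\<^bsub>?L\<^esub> h)), conj (\<Phi> g) \<bullet>\<^sub>p conj (\<Phi> h)) \<in> R"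
        unfolding L_mult .
    next
      fix \<beta> assume "\<beta> \<in> carrier (edge_loops \<Theta> v)"
      then have \<beta>: "\<beta> \<in> signed_paths \<Theta>" "path_begin \<beta> = v" "path_end \<beta> = v"
        by (auto simp: carrier_edge_loops)
      \<comment> \<open>A loop at \<open>v\<close> is carried to \<open>?u\<close> by the opposite
        conjugation, and conjugating back recovers it modulo \<open>R\<close>.\<close>
      define \<alpha> where "\<alpha> = ?\<epsilon> \<bullet>\<^sub>p \<beta> \<bullet>\<^sub>p \<delta>"
      have \<alpha>: "\<alpha> \<in> signed_paths \<Theta>" "path_begin \<alpha> = ?u" "path_end \<alpha> = ?u"
        using \<beta> \<delta> \<epsilon> by (auto simp: \<alpha>_def signed_paths_comp)
      obtain g where g: "g \<in> carrier ?L" "(\<Phi> g, \<alpha>) \<in> R"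
        using \<Phi>_surj[OF \<alpha>] unfolding carrier_loop_structure by blast
      have "(?\<epsilon> \<bullet>\<^sub>p conj \<alpha> \<bullet>\<^sub>p \<delta>, ?\<epsilon> \<bullet>\<^sub>p \<beta> \<bullet>\<^sub>p \<delta>) \<in> R"
        using unconj[OF \<alpha>] by (simp add: \<alpha>_def)
      then have "(?\<epsilon> \<bullet>\<^sub>p conj \<alpha>, ?\<epsilon> \<bullet>\<^sub>p \<beta>) \<in> R"
        by (rule paths.cmp_left_cancel)
          (use \<beta> \<delta> \<epsilon> conj_in[OF \<alpha>] in \<open>simp_all add: signed_paths_comp\<close>)
      from paths.cmp_r_right[OF this \<delta>(1)]
      have 1: "(\<delta> \<bullet>\<^sub>p ?\<epsilon> \<bullet>\<^sub>p conj \<alpha>, \<delta> \<bullet>\<^sub>p ?\<epsilon> \<bullet>\<^sub>p \<beta>) \<in> R"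
        using \<delta>(3) \<epsilon>(2) by (simp add: path_comp_assoc)
      have drop: "(\<delta> \<bullet>\<^sub>p ?\<epsilon> \<bullet>\<^sub>p \<gamma>, \<gamma>) \<in> R" if "\<gamma> \<in> signed_paths \<Theta>" "path_begin \<gamma> = v" for \<gamma>
        using paths.cmp_r_left[OF cancel[OF \<delta>(1)] that(1)] that(2) \<delta>(2) \<epsilon>(3) \<delta>(3) by simp
      have "(conj \<alpha>, \<beta>) \<in> R"
        by (rule paths.trans_r[OF paths.sym_r[OF drop[OF conj_in(1,2)[OF \<alpha>]]] paths.trans_r[OF 1 drop[OF \<beta>(1,2)]]])
      with conj_R[OF g(2) \<Phi>(2,3)[OF g(1)]] have "(conj (\<Phi> g), \<beta>) \<in> R"
        by (rule paths.trans_r)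
      then show "\<exists>g\<in>carrier ?L. (conj (\<Phi> g), \<beta>) \<in> R"
        using g(1) by (rule bexI)
    qed
    then show ?thesis
      unfolding fundamental_group_def .
  qed
qed

end
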